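(* Let $V$ be a finite dimensional $\Gamma$-graded vector space, let $\mathscr T(V)$ be the coordinate algebra and $T\subset\mathscr T(V)$ the subalgebra generated by the matrix coefficients $t_{ba}$ of $V$. Let $\mathbb D=\{D_+^iD_-^j\mid i,j\in\mathbb Z_{\ge0}\}\subset T$ and let $\mathbb D^{-1}T$ be the ring of fractions of $T$ with respect to $\mathbb D$. Then the element $$t=\sum_{a,b}\omega(\gamma_b,\gamma_a-\gamma_b)\,t_{ba}\otimes E_{ba}$$ has a multiplicative inverse in $\mathbb D^{-1}T\otimes\mathrm{End}_{\mathbb C}(V)$. Furthermore, $\mathscr T(V)\simeq\mathbb D^{-1}T$ as $(\Gamma,\omega)$-algebras (i.e. as $\Gamma$-graded associative algebras).
   Context: All vector spaces are over $\mathbb C$. $\Gamma$ is an additive abelian group with a commutative factor $\omega:\Gamma\times\Gamma\to\mathbb C^*$, i.e. $\omega(\alpha,\beta)=\omega(\beta,\alpha)^{-1}$ and $\omega$ is multiplicative in each argument. $\Gamma^\pm=\{\alpha:\omega(\alpha,\alpha)=\pm1\}$. $d(x)$ is the degree of a homogeneous element; formulas with $d$ are extended linearly. Tensor products of $\Gamma$-graded algebras have multiplication $(a\otimes b)(a'\otimes b')=\omega(d(b),d(a'))aa'\otimes bb'$. $V=\bigoplus_\alpha V_\alpha$, $V_\pm=\bigoplus_{\alpha\in\Gamma^\pm}V_\alpha$, $M_\pm=\dim V_\pm$; $\mathfrak{gl}(V)=\mathrm{End}_{\mathbb C}(V)$ graded by $\mathfrak{gl}(V)_\alpha=\bigoplus_\beta\mathrm{Hom}(V_\beta,V_{\alpha+\beta})$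 with bracket $[X,Y]=XY-\omega(d(X),d(Y))YX$; $\mathrm U$ is the tensor algebra modulo $XY-\omega(d(X),d(Y))YX=[X,Y]$, a Hopf $(\Gamma,\omega)$-algebra with $\Delta(X)=X\otimes1+1\otimes X$, $\varepsilon(X)=0$, $S(X)=-X$ on $\mathfrak{gl}(V)$, $S(xy)=\omega(d(x),d(y))S(y)S(x)$. $V^*$, graded by $(V^* )_{-\alpha}=(V_\alpha)^*$, has action $\langle x\cdot f,v\rangle=\omega(d(x),d(f))\langle f,S(x)v\rangle$. The finite dual $\mathrm U^0\subset\mathrm U^*$ is the span of homogeneous functionals (degree $\gamma$ if vanishing on $\mathrm U_\alpha$ for $\alpha\ne-\gamma$) vanishing on a two-sided graded ideal of finite codimension, with product $\langle fg,x\rangle=\langle f\otimes g,\Delta(x)\rangle$, where $\langle f\otimes g,x\otimes y\rangle=\omega(d(g),d(x))\langle f,x\rangle\langle g,y\rangle$. Let $(b_a)$ be a homogeneous basis of $V$, $\gamma_a=d(b_a)$, $(\overline b_a)$ the dual basis, $E_{ba}$ the matrix units ($E_{ba}b_c=\delta_{ac}b_b$). $t_{ba},\overline t_{ba}\in\mathrm U^0$ (of degrees $\gamma_a-\gamma_b$, $\gamma_b-\gamma_a$) are defined by $x\cdot b_a=\sum_b\omega(d(x),\gamma_a)\langle t_{ba},x\rangle b_b$ and $x\cdot\overline b_a=\sum_b\omega(d(x),-\gamma_a)\langle\overline t_{ba},x\rangle\overline b_b$. $\mathscr T(V)$ is the subalgebra of $\mathrm U^0$ generated by all $t_{ba},\overline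 t_{ba}$; it is graded commutative: $fg=\omega(d(f),d(g))gf$. Co-action: $\delta_V(b_a)=\sum_bb_b\otimes t_{ba}$, extended to $\delta_{V^{\otimes r}}:V^{\otimes r}\to V^{\otimes r}\otimes T$ by the rule: if $\delta(v)=\sum v_{(0)}\otimes v_{(1)}$, $\delta(w)=\sum w_{(0)}\otimes w_{(1)}$, then $\delta(v\otimes w)=\sum\omega(d(v_{(1)}),d(w_{(0)}))\,v_{(0)}\otimes w_{(0)}\otimes v_{(1)}w_{(1)}$. $\mathrm{Sym}_r$ acts on $V^{\otimes r}$ with $s_i$ acting by $\cdots v_i\otimes v_{i+1}\cdots\mapsto\omega(d(v_i),d(v_{i+1}))\cdots v_{i+1}\otimes v_i\cdots$. Let $\Lambda_+$ span the one-dimensional space $\big(\sum_{\sigma}\mathrm{sgn}(\sigma)\sigma\big)(V_+^{\otimes M_+})$ and $\Lambda_-$ span the one-dimensional space $\big(\sum_\sigma\sigma\big)(V_-^{\otimes M_-})$. With $p_\pm:V\to V_\pm$ the projections along $V_\mp$, the elements $D_\pm\in T$ are defined by $(p_\pm^{\otimes M_\pm}\otimes\mathrm{id})\,\delta_{V^{\otimes M_\pm}}(\Lambda_\pm)=\Lambda_\pm\otimes D_\pm$. They have $\Gamma$-degree $0$, hence are central in $\mathscr T(V)$. *)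

theory Defs
  imports
    Complex_Main
    "HOL-Library.Function_Algebras"
    "HOL-Library.Poly_Mapping"
    "HOL-Combinatorics.Permutations"
    "HOL-Algebra.QuotRing"
    "HOL-Algebra.Module"
    "HOL-Algebra.Subrings"
begin

section \<open>Graded algebras\<close>

text \<open>A complex algebra graded by a group is a HOL-Algebra module record over the complex numbers
  together with its homogeneous subspaces. Graded vector spaces are treated as the same records,
  with the multiplication ignored.\<close>

record ('a, 'g) galg = "(complex, 'a) module" +
  hpart :: "'g \<Rightarrow> 'a set"

definition commutative_factor :: "('g::ab_group_add \<Rightarrow> 'g \<Rightarrow> complex) \<Rightarrow> bool" where
  "commutative_factor \<omega> \<longleftrightarrow>
     (\<forall>\<alpha> \<beta>. \<omega> \<alpha> \<beta> \<noteq> 0 \<and> \<omega> \<alpha> \<beta> = inverse (\<omega> \<beta> \<alpha>)) \<and>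
     (\<forall>\<alpha> \<beta> \<gamma>. \<omega> (\<alpha> + \<beta>) \<gamma> = \<omega> \<alpha> \<gamma> * \<omega> \<beta> \<gamma>) \<and>
     (\<forall>\<alpha> \<beta> \<gamma>. \<omega> \<alpha> (\<beta> + \<gamma>) = \<omega> \<alpha> \<beta> * \<omega> \<alpha> \<gamma>)"

text \<open>\<open>hcomp A \<alpha> x\<close> is the homogeneous component of degree \<open>\<alpha>\<close> of \<open>x\<close>. It is used to extend formulas
  that involve degrees linearly to all elements.\<close>

definition hcomp :: "('a, 'g) galg \<Rightarrow> 'g \<Rightarrow> 'a \<Rightarrow> 'a" where
  "hcomp A \<alpha> x = (THE c. (\<forall>\<beta>. c \<beta> \<in> hpart A \<beta>) \<and> finite {\<beta>. c \<beta> \<noteq> \<zero>\<^bsub>A\<^esub>} \<and>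
     x = finsum A c {\<beta>. c \<beta> \<noteq> \<zero>\<^bsub>A\<^esub>}) \<alpha>"

definition hsupp :: "('a, 'g) galg \<Rightarrow> 'a \<Rightarrow> 'g set" where
  "hsupp A x = {\<alpha>. hcomp A \<alpha> x \<noteq> \<zero>\<^bsub>A\<^esub>}"

definition linear_functional :: "('a, 'g) galg \<Rightarrow> ('a \<Rightarrow> complex) \<Rightarrow> bool" where
  "linear_functional A f \<longleftrightarrow>
     (\<forall>x\<in>carrier A. \<forall>y\<in>carrier A. f (x \<oplus>\<^bsub>A\<^esub> y) = f x + f y) \<and>
     (\<forall>c. \<forall>x\<in>carrier A. f (c \<odot>\<^bsub>A\<^esub> x) = c * f x)"

definition dual_space :: "('a, 'g) galg \<Rightarrow> ('a \<Rightarrow> complex) set" where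
  "dual_space A = {f. linear_functional A f \<and> (\<forall>x. x \<notin> carrier A \<longrightarrow> f x = 0)}"

definition alg_hom :: "('a, 'g) galg \<Rightarrow> ('b, 'g) galg \<Rightarrow> ('a \<Rightarrow> 'b) set" where
  "alg_hom A B = {h \<in> ring_hom A B. \<forall>c. \<forall>x\<in>carrier A. h (c \<odot>\<^bsub>A\<^esub> x) = c \<odot>\<^bsub>B\<^esub> h x}"

definition galg_iso :: "('a, 'g) galg \<Rightarrow> ('b, 'g) galg \<Rightarrow> ('a \<Rightarrow> 'b) set" where
  "galg_iso A B = {h \<in> ring_iso A B. h \<in> alg_hom A B \<and> (\<forall>\<alpha>. h ` hpart A \<alpha> = hpart B \<alpha>)}"

definition generated_subalgebra :: "('a, 'g) galg \<Rightarrow> 'a set \<Rightarrow> ('a, 'g) galg" where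
  "generated_subalgebra A X =
     (let B = \<Inter>{B. subring B A \<and> (\<forall>c. \<forall>x\<in>B. c \<odot>\<^bsub>A\<^esub> x \<in> B) \<and> X \<subseteq> B}
      in A\<lparr>carrier := B, hpart := (\<lambda>\<alpha>. hpart A \<alpha> \<inter> B)\<rparr>)"

definition graded_ideal :: "('a, 'g) galg \<Rightarrow> 'a set \<Rightarrow> bool" where
  "graded_ideal A K \<longleftrightarrow> ideal K A \<and> (\<forall>x\<in>K. \<forall>\<alpha>. hcomp A \<alpha> x \<in> K)"

definition finite_codimension :: "('a, 'g) galg \<Rightarrow> 'a set \<Rightarrow> bool" where
  "finite_codimension A K \<longleftrightarrow>
     (\<exists>E. finite E \<and> E \<subseteq> carrier A \<and>
       (\<forall>x\<in>carrier A. \<exists>c. x \<ominus>\<^bsub>A\<^esub> finsum A (\<lambda>e. c e \<odot>\<^bsub>A\<^esub> e) E \<in> K))"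

abbreviation fscale :: "complex \<Rightarrow> ('a \<Rightarrow> complex) \<Rightarrow> 'a \<Rightarrow> complex" where
  "fscale \<equiv> \<lambda>c f x. c * f x"

section \<open>Tensor products\<close>

text \<open>Over a field the canonical map from \<open>A \<otimes> B\<close> to the dual of the space of bilinear forms on
  \<open>A \<times> B\<close> is injective, so \<open>A \<otimes> B\<close> is realised as its image: the span of the evaluations
  \<open>\<beta> \<mapsto> \<beta> a b\<close>. The value \<open>x \<beta>\<close> of a tensor \<open>x\<close> is thus the value at \<open>x\<close> of the linear form on
  \<open>A \<otimes> B\<close> induced by \<open>\<beta>\<close>.\<close>

definition bilinear_forms :: "('a, 'g) galg \<Rightarrow> ('b, 'g) galg \<Rightarrow> ('a \<Rightarrow> 'b \<Rightarrow> complex) set" where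
  "bilinear_forms A B = {\<beta>. (\<forall>b\<in>carrier B. linear_functional A (\<lambda>a. \<beta> a b)) \<and>
                            (\<forall>a\<in>carrier A. linear_functional B (\<beta> a))}"

type_synonym ('a, 'b) tensor = "('a \<Rightarrow> 'b \<Rightarrow> complex) \<Rightarrow> complex"

definition tens :: "('a, 'g) galg \<Rightarrow> ('b, 'g) galg \<Rightarrow> 'a \<Rightarrow> 'b \<Rightarrow> ('a, 'b) tensor" where
  "tens A B a b = (\<lambda>\<beta>. if \<beta> \<in> bilinear_forms A B then \<beta> a b else 0)"

text \<open>The product is the bilinear extension of
  \<open>(a \<otimes> b)(a' \<otimes> b') = \<omega>(d(b), d(a')) aa' \<otimes> bb'\<close>.\<close>

definition tensor_mult :: "('g \<Rightarrow> 'g \<Rightarrow> complex) \<Rightarrow> ('a, 'g) galg \<Rightarrow> ('b, 'g) galg \<Rightarrow>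
    ('a, 'b) tensor \<Rightarrow> ('a, 'b) tensor \<Rightarrow> ('a, 'b) tensor" where
  "tensor_mult \<omega> A B x y = (\<lambda>\<beta>. if \<beta> \<in> bilinear_forms A B then
     x (\<lambda>a b. y (\<lambda>a' b'. \<Sum>\<eta>\<in>hsupp B b. \<Sum>\<alpha>\<in>hsupp A a'.
       \<omega> \<eta> \<alpha> * \<beta> (a \<otimes>\<^bsub>A\<^esub> hcomp A \<alpha> a') (hcomp B \<eta> b \<otimes>\<^bsub>B\<^esub> b'))) else 0)"

definition tensor_alg :: "('g::ab_group_add \<Rightarrow> 'g \<Rightarrow> complex) \<Rightarrow> ('a, 'g) galg \<Rightarrow> ('b, 'g) galg \<Rightarrow>
    (('a, 'b) tensor, 'g) galg" where
  "tensor_alg \<omega> A B =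
     \<lparr>carrier = module.span fscale {tens A B a b | a b. a \<in> carrier A \<and> b \<in> carrier B},
      mult = tensor_mult \<omega> A B,
      one = tens A B \<one>\<^bsub>A\<^esub> \<one>\<^bsub>B\<^esub>,
      zero = (\<lambda>_. 0),
      add = (\<lambda>x y \<beta>. x \<beta> + y \<beta>),
      smult = fscale,
      hpart = (\<lambda>\<gamma>. module.span fscale
        {tens A B a b | a b. \<exists>\<alpha> \<beta>. \<alpha> + \<beta> = \<gamma> \<and> a \<in> hpart A \<alpha> \<and> b \<in> hpart B \<beta>})\<rparr>"

text \<open>\<open>f \<otimes> g\<close> for linear maps \<open>f\<close>, \<open>g\<close> into \<open>A'\<close>, \<open>B'\<close>.\<close>

definition tensor_map :: "('c, 'g) galg \<Rightarrow> ('d, 'g) galg \<Rightarrow> ('a \<Rightarrow> 'c) \<Rightarrow> ('b \<Rightarrow> 'd) \<Rightarrow>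
    ('a, 'b) tensor \<Rightarrow> ('c, 'd) tensor" where
  "tensor_map A' B' f g x =
     (\<lambda>\<beta>. if \<beta> \<in> bilinear_forms A' B' then x (\<lambda>a b. \<beta> (f a) (g b)) else 0)"

section \<open>Rings of fractions\<close>

text \<open>\<open>fraction A D a d\<close> is the class \<open>a/d\<close>, where \<open>a/d = a'/d'\<close> iff \<open>u(ad' - a'd) = 0\<close> for some
  \<open>u \<in> D\<close>; no element of \<open>D\<close> is assumed to be regular. \<open>D\<close> is meant to be a multiplicative set of
  central elements of degree 0.\<close>

definition fraction :: "('a, 'g) galg \<Rightarrow> 'a set \<Rightarrow> 'a \<Rightarrow> 'a \<Rightarrow> ('a \<times> 'a) set" where
  "fraction A D a d = {(a', d'). a' \<in> carrier A \<and> d' \<in> D \<and>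
     (\<exists>u\<in>D. u \<otimes>\<^bsub>A\<^esub> (a \<otimes>\<^bsub>A\<^esub> d' \<ominus>\<^bsub>A\<^esub> a' \<otimes>\<^bsub>A\<^esub> d) = \<zero>\<^bsub>A\<^esub>)}"

definition fraction_alg :: "('a, 'g) galg \<Rightarrow> 'a set \<Rightarrow> (('a \<times> 'a) set, 'g) galg" where
  "fraction_alg A D =
     \<lparr>carrier = {fraction A D a d | a d. a \<in> carrier A \<and> d \<in> D},
      mult = (\<lambda>X Y. \<Union>(a, d)\<in>X. \<Union>(b, e)\<in>Y. fraction A D (a \<otimes>\<^bsub>A\<^esub> b) (d \<otimes>\<^bsub>A\<^esub> e)),
      one = fraction A D \<one>\<^bsub>A\<^esub> \<one>\<^bsub>A\<^esub>,
      zero = fraction A D \<zero>\<^bsub>A\<^esub> \<one>\<^bsub>A\<^esub>,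
      add = (\<lambda>X Y. \<Union>(a, d)\<in>X. \<Union>(b, e)\<in>Y.
               fraction A D (a \<otimes>\<^bsub>A\<^esub> e \<oplus>\<^bsub>A\<^esub> b \<otimes>\<^bsub>A\<^esub> d) (d \<otimes>\<^bsub>A\<^esub> e)),
      smult = (\<lambda>c X. \<Union>(a, d)\<in>X. fraction A D (c \<odot>\<^bsub>A\<^esub> a) d),
      hpart = (\<lambda>\<alpha>. {fraction A D a d | a d. a \<in> hpart A \<alpha> \<and> d \<in> D})\<rparr>"

section \<open>Tensor algebras\<close>

text \<open>The free monoid, in the additive notation in which convolution algebras are provided by
  \<open>Poly_Mapping\<close>.\<close>

instantiation list :: (type) monoid_add
begin

definition zero_list :: "'a list" where "zero_list = []"

definition plus_list :: "'a list \<Rightarrow> 'a list \<Rightarrow> 'a list" where "plus_list xs ys = xs @ ys"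

instance by standard (simp_all add: zero_list_def plus_list_def)

end

text \<open>The tensor algebra of a space with a homogeneous basis indexed by \<open>L\<close>, with basis the words
  over \<open>L\<close>: the word \<open>[l1, ..., lr]\<close> is the tensor product of the corresponding basis vectors.\<close>

definition word_deg :: "('l \<Rightarrow> 'g::ab_group_add) \<Rightarrow> 'l list \<Rightarrow> 'g" where
  "word_deg \<gamma> w = sum_list (map \<gamma> w)"

definition tensor_algebra :: "'l set \<Rightarrow> ('l \<Rightarrow> 'g::ab_group_add) \<Rightarrow> ('l list \<Rightarrow>\<^sub>0 complex, 'g) galg" where
  "tensor_algebra L \<gamma> =
     \<lparr>carrier = {x. \<forall>w\<in>Poly_Mapping.keys x. set w \<subseteq> L},
      mult = (*),
      one = 1,
      zero = 0,
      add = (+),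
      smult = (\<lambda>c. Poly_Mapping.map ((*) c)),
      hpart = (\<lambda>\<alpha>. {x. \<forall>w\<in>Poly_Mapping.keys x. set w \<subseteq> L \<and> word_deg \<gamma> w = \<alpha>})\<rparr>"

section \<open>The graded space and its endomorphisms\<close>

record ('g, 'v, 'i) gspace =
  fac :: "'g \<Rightarrow> 'g \<Rightarrow> complex"
  scal :: "complex \<Rightarrow> 'v \<Rightarrow> 'v"
  part :: "'g \<Rightarrow> 'v set"
  ind :: "'i set"
  bas :: "'i \<Rightarrow> 'v"
  deg :: "'i \<Rightarrow> 'g"

definition graded_vector_space ::
    "(complex \<Rightarrow> 'v::ab_group_add \<Rightarrow> 'v) \<Rightarrow> ('g::ab_group_add \<Rightarrow> 'v set) \<Rightarrow> bool" where
  "graded_vector_space s P \<longleftrightarrow> vector_space s \<and> (\<forall>\<alpha>. module.subspace s (P \<alpha>)) \<and>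
     (\<forall>v. \<exists>!c. (\<forall>\<alpha>. c \<alpha> \<in> P \<alpha>) \<and> finite {\<alpha>. c \<alpha> \<noteq> 0} \<and> v = (\<Sum>\<alpha> | c \<alpha> \<noteq> 0. c \<alpha>))"

definition homogeneous_basis :: "('g::ab_group_add, 'v::ab_group_add, 'i) gspace \<Rightarrow> bool" where
  "homogeneous_basis V \<longleftrightarrow> inj_on (bas V) (ind V) \<and>
     finite_dimensional_vector_space (scal V) (bas V ` ind V) \<and>
     (\<forall>a\<in>ind V. bas V a \<in> part V (deg V a))"

definition dual_basis ::
    "('g, 'v::ab_group_add, 'i) gspace \<Rightarrow> 'i \<Rightarrow> 'v \<Rightarrow> complex" where
  "dual_basis V a v = module.representation (scal V) (bas V ` ind V) v (bas V a)"

definition End_alg ::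
    "('g::ab_group_add, 'v::ab_group_add, 'i) gspace \<Rightarrow> ('v \<Rightarrow> 'v, 'g) galg" where
  "End_alg V =
     \<lparr>carrier = {X. Vector_Spaces.linear (scal V) (scal V) X},
      mult = (\<circ>),
      one = id,
      zero = (\<lambda>_. 0),
      add = (\<lambda>X Y v. X v + Y v),
      smult = (\<lambda>c X v. scal V c (X v)),
      hpart = (\<lambda>\<alpha>. {X. Vector_Spaces.linear (scal V) (scal V) X \<and>
                        (\<forall>\<beta>. X ` part V \<beta> \<subseteq> part V (\<alpha> + \<beta>))})\<rparr>"

definition unit_matrix ::
    "('g, 'v::ab_group_add, 'i) gspace \<Rightarrow> 'i \<Rightarrow> 'i \<Rightarrow> 'v \<Rightarrow> 'v" where
  "unit_matrix V b a v = scal V (dual_basis V a v) (bas V b)"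

section \<open>The enveloping algebra of the general linear algebra\<close>

text \<open>The tensor algebra of \<open>gl(V)\<close> in the basis of matrix units; the letter \<open>(b, a)\<close> is \<open>E\<^sub>b\<^sub>a\<close>.\<close>

definition gl_tensor_algebra ::
    "('g::ab_group_add, 'v::ab_group_add, 'i) gspace \<Rightarrow> (('i \<times> 'i) list \<Rightarrow>\<^sub>0 complex, 'g) galg" where
  "gl_tensor_algebra V = tensor_algebra (ind V \<times> ind V) (\<lambda>(b, a). deg V b - deg V a)"

definition gl_embed ::
    "('g, 'v::ab_group_add, 'i) gspace \<Rightarrow> ('v \<Rightarrow> 'v) \<Rightarrow> ('i \<times> 'i) list \<Rightarrow>\<^sub>0 complex" where
  "gl_embed V X = (\<Sum>a\<in>ind V. \<Sum>b\<in>ind V.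
     Poly_Mapping.single [(b, a)] (dual_basis V b (X (bas V a))))"

definition env_ideal ::
    "('g::ab_group_add, 'v::ab_group_add, 'i) gspace \<Rightarrow> (('i \<times> 'i) list \<Rightarrow>\<^sub>0 complex) set" where
  "env_ideal V = genideal (gl_tensor_algebra V)
     {gl_embed V X * gl_embed V Y
        - Poly_Mapping.map ((*) (fac V \<alpha> \<beta>)) (gl_embed V Y * gl_embed V X)
        - gl_embed V (\<lambda>v. X (Y v) - scal V (fac V \<alpha> \<beta>) (Y (X v)))
      | X Y \<alpha> \<beta>. X \<in> hpart (End_alg V) \<alpha> \<and> Y \<in> hpart (End_alg V) \<beta>}"

type_synonym 'i env = "(('i \<times> 'i) list \<Rightarrow>\<^sub>0 complex) set"

definition env_class ::
    "('g::ab_group_add, 'v::ab_group_add, 'i) gspace \<Rightarrow> (('i \<times> 'i) list \<Rightarrow>\<^sub>0 complex) \<Rightarrow> 'i env" where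
  "env_class V p = env_ideal V +>\<^bsub>gl_tensor_algebra V\<^esub> p"

definition env_alg :: "('g::ab_group_add, 'v::ab_group_add, 'i) gspace \<Rightarrow> ('i env, 'g) galg" where
  "env_alg V = (let F = gl_tensor_algebra V; Q = F Quot env_ideal V in
     \<lparr>carrier = carrier Q,
      mult = mult Q,
      one = one Q,
      zero = zero Q,
      add = add Q,
      smult = (\<lambda>c X. env_class V (c \<odot>\<^bsub>F\<^esub> \<one>\<^bsub>F\<^esub>) \<otimes>\<^bsub>Q\<^esub> X),
      hpart = (\<lambda>\<alpha>. env_class V ` hpart F \<alpha>)\<rparr>)"

definition gl_env :: "('g::ab_group_add, 'v::ab_group_add, 'i) gspace \<Rightarrow> ('v \<Rightarrow> 'v) \<Rightarrow> 'i env" where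
  "gl_env V X = env_class V (gl_embed V X)"

text \<open>The choice operator below selects maps whose values on the carrier of the enveloping algebra
  are uniquely determined by the stated conditions.\<close>

definition env_action ::
    "('g::ab_group_add, 'v::ab_group_add, 'i) gspace \<Rightarrow> 'i env \<Rightarrow> 'v \<Rightarrow> 'v" where
  "env_action V = (SOME \<rho>. \<rho> \<in> alg_hom (env_alg V) (End_alg V) \<and>
     (\<forall>X\<in>carrier (End_alg V). \<rho> (gl_env V X) = X))"

definition coproduct ::
    "('g::ab_group_add, 'v::ab_group_add, 'i) gspace \<Rightarrow> 'i env \<Rightarrow> ('i env, 'i env) tensor" where
  "coproduct V = (let U = env_alg V; UU = tensor_alg (fac V) U U in
     SOME \<Delta>. \<Delta> \<in> alg_hom U UU \<and>
       (\<forall>X\<in>carrier (End_alg V).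
          \<Delta> (gl_env V X) = tens U U (gl_env V X) \<one>\<^bsub>U\<^esub> \<oplus>\<^bsub>UU\<^esub> tens U U \<one>\<^bsub>U\<^esub> (gl_env V X)))"

definition counit ::
    "('g::ab_group_add, 'v::ab_group_add, 'i) gspace \<Rightarrow> 'i env \<Rightarrow> complex" where
  "counit V = (let U = env_alg V in
     THE \<epsilon>. \<epsilon> \<in> dual_space U \<and> \<epsilon> \<one>\<^bsub>U\<^esub> = 1 \<and>
       (\<forall>x\<in>carrier U. \<forall>y\<in>carrier U. \<epsilon> (x \<otimes>\<^bsub>U\<^esub> y) = \<epsilon> x * \<epsilon> y) \<and>
       (\<forall>X\<in>carrier (End_alg V). \<epsilon> (gl_env V X) = 0))"

definition antipode ::
    "('g::ab_group_add, 'v::ab_group_add, 'i) gspace \<Rightarrow> 'i env \<Rightarrow> 'i env" where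
  "antipode V = (let U = env_alg V in
     SOME S. S \<in> carrier U \<rightarrow> carrier U \<and> S \<one>\<^bsub>U\<^esub> = \<one>\<^bsub>U\<^esub> \<and>
       (\<forall>x\<in>carrier U. \<forall>y\<in>carrier U. S (x \<oplus>\<^bsub>U\<^esub> y) = S x \<oplus>\<^bsub>U\<^esub> S y) \<and>
       (\<forall>c. \<forall>x\<in>carrier U. S (c \<odot>\<^bsub>U\<^esub> x) = c \<odot>\<^bsub>U\<^esub> S x) \<and>
       (\<forall>X\<in>carrier (End_alg V). S (gl_env V X) = \<ominus>\<^bsub>U\<^esub> gl_env V X) \<and>
       (\<forall>\<alpha> \<beta>. \<forall>x\<in>hpart U \<alpha>. \<forall>y\<in>hpart U \<beta>.
          S (x \<otimes>\<^bsub>U\<^esub> y) = fac V \<alpha> \<beta> \<odot>\<^bsub>U\<^esub> (S y \<otimes>\<^bsub>U\<^esub> S x)))"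

text \<open>\<open>x \<cdot> f\<close> for \<open>x\<close> of degree \<open>\<alpha>\<close> and \<open>f \<in> V\<^sup>*\<close> of degree \<open>\<eta>\<close>.\<close>

definition dual_action ::
    "('g::ab_group_add, 'v::ab_group_add, 'i) gspace \<Rightarrow> 'g \<Rightarrow> 'g \<Rightarrow> 'i env \<Rightarrow>
     ('v \<Rightarrow> complex) \<Rightarrow> 'v \<Rightarrow> complex" where
  "dual_action V \<alpha> \<eta> x f = (\<lambda>v. fac V \<alpha> \<eta> * f (env_action V (antipode V x) v))"

section \<open>The finite dual and the coordinate algebra\<close>

definition functional_degree ::
    "('g::ab_group_add, 'v::ab_group_add, 'i) gspace \<Rightarrow> 'g \<Rightarrow> ('i env \<Rightarrow> complex) \<Rightarrow> bool" where
  "functional_degree V \<gamma> f \<longleftrightarrow> (\<forall>\<alpha>. \<alpha> \<noteq> - \<gamma> \<longrightarrow> (\<forall>x\<in>hpart (env_alg V) \<alpha>. f x = 0))"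

definition finite_dual ::
    "('g::ab_group_add, 'v::ab_group_add, 'i) gspace \<Rightarrow> ('i env \<Rightarrow> complex) set" where
  "finite_dual V = module.span fscale
     {f \<in> dual_space (env_alg V). (\<exists>\<gamma>. functional_degree V \<gamma> f) \<and>
        (\<exists>K. graded_ideal (env_alg V) K \<and> finite_codimension (env_alg V) K \<and> (\<forall>x\<in>K. f x = 0))}"

text \<open>The form \<open>(x, y) \<mapsto> \<langle>f \<otimes> g, x \<otimes> y\<rangle> = \<omega>(d(g), d(x)) \<langle>f, x\<rangle> \<langle>g, y\<rangle>\<close>. For \<open>y\<close> of degree \<open>\<eta>\<close> only
  the component of \<open>g\<close> of degree \<open>- \<eta>\<close> contributes to \<open>\<langle>g, y\<rangle>\<close>, hence the factor \<open>\<omega>(- \<eta>, d(x))\<close>.\<close>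

definition functional_pairing ::
    "('g::ab_group_add, 'v::ab_group_add, 'i) gspace \<Rightarrow> ('i env \<Rightarrow> complex) \<Rightarrow>
     ('i env \<Rightarrow> complex) \<Rightarrow> 'i env \<Rightarrow> 'i env \<Rightarrow> complex" where
  "functional_pairing V f g x y = (let U = env_alg V in
     \<Sum>\<alpha>\<in>hsupp U x. \<Sum>\<eta>\<in>hsupp U y.
       fac V (- \<eta>) \<alpha> * f (hcomp U \<alpha> x) * g (hcomp U \<eta> y))"

definition finite_dual_alg ::
    "('g::ab_group_add, 'v::ab_group_add, 'i) gspace \<Rightarrow> ('i env \<Rightarrow> complex, 'g) galg" where
  "finite_dual_alg V =
     \<lparr>carrier = finite_dual V,
      mult = (\<lambda>f g x. if x \<in> carrier (env_alg V)
                       then coproduct V x (functional_pairing V f g) else 0),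
      one = counit V,
      zero = (\<lambda>_. 0),
      add = (\<lambda>f g x. f x + g x),
      smult = fscale,
      hpart = (\<lambda>\<gamma>. {f \<in> finite_dual V. functional_degree V \<gamma> f})\<rparr>"

definition mcoeff ::
    "('g::ab_group_add, 'v::ab_group_add, 'i) gspace \<Rightarrow> 'i \<Rightarrow> 'i \<Rightarrow> 'i env \<Rightarrow> complex" where
  "mcoeff V = (SOME t. (\<forall>a\<in>ind V. \<forall>b\<in>ind V. t b a \<in> finite_dual V) \<and>
     (\<forall>a\<in>ind V. \<forall>\<alpha>. \<forall>x\<in>hpart (env_alg V) \<alpha>.
        env_action V x (bas V a) =
          (\<Sum>b\<in>ind V. scal V (fac V \<alpha> (deg V a) * t b a x) (bas V b))))"

definition dual_mcoeff ::
    "('g::ab_group_add, 'v::ab_group_add, 'i) gspace \<Rightarrow> 'i \<Rightarrow> 'i \<Rightarrow> 'i env \<Rightarrow> complex" where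
  "dual_mcoeff V = (SOME t. (\<forall>a\<in>ind V. \<forall>b\<in>ind V. t b a \<in> finite_dual V) \<and>
     (\<forall>a\<in>ind V. \<forall>\<alpha>. \<forall>x\<in>hpart (env_alg V) \<alpha>.
        dual_action V \<alpha> (- deg V a) x (dual_basis V a) =
          (\<lambda>v. \<Sum>b\<in>ind V. fac V \<alpha> (- deg V a) * t b a x * dual_basis V b v)))"

definition matrix_coeff_alg ::
    "('g::ab_group_add, 'v::ab_group_add, 'i) gspace \<Rightarrow> ('i env \<Rightarrow> complex, 'g) galg" where
  "matrix_coeff_alg V = generated_subalgebra (finite_dual_alg V)
     {mcoeff V b a | a b. a \<in> ind V \<and> b \<in> ind V}"

definition coordinate_alg ::
    "('g::ab_group_add, 'v::ab_group_add, 'i) gspace \<Rightarrow> ('i env \<Rightarrow> complex, 'g) galg" where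
  "coordinate_alg V = generated_subalgebra (finite_dual_alg V)
     ({mcoeff V b a | a b. a \<in> ind V \<and> b \<in> ind V} \<union>
      {dual_mcoeff V b a | a b. a \<in> ind V \<and> b \<in> ind V})"

section \<open>Tensor powers, symmetric group action and coaction\<close>

text \<open>Tensor powers of \<open>V\<close> are the subspaces of the tensor algebra of \<open>V\<close> spanned by the words of a
  given length. The sign \<open>\<epsilon> = \<plusminus>1\<close> selects the subspaces indexed by \<open>{\<alpha>. \<omega>(\<alpha>, \<alpha>) = \<epsilon>}\<close>.\<close>

definition V_tensor_algebra ::
    "('g::ab_group_add, 'v, 'i) gspace \<Rightarrow> ('i list \<Rightarrow>\<^sub>0 complex, 'g) galg" where
  "V_tensor_algebra V = tensor_algebra (ind V) (deg V)"

definition sgn_space :: "('g, 'v::ab_group_add, 'i) gspace \<Rightarrow> complex \<Rightarrow> 'v set" where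
  "sgn_space V \<epsilon> = module.span (scal V) (\<Union>\<alpha>\<in>{\<alpha>. fac V \<alpha> \<alpha> = \<epsilon>}. part V \<alpha>)"

definition sgn_dim :: "('g, 'v::ab_group_add, 'i) gspace \<Rightarrow> complex \<Rightarrow> nat" where
  "sgn_dim V \<epsilon> = vector_space.dim (scal V) (sgn_space V \<epsilon>)"

definition sgn_ind :: "('g, 'v, 'i) gspace \<Rightarrow> complex \<Rightarrow> 'i set" where
  "sgn_ind V \<epsilon> = {a \<in> ind V. fac V (deg V a) (deg V a) = \<epsilon>}"

definition sgn_tensor_power ::
    "('g, 'v, 'i) gspace \<Rightarrow> complex \<Rightarrow> nat \<Rightarrow> ('i list \<Rightarrow>\<^sub>0 complex) set" where
  "sgn_tensor_power V \<epsilon> r =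
     {x. \<forall>w\<in>Poly_Mapping.keys x. length w = r \<and> set w \<subseteq> sgn_ind V \<epsilon>}"

text \<open>The tensor power of the projection of \<open>V\<close> onto the subspace selected by \<open>\<epsilon>\<close>.\<close>

definition sgn_proj ::
    "('g, 'v, 'i) gspace \<Rightarrow> complex \<Rightarrow> ('i list \<Rightarrow>\<^sub>0 complex) \<Rightarrow> ('i list \<Rightarrow>\<^sub>0 complex)" where
  "sgn_proj V \<epsilon> x = (\<Sum>w | w \<in> Poly_Mapping.keys x \<and> set w \<subseteq> sgn_ind V \<epsilon>.
     Poly_Mapping.single w (Poly_Mapping.lookup x w))"

text \<open>A permutation \<open>\<sigma>\<close> moves the factor in position \<open>i\<close> to position \<open>\<sigma> i\<close>. In a decomposition of
  \<open>\<sigma>\<close> into adjacent transpositions of minimal length each inversion is swapped once, which gives the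
  product of the factors \<open>\<omega>(d(v\<^sub>i), d(v\<^sub>j))\<close> over all inversions.\<close>

definition perm_action ::
    "('g, 'v, 'i) gspace \<Rightarrow> (nat \<Rightarrow> nat) \<Rightarrow> ('i list \<Rightarrow>\<^sub>0 complex) \<Rightarrow> ('i list \<Rightarrow>\<^sub>0 complex)" where
  "perm_action V \<sigma> x = (\<Sum>w\<in>Poly_Mapping.keys x.
     Poly_Mapping.single (permute_list (inv_into UNIV \<sigma>) w)
       ((\<Prod>(i, j)\<in>{(i, j). i < j \<and> j < length w \<and> \<sigma> j < \<sigma> i}.
           fac V (deg V (w ! i)) (deg V (w ! j))) * Poly_Mapping.lookup x w))"

definition antisymmetrizer ::
    "('g, 'v, 'i) gspace \<Rightarrow> nat \<Rightarrow> ('i list \<Rightarrow>\<^sub>0 complex) \<Rightarrow> ('i list \<Rightarrow>\<^sub>0 complex)" where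
  "antisymmetrizer V r x =
     (\<Sum>\<sigma> | \<sigma> permutes {..<r}. Poly_Mapping.map ((*) (of_int (sign \<sigma>))) (perm_action V \<sigma> x))"

definition symmetrizer ::
    "('g, 'v, 'i) gspace \<Rightarrow> nat \<Rightarrow> ('i list \<Rightarrow>\<^sub>0 complex) \<Rightarrow> ('i list \<Rightarrow>\<^sub>0 complex)" where
  "symmetrizer V r x = (\<Sum>\<sigma> | \<sigma> permutes {..<r}. perm_action V \<sigma> x)"

text \<open>\<open>coaction_coeff V u w\<close> is the coefficient of the word \<open>u\<close> in the coaction on the word \<open>w\<close>. The
  recursion is the rule for \<open>\<delta>(v \<otimes> w)\<close> with \<open>v = b\<^sub>a\<close>, in which \<open>t\<^sub>b\<^sub>a\<close> of degree
  \<open>\<gamma>\<^sub>a - \<gamma>\<^sub>b\<close> is moved past \<open>u\<close>.\<close>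

fun coaction_coeff ::
    "('g::ab_group_add, 'v::ab_group_add, 'i) gspace \<Rightarrow> 'i list \<Rightarrow> 'i list \<Rightarrow> 'i env \<Rightarrow> complex" where
  "coaction_coeff V [] [] = \<one>\<^bsub>finite_dual_alg V\<^esub>"
| "coaction_coeff V (b # u) (a # w) =
     fac V (deg V a - deg V b) (word_deg (deg V) u) \<odot>\<^bsub>finite_dual_alg V\<^esub>
       (mcoeff V b a \<otimes>\<^bsub>finite_dual_alg V\<^esub> coaction_coeff V u w)"
| "coaction_coeff V _ _ = \<zero>\<^bsub>finite_dual_alg V\<^esub>"

definition coaction ::
    "('g::ab_group_add, 'v::ab_group_add, 'i) gspace \<Rightarrow> ('i list \<Rightarrow>\<^sub>0 complex) \<Rightarrow>
     ('i list \<Rightarrow>\<^sub>0 complex, 'i env \<Rightarrow> complex) tensor" where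
  "coaction V x = (let A = V_tensor_algebra V; T = matrix_coeff_alg V in
     \<Sum>w\<in>Poly_Mapping.keys x. \<Sum>u | set u \<subseteq> ind V \<and> length u = length w.
       fscale (Poly_Mapping.lookup x w) (tens A T (Poly_Mapping.single u 1) (coaction_coeff V u w)))"

text \<open>\<open>(p \<otimes> id) \<delta>(\<Lambda>) = \<Lambda> \<otimes> D\<close> for the projection selected by \<open>\<epsilon>\<close>.\<close>

definition coaction_minor ::
    "('g::ab_group_add, 'v::ab_group_add, 'i) gspace \<Rightarrow> complex \<Rightarrow> ('i list \<Rightarrow>\<^sub>0 complex) \<Rightarrow>
     ('i env \<Rightarrow> complex) \<Rightarrow> bool" where
  "coaction_minor V \<epsilon> \<Lambda> D \<longleftrightarrow> (let A = V_tensor_algebra V; T = matrix_coeff_alg V in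
     D \<in> carrier T \<and>
     tensor_map A T (sgn_proj V \<epsilon>) (\<lambda>f. f) (coaction V \<Lambda>) = tens A T \<Lambda> D)"

definition minor_powers ::
    "('g::ab_group_add, 'v::ab_group_add, 'i) gspace \<Rightarrow> ('i env \<Rightarrow> complex) \<Rightarrow>
     ('i env \<Rightarrow> complex) \<Rightarrow> ('i env \<Rightarrow> complex) set" where
  "minor_powers V Dp Dm = (let T = matrix_coeff_alg V in
     {(Dp [^]\<^bsub>T\<^esub> i) \<otimes>\<^bsub>T\<^esub> (Dm [^]\<^bsub>T\<^esub> j) | (i::nat) (j::nat). True})"

end

theory Submission
  imports Defs "Jordan_Normal_Form.Determinant"
begin

text \<open>A functional on the enveloping algebra is determined by its values on words in the matrix units, and the
  product of the finite dual becomes an \<open>\<omega>\<close>-twisted shuffle product of functions on words. Writing \<open>\<omega>\<close>, up to the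
  sign of supercommutation, as the antisymmetrisation of a bimultiplicative function turns it into a rescaling of
  the supercommutative shuffle product. The rescaled matrix \<open>(t\<^sub>b\<^sub>a)\<close> is then an even supermatrix, its inverse is
  given by the antipode, and the determinants of its diagonal blocks are proportional to \<open>D\<^sub>+\<close> and \<open>D\<^sub>-\<close>. Products
  of two odd elements are nilpotent, so both determinants are units of the coordinate algebra, while Cramer's
  rule and a finite Neumann series write the entries of the inverse with a power of \<open>D\<^sub>+ D\<^sub>-\<close> as denominator.
  Hence every \<open>x\<close> in the coordinate algebra satisfies \<open>d x = a\<close> with \<open>a \<in> T\<close> and \<open>d\<close> a product of powers of
  \<open>D\<^sub>+\<close> and \<open>D\<^sub>-\<close>, and \<open>x\<close> corresponds to the fraction \<open>a/d\<close>, that is, to the set of all such pairs \<open>(a, d)\<close>.\<close>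

text \<open>No basis of the enveloping algebra is used: a functional is a function on words that
  kills every inserted commutation relation, so products, degrees and supports are computed in the
  free algebra. The obstacle is that determinants need commutativity, which \<omega>-commutation
  denies even to the entries of a diagonal block. On \<Gamma> itself a bimultiplicative function
  with the required antisymmetrisation would have to respect all relations between the degrees; on
  the free abelian group over the index set of the basis it may be prescribed freely on pairs of
  generators, so an arbitrary numbering of the indices suffices. The price is a grading finer than
  that by \<Gamma>: the rescaling is multiplicative only up to a scalar depending on the finer
  degrees, and the algebras involved must be generated by elements homogeneous for it. The same
  scalars explain why the antisymmetrizer on \<open>V\<^sub>+\<close> and the symmetrizer on
  \<open>V\<^sub>-\<close> both lead to ordinary determinants.\<close>

type_synonym 'l wfun = "'l list => complex"
type_synonym 'i gword = "('i \<times> 'i) list"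
type_synonym 'i gfun = "('i \<times> 'i) wfun"

abbreviation "wsingle \<equiv> Poly_Mapping.single"
abbreviation "wlookup \<equiv> Poly_Mapping.lookup"
abbreviation "wkeys \<equiv> Poly_Mapping.keys"
abbreviation "pscale c \<equiv> Poly_Mapping.map ((*) (c :: complex))"

section \<open>Sums over the splittings of a word\<close>

text \<open>\<open>split_sum k \<beta> w\<close> is the sum of \<open>\<beta>(u, v)\<close> over all ways of distributing the letters of \<open>w\<close> over a
  pair of words \<open>(u, v)\<close>, where a factor \<open>k\<close> is picked up whenever a letter of \<open>v\<close> has to pass a later letter
  of \<open>u\<close>. This is the coproduct of \<open>w\<close> in a tensor algebra whose letters are primitive.\<close>

primrec split_sum ::
    "('l list => 'l list => complex) => ('l list => 'l list => complex) => 'l list => complex" where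
  "split_sum k \<beta> [] = \<beta> [] []"
| "split_sum k \<beta> (l # w) =
     (split_sum k (\<lambda>u v. \<beta> (l # u) v) w) + (split_sum k (\<lambda>u v. k [l] u * \<beta> u (l # v)) w)"

declare split_sum.simps(2) [simp del]

text \<open>A splitting only uses letters of \<open>w\<close>, so the forms have to agree on such
  pairs alone; this makes side conditions such as \<open>set w \<subseteq> L\<close> available under
  the sum.\<close>

lemma split_sum_cong_set:
  assumes "\<And>u v. set u \<union> set v = set w ==> \<beta> u v = \<beta>' u v"
  shows "split_sum k \<beta> w = split_sum k \<beta>' w"
  using assms
proof (induction w arbitrary: \<beta> \<beta>')
  case (Cons l w)
  have "split_sum k (\<lambda>u v. \<beta> (l # u) v) w = split_sum k (\<lambda>u v. \<beta>' (l # u) v) w"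
    by (intro Cons.IH Cons.prems) auto
  moreover have "split_sum k (\<lambda>u v. k [l] u * \<beta> u (l # v)) w =
      split_sum k (\<lambda>u v. k [l] u * \<beta>' u (l # v)) w"
    by (intro Cons.IH arg_cong[where f = "(*) _"] Cons.prems) auto
  ultimately show ?case by (simp add: split_sum.simps)
qed simp

lemma split_sum_add:
  "split_sum k (\<lambda>u v. \<beta> u v + \<beta>' u v) w = split_sum k \<beta> w + split_sum k \<beta>' w"
  by (induction w arbitrary: \<beta> \<beta>') (simp_all add: split_sum.simps distrib_left algebra_simps)

lemma split_sum_scale: "split_sum k (\<lambda>u v. c * \<beta> u v) w = c * split_sum k \<beta> w"
proof (induction w arbitrary: \<beta>)
  case (Cons l w)
  have "(\<lambda>u v. k [l] u * (c * \<beta> u (l # v))) = (\<lambda>u v. c * (k [l] u * \<beta> u (l # v)))"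
    by (simp add: fun_eq_iff)
  then show ?case using Cons by (simp add: split_sum.simps distrib_left)
qed simp

lemma split_sum_scale_right: "split_sum k (\<lambda>u v. \<beta> u v * c) w = split_sum k \<beta> w * c"
  using split_sum_scale[of k c \<beta> w] by (simp add: mult.commute)

lemma split_sum_zero: "split_sum k (\<lambda>u v. 0) w = 0"
  using split_sum_scale[of k 0 "\<lambda>_ _. 0" w] by simp

lemma split_sum_sum: "split_sum k (\<lambda>u v. \<Sum>i\<in>A. \<beta> i u v) w = (\<Sum>i\<in>A. split_sum k (\<beta> i) w)"
  by (induction A rule: infinite_finite_induct) (simp_all add: split_sum_zero split_sum_add)

text \<open>The counit of the tensor algebra as a function on words, hence the unit of the shuffle
  product.\<close>

definition unit_word :: "'l list => complex" where
  "unit_word w = (if w = [] then 1 else 0)"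

section \<open>Bimultiplicative weights on the free monoid\<close>

locale word_bichar =
  fixes k :: "'l list => 'l list => complex"
  assumes k_append_left: "k (u @ v) w = k u w * k v w"
    and k_append_right: "k w (u @ v) = k w u * k w v"
    and k_Nil_left [simp]: "k [] w = 1"
    and k_Nil_right [simp]: "k w [] = 1"
begin

definition k_letter_left :: "'l => 'l list => complex" where
  "k_letter_left l w = k [l] w"

definition k_letter_right :: "'l list => 'l => complex" where
  "k_letter_right w l = k w [l]"

text \<open>The two abbreviating constants prevent these rules from rewriting their own right-hand sides.\<close>

lemma k_Cons_left: "k (l # v) w = k_letter_left l w * k v w"
  unfolding k_letter_left_def using k_append_left[of "[l]" v w] by (metis append_Cons append_Nil)

lemma k_Cons_right: "k w (l # v) = k_letter_right w l * k w v"
  unfolding k_letter_right_def using k_append_right[of w "[l]" v] by (metis append_Cons append_Nil)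

lemma k_letter_left_append: "k_letter_left l (u @ v) = k_letter_left l u * k_letter_left l v"
  by (simp add: k_letter_left_def k_append_right)

text \<open>The words \<open>u\<close> and \<open>v\<close> share out the letters of
  \<open>w\<close>, so by multiplicativity \<open>k x u * k x v\<close> equals \<open>k x w\<close>
  for every splitting. The weight \<open>j\<close> of the splitting itself is unrelated to
  \<open>k\<close>.\<close>

lemma split_sum_weight_left:
  "split_sum j (\<lambda>u v. k x u * k x v * \<beta> u v) w = k x w * split_sum j \<beta> w"
proof (induction w arbitrary: \<beta>)
  case (Cons l w)
  have 1: "(\<lambda>u v. k x (l # u) * k x v * \<beta> (l # u) v) = (\<lambda>u v. k x u * k x v * (k x [l] * \<beta> (l # u) v))"
    by (simp add: fun_eq_iff k_Cons_right mult_ac)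
  have 2: "(\<lambda>u v. j [l] u * (k x u * k x (l # v) * \<beta> u (l # v))) =
      (\<lambda>u v. k x u * k x v * (k x [l] * (j [l] u * \<beta> u (l # v))))"
    by (simp add: fun_eq_iff k_Cons_right mult_ac)
  show ?case
    unfolding split_sum.simps 1 2 Cons.IH split_sum_scale by (simp add: k_Cons_right algebra_simps)
qed simp

lemma split_sum_weight_right:
  "split_sum j (\<lambda>u v. k u x * k v x * \<beta> u v) w = k w x * split_sum j \<beta> w"
proof (induction w arbitrary: \<beta>)
  case (Cons l w)
  have 1: "(\<lambda>u v. k (l # u) x * k v x * \<beta> (l # u) v) = (\<lambda>u v. k u x * k v x * (k [l] x * \<beta> (l # u) v))"
    by (simp add: fun_eq_iff k_Cons_left mult_ac)
  have 2: "(\<lambda>u v. j [l] u * (k u x * k (l # v) x * \<beta> u (l # v))) =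
      (\<lambda>u v. k u x * k v x * (k [l] x * (j [l] u * \<beta> u (l # v))))"
    by (simp add: fun_eq_iff k_Cons_left mult_ac)
  show ?case
    unfolding split_sum.simps 1 2 Cons.IH split_sum_scale by (simp add: k_Cons_left algebra_simps)
qed simp

text \<open>Multiplicativity of the coproduct: in the product of \<open>u \<otimes> v\<close> and
  \<open>u' \<otimes> v'\<close> the middle factors \<open>v\<close> and \<open>u'\<close> change
  places, which costs \<open>k v u'\<close>.\<close>

lemma split_sum_append:
  "split_sum k \<beta> (x @ y) =
     split_sum k (\<lambda>u v. split_sum k (\<lambda>u' v'. k v u' * \<beta> (u @ u') (v @ v')) y) x"
proof (induction x arbitrary: \<beta>)
  case (Cons l x)
  have "(\<lambda>u v. split_sum k (\<lambda>u' v'. k v u' * (k [l] (u @ u') * \<beta> (u @ u') (l # v @ v'))) y) =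
      (\<lambda>u v. k [l] u * split_sum k (\<lambda>u' v'. k (l # v) u' * \<beta> (u @ u') ((l # v) @ v')) y)"
    by (simp add: fun_eq_iff k_Cons_left k_letter_left_append split_sum_scale[symmetric] mult_ac)
  then show ?case by (simp add: split_sum.simps Cons.IH)
qed simp

text \<open>The leading letter goes to one of three places. Its weight past a word that is split
  further is distributed over the parts by \<open>split_sum_weight_left\<close>, so both iterated
  sums yield the same three terms.\<close>

lemma split_sum_coassoc:
  "split_sum k (\<lambda>u v. split_sum k (\<lambda>u1 u2. \<beta> u1 u2 v) u) w =
   split_sum k (\<lambda>u v. split_sum k (\<lambda>v1 v2. \<beta> u v1 v2) v) w"
proof (induction w arbitrary: \<beta>)
  case (Cons l w)
  have 1: "(\<lambda>u v. k [l] u * split_sum k (\<lambda>u1 u2. \<beta> u1 u2 (l # v)) u) =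
      (\<lambda>u v. split_sum k (\<lambda>u1 u2. k [l] u1 * k [l] u2 * \<beta> u1 u2 (l # v)) u)"
    by (simp add: fun_eq_iff split_sum_weight_left)
  have 2: "(\<lambda>u v. k [l] u * (split_sum k (\<lambda>v1 v2. \<beta> u (l # v1) v2) v +
        split_sum k (\<lambda>v1 v2. k [l] v1 * \<beta> u v1 (l # v2)) v)) =
      (\<lambda>u v. split_sum k (\<lambda>v1 v2. k [l] u * \<beta> u (l # v1) v2) v +
        split_sum k (\<lambda>v1 v2. k [l] u * k [l] v1 * \<beta> u v1 (l # v2)) v)"
    by (simp add: fun_eq_iff split_sum_scale[symmetric] algebra_simps)
  show ?case
    by (simp only: split_sum.simps 1 2 split_sum_add Cons.IH) (simp add: add.assoc)
qed simp

end

section \<open>Commutation factors on words and the shuffle product\<close>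

locale word_commutation = word_bichar k for k :: "'l list => 'l list => complex" +
  assumes k_swap: "k u v * k v u = 1"
begin

lemma k_swap': "k v u * (k u v * c) = c" "k v u * (c * k u v) = c"
  using k_swap[of v u] by (simp_all only: mult.assoc[symmetric] mult_1_left) (metis mult.commute mult.left_commute mult_1_left)

lemma k_letter_swap:
  "k_letter_left l u * (k_letter_right u l * c) = c" "k_letter_right u l * (k_letter_left l u * c) = c"
  unfolding k_letter_left_def k_letter_right_def by (rule k_swap')+

lemma k_nonzero [simp]: "k u v \<noteq> 0"
  using k_swap[of u v] by auto

text \<open>Exchanging \<open>u\<close> and \<open>v\<close> exchanges the two places open to the
  leading letter, and \<open>k_swap\<close> cancels the weight that it picks up in one of
  them.\<close>

lemma split_sum_cocommute:
  "split_sum k \<beta> w = split_sum k (\<lambda>u v. k u v * \<beta> v u) w"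
proof (induction w arbitrary: \<beta>)
  case (Cons l w)
  have 1: "split_sum k (\<lambda>u v. k (l # u) v * \<beta> v (l # u)) w = split_sum k (\<lambda>u v. k [l] u * \<beta> u (l # v)) w"
  proof -
    have "split_sum k (\<lambda>u v. k [l] u * \<beta> u (l # v)) w =
        split_sum k (\<lambda>u v. k u v * (k [l] v * \<beta> v (l # u))) w"
      using Cons.IH[of "\<lambda>u v. k [l] u * \<beta> u (l # v)"] .
    then show ?thesis by (simp add: k_Cons_left mult_ac)
  qed
  have 2: "split_sum k (\<lambda>u v. k [l] u * (k u (l # v) * \<beta> (l # v) u)) w = split_sum k (\<lambda>u v. \<beta> (l # u) v) w"
  proof -
    have "(\<lambda>u v. k [l] u * (k u (l # v) * \<beta> (l # v) u)) = (\<lambda>u v. k u v * \<beta> (l # v) u)"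
      by (simp add: fun_eq_iff k_Cons_left k_Cons_right mult.assoc k_letter_swap)
    then show ?thesis using Cons.IH[of "\<lambda>u v. \<beta> (l # u) v"] by simp
  qed
  show ?case by (simp add: split_sum.simps 1 2)
qed simp

text \<open>Dual to the coproduct is the shuffle product of functions on words. The factor \<open>k u v\<close> is the
  one by which the value of \<open>f \<otimes> g\<close> at \<open>u \<otimes> v\<close> differs from \<open>f u * g v\<close>.\<close>

definition shuffle :: "'l wfun => 'l wfun => 'l list => complex"
    (infixl \<open>\<star>\<close> 70) where
  "(f \<star> g) w = split_sum k (\<lambda>u v. k u v * f u * g v) w"

lemma shuffle_assoc: "(f \<star> g) \<star> h = f \<star> (g \<star> h)"
proof
  fix w
  have "((f \<star> g) \<star> h) w =
     split_sum k (\<lambda>u v. split_sum k (\<lambda>u1 u2. k u1 v * k u2 v * (k u1 u2 * f u1 * g u2) * h v) u) w"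
    by (simp only: shuffle_def split_sum_weight_right split_sum_scale_right)
  also have "\<dots> = split_sum k (\<lambda>u v. split_sum k (\<lambda>v1 v2. k u v2 * k v1 v2 * (k u v1 * f u * g v1) * h v2) v) w"
    by (rule split_sum_coassoc)
  also have "\<dots> = split_sum k (\<lambda>u v. split_sum k (\<lambda>v1 v2. f u * (k u v1 * k u v2 * (k v1 v2 * g v1 * h v2))) v) w"
    by (simp only: mult_ac)
  also have "\<dots> = split_sum k (\<lambda>u v. f u * (k u v * split_sum k (\<lambda>v1 v2. k v1 v2 * g v1 * h v2) v)) w"
    by (simp only: split_sum_weight_left split_sum_scale)
  also have "\<dots> = (f \<star> (g \<star> h)) w"
    unfolding shuffle_def by (simp only: mult_ac)
  finally show "((f \<star> g) \<star> h) w = (f \<star> (g \<star> h)) w" .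
qed

text \<open>Left translation by a letter is a twisted derivation of the shuffle product. Together
  with its mirror image \<open>shuffle_snoc\<close> this keeps products of representative functions
  representative.\<close>

lemma shuffle_Cons:
  "(f \<star> g) (l # w) = ((\<lambda>u. f (l # u)) \<star> (\<lambda>v. k [l] v * g v)) w + (f \<star> (\<lambda>v. g (l # v))) w"
proof -
  have 1: "(\<lambda>u v. k (l # u) v * f (l # u) * g v) = (\<lambda>u v. k u v * f (l # u) * (k [l] v * g v))"
    by (simp add: fun_eq_iff k_Cons_left mult_ac)
  have 2: "(\<lambda>u v. k [l] u * (k u (l # v) * f u * g (l # v))) = (\<lambda>u v. k u v * f u * g (l # v))"
    by (simp add: fun_eq_iff k_Cons_left k_Cons_right mult.assoc k_letter_swap)
  show ?thesis unfolding shuffle_def split_sum.simps 1 2 ..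
qed

lemma shuffle_snoc:
  "(f \<star> g) (w @ [l]) = ((\<lambda>u. f (u @ [l])) \<star> g) w + ((\<lambda>u. k u [l] * f u) \<star> (\<lambda>v. g (v @ [l]))) w"
proof -
  have 1: "(\<lambda>u v. k v [l] * (k (u @ [l]) v * f (u @ [l]) * g v)) = (\<lambda>u v. k u v * f (u @ [l]) * g v)"
    by (simp add: fun_eq_iff k_append_left k_Cons_left k_Cons_right mult.assoc)
       (simp add: mult.left_commute k_letter_swap k_letter_swap[where c = 1, simplified])
  have 2: "(\<lambda>u v. k u (v @ [l]) * f u * g (v @ [l])) = (\<lambda>u v. k u v * (k u [l] * f u) * g (v @ [l]))"
    by (simp add: fun_eq_iff k_append_right mult_ac)
  have "(f \<star> g) (w @ [l]) = split_sum k (\<lambda>u v. k v [l] * (k (u @ [l]) v * f (u @ [l]) * g v) +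
      k u (v @ [l]) * f u * g (v @ [l])) w"
    by (simp add: shuffle_def split_sum_append split_sum.simps)
  then show ?thesis by (simp only: split_sum_add shuffle_def 1 2)
qed

lemma shuffle_add_left: "(\<lambda>w. f w + f' w) \<star> g = (\<lambda>w. (f \<star> g) w + (f' \<star> g) w)"
  by (simp add: fun_eq_iff shuffle_def distrib_left distrib_right split_sum_add)

lemma shuffle_add_right: "f \<star> (\<lambda>w. g w + g' w) = (\<lambda>w. (f \<star> g) w + (f \<star> g') w)"
  by (simp add: fun_eq_iff shuffle_def distrib_left distrib_right split_sum_add)

lemma shuffle_scale_left: "(\<lambda>w. c * f w) \<star> g = (\<lambda>w. c * (f \<star> g) w)"
  by (simp add: fun_eq_iff shuffle_def split_sum_scale[symmetric] mult_ac)

lemma shuffle_scale_right: "f \<star> (\<lambda>w. c * g w) = (\<lambda>w. c * (f \<star> g) w)"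
  by (simp add: fun_eq_iff shuffle_def split_sum_scale[symmetric] mult_ac)

lemma shuffle_zero_left: "(\<lambda>w. 0) \<star> g = (\<lambda>w. 0)"
  using shuffle_scale_left[of 0 "\<lambda>_. 0" g] by simp

lemma shuffle_zero_right: "g \<star> (\<lambda>w. 0) = (\<lambda>w. 0)"
  using shuffle_scale_right[of g 0 "\<lambda>_. 0"] by simp

lemma shuffle_unit_left [simp]: "unit_word \<star> g = g"
proof -
  have "split_sum k (\<lambda>u v. k u v * unit_word u * g v) w = g w" for w
  proof (induction w arbitrary: g)
    case (Cons l w)
    have "(\<lambda>u v. k (l # u) v * unit_word (l # u) * g v) = (\<lambda>u v. 0)"
      by (simp add: unit_word_def)
    moreover have "(\<lambda>u v. k [l] u * (k u (l # v) * unit_word u * g (l # v))) = (\<lambda>u v. k u v * unit_word u * g (l # v))"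
      by (auto simp: fun_eq_iff unit_word_def)
    ultimately show ?case using Cons[of "\<lambda>v. g (l # v)"] by (simp add: split_sum.simps split_sum_zero)
  qed (simp add: unit_word_def)
  then show ?thesis by (simp add: fun_eq_iff shuffle_def)
qed

lemma shuffle_unit_right [simp]: "g \<star> unit_word = g"
proof -
  have "split_sum k (\<lambda>u v. k u v * g u * unit_word v) w = g w" for w
  proof (induction w arbitrary: g)
    case (Cons l w)
    have "(\<lambda>u v. k [l] u * (k u (l # v) * g u * unit_word (l # v))) = (\<lambda>u v. 0)"
      by (simp add: unit_word_def)
    moreover have "(\<lambda>u v. k (l # u) v * g (l # u) * unit_word v) = (\<lambda>u v. k u v * g (l # u) * unit_word v)"
      by (auto simp: fun_eq_iff unit_word_def)
    ultimately show ?case using Cons[of "\<lambda>v. g (l # v)"] by (simp add: split_sum.simps split_sum_zero)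
  qed (simp add: unit_word_def)
  then show ?thesis by (simp add: fun_eq_iff shuffle_def)
qed

text \<open>Cocommutativity dualised. For homogeneous \<open>f\<close> and \<open>g\<close> the
  scalar \<open>c\<close> is the commutation factor of their degrees.\<close>

lemma shuffle_commute:
  assumes "\<And>u v. f u \<noteq> 0 ==> g v \<noteq> 0 ==> k u v = c"
  shows "f \<star> g = (\<lambda>w. c * (g \<star> f) w)"
proof
  fix w
  have "(g \<star> f) w = split_sum k (\<lambda>u v. k u v * (k v u * g v * f u)) w"
    unfolding shuffle_def by (subst split_sum_cocommute) simp
  also have "\<dots> = split_sum k (\<lambda>u v. f u * g v) w"
    by (simp add: mult.assoc k_swap') (simp add: mult.commute)
  finally have "c * (g \<star> f) w = split_sum k (\<lambda>u v. c * (f u * g v)) w"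
    by (simp add: split_sum_scale)
  moreover have "(\<lambda>u v. k u v * f u * g v) = (\<lambda>u v. c * (f u * g v))"
  proof (intro ext)
    fix u v show "k u v * f u * g v = c * (f u * g v)"
      using assms[of u v] by (cases "f u = 0"; cases "g v = 0") auto
  qed
  ultimately show "(f \<star> g) w = c * (g \<star> f) w" by (simp add: shuffle_def)
qed

text \<open>Only the multisets of letters are recorded, since degrees, parities and sets of letters
  depend on nothing else.\<close>

lemma shuffle_nonzeroE:
  assumes "(f \<star> g) w \<noteq> 0"
  obtains u v where "f u \<noteq> 0" "g v \<noteq> 0" "mset w = mset u + mset v"
proof -
  have "\<exists>u v. \<beta> u v \<noteq> 0 \<and> mset w = mset u + mset v" if "split_sum k \<beta> w \<noteq> 0" for \<beta>
    using that
  proof (induction w arbitrary: \<beta>)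
    case (Cons l w)
    have "split_sum k (\<lambda>u v. \<beta> (l # u) v) w \<noteq> 0 \<or> split_sum k (\<lambda>u v. k [l] u * \<beta> u (l # v)) w \<noteq> 0"
      using Cons.prems by (intro disjCI notI) (simp only: split_sum.simps(2) add_0_left simp_thms)
    then show ?case
    proof
      assume "split_sum k (\<lambda>u v. \<beta> (l # u) v) w \<noteq> 0"
      from Cons.IH[OF this] obtain u v where "\<beta> (l # u) v \<noteq> 0" "mset w = mset u + mset v" by auto
      then show ?thesis by (intro exI[of _ "l # u"] exI[of _ v]) simp
    next
      assume "split_sum k (\<lambda>u v. k [l] u * \<beta> u (l # v)) w \<noteq> 0"
      from Cons.IH[OF this] obtain u v where "\<beta> u (l # v) \<noteq> 0" "mset w = mset u + mset v" by auto
      then show ?thesis by (intro exI[of _ u] exI[of _ "l # v"]) simp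
    qed
  qed auto
  from this[of "\<lambda>u v. k u v * f u * g v"] assms that show thesis
    unfolding shuffle_def by auto
qed

end

section \<open>The supercommutative shuffle algebra\<close>

text \<open>Letters carry their parity, so that the algebra is a type without parameters and the theory of
  determinants over commutative rings applies to its even part.\<close>

definition odd_word :: "('l \<times> bool) list => bool" where
  "odd_word w \<longleftrightarrow> odd (length (filter snd w))"

definition super_sign :: "('l \<times> bool) list => ('l \<times> bool) list => complex" where
  "super_sign u v = (if odd_word u \<and> odd_word v then - 1 else 1)"

lemma odd_word_append: "odd_word (u @ v) \<longleftrightarrow> odd_word u \<noteq> odd_word v"
  by (auto simp: odd_word_def)

lemma odd_word_Nil [simp]: "\<not> odd_word []"
  by (simp add: odd_word_def)

interpretation super: word_commutation super_sign
  by standard (auto simp: super_sign_def odd_word_append)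

typedef 'l sfun = "UNIV :: (('l \<times> bool) list => complex) set"
  morphisms sfun_val Sfun by simp

setup_lifting type_definition_sfun

instantiation sfun :: (type) ring_1
begin
lift_definition zero_sfun :: "'a sfun" is "\<lambda>w. 0" .
lift_definition one_sfun :: "'a sfun" is unit_word .
lift_definition plus_sfun :: "'a sfun => 'a sfun => 'a sfun" is "\<lambda>f g w. f w + g w" .
lift_definition minus_sfun :: "'a sfun => 'a sfun => 'a sfun" is "\<lambda>f g w. f w - g w" .
lift_definition uminus_sfun :: "'a sfun => 'a sfun" is "\<lambda>f w. - f w" .
lift_definition times_sfun :: "'a sfun => 'a sfun => 'a sfun" is super.shuffle .
instance
proof
  fix a b c :: "'a sfun"
  show "(a * b) * c = a * (b * c)" by transfer (rule super.shuffle_assoc)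
  show "1 * a = a" by transfer (rule super.shuffle_unit_left)
  show "a * 1 = a" by transfer (rule super.shuffle_unit_right)
  show "(a + b) * c = a * c + b * c" by transfer (rule super.shuffle_add_left)
  show "a * (b + c) = a * b + a * c" by transfer (rule super.shuffle_add_right)
  show "(0 :: 'a sfun) \<noteq> 1" by transfer (metis unit_word_def zero_neq_one)
qed (transfer; simp add: fun_eq_iff)+
end

lift_definition sfun_even :: "'l sfun => bool" is "\<lambda>f. \<forall>w. f w \<noteq> 0 \<longrightarrow> \<not> odd_word w" .
lift_definition sfun_odd :: "'l sfun => bool" is "\<lambda>f. \<forall>w. f w \<noteq> 0 \<longrightarrow> odd_word w" .

lemma odd_word_mset_add:
  assumes "mset w = mset u + mset v"
  shows "odd_word w \<longleftrightarrow> odd_word u \<noteq> odd_word v"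
proof -
  have "mset (filter snd w) = mset (filter snd u) + mset (filter snd v)"
    using assms by (simp add: mset_filter)
  then have "length (filter snd w) = length (filter snd u) + length (filter snd v)"
    by (metis size_mset size_union)
  then show ?thesis by (simp add: odd_word_def)
qed

lemma sfun_even_mult: "sfun_even a ==> sfun_even b ==> sfun_even (a * b)"
  by transfer (metis odd_word_mset_add super.shuffle_nonzeroE)

lemma sfun_odd_mult: "sfun_odd a ==> sfun_odd b ==> sfun_even (a * b)"
  by transfer (metis odd_word_mset_add super.shuffle_nonzeroE)

lemma sfun_even_odd_mult: "sfun_even a ==> sfun_odd b ==> sfun_odd (a * b)"
  by transfer (metis odd_word_mset_add super.shuffle_nonzeroE)

lemma sfun_even_add: "sfun_even a ==> sfun_even b ==> sfun_even (a + b)"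
  by transfer (metis add_0)

lemma sfun_odd_add: "sfun_odd a ==> sfun_odd b ==> sfun_odd (a + b)"
  by transfer (metis add_0)

lemma sfun_even_uminus: "sfun_even a ==> sfun_even (- a)"
  by transfer simp

lemma sfun_even_diff: "sfun_even a ==> sfun_even b ==> sfun_even (a - b)"
  using sfun_even_add[of a "- b"] sfun_even_uminus[of b] by simp

lemma sfun_even_zero [simp]: "sfun_even 0"
  by transfer simp

lemma sfun_odd_zero [simp]: "sfun_odd 0"
  by transfer simp

lemma sfun_even_one [simp]: "sfun_even 1"
  by transfer (simp add: unit_word_def)

lemma sfun_odd_sum: "(\<And>i. i \<in> A ==> sfun_odd (f i)) ==> sfun_odd (sum f A)"
  by (induction A rule: infinite_finite_induct) (auto intro: sfun_odd_add)

lemma sfun_even_commute: "sfun_even a ==> a * b = b * a"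
proof transfer
  fix a b :: "('a \<times> bool) list => complex"
  assume "\<forall>w. a w \<noteq> 0 \<longrightarrow> \<not> odd_word w"
  then show "super.shuffle a b = super.shuffle b a"
    using super.shuffle_commute[of a b 1] by (simp add: super_sign_def)
qed

lemma sfun_odd_anticommute: "sfun_odd a ==> sfun_odd b ==> a * b = - (b * a)"
proof transfer
  fix a b :: "('a \<times> bool) list => complex"
  assume "\<forall>w. a w \<noteq> 0 \<longrightarrow> odd_word w" "\<forall>w. b w \<noteq> 0 \<longrightarrow> odd_word w"
  then show "super.shuffle a b = (\<lambda>w. - super.shuffle b a w)"
    using super.shuffle_commute[of a b "- 1"] by (simp add: super_sign_def)
qed

text \<open>Anticommutation gives \<open>a * a = - (a * a)\<close>, and 2 is invertible in the
  complex values.\<close>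

lemma sfun_odd_square: "sfun_odd a ==> a * a = 0"
proof -
  assume "sfun_odd a"
  then have "a * a + a * a = 0" using sfun_odd_anticommute[of a a] by (metis add.right_inverse)
  then show ?thesis by transfer (simp add: fun_eq_iff flip: mult_2)
qed

text \<open>Exchanging the inner factors \<open>b\<close> and \<open>a\<close> isolates the squares
  of \<open>a\<close> and \<open>b\<close>. All nilpotent elements in the determinant argument stem
  from this.\<close>

lemma sfun_odd_product_square:
  assumes "sfun_odd a" "sfun_odd b"
  shows "(a * b) * (a * b) = 0"
proof -
  have "(a * b) * (a * b) = a * (b * a) * b" by (simp add: mult.assoc)
  also have "\<dots> = - ((a * a) * (b * b))"
    using sfun_odd_anticommute[OF assms(2,1)] by (simp add: mult.assoc)
  finally show ?thesis using sfun_odd_square[OF assms(1)] by simp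
qed

text \<open>A type of its own, since determinants and adjugates are available for types of class
  \<open>comm_ring_1\<close>.\<close>

typedef 'l efun = "{f :: 'l sfun. sfun_even f}"
  morphisms efun_val Efun by (intro exI[of _ 0]) simp

setup_lifting type_definition_efun

instantiation efun :: (type) comm_ring_1
begin
lift_definition zero_efun :: "'a efun" is 0 by simp
lift_definition one_efun :: "'a efun" is 1 by simp
lift_definition plus_efun :: "'a efun => 'a efun => 'a efun" is "(+)" by (rule sfun_even_add)
lift_definition minus_efun :: "'a efun => 'a efun => 'a efun" is "(-)" by (rule sfun_even_diff)
lift_definition uminus_efun :: "'a efun => 'a efun" is uminus by (rule sfun_even_uminus)
lift_definition times_efun :: "'a efun => 'a efun => 'a efun" is "(*)" by (rule sfun_even_mult)
instance
proof
  fix a b :: "'a efun"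
  show "a * b = b * a" by transfer (rule sfun_even_commute)
qed (transfer; simp add: algebra_simps)+
end

lemma efun_val_simps [simp]:
  "efun_val 0 = 0" "efun_val 1 = 1" "efun_val (a + b) = efun_val a + efun_val b"
  "efun_val (a - b) = efun_val a - efun_val b" "efun_val (- a) = - efun_val a"
  "efun_val (a * b) = efun_val a * efun_val b"
  by (transfer; simp)+

interpretation efun_val: ring_hom efun_val
  by standard simp_all

lemma efun_val_sum: "efun_val (sum f A) = (\<Sum>i\<in>A. efun_val (f i))"
  by (induction A rule: infinite_finite_induct) simp_all

lemma efun_val_power: "efun_val (a ^ n) = efun_val a ^ n"
  by (induction n) simp_all

lemma sfun_even_efun_val [simp]: "sfun_even (efun_val a)"
  using efun_val by auto

lemma efun_val_Efun [simp]: "sfun_even a ==> efun_val (Efun a) = a"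
  by (simp add: Efun_inverse)

lemma efun_eq_iff: "a = b \<longleftrightarrow> efun_val a = efun_val b"
  by (simp add: efun_val_inject)

section \<open>Determinants modulo nilpotent elements\<close>

text \<open>The determinant argument has to remember in which subring its results lie. As a set, the
  subring can be varied within one type: the images of \<open>T\<close>, of the coordinate algebra
  and of a localisation all occur.\<close>

definition subring_set :: "'a::ring_1 set => bool" where
  "subring_set K \<longleftrightarrow> 1 \<in> K \<and> (\<forall>a\<in>K. - a \<in> K) \<and> (\<forall>a\<in>K. \<forall>b\<in>K. a + b \<in> K \<and> a * b \<in> K)"

lemma subring_setD:
  assumes "subring_set K"
  shows "1 \<in> K" "0 \<in> K" "a \<in> K ==> - a \<in> K" "a \<in> K ==> b \<in> K ==> a + b \<in> K"
    "a \<in> K ==> b \<in> K ==> a * b \<in> K" "a \<in> K ==> b \<in> K ==> a - b \<in> K"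
proof -
  show 1: "1 \<in> K" "a \<in> K ==> - a \<in> K" "a \<in> K ==> b \<in> K ==> a + b \<in> K" "a \<in> K ==> b \<in> K ==> a * b \<in> K" for a b
    using assms by (auto simp: subring_set_def)
  from 1(3)[OF 1(1) 1(2)[OF 1(1)]] show "0 \<in> K" by simp
  show "a \<in> K ==> b \<in> K ==> a - b \<in> K" using 1(3)[of a "- b"] 1(2)[of b] by simp
qed

lemma subring_set_sum: "subring_set K ==> (\<And>i. i \<in> A ==> f i \<in> K) ==> sum f A \<in> K"
  by (induction A rule: infinite_finite_induct) (auto intro: subring_setD)

lemma subring_set_prod:
  "subring_set K ==> (\<And>i. i \<in> A ==> f i \<in> K) ==> prod f A \<in> K" for f :: "_ => 'a::comm_ring_1"
  by (induction A rule: infinite_finite_induct) (auto intro: subring_setD)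

lemma subring_set_power: "subring_set K ==> a \<in> K ==> a ^ n \<in> K"
  by (induction n) (auto intro: subring_setD)

lemma subring_set_det:
  fixes A :: "'a::comm_ring_1 mat"
  assumes K: "subring_set K" and A: "A \<in> carrier_mat n n" "\<And>i j. i < n ==> j < n ==> A $$ (i, j) \<in> K"
  shows "det A \<in> K"
  unfolding det_def'[OF A(1)]
proof (intro subring_set_sum[OF K] subring_setD(5)[OF K] subring_set_prod[OF K])
  fix p i assume "p \<in> {p. p permutes {0..<n}}" "i \<in> {0..<n}"
  then show "A $$ (i, p i) \<in> K" using A(2) permutes_in_image[of p "{0..<n}" i] by auto
next
  fix p :: "nat => nat"
  show "signof p \<in> K" using subring_setD[OF K] by (auto simp: sign_def)
qed

lemma subring_set_adj_mat:
  fixes A :: "'a::comm_ring_1 mat"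
  assumes K: "subring_set K" and A: "A \<in> carrier_mat n n" "\<And>i j. i < n ==> j < n ==> A $$ (i, j) \<in> K"
    and ij: "i < n" "j < n"
  shows "adj_mat A $$ (i, j) \<in> K"
proof -
  have "mat_delete A j i $$ (i', j') \<in> K" if "i' < n - 1" "j' < n - 1" for i' j'
    using that A by (auto simp: mat_delete_def)
  then have "det (mat_delete A j i) \<in> K"
    by (intro subring_set_det[OF K mat_delete_carrier[OF A(1)]])
  then show ?thesis
    using A(1) ij by (auto simp: adj_mat_def cofactor_def intro!: subring_setD[OF K] subring_set_power[OF K])
qed

lemma prod_diff_in_ideal:
  fixes f g :: "_ => 'a::comm_ring_1"
  assumes J: "0 \<in> J" "\<And>a b. a \<in> J ==> b \<in> J ==> a + b \<in> J" "\<And>a r. a \<in> J ==> r * a \<in> J"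
    and fg: "\<And>i. i \<in> A ==> f i - g i \<in> J"
  shows "prod f A - prod g A \<in> J"
  using fg
proof (induction A rule: infinite_finite_induct)
  case (insert x A)
  have "prod f (insert x A) - prod g (insert x A) = f x * (prod f A - prod g A) + prod g A * (f x - g x)"
    using insert(1,2) by (simp add: algebra_simps)
  then show ?case using insert J(2,3) by simp
qed (simp_all add: J(1))

text \<open>By Leibniz' formula the determinant is a polynomial in the entries, and congruences
  modulo \<open>J\<close> pass through sums and products.\<close>

lemma det_diff_in_ideal:
  fixes A B :: "'a::comm_ring_1 mat"
  assumes J: "0 \<in> J" "\<And>a b. a \<in> J ==> b \<in> J ==> a + b \<in> J" "\<And>a r. a \<in> J ==> r * a \<in> J"
    and AB: "A \<in> carrier_mat n n" "B \<in> carrier_mat n n"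
      "\<And>i j. i < n ==> j < n ==> A $$ (i, j) - B $$ (i, j) \<in> J"
  shows "det A - det B \<in> J"
proof -
  have sum_in: "finite S ==> (\<And>i. i \<in> S ==> f i \<in> J) ==> sum f S \<in> J" for S :: "(nat => nat) set" and f
    by (induction S rule: finite_induct) (auto intro: J)
  have "det A - det B = (\<Sum>p | p permutes {0..<n}. signof p *
      ((\<Prod>i = 0..<n. A $$ (i, p i)) - (\<Prod>i = 0..<n. B $$ (i, p i))))"
    unfolding det_def'[OF AB(1)] det_def'[OF AB(2)] by (simp add: algebra_simps sum_subtractf)
  also have "\<dots> \<in> J"
  proof (intro sum_in J(3) prod_diff_in_ideal J(1,2))
    fix p i assume "p \<in> {p. p permutes {0..<n}}" "i \<in> {0..<n}"
    then show "A $$ (i, p i) - B $$ (i, p i) \<in> J"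
      using AB(3) permutes_in_image[of p "{0..<n}" i] by auto
  qed (auto simp: finite_permutations)
  finally show ?thesis .
qed

section \<open>Nilpotent elements and unipotent matrices\<close>

definition nilpotents :: "'a::comm_ring_1 set" where
  "nilpotents = {a. \<exists>n. a ^ n = 0}"

lemma nilpotents_zero: "0 \<in> nilpotents"
  by (auto simp: nilpotents_def intro: exI[of _ 1])

lemma nilpotents_mult: "a \<in> nilpotents ==> r * a \<in> nilpotents"
  unfolding nilpotents_def mem_Collect_eq by (metis mult_zero_right power_mult_distrib)

lemma nilpotents_add:
  assumes "a \<in> nilpotents" "b \<in> nilpotents"
  shows "a + b \<in> nilpotents"
proof -
  obtain m n where mn: "a ^ m = 0" "b ^ n = 0" using assms by (auto simp: nilpotents_def)
  have "(a + b) ^ (m + n) = (\<Sum>k\<le>m + n. of_nat (m + n choose k) * a ^ k * b ^ (m + n - k))"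
    by (rule binomial_ring)
  also have "\<dots> = 0"
  proof (intro sum.neutral ballI)
    fix k assume "k \<in> {..m + n}"
    show "of_nat (m + n choose k) * a ^ k * b ^ (m + n - k) = 0"
    proof (cases "m \<le> k")
      case True
      then have "a ^ k = a ^ m * a ^ (k - m)" by (metis le_add_diff_inverse power_add)
      then show ?thesis using mn by simp
    next
      case False
      then have "b ^ (m + n - k) = b ^ n * b ^ (m - k)"
        by (metis add.commute add_diff_assoc2 nat_le_linear power_add)
      then show ?thesis using mn by simp
    qed
  qed
  finally show ?thesis by (auto simp: nilpotents_def)
qed

lemma nilpotents_sum: "(\<And>i. i \<in> A ==> f i \<in> nilpotents) ==> sum f A \<in> nilpotents"
  by (induction A rule: infinite_finite_induct) (auto intro: nilpotents_zero nilpotents_add)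

text \<open>The finite geometric series in \<open>1 - a\<close> inverts \<open>a\<close>, and as a
  polynomial in \<open>a\<close> it stays in \<open>K\<close>.\<close>

lemma unipotent_unit:
  assumes K: "subring_set K" and a: "1 - a \<in> nilpotents" "a \<in> K"
  obtains u where "u \<in> K" "a * u = 1"
proof -
  obtain n where n: "(1 - a) ^ n = 0" using a by (auto simp: nilpotents_def)
  have "a * (\<Sum>i<n. (1 - a) ^ i) = 1 - (1 - a) ^ n"
    using one_diff_power_eq[of "1 - a" n] by simp
  then show thesis
    using n by (intro that[of "\<Sum>i<n. (1 - a) ^ i"] subring_set_sum[OF K] subring_set_power[OF K])
      (auto intro: subring_setD[OF K] a)
qed

text \<open>Modulo nilpotent elements the matrix is the identity, so its determinant is 1 up to a
  nilpotent element.\<close>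

lemma det_unipotent_unit:
  fixes A :: "'a::comm_ring_1 mat"
  assumes K: "subring_set K" and A: "A \<in> carrier_mat n n" "\<And>i j. i < n ==> j < n ==> A $$ (i, j) \<in> K"
    and nil: "\<And>i j. i < n ==> j < n ==> (if i = j then 1 else 0) - A $$ (i, j) \<in> nilpotents"
  obtains u where "u \<in> K" "det A * u = 1"
proof (rule unipotent_unit[OF K])
  have "det (1\<^sub>m n) - det A \<in> nilpotents"
    using nil by (intro det_diff_in_ideal[OF nilpotents_zero nilpotents_add nilpotents_mult]) (auto simp: A(1))
  then show "1 - det A \<in> nilpotents" by simp
  show "det A \<in> K" by (rule subring_set_det[OF K A])
qed


lemma efun_nilpotent_odd_product:
  assumes "sfun_odd a" "sfun_odd b"
  shows "Efun (a * b) \<in> nilpotents"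
proof -
  have "Efun (a * b) ^ 2 = 0"
    unfolding efun_eq_iff power2_eq_square
    using assms by (simp add: sfun_odd_mult sfun_odd_product_square)
  then show ?thesis unfolding nilpotents_def by blast
qed

text \<open>A diagonal block of the equation \<open>t s = 1\<close> for supermatrices, with
  \<open>A\<close> and \<open>A'\<close> the even blocks, \<open>X\<close> and \<open>Y\<close> the
  odd ones. The entries of \<open>X Y\<close> are nilpotent, so \<open>A A'\<close> is unipotent,
  and \<open>det A'\<close> divided by its determinant inverts \<open>det A\<close>. Since
  \<open>K\<close> must contain the entries of \<open>A'\<close>, this serves the coordinate algebra
  rather than \<open>T\<close>.\<close>

lemma block_det_unit:
  fixes A A' :: "nat => nat => 'l efun" and X Y :: "nat => nat => 'l sfun"
  assumes K: "subring_set K"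
    and A: "\<And>i j. i < p ==> j < p ==> A i j \<in> K" "\<And>i j. i < p ==> j < p ==> A' i j \<in> K"
    and X: "\<And>i a. i < p ==> a < q ==> sfun_odd (X i a)" and Y: "\<And>a j. a < q ==> j < p ==> sfun_odd (Y a j)"
    and eq: "\<And>i j. i < p ==> j < p ==>
      (\<Sum>a<p. efun_val (A i a) * efun_val (A' a j)) + (\<Sum>a<q. X i a * Y a j) = (if i = j then 1 else 0)"
  obtains u where "u \<in> K" "det (mat p p (\<lambda>(i, j). A i j)) * u = 1"
proof -
  let ?A = "mat p p (\<lambda>(i, j). A i j)" and ?A' = "mat p p (\<lambda>(i, j). A' i j)"
  have car: "?A \<in> carrier_mat p p" "?A' \<in> carrier_mat p p" "?A * ?A' \<in> carrier_mat p p" by auto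
  have prod: "(?A * ?A') $$ (i, j) = (\<Sum>a<p. A i a * A' a j)" if "i < p" "j < p" for i j
    using that by (simp add: scalar_prod_def lessThan_atLeast0)
  have "(if i = j then 1 else 0) - (?A * ?A') $$ (i, j) = (\<Sum>a<q. Efun (X i a * Y a j))"
    if ij: "i < p" "j < p" for i j
  proof -
    have "efun_val (if i = j then 1 else 0) = (if i = j then 1 else 0)" by simp
    moreover have "efun_val (\<Sum>a<q. Efun (X i a * Y a j)) = (\<Sum>a<q. X i a * Y a j)"
      unfolding efun_val_sum using ij X Y by (intro sum.cong) (auto simp: sfun_odd_mult)
    ultimately show ?thesis
      unfolding efun_eq_iff prod[OF ij] using eq[OF ij] by (simp add: efun_val_sum algebra_simps)
  qed
  then have "(if i = j then 1 else 0) - (?A * ?A') $$ (i, j) \<in> nilpotents" if "i < p" "j < p" for i j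
    using that X Y by (simp only:) (intro nilpotents_sum efun_nilpotent_odd_product, auto)
  moreover have "(?A * ?A') $$ (i, j) \<in> K" if "i < p" "j < p" for i j
    unfolding prod[OF that] using that A by (intro subring_set_sum[OF K] subring_setD(5)[OF K]) auto
  ultimately obtain u where u: "u \<in> K" "det (?A * ?A') * u = 1"
    using det_unipotent_unit[OF K car(3)] by blast
  have "det ?A' \<in> K" using A by (intro subring_set_det[OF K car(2)]) auto
  moreover have "det ?A * (det ?A' * u) = 1"
    using u det_mult[OF car(1,2)] by (simp add: mult.assoc)
  ultimately show thesis using u(1) that subring_setD(5)[OF K] by blast
qed

text \<open>Cramer's rule. The adjugate is used on the left because the blocks of \<open>t\<close>
  are to be cancelled from that side.\<close>

lemma det_right_inverse_entries:
  fixes A :: "'a::comm_ring_1 mat"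
  assumes A: "A \<in> carrier_mat n n" and u: "det A * u = 1"
  shows "(u \<cdot>\<^sub>m adj_mat A) * A = 1\<^sub>m n" "u \<cdot>\<^sub>m adj_mat A \<in> carrier_mat n n"
proof -
  have "(u \<cdot>\<^sub>m adj_mat A) * A = u \<cdot>\<^sub>m (adj_mat A * A)"
    using adj_mat(1)[OF A] A by (simp add: mult_smult_assoc_mat)
  also have "\<dots> = (u * det A) \<cdot>\<^sub>m 1\<^sub>m n" using adj_mat(3)[OF A] by (auto simp: mult.assoc)
  also have "u * det A = 1" using u by (simp add: mult.commute)
  also have "1 \<cdot>\<^sub>m 1\<^sub>m n = (1\<^sub>m n :: 'a mat)" by (intro eq_matI) auto
  finally show "(u \<cdot>\<^sub>m adj_mat A) * A = 1\<^sub>m n" .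
  show "u \<cdot>\<^sub>m adj_mat A \<in> carrier_mat n n" using adj_mat(1)[OF A] by simp
qed

text \<open>Modulo nilpotent elements the supermatrix \<open>t\<close> is block diagonal. Writing \<open>g\<close> for the inverse of its
  diagonal part and \<open>g t = 1 + N\<close>, the square of \<open>N\<close> is an even matrix with nilpotent entries, so that
  \<open>t\<^sup>-\<^sup>1 = (1 - N\<^sup>2)\<^sup>-\<^sup>1 (1 - N) g\<close>.\<close>

theorem supermatrix_inverse_entries:
  fixes t s :: "nat => nat => 'l sfun" and m q :: nat
  defines "A \<equiv> mat m m (\<lambda>(i, j). Efun (t i j))"
    and "B \<equiv> mat q q (\<lambda>(i, j). Efun (t (m + i) (m + j)))"
  assumes even: "\<And>i j. i < m + q ==> j < m + q ==> (i < m \<longleftrightarrow> j < m) ==> sfun_even (t i j) \<and> sfun_even (s i j)"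
    and odd: "\<And>i j. i < m + q ==> j < m + q ==> (i < m \<longleftrightarrow> \<not> j < m) ==> sfun_odd (t i j) \<and> sfun_odd (s i j)"
    and ts: "\<And>i j. i < m + q ==> j < m + q ==> (\<Sum>a<m + q. t i a * s a j) = (if i = j then 1 else 0)"
    and T: "subring_set T" "\<And>i j. i < m + q ==> j < m + q ==> t i j \<in> T"
    and T': "subring_set T'" "\<And>i j. i < m + q ==> j < m + q ==> t i j \<in> T' \<and> s i j \<in> T'"
  shows "\<exists>u\<in>T'. sfun_even u \<and> efun_val (det A) * u = 1"
    and "\<exists>u\<in>T'. sfun_even u \<and> efun_val (det B) * u = 1"
    and "\<And>i j. i < m + q ==> j < m + q ==> \<exists>k. efun_val (det A * det B) ^ k * s i j \<in> T"
proof -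
  define n where "n = m + q"
  have split: "(\<Sum>a<n. f a) = (\<Sum>a<m. f a) + (\<Sum>a<q. f (m + a))" for f :: "nat => 'l sfun"
    unfolding n_def by (simp add: lessThan_atLeast0 sum.atLeastLessThan_concat[of 0 m "m + q", symmetric]
      sum.shift_bounds_nat_ivl[of f 0 m q, simplified add_0, symmetric] add.commute)
  have E_sub: "subring_set {e. efun_val e \<in> K}" if K: "subring_set K" for K :: "'l sfun set"
    unfolding subring_set_def using subring_setD[OF K] by simp
  have Acar: "A \<in> carrier_mat m m" and Bcar: "B \<in> carrier_mat q q" by (auto simp: A_def B_def)
  obtain u where u: "efun_val u \<in> T'" "det A * u = 1"
  proof (rule block_det_unit[OF E_sub[OF T'(1)], where p = m and q = q and A = "\<lambda>i j. Efun (t i j)"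
        and A' = "\<lambda>i j. Efun (s i j)" and X = "\<lambda>i a. t i (m + a)" and Y = "\<lambda>a j. s (m + a) j"])
    show "(\<Sum>a<m. efun_val (Efun (t i a)) * efun_val (Efun (s a j))) + (\<Sum>a<q. t i (m + a) * s (m + a) j) =
      (if i = j then 1 else 0)" if "i < m" "j < m" for i j
      using ts[of i j] that even unfolding n_def[symmetric] split by (simp add: n_def)
  qed (use even odd T' in \<open>auto simp: A_def\<close>)
  obtain v where v: "efun_val v \<in> T'" "det B * v = 1"
  proof (rule block_det_unit[OF E_sub[OF T'(1)], where p = q and q = m and A = "\<lambda>i j. Efun (t (m + i) (m + j))"
        and A' = "\<lambda>i j. Efun (s (m + i) (m + j))" and X = "\<lambda>i a. t (m + i) a" and Y = "\<lambda>a j. s a (m + j)"])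
    show "(\<Sum>a<q. efun_val (Efun (t (m + i) (m + a))) * efun_val (Efun (s (m + a) (m + j)))) +
        (\<Sum>a<m. t (m + i) a * s a (m + j)) = (if i = j then 1 else 0)" if "i < q" "j < q" for i j
      using ts[of "m + i" "m + j"] that even unfolding n_def[symmetric] split by (simp add: n_def add.commute)
  qed (use even odd T' in \<open>auto simp: B_def\<close>)
  have "efun_val (det A) * efun_val u = 1" "efun_val (det B) * efun_val v = 1"
    unfolding efun_val_simps(6)[symmetric] u v by simp_all
  then show "\<exists>u\<in>T'. sfun_even u \<and> efun_val (det A) * u = 1" "\<exists>u\<in>T'. sfun_even u \<and> efun_val (det B) * u = 1"
    using u(1) v(1) sfun_even_efun_val by blast+

  define d where "d = efun_val (det A * det B)"
  \<comment> \<open>The localisation of \<open>T\<close> at \<open>d\<close>, seen inside the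
    ambient ring. The aim is to show that the entries of \<open>s\<close> lie in it.\<close>
  define K where "K = {x. \<exists>k. d ^ k * x \<in> T}"
  have A_T: "efun_val (A $$ (i, j)) \<in> T" if "i < m" "j < m" for i j
    using that even T by (simp add: A_def)
  have B_T: "efun_val (B $$ (i, j)) \<in> T" if "i < q" "j < q" for i j
    using that even T by (simp add: B_def)
  have det_T: "efun_val (det A) \<in> T" "efun_val (det B) \<in> T"
    using subring_set_det[OF E_sub[OF T(1)] Acar] subring_set_det[OF E_sub[OF T(1)] Bcar] A_T B_T by auto
  have dT: "d \<in> T" using det_T by (simp add: d_def subring_setD[OF T(1)])
  have d_central: "d ^ k * x = x * d ^ k" for k x
    unfolding d_def efun_val_power[symmetric] by (rule sfun_even_commute) simp
  have T_K: "x \<in> K" if "x \<in> T" for x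
    using that by (auto simp: K_def intro!: exI[of _ 0])
  have K: "subring_set K"
    unfolding subring_set_def
  proof (intro conjI ballI)
    show "1 \<in> K" using subring_setD[OF T(1)] by (intro T_K)
    fix x assume "x \<in> K"
    then obtain k where k: "d ^ k * x \<in> T" by (auto simp: K_def)
    show "- x \<in> K" using subring_setD(3)[OF T(1) k] by (auto simp: K_def intro: exI[of _ k])
    fix y assume "y \<in> K"
    then obtain l where l: "d ^ l * y \<in> T" by (auto simp: K_def)
    have "d ^ (k + l) * (x + y) = d ^ l * (d ^ k * x) + d ^ k * (d ^ l * y)"
      by (simp add: distrib_left mult.assoc[symmetric] flip: power_add) (simp add: add.commute)
    also have "\<dots> \<in> T"
      by (rule subring_setD(4)[OF T(1) subring_setD(5)[OF T(1) subring_set_power[OF T(1) dT] k]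
        subring_setD(5)[OF T(1) subring_set_power[OF T(1) dT] l]])
    finally show "x + y \<in> K" unfolding K_def by blast
    have "d ^ (k + l) * (x * y) = (d ^ k * x) * (d ^ l * y)"
      by (simp add: power_add mult.assoc) (metis d_central mult.assoc)
    also have "\<dots> \<in> T" by (rule subring_setD(5)[OF T(1) k l])
    finally show "x * y \<in> K" unfolding K_def by blast
  qed
  \<comment> \<open>Only the product \<open>d\<close> of both determinants is inverted in
    \<open>K\<close>; its factor \<open>det A\<close> cancels against \<open>u\<close>, and
    \<open>det B\<close> remains, which lies in \<open>T\<close>.\<close>
  have u_K: "efun_val u \<in> K"
  proof -
    have "d * efun_val u = efun_val (det B)"
      unfolding d_def efun_val_simps(6)[symmetric] using u(2) by (metis mult.commute mult.left_commute mult_1_right)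
    then show ?thesis using det_T unfolding K_def by (auto intro!: exI[of _ 1])
  qed
  have v_K: "efun_val v \<in> K"
  proof -
    have "d * efun_val v = efun_val (det A)"
      unfolding d_def efun_val_simps(6)[symmetric] using v(2) by (metis mult.assoc mult_1_right)
    then show ?thesis using det_T unfolding K_def by (auto intro!: exI[of _ 1])
  qed
  note EK = E_sub[OF K]

  define gA where "gA = u \<cdot>\<^sub>m adj_mat A"
  define gB where "gB = v \<cdot>\<^sub>m adj_mat B"
  have gA: "gA * A = 1\<^sub>m m" "gA \<in> carrier_mat m m" and gB: "gB * B = 1\<^sub>m q" "gB \<in> carrier_mat q q"
    using det_right_inverse_entries[OF Acar u(2)] det_right_inverse_entries[OF Bcar v(2)]
    by (simp_all add: gA_def gB_def)
  have gA_K: "efun_val (gA $$ (i, j)) \<in> K" if "i < m" "j < m" for i j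
    using subring_set_adj_mat[OF EK Acar _ that] that u_K A_T T_K subring_setD(5)[OF K] adj_mat(1)[OF Acar]
    by (simp add: gA_def)
  have gB_K: "efun_val (gB $$ (i, j)) \<in> K" if "i < q" "j < q" for i j
    using subring_set_adj_mat[OF EK Bcar _ that] that v_K B_T T_K subring_setD(5)[OF K] adj_mat(1)[OF Bcar]
    by (simp add: gB_def)
  \<comment> \<open>Inverse of the block diagonal part of \<open>t\<close>. The diagonal blocks of
    \<open>G t - 1\<close> then vanish, so that \<open>N\<close> is off-diagonal and its entries are
    odd.\<close>
  define G where "G = mat n n (\<lambda>(i, j). if i < m \<and> j < m then efun_val (gA $$ (i, j))
     else if m \<le> i \<and> m \<le> j then efun_val (gB $$ (i - m, j - m)) else 0)"
  define t' where "t' = mat n n (\<lambda>(i, j). t i j)"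
  define s' where "s' = mat n n (\<lambda>(i, j). s i j)"
  define N where "N = G * t' - 1\<^sub>m n"
  have car: "G \<in> carrier_mat n n" "t' \<in> carrier_mat n n" "s' \<in> carrier_mat n n" "N \<in> carrier_mat n n"
    by (auto simp: G_def t'_def s'_def N_def)
  have G_K: "G $$ (i, j) \<in> K" if "i < n" "j < n" for i j
    using that gA_K gB_K subring_setD(2)[OF K] by (auto simp: G_def n_def)
  have Gt: "(G * t') $$ (i, j) = (\<Sum>a<n. G $$ (i, a) * t a j)" if "i < n" "j < n" for i j
    using that car by (simp add: scalar_prod_def lessThan_atLeast0 t'_def)
  have Gt1: "(G * t') $$ (i, j) = (\<Sum>a<m. efun_val (gA $$ (i, a)) * t a j)" if "i < m" "j < n" for i j
  proof -
    have "i < n" using that by (simp add: n_def)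
    from Gt[OF this that(2)] show ?thesis unfolding split using that by (simp add: G_def n_def)
  qed
  have Gt2: "(G * t') $$ (m + i, j) = (\<Sum>a<q. efun_val (gB $$ (i, a)) * t (m + a) j)" if "i < q" "j < n" for i j
  proof -
    have "m + i < n" using that by (simp add: n_def)
    from Gt[OF this that(2)] show ?thesis unfolding split using that by (simp add: G_def n_def)
  qed
  have N_even: "N $$ (i, j) = 0" if ij: "i < n" "j < n" "i < m \<longleftrightarrow> j < m" for i j
  proof (cases "i < m")
    case True
    then have j: "j < m" using ij by simp
    have "(G * t') $$ (i, j) = efun_val ((gA * A) $$ (i, j))"
      unfolding Gt1[OF True ij(2)] using True j gA(2) even
      by (simp add: scalar_prod_def lessThan_atLeast0 efun_val_sum A_def)
    then show ?thesis using gA True j ij car by (simp add: N_def)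
  next
    case False
    then obtain i' j' where i: "i = m + i'" "i' < q" and j: "j = m + j'" "j' < q"
      using ij by (metis add_diff_inverse_nat n_def nat_add_left_cancel_less)
    have "(G * t') $$ (i, j) = efun_val ((gB * B) $$ (i', j'))"
      unfolding i(1) Gt2[OF i(2) ij(2)] using i j gB(2) even
      by (simp add: scalar_prod_def lessThan_atLeast0 efun_val_sum B_def)
    then show ?thesis using gB i j ij car by (simp add: N_def)
  qed
  have N_odd: "sfun_odd (N $$ (i, j))" if ij: "i < n" "j < n" for i j
  proof (cases "i < m \<longleftrightarrow> j < m")
    case True
    then show ?thesis using N_even[OF ij] by simp
  next
    case False
    then have "i \<noteq> j" by auto
    then have N: "N $$ (i, j) = (G * t') $$ (i, j)" using ij car by (simp add: N_def)
    show ?thesis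
    proof (cases "i < m")
      case True
      then show ?thesis unfolding N Gt1[OF True ij(2)] using False odd ij
        by (intro sfun_odd_sum sfun_even_odd_mult) (auto simp: n_def)
    next
      case i: False
      then obtain i' where i': "i = m + i'" "i' < q"
        using ij by (metis add_diff_inverse_nat n_def nat_add_left_cancel_less)
      have "N $$ (i, j) = (\<Sum>a<q. efun_val (gB $$ (i', a)) * t (m + a) j)"
        using N Gt2[OF i'(2) ij(2)] i'(1) by simp
      then show ?thesis using False i odd ij
        by (simp only:, intro sfun_odd_sum sfun_even_odd_mult) (auto simp: n_def)
    qed
  qed
  have N_K: "N $$ (i, j) \<in> K" if "i < n" "j < n" for i j
  proof -
    have "(G * t') $$ (i, j) \<in> K"
      unfolding Gt[OF that] using that G_K T T_K
      by (intro subring_set_sum[OF K] subring_setD(5)[OF K]) (auto simp: n_def)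
    then show ?thesis using that car subring_setD[OF K] by (auto simp: N_def)
  qed
  \<comment> \<open>The square of \<open>N\<close>, taken over the even ring so that determinants
    apply; its entries are sums of products of two odd elements.\<close>
  define Q where "Q = mat n n (\<lambda>(i, j). \<Sum>a<n. Efun (N $$ (i, a) * N $$ (a, j)))"
  define M where "M = 1\<^sub>m n - Q"
  have Mcar: "M \<in> carrier_mat n n" "Q \<in> carrier_mat n n" by (auto simp: M_def Q_def)
  have NN: "map_mat efun_val Q = N * N"
  proof (rule eq_matI)
    fix i j assume "i < dim_row (N * N)" "j < dim_col (N * N)"
    then have ij: "i < n" "j < n" using car by auto
    then have "map_mat efun_val Q $$ (i, j) = (\<Sum>a<n. N $$ (i, a) * N $$ (a, j))"
      using N_odd by (auto simp: Q_def efun_val_sum sfun_odd_mult intro!: sum.cong)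
    then show "map_mat efun_val Q $$ (i, j) = (N * N) $$ (i, j)"
      using ij car by (simp add: scalar_prod_def lessThan_atLeast0)
  qed (use car in \<open>auto simp: Q_def\<close>)
  have Q_nil: "Q $$ (i, j) \<in> nilpotents" and Q_K: "efun_val (Q $$ (i, j)) \<in> K" if "i < n" "j < n" for i j
    using that N_odd N_K
    by (auto simp: Q_def efun_val_sum sfun_odd_mult intro!: nilpotents_sum efun_nilpotent_odd_product
        subring_set_sum[OF K] subring_setD(5)[OF K])
  have M_K: "efun_val (M $$ (i, j)) \<in> K" if "i < n" "j < n" for i j
    using that Q_K subring_setD[OF K] Mcar(2) by (auto simp: M_def)
  obtain r where r: "efun_val r \<in> K" "det M * r = 1"
  proof (rule det_unipotent_unit[OF EK Mcar(1)])
    show "(if i = j then 1 else 0) - M $$ (i, j) \<in> nilpotents" if "i < n" "j < n" for i j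
      using that Q_nil[of i j] Mcar(2) by (auto simp: M_def)
  qed (use M_K in auto)
  define W where "W = r \<cdot>\<^sub>m adj_mat M"
  have W: "W * M = 1\<^sub>m n" "W \<in> carrier_mat n n"
    using det_right_inverse_entries[OF Mcar(1) r(2)] by (simp_all add: W_def)
  have W_K: "efun_val (W $$ (i, j)) \<in> K" if "i < n" "j < n" for i j
    using subring_set_adj_mat[OF EK Mcar(1) _ that] that r M_K subring_setD(5)[OF K] adj_mat(1)[OF Mcar(1)]
    by (simp add: W_def)
  define W' where "W' = map_mat efun_val W"
  have W'car: "W' \<in> carrier_mat n n" using W by (simp add: W'_def)
  have one_N: "1\<^sub>m n - N \<in> carrier_mat n n" "1\<^sub>m n + N \<in> carrier_mat n n" using car by auto
  have GtN: "G * t' = 1\<^sub>m n + N"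
    by (rule eq_matI) (use car in \<open>auto simp: N_def\<close>)
  \<comment> \<open>The entries of \<open>N\<close> do not commute, but the factorisation of
    \<open>1 - N * N\<close> involves powers of the one matrix \<open>N\<close> only.\<close>
  have MN: "map_mat efun_val M = (1\<^sub>m n - N) * (1\<^sub>m n + N)"
  proof -
    have "(1\<^sub>m n - N) * (1\<^sub>m n + N) = (1\<^sub>m n - N) * 1\<^sub>m n + (1\<^sub>m n - N) * N"
      using car one_N by (intro mult_add_distrib_mat) auto
    also have "(1\<^sub>m n - N) * N = 1\<^sub>m n * N - N * N"
      using car by (intro minus_mult_distrib_mat) auto
    also have "(1\<^sub>m n - N) * 1\<^sub>m n + (1\<^sub>m n * N - N * N) = 1\<^sub>m n - N * N"
      using car one_N by (intro eq_matI) auto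
    finally show ?thesis
      unfolding NN[symmetric] by (intro eq_matI) (use Mcar in \<open>auto simp: M_def\<close>)
  qed
  have "W' * (1\<^sub>m n - N) * (1\<^sub>m n + N) = W' * ((1\<^sub>m n - N) * (1\<^sub>m n + N))"
    by (rule assoc_mult_mat[OF W'car one_N])
  also have "\<dots> = W' * map_mat efun_val M" by (simp only: MN)
  also have "\<dots> = map_mat efun_val (W * M)"
    unfolding W'_def by (rule efun_val.mat_hom_mult[OF W(2) Mcar(1), symmetric])
  also have "\<dots> = 1\<^sub>m n" unfolding W(1) by (rule efun_val.mat_hom_one)
  finally have inv: "W' * (1\<^sub>m n - N) * (G * t') = 1\<^sub>m n" unfolding GtN .
  have ts': "t' * s' = 1\<^sub>m n"
    by (rule eq_matI)
      (use ts car in \<open>auto simp: scalar_prod_def lessThan_atLeast0 t'_def s'_def n_def\<close>)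
  have WN: "W' * (1\<^sub>m n - N) \<in> carrier_mat n n" using W'car one_N by auto
  \<comment> \<open>A left inverse of \<open>t'\<close> equals the right inverse \<open>s'\<close>,
    and all factors of this left inverse have their entries in \<open>K\<close>.\<close>
  have "s' = W' * (1\<^sub>m n - N) * (G * t') * s'" using inv car by simp
  also have "\<dots> = W' * (1\<^sub>m n - N) * G * (t' * s')"
    using assoc_mult_mat[OF WN car(1) car(2)] assoc_mult_mat[OF _ car(2) car(3), of "W' * (1\<^sub>m n - N) * G"] WN car
    by (metis mult_carrier_mat)
  also have "\<dots> = W' * (1\<^sub>m n - N) * G" using ts' WN car by simp
  finally have s': "s' = W' * (1\<^sub>m n - N) * G" .
  have mult_K: "(X * Y) $$ (i, j) \<in> K"
    if "X \<in> carrier_mat n n" "Y \<in> carrier_mat n n" "\<And>i j. i < n ==> j < n ==> X $$ (i, j) \<in> K"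
      "\<And>i j. i < n ==> j < n ==> Y $$ (i, j) \<in> K" "i < n" "j < n" for X Y :: "'l sfun mat" and i j
    using that by (auto simp: scalar_prod_def intro!: subring_set_sum[OF K] subring_setD(5)[OF K])
  have "(1\<^sub>m n - N) $$ (i, j) \<in> K" if "i < n" "j < n" for i j
    using that car N_K subring_setD[OF K] by auto
  moreover have "W' $$ (i, j) \<in> K" if "i < n" "j < n" for i j
    using that W W_K by (simp add: W'_def)
  ultimately have s'_K: "s' $$ (i, j) \<in> K" if "i < n" "j < n" for i j
    unfolding s' using that W'car one_N WN car G_K by (intro mult_K) auto
  show "\<exists>k. efun_val (det A * det B) ^ k * s i j \<in> T" if "i < m + q" "j < m + q" for i j
    using s'_K[of i j] that unfolding n_def[symmetric] by (simp add: s'_def K_def d_def)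
qed

section \<open>Free algebras\<close>

lemma lookup_pscale [simp]: "wlookup (pscale (c :: complex) p) w = c * wlookup p w"
  by (simp add: map.rep_eq when_def)

lemma poly_sum_single:
  fixes p :: "'w \<Rightarrow>\<^sub>0 complex"
  shows "p = (\<Sum>w\<in>wkeys p. wsingle w (wlookup p w))"
proof (rule poly_mapping_eqI)
  fix v
  have "wlookup (\<Sum>w\<in>wkeys p. wsingle w (wlookup p w)) v =
      (\<Sum>w\<in>wkeys p. if w = v then wlookup p v else 0)"
    unfolding lookup_sum by (intro sum.cong refl) (auto simp: lookup_single when_def)
  then show "wlookup p v =
      wlookup (\<Sum>w\<in>wkeys p. wsingle w (wlookup p w)) v"
    by (simp add: in_keys_iff)
qed

text \<open>The predicate \<open>Q\<close> on words is carried along so that the induction stays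
  inside the carrier of a tensor algebra.\<close>

lemma poly_induct_on [consumes 1, case_names zero single add]:
  fixes p :: "'w \<Rightarrow>\<^sub>0 complex"
  assumes "\<forall>w\<in>wkeys p. Q w"
    and "P 0" and "\<And>w c. Q w ==> P (wsingle w c)"
    and "\<And>p q. \<forall>w\<in>wkeys p. Q w ==> \<forall>w\<in>wkeys q. Q w ==> P p ==> P q ==> P (p + q)"
  shows "P p"
proof -
  have "P (\<Sum>w\<in>A. wsingle w (wlookup p w)) \<and>
      (\<forall>w\<in>wkeys (\<Sum>w\<in>A. wsingle w (wlookup p w)). Q w)"
    if "A \<subseteq> wkeys p" for A
    using finite_subset[OF that finite_keys] that
  proof (induction A rule: finite_induct)
    case (insert w A)
    then have "Q w" using assms(1) by auto
    then have k: "\<forall>v\<in>wkeys (wsingle w (wlookup p w)). Q v" by simp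
    with insert \<open>Q w\<close> show ?case
      using assms(3,4) keys_add[of "wsingle w (wlookup p w)"
          "\<Sum>w\<in>A. wsingle w (wlookup p w)"]
      by auto
  qed (simp add: assms(2))
  from this[of "wkeys p"] show ?thesis by (simp flip: poly_sum_single)
qed

lemma poly_induct [case_names zero single add]:
  fixes p :: "'w \<Rightarrow>\<^sub>0 complex"
  assumes "P 0" "\<And>w c. P (wsingle w c)" "\<And>p q. P p ==> P q ==> P (p + q)"
  shows "P p"
  by (rule poly_induct_on[where Q = "\<lambda>_. True"]) (auto intro: assms)

text \<open>Words form a basis of the free algebra, so this pairing identifies its full dual with
  the space of all functions on words.\<close>

definition word_eval :: "'l wfun => ('l list \<Rightarrow>\<^sub>0 complex) => complex" where
  "word_eval \<phi> p = (\<Sum>w\<in>wkeys p. wlookup p w * \<phi> w)"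

lemma word_eval_superset:
  assumes "finite A" "wkeys p \<subseteq> A"
  shows "word_eval \<phi> p = (\<Sum>w\<in>A. wlookup p w * \<phi> w)"
  unfolding word_eval_def using assms by (intro sum.mono_neutral_left) (auto simp: in_keys_iff)

lemma word_eval_add [simp]: "word_eval \<phi> (p + q) = word_eval \<phi> p + word_eval \<phi> q"
proof -
  let ?A = "wkeys p \<union> wkeys q"
  have "word_eval \<phi> (p + q) = (\<Sum>w\<in>?A. wlookup (p + q) w * \<phi> w)"
    using keys_add[of p q] by (intro word_eval_superset) auto
  then show ?thesis
    by (simp add: word_eval_superset[of ?A p] word_eval_superset[of ?A q] lookup_add distrib_right sum.distrib)
qed

lemma word_eval_single [simp]: "word_eval \<phi> (wsingle w c) = c * \<phi> w"
  by (subst word_eval_superset[of "{w}"]) auto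

lemma word_eval_zero [simp]: "word_eval \<phi> 0 = 0"
  by (simp add: word_eval_def)

lemma word_eval_uminus [simp]: "word_eval \<phi> (- p) = - word_eval \<phi> p"
  using word_eval_add[of \<phi> p "- p"] by (simp add: eq_neg_iff_add_eq_0 add.commute)

lemma word_eval_diff [simp]: "word_eval \<phi> (p - q) = word_eval \<phi> p - word_eval \<phi> q"
  using word_eval_add[of \<phi> p "- q"] by simp

lemma word_eval_sum: "word_eval \<phi> (sum f A) = (\<Sum>i\<in>A. word_eval \<phi> (f i))"
  by (induction A rule: infinite_finite_induct) simp_all

lemma word_eval_pscale [simp]: "word_eval \<phi> (pscale c p) = c * word_eval \<phi> p"
  by (subst word_eval_superset[of "wkeys p"]) (auto simp: in_keys_iff word_eval_def sum_distrib_left mult.assoc)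

lemma word_eval_fun_add: "word_eval (\<lambda>w. \<phi> w + \<psi> w) p = word_eval \<phi> p + word_eval \<psi> p"
  by (simp add: word_eval_def distrib_left sum.distrib)

lemma word_eval_fun_scale: "word_eval (\<lambda>w. c * \<phi> w) p = c * word_eval \<phi> p"
  by (simp add: word_eval_def sum_distrib_left mult_ac)

lemma word_eval_fun_sum: "word_eval (\<lambda>w. \<Sum>i\<in>A. \<phi> i w) p = (\<Sum>i\<in>A. word_eval (\<phi> i) p)"
  by (induction A rule: infinite_finite_induct) (simp_all add: word_eval_fun_add, simp_all add: word_eval_def)

lemma word_eval_cong: "(\<And>w. w \<in> wkeys p ==> \<phi> w = \<psi> w) ==> word_eval \<phi> p = word_eval \<psi> p"
  by (simp add: word_eval_def)

text \<open>A product is evaluated by translating the functional; tests on an ideal thereby become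
  insertions between two words.\<close>

lemma word_eval_mult: "word_eval \<phi> (p * q) = word_eval (\<lambda>u. word_eval (\<lambda>v. \<phi> (u @ v)) q) p"
proof (induction p rule: poly_induct)
  case (single u c)
  show ?case
  proof (induction q rule: poly_induct)
    case (single v c')
    show ?case by (simp add: mult_single plus_list_def)
  qed (simp_all add: distrib_left)
qed (simp_all add: distrib_right)

text \<open>Functionals separate polynomials. Identities in the free algebra are proved below by
  evaluating both sides.\<close>

lemma poly_word_eval_eqI:
  assumes "\<And>\<phi>. word_eval \<phi> p = word_eval \<phi> q"
  shows "p = q"
proof (rule poly_mapping_eqI)
  fix w
  have "word_eval (\<lambda>v. if v = w then 1 else 0) r = wlookup r w" for r :: "'a list \<Rightarrow>\<^sub>0 complex"
    by (simp add: word_eval_def in_keys_iff if_distrib cong: if_cong)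
  with assms show "wlookup p w = wlookup q w" by metis
qed

lemma pscale_mult:
  "pscale c p * q = pscale c (p * q)"
  "p * pscale c q = pscale c (p * q)" for p q :: "'l list \<Rightarrow>\<^sub>0 complex"
  by (rule poly_word_eval_eqI; simp add: word_eval_mult word_eval_fun_scale)+

lemma tensor_algebra_simps [simp]:
  "mult (tensor_algebra L \<gamma>) = (*)" "one (tensor_algebra L \<gamma>) = 1" "zero (tensor_algebra L \<gamma>) = 0"
  "add (tensor_algebra L \<gamma>) = (+)" "module.smult (tensor_algebra L \<gamma>) = (\<lambda>c. pscale c)"
  "hpart (tensor_algebra L \<gamma>) = (\<lambda>\<alpha>. {x. \<forall>w\<in>wkeys x. set w \<subseteq> L \<and> word_deg \<gamma> w = \<alpha>})"
  "carrier (tensor_algebra L \<gamma>) = {x. \<forall>w\<in>wkeys x. set w \<subseteq> L}"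
  by (simp_all add: tensor_algebra_def)

lemma free_closed:
  defines "F \<equiv> \<lambda>L. {x :: 'l list \<Rightarrow>\<^sub>0 complex. \<forall>w\<in>wkeys x. set w \<subseteq> L}"
  shows "p \<in> F L ==> q \<in> F L ==> p + q \<in> F L" "p \<in> F L ==> q \<in> F L ==> p * q \<in> F L"
    "p \<in> F L ==> - p \<in> F L" "p \<in> F L ==> q \<in> F L ==> p - q \<in> F L"
    "p \<in> F L ==> pscale c p \<in> F L" "0 \<in> F L" "1 \<in> F L"
    "set w \<subseteq> L ==> wsingle w c \<in> F L"
proof -
  show add: "p + q \<in> F L" if "p \<in> F L" "q \<in> F L" for p q
    using that keys_add[of p q] by (auto simp: F_def)
  show neg: "- p \<in> F L" if "p \<in> F L" for p
    using that by (auto simp: F_def in_keys_iff)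
  show "p - q \<in> F L" if "p \<in> F L" "q \<in> F L"
    using add[OF that(1) neg[OF that(2)]] by simp
  show "p * q \<in> F L" if "p \<in> F L" "q \<in> F L"
    using that keys_mult[of p q] by (auto simp: F_def plus_list_def) fastforce
  show "1 \<in> F L" by (auto simp: F_def in_keys_iff lookup_one when_def zero_list_def split: if_splits)
qed (auto simp: F_def in_keys_iff lookup_single when_def split: if_splits)

lemma ring_of_ring_1:
  fixes R :: "('a::ring_1, 'b) ring_scheme"
  assumes "mult R = (*)" "one R = 1" "zero R = 0" "add R = (+)"
    and "1 \<in> carrier R" "0 \<in> carrier R" "\<And>x. x \<in> carrier R ==> - x \<in> carrier R"
    and "\<And>x y. x \<in> carrier R ==> y \<in> carrier R ==> x + y \<in> carrier R"
    and "\<And>x y. x \<in> carrier R ==> y \<in> carrier R ==> x * y \<in> carrier R"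
  shows "ring R"
proof -
  have "\<exists>y\<in>carrier R. y + x = 0" if "x \<in> carrier R" for x
    using that assms(7) by (intro bexI[of _ "- x"]) auto
  then show ?thesis
    by (intro ringI abelian_groupI monoidI) (simp_all add: assms algebra_simps)
qed

lemma ring_tensor_algebra: "ring (tensor_algebra L \<gamma>)"
  by (rule ring_of_ring_1) (simp_all only: tensor_algebra_simps free_closed)

lemma tensor_algebra_a_minus:
  assumes "p \<in> carrier (tensor_algebra L \<gamma>)" "q \<in> carrier (tensor_algebra L \<gamma>)"
  shows "p \<ominus>\<^bsub>tensor_algebra L \<gamma>\<^esub> q = p - q"
proof -
  interpret ring "tensor_algebra L \<gamma>" by (rule ring_tensor_algebra)
  have "- q \<in> carrier (tensor_algebra L \<gamma>)" using assms free_closed(3)[of q L] by simp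
  then have "\<ominus>\<^bsub>tensor_algebra L \<gamma>\<^esub> q = - q" using assms by (intro minus_equality) auto
  then show ?thesis by (simp add: a_minus_def)
qed

section \<open>Graded algebras and their tensor products\<close>

text \<open>\<open>R\<close> and \<open>S\<close> may be records of different types, as happens when
  a quotient or an image is repackaged as a graded algebra.\<close>

lemma ring_transport:
  fixes R :: "('a, 'b) ring_scheme" and S :: "('a, 'c) ring_scheme"
  assumes "ring R" "carrier S = carrier R" "mult S = mult R" "one S = one R" "zero S = zero R" "add S = add R"
  shows "ring S"
proof -
  interpret R: ring R by fact
  have "\<exists>y\<in>carrier R. y \<oplus>\<^bsub>R\<^esub> x = \<zero>\<^bsub>R\<^esub>" if "x \<in> carrier R" for x
    using that by (intro bexI[of _ "\<ominus>\<^bsub>R\<^esub> x"]) (auto simp: R.l_neg)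
  then show ?thesis
    by (intro ringI abelian_groupI monoidI)
      (auto simp: assms(2-) R.a_assoc R.m_assoc R.l_distr R.r_distr intro: R.a_comm)
qed

text \<open>The projections \<open>pr\<close> are part of the data: every algebra below has explicit
  ones, and \<open>hcomp_eq\<close> identifies them with the definite description behind
  \<open>hcomp\<close>.\<close>

locale graded_algebra = ring A for A :: "('a, 'g::ab_group_add) galg" (structure) +
  fixes pr :: "'g => 'a => 'a"
  assumes smult_closed: "x \<in> carrier A ==> c \<odot> x \<in> carrier A"
    and hpart_carrier: "x \<in> hpart A \<alpha> ==> x \<in> carrier A"
    and pr_hpart: "x \<in> carrier A ==> pr \<alpha> x \<in> hpart A \<alpha>"
    and pr_add: "x \<in> carrier A ==> y \<in> carrier A ==> pr \<alpha> (x \<oplus> y) = pr \<alpha> x \<oplus> pr \<alpha> y"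
    and pr_smult: "x \<in> carrier A ==> pr \<alpha> (c \<odot> x) = c \<odot> pr \<alpha> x"
    and pr_same: "x \<in> hpart A \<alpha> ==> pr \<beta> x = (if \<beta> = \<alpha> then x else \<zero>)"
    and pr_finite: "x \<in> carrier A ==> finite {\<alpha>. pr \<alpha> x \<noteq> \<zero>}"
    and pr_sum: "x \<in> carrier A ==> x = finsum A (\<lambda>\<alpha>. pr \<alpha> x) {\<alpha>. pr \<alpha> x \<noteq> \<zero>}"
    and smult_l_mult: "x \<in> carrier A ==> y \<in> carrier A ==> (c \<odot> x) \<otimes> y = c \<odot> (x \<otimes> y)"
    and smult_r_mult: "x \<in> carrier A ==> y \<in> carrier A ==> x \<otimes> (c \<odot> y) = c \<odot> (x \<otimes> y)"
begin

lemma pr_closed: "x \<in> carrier A ==> pr \<alpha> x \<in> carrier A"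
  using pr_hpart hpart_carrier by blast

lemma zero_hpart: "\<zero> \<in> hpart A \<alpha>"
proof (cases "pr \<alpha> \<zero> = \<zero>")
  case True then show ?thesis using pr_hpart[of \<zero> \<alpha>] by simp
next
  case False
  have "pr \<alpha> (\<zero> \<oplus> \<zero>) = pr \<alpha> \<zero> \<oplus> pr \<alpha> \<zero>" by (rule pr_add) auto
  then show ?thesis using False pr_closed[of \<zero> \<alpha>] by (metis l_zero local.add.l_cancel_one zero_closed)
qed

lemma pr_zero: "pr \<alpha> \<zero> = \<zero>"
  using pr_same[OF zero_hpart[of \<alpha>], of \<alpha>] by simp

lemma pr_finsum:
  assumes "finite S" "\<And>i. i \<in> S ==> f i \<in> carrier A"
  shows "pr \<alpha> (finsum A f S) = finsum A (\<lambda>i. pr \<alpha> (f i)) S"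
  using assms
proof (induction S rule: finite_induct)
  case (insert x S)
  then show ?case
    using finsum_insert[OF insert.hyps(1,2), of f] finsum_insert[OF insert.hyps(1,2), of "\<lambda>i. pr \<alpha> (f i)"]
    by (simp add: pr_add pr_closed finsum_closed Pi_def)
qed (simp add: pr_zero)

text \<open>Applying \<open>pr \<alpha>\<close> to any homogeneous decomposition of \<open>x\<close>
  leaves its term of degree \<alpha>, so the decomposition is unique.\<close>

lemma hcomp_eq: "x \<in> carrier A ==> hcomp A \<alpha> x = pr \<alpha> x"
proof -
  assume x: "x \<in> carrier A"
  have "(THE c. (\<forall>\<beta>. c \<beta> \<in> hpart A \<beta>) \<and> finite {\<beta>. c \<beta> \<noteq> \<zero>} \<and> x = finsum A c {\<beta>. c \<beta> \<noteq> \<zero>}) = (\<lambda>\<alpha>. pr \<alpha> x)"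
  proof (rule the_equality)
    show "(\<forall>\<beta>. pr \<beta> x \<in> hpart A \<beta>) \<and> finite {\<beta>. pr \<beta> x \<noteq> \<zero>} \<and>
        x = finsum A (\<lambda>\<alpha>. pr \<alpha> x) {\<beta>. pr \<beta> x \<noteq> \<zero>}"
      using x pr_sum pr_finite pr_hpart by blast
  next
    fix c assume "(\<forall>\<beta>. c \<beta> \<in> hpart A \<beta>) \<and> finite {\<beta>. c \<beta> \<noteq> \<zero>} \<and> x = finsum A c {\<beta>. c \<beta> \<noteq> \<zero>}"
    then have c: "\<forall>\<beta>. c \<beta> \<in> hpart A \<beta>" "finite {\<beta>. c \<beta> \<noteq> \<zero>}" "x = finsum A c {\<beta>. c \<beta> \<noteq> \<zero>}" by auto
    have cc: "c \<beta> \<in> carrier A" for \<beta> using c hpart_carrier by blast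
    show "c = (\<lambda>\<alpha>. pr \<alpha> x)"
    proof
      fix \<alpha>
      have "pr \<alpha> x = finsum A (\<lambda>i. pr \<alpha> (c i)) {\<beta>. c \<beta> \<noteq> \<zero>}"
        by (subst c(3)) (rule pr_finsum[OF c(2) cc])
      also have "\<dots> = finsum A (\<lambda>i. if \<alpha> = i then c i else \<zero>) {\<beta>. c \<beta> \<noteq> \<zero>}"
        using c(1) cc pr_same by (intro finsum_cong') auto
      also have "\<dots> = c \<alpha>"
      proof (cases "c \<alpha> = \<zero>")
        case True
        then have "finsum A (\<lambda>i. if \<alpha> = i then c i else \<zero>) {\<beta>. c \<beta> \<noteq> \<zero>} = finsum A (\<lambda>i. \<zero>) {\<beta>. c \<beta> \<noteq> \<zero>}"
          by (intro finsum_cong') auto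
        then show ?thesis using True by simp
      next
        case False
        then show ?thesis using c(2) cc finsum_singleton[of \<alpha> "{\<beta>. c \<beta> \<noteq> \<zero>}" c] by auto
      qed
      finally show "c \<alpha> = pr \<alpha> x" ..
    qed
  qed
  then show "hcomp A \<alpha> x = pr \<alpha> x" by (simp add: hcomp_def)
qed

lemma hsupp_eq: "x \<in> carrier A ==> hsupp A x = {\<alpha>. pr \<alpha> x \<noteq> \<zero>}"
  by (simp add: hsupp_def hcomp_eq)

lemma finite_hsupp: "x \<in> carrier A ==> finite (hsupp A x)"
  by (simp add: hsupp_eq pr_finite)

lemma linear_functional_zero: "linear_functional A f ==> f \<zero> = 0"
  unfolding linear_functional_def by (metis add_cancel_right_left l_zero zero_closed)

lemma sum_hsupp_superset:
  assumes "x \<in> carrier A" "finite S" "hsupp A x \<subseteq> S" "\<And>\<alpha>. G \<alpha> \<zero> = (0 :: complex)"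
  shows "(\<Sum>\<alpha>\<in>hsupp A x. G \<alpha> (hcomp A \<alpha> x)) = (\<Sum>\<alpha>\<in>S. G \<alpha> (pr \<alpha> x))"
proof -
  have "(\<Sum>\<alpha>\<in>hsupp A x. G \<alpha> (hcomp A \<alpha> x)) = (\<Sum>\<alpha>\<in>hsupp A x. G \<alpha> (pr \<alpha> x))"
    using assms by (simp add: hcomp_eq)
  also have "\<dots> = (\<Sum>\<alpha>\<in>S. G \<alpha> (pr \<alpha> x))"
    using assms by (intro sum.mono_neutral_left) (auto simp: hsupp_eq)
  finally show ?thesis .
qed

lemma sum_hsupp_homogeneous:
  assumes "x \<in> hpart A \<alpha>" "\<And>\<alpha>. G \<alpha> \<zero> = (0 :: complex)"
  shows "(\<Sum>\<alpha>\<in>hsupp A x. G \<alpha> (hcomp A \<alpha> x)) = G \<alpha> x"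
proof -
  have "(\<Sum>\<alpha>\<in>hsupp A x. G \<alpha> (hcomp A \<alpha> x)) = (\<Sum>\<alpha>\<in>{\<alpha>}. G \<alpha> (pr \<alpha> x))"
    using assms hpart_carrier[OF assms(1)]
    by (intro sum_hsupp_superset) (auto simp: hsupp_eq pr_same split: if_splits)
  then show ?thesis using assms by (simp add: pr_same)
qed

text \<open>The range \<open>hsupp A x\<close> varies with \<open>x\<close>. Additivity becomes
  visible after enlarging the supports of two summands and of their sum to one finite set, which
  only adds zero terms.\<close>

lemma linear_functional_sum_hsupp:
  assumes G: "\<And>\<alpha>. linear_functional A (G \<alpha>)"
  shows "linear_functional A (\<lambda>x. \<Sum>\<alpha>\<in>hsupp A x. G \<alpha> (hcomp A \<alpha> x))"
  unfolding linear_functional_def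
proof (intro conjI ballI allI)
  have G0: "G \<alpha> \<zero> = 0" for \<alpha> using G linear_functional_zero by blast
  have sup: "(\<Sum>\<alpha>\<in>hsupp A z. G \<alpha> (hcomp A \<alpha> z)) = (\<Sum>\<alpha>\<in>S. G \<alpha> (pr \<alpha> z))"
    if "z \<in> carrier A" "finite S" "hsupp A z \<subseteq> S" for z S
    using that G0 by (rule sum_hsupp_superset)
  fix x assume x: "x \<in> carrier A"
  {
    fix y assume y: "y \<in> carrier A"
    obtain S where S: "finite S" "hsupp A x \<subseteq> S" "hsupp A y \<subseteq> S" "hsupp A (x \<oplus> y) \<subseteq> S"
      using that[of "hsupp A x \<union> hsupp A y \<union> hsupp A (x \<oplus> y)"] x y by (auto simp: finite_hsupp)
    have "(\<Sum>\<alpha>\<in>S. G \<alpha> (pr \<alpha> (x \<oplus> y))) = (\<Sum>\<alpha>\<in>S. G \<alpha> (pr \<alpha> x) + G \<alpha> (pr \<alpha> y))"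
      using x y G by (intro sum.cong refl) (simp add: pr_add linear_functional_def pr_closed)
    then show "(\<Sum>\<alpha>\<in>hsupp A (x \<oplus> y). G \<alpha> (hcomp A \<alpha> (x \<oplus> y))) =
        (\<Sum>\<alpha>\<in>hsupp A x. G \<alpha> (hcomp A \<alpha> x)) + (\<Sum>\<alpha>\<in>hsupp A y. G \<alpha> (hcomp A \<alpha> y))"
      using sup[OF x S(1,2)] sup[OF y S(1,3)] sup[OF a_closed[OF x y] S(1,4)] by (simp add: sum.distrib)
  }
  fix c
  obtain S where S: "finite S" "hsupp A x \<subseteq> S" "hsupp A (c \<odot> x) \<subseteq> S"
    using that[of "hsupp A x \<union> hsupp A (c \<odot> x)"] x by (auto simp: finite_hsupp smult_closed)
  have "(\<Sum>\<alpha>\<in>S. G \<alpha> (pr \<alpha> (c \<odot> x))) = (\<Sum>\<alpha>\<in>S. c * G \<alpha> (pr \<alpha> x))"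
    using x G by (intro sum.cong refl) (simp add: pr_smult linear_functional_def pr_closed)
  then show "(\<Sum>\<alpha>\<in>hsupp A (c \<odot> x). G \<alpha> (hcomp A \<alpha> (c \<odot> x))) = c * (\<Sum>\<alpha>\<in>hsupp A x. G \<alpha> (hcomp A \<alpha> x))"
    using sup[OF x S(1,2)] sup[OF smult_closed[OF x] S(1,3)] by (simp add: sum_distrib_left)
qed

lemma linear_functional_mult_left:
  "linear_functional A f ==> y \<in> carrier A ==> linear_functional A (\<lambda>x. f (y \<otimes> x))"
  by (auto simp: linear_functional_def r_distr smult_r_mult)

lemma linear_functional_mult_right:
  "linear_functional A f ==> y \<in> carrier A ==> linear_functional A (\<lambda>x. f (x \<otimes> y))"
  by (auto simp: linear_functional_def l_distr smult_l_mult)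

lemma hcomp_closed: "x \<in> carrier A ==> hcomp A \<alpha> x \<in> carrier A"
  by (simp add: hcomp_eq pr_closed)

end

lemma linear_functional_sum:
  "(\<And>i. i \<in> S ==> linear_functional A (f i)) ==> linear_functional A (\<lambda>x. \<Sum>i\<in>S. f i x)"
  by (simp add: linear_functional_def sum.distrib sum_distrib_left)

lemma linear_functional_scale: "linear_functional A f ==> linear_functional A (\<lambda>x. c * f x)"
  by (simp add: linear_functional_def distrib_left mult.left_commute)

lemma linear_functional_add:
  "linear_functional A f ==> linear_functional A g ==> linear_functional A (\<lambda>x. f x + g x)"
  by (simp add: linear_functional_def distrib_left)

section \<open>Tensors as linear forms on bilinear forms\<close>

interpretation fscale: vector_space "\<lambda>c (f :: 'a => complex) x. c * f x"
  by standard (simp_all add: fun_eq_iff algebra_simps)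

lemma bilinear_formsD:
  assumes "\<beta> \<in> bilinear_forms A B"
  shows "b \<in> carrier B ==> linear_functional A (\<lambda>a. \<beta> a b)" "a \<in> carrier A ==> linear_functional B (\<beta> a)"
  using assms by (auto simp: bilinear_forms_def)

lemma bilinear_forms_add:
  "\<beta> \<in> bilinear_forms A B ==> \<beta>' \<in> bilinear_forms A B ==> (\<lambda>a b. \<beta> a b + \<beta>' a b) \<in> bilinear_forms A B"
  by (simp add: bilinear_forms_def linear_functional_add)

lemma bilinear_forms_scale:
  "\<beta> \<in> bilinear_forms A B ==> (\<lambda>a b. c * \<beta> a b) \<in> bilinear_forms A B"
  by (simp add: bilinear_forms_def linear_functional_scale)

lemma tensor_carrier:
  "carrier (tensor_alg \<omega> A B) = module.span fscale {tens A B a b | a b. a \<in> carrier A \<and> b \<in> carrier B}"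
  by (simp add: tensor_alg_def)

lemma tensor_induct [consumes 1, case_names zero tens add scale]:
  assumes z: "z \<in> carrier (tensor_alg \<omega> A B)"
    and "P (\<lambda>_. 0)" "\<And>a b. a \<in> carrier A ==> b \<in> carrier B ==> P (tens A B a b)"
    and "\<And>x y. P x ==> P y ==> P (\<lambda>\<beta>. x \<beta> + y \<beta>)" "\<And>c x. P x ==> P (\<lambda>\<beta>. c * x \<beta>)"
  shows "P z"
  using z unfolding tensor_carrier
proof (induction rule: fscale.span_induct)
  case base
  show ?case
    using assms unfolding fscale.subspace_def plus_fun_def zero_fun_def by auto
qed (use assms in auto)

text \<open>A tensor is a function of arbitrary maps \<beta>; by induction over the span it is
  linear on bilinear forms and sees only their values on the carriers.\<close>

lemma tensor_eval:
  assumes "z \<in> carrier (tensor_alg \<omega> A B)"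
  shows tensor_eval_add: "\<beta> \<in> bilinear_forms A B ==> \<beta>' \<in> bilinear_forms A B ==> z (\<lambda>a b. \<beta> a b + \<beta>' a b) = z \<beta> + z \<beta>'"
    and tensor_eval_scale: "\<beta> \<in> bilinear_forms A B ==> z (\<lambda>a b. c * \<beta> a b) = c * z \<beta>"
    and tensor_eval_cong: "\<beta> \<in> bilinear_forms A B ==> \<beta>' \<in> bilinear_forms A B ==>
      (\<And>a b. a \<in> carrier A ==> b \<in> carrier B ==> \<beta> a b = \<beta>' a b) ==> z \<beta> = z \<beta>'"
proof -
  show "z (\<lambda>a b. \<beta> a b + \<beta>' a b) = z \<beta> + z \<beta>'" if "\<beta> \<in> bilinear_forms A B" "\<beta>' \<in> bilinear_forms A B"
    using assms by (induction rule: tensor_induct)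
      (auto simp: tens_def that bilinear_forms_add algebra_simps)
  show "z (\<lambda>a b. c * \<beta> a b) = c * z \<beta>" if "\<beta> \<in> bilinear_forms A B"
    using assms by (induction rule: tensor_induct)
      (auto simp: tens_def that bilinear_forms_scale algebra_simps)
  show "z \<beta> = z \<beta>'" if "\<beta> \<in> bilinear_forms A B" "\<beta>' \<in> bilinear_forms A B"
      "\<And>a b. a \<in> carrier A ==> b \<in> carrier B ==> \<beta> a b = \<beta>' a b"
    using assms by (induction rule: tensor_induct) (auto simp: tens_def that)
qed

text \<open>The pullback of \<beta> along the twisted product, a form in four arguments that
  \<open>tensor_mult\<close> evaluates in two stages.\<close>

definition mult_form :: "('g => 'g => complex) => ('a, 'g) galg => ('b, 'g) galg =>
    ('a => 'b => complex) => 'a => 'b => 'a => 'b => complex" where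
  "mult_form \<omega> A B \<beta> a b a' b' = (\<Sum>\<eta>\<in>hsupp B b. \<Sum>\<alpha>\<in>hsupp A a'.
       \<omega> \<eta> \<alpha> * \<beta> (a \<otimes>\<^bsub>A\<^esub> hcomp A \<alpha> a') (hcomp B \<eta> b \<otimes>\<^bsub>B\<^esub> b'))"

lemma tensor_mult_eq:
  "tensor_mult \<omega> A B x y = (\<lambda>\<beta>. if \<beta> \<in> bilinear_forms A B then x (\<lambda>a b. y (mult_form \<omega> A B \<beta> a b)) else 0)"
proof -
  have "mult_form \<omega> A B \<beta> a b = (\<lambda>a' b'. \<Sum>\<eta>\<in>hsupp B b. \<Sum>\<alpha>\<in>hsupp A a'.
       \<omega> \<eta> \<alpha> * \<beta> (a \<otimes>\<^bsub>A\<^esub> hcomp A \<alpha> a') (hcomp B \<eta> b \<otimes>\<^bsub>B\<^esub> b'))" for \<beta> a b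
    by (intro ext) (rule mult_form_def)
  then show ?thesis unfolding tensor_mult_def by (simp only:)
qed

locale graded_algebra_pair = A: graded_algebra A prA + B: graded_algebra B prB
  for A :: "('a, 'g::ab_group_add) galg" and prA and B :: "('b, 'g) galg" and prB
begin

lemma mult_form_linear:
  assumes \<beta>: "\<beta> \<in> bilinear_forms A B"
  shows "a \<in> carrier A ==> b \<in> carrier B ==> b' \<in> carrier B ==>
      linear_functional A (\<lambda>a'. mult_form \<omega> A B \<beta> a b a' b')"
    and "a \<in> carrier A ==> b \<in> carrier B ==> a' \<in> carrier A ==>
      linear_functional B (\<lambda>b'. mult_form \<omega> A B \<beta> a b a' b')"
    and "a' \<in> carrier A ==> b \<in> carrier B ==> b' \<in> carrier B ==>
      linear_functional A (\<lambda>a. mult_form \<omega> A B \<beta> a b a' b')"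
    and "a \<in> carrier A ==> a' \<in> carrier A ==> b' \<in> carrier B ==>
      linear_functional B (\<lambda>b. mult_form \<omega> A B \<beta> a b a' b')"
  unfolding mult_form_def
  by (rule linear_functional_sum A.linear_functional_sum_hsupp B.linear_functional_sum_hsupp
      linear_functional_scale A.linear_functional_mult_left B.linear_functional_mult_left
      A.linear_functional_mult_right B.linear_functional_mult_right bilinear_formsD[OF \<beta>]
      A.hcomp_closed B.hcomp_closed A.m_closed B.m_closed | assumption)+

lemma mult_form_bilinear:
  "\<beta> \<in> bilinear_forms A B ==> a \<in> carrier A ==> b \<in> carrier B ==> mult_form \<omega> A B \<beta> a b \<in> bilinear_forms A B"
  using mult_form_linear(1,2)[of \<beta> a b] by (simp add: bilinear_forms_def[of A B])

text \<open>In a product the left tensor is evaluated at a map built from the right one. Pure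
  tensors are zero off the bilinear forms, so this map must be known to be bilinear before anything
  can be computed.\<close>

lemma mult_form_eval_bilinear:
  assumes \<beta>: "\<beta> \<in> bilinear_forms A B" and y: "y \<in> carrier (tensor_alg \<omega>' A B)"
  shows "(\<lambda>a b. y (mult_form \<omega> A B \<beta> a b)) \<in> bilinear_forms A B"
proof -
  note bil = mult_form_bilinear[OF \<beta>, where \<omega> = \<omega>]
  have 1: "y (mult_form \<omega> A B \<beta> (a \<oplus>\<^bsub>A\<^esub> a') b) = y (mult_form \<omega> A B \<beta> a b) + y (mult_form \<omega> A B \<beta> a' b)"
    if "a \<in> carrier A" "a' \<in> carrier A" "b \<in> carrier B" for a a' b
    unfolding tensor_eval_add[OF y bil[OF that(1,3)] bil[OF that(2,3)], symmetric] using that mult_form_linear(3)[OF \<beta>]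
    by (intro tensor_eval_cong[OF y] bilinear_forms_add bil) (auto simp: linear_functional_def)
  have 2: "y (mult_form \<omega> A B \<beta> a (b \<oplus>\<^bsub>B\<^esub> b')) = y (mult_form \<omega> A B \<beta> a b) + y (mult_form \<omega> A B \<beta> a b')"
    if "a \<in> carrier A" "b \<in> carrier B" "b' \<in> carrier B" for a b b'
    unfolding tensor_eval_add[OF y bil[OF that(1,2)] bil[OF that(1,3)], symmetric] using that mult_form_linear(4)[OF \<beta>]
    by (intro tensor_eval_cong[OF y] bilinear_forms_add bil) (auto simp: linear_functional_def)
  have 3: "y (mult_form \<omega> A B \<beta> (c \<odot>\<^bsub>A\<^esub> a) b) = c * y (mult_form \<omega> A B \<beta> a b)"
    if "a \<in> carrier A" "b \<in> carrier B" for a b c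
    unfolding tensor_eval_scale[OF y bil[OF that], symmetric] using that mult_form_linear(3)[OF \<beta>]
    by (intro tensor_eval_cong[OF y] bilinear_forms_scale bil) (auto simp: linear_functional_def A.smult_closed)
  have 4: "y (mult_form \<omega> A B \<beta> a (c \<odot>\<^bsub>B\<^esub> b)) = c * y (mult_form \<omega> A B \<beta> a b)"
    if "a \<in> carrier A" "b \<in> carrier B" for a b c
    unfolding tensor_eval_scale[OF y bil[OF that], symmetric] using that mult_form_linear(4)[OF \<beta>]
    by (intro tensor_eval_cong[OF y] bilinear_forms_scale bil) (auto simp: linear_functional_def B.smult_closed)
  show ?thesis
    unfolding bilinear_forms_def[of A B] linear_functional_def mem_Collect_eq by (intro conjI ballI allI 1 2 3 4)
qed

lemma mult_form_homogeneous:
  assumes \<beta>: "\<beta> \<in> bilinear_forms A B"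
    and "a \<in> carrier A" "a' \<in> hpart A \<alpha>" "b \<in> hpart B \<eta>" "b' \<in> carrier B"
  shows "mult_form \<omega> A B \<beta> a b a' b' = \<omega> \<eta> \<alpha> * \<beta> (a \<otimes>\<^bsub>A\<^esub> a') (b \<otimes>\<^bsub>B\<^esub> b')"
proof -
  have lin: "linear_functional A (\<lambda>x. \<omega> \<eta> \<alpha> * \<beta> (a \<otimes>\<^bsub>A\<^esub> x) (y \<otimes>\<^bsub>B\<^esub> b'))"
    "linear_functional B (\<lambda>y. \<omega> \<eta> \<alpha> * \<beta> (a \<otimes>\<^bsub>A\<^esub> x) (y \<otimes>\<^bsub>B\<^esub> b'))"
    if "x \<in> carrier A" "y \<in> carrier B" for \<eta> \<alpha> x y
    using that assms
    by (auto intro!: linear_functional_scale A.linear_functional_mult_left B.linear_functional_mult_right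
      bilinear_formsD[OF \<beta>])
  have a'b: "a' \<in> carrier A" "b \<in> carrier B" using assms A.hpart_carrier B.hpart_carrier by blast+
  have "mult_form \<omega> A B \<beta> a b a' b' = (\<Sum>\<eta>\<in>hsupp B b. \<omega> \<eta> \<alpha> * \<beta> (a \<otimes>\<^bsub>A\<^esub> a') (hcomp B \<eta> b \<otimes>\<^bsub>B\<^esub> b'))"
    unfolding mult_form_def using a'b lin(1)[THEN A.linear_functional_zero]
    by (intro sum.cong refl A.sum_hsupp_homogeneous[OF assms(3)]) (auto simp: B.hcomp_closed)
  also have "\<dots> = \<omega> \<eta> \<alpha> * \<beta> (a \<otimes>\<^bsub>A\<^esub> a') (b \<otimes>\<^bsub>B\<^esub> b')"
    using a'b lin(2)[THEN B.linear_functional_zero] by (intro B.sum_hsupp_homogeneous[OF assms(4)]) auto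
  finally show ?thesis .
qed

end

lemma single_pscale: "wsingle w (c * k) = pscale c (wsingle w (k :: complex))"
  by (rule poly_mapping_eqI) (simp add: lookup_single when_def)

lemma pscale_pscale: "pscale c (pscale d p) = pscale (c * d :: complex) p"
  by (rule poly_mapping_eqI) simp

text \<open>Any finite set of degrees outside of which the components vanish may replace the exact
  support, which is awkward to determine in a quotient.\<close>

lemma graded_algebraI:
  fixes A :: "('a, 'g::ab_group_add) galg" (structure)
  assumes "ring A"
    and "\<And>x c. x \<in> carrier A ==> c \<odot> x \<in> carrier A"
    and "\<And>x \<alpha>. x \<in> hpart A \<alpha> ==> x \<in> carrier A"
    and h: "\<And>x \<alpha>. x \<in> carrier A ==> pr \<alpha> x \<in> hpart A \<alpha>"
    and "\<And>x y \<alpha>. x \<in> carrier A ==> y \<in> carrier A ==> pr \<alpha> (x \<oplus> y) = pr \<alpha> x \<oplus> pr \<alpha> y"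
    and "\<And>x c \<alpha>. x \<in> carrier A ==> pr \<alpha> (c \<odot> x) = c \<odot> pr \<alpha> x"
    and "\<And>x \<alpha> \<beta>. x \<in> hpart A \<alpha> ==> pr \<beta> x = (if \<beta> = \<alpha> then x else \<zero>)"
    and S: "\<And>x. x \<in> carrier A ==> \<exists>S. finite S \<and> (\<forall>\<alpha>. \<alpha> \<notin> S \<longrightarrow> pr \<alpha> x = \<zero>) \<and> x = finsum A (\<lambda>\<alpha>. pr \<alpha> x) S"
    and "\<And>x y c. x \<in> carrier A ==> y \<in> carrier A ==> (c \<odot> x) \<otimes> y = c \<odot> (x \<otimes> y)"
    and "\<And>x y c. x \<in> carrier A ==> y \<in> carrier A ==> x \<otimes> (c \<odot> y) = c \<odot> (x \<otimes> y)"
  shows "graded_algebra A pr"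
proof -
  interpret ring A by fact
  have "finite {\<alpha>. pr \<alpha> x \<noteq> \<zero>} \<and> x = finsum A (\<lambda>\<alpha>. pr \<alpha> x) {\<alpha>. pr \<alpha> x \<noteq> \<zero>}" if x: "x \<in> carrier A" for x
  proof -
    obtain S where S': "finite S" "\<forall>\<alpha>. \<alpha> \<notin> S \<longrightarrow> pr \<alpha> x = \<zero>" "x = finsum A (\<lambda>\<alpha>. pr \<alpha> x) S"
      using S[OF x] by blast
    have sub: "{\<alpha>. pr \<alpha> x \<noteq> \<zero>} \<subseteq> S" using S'(2) by blast
    have pc: "pr \<alpha> x \<in> carrier A" for \<alpha> using x h assms(3) by blast
    have "finsum A (\<lambda>\<alpha>. pr \<alpha> x) {\<alpha>. pr \<alpha> x \<noteq> \<zero>} = finsum A (\<lambda>\<alpha>. pr \<alpha> x) S"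
      by (rule add.finprod_mono_neutral_cong_left) (use S' sub pc in auto)
    then show ?thesis using S' sub finite_subset by simp
  qed
  note X = this
  show ?thesis
  proof (rule graded_algebra.intro[OF assms(1)], rule graded_algebra_axioms.intro)
    show "finite {\<alpha>. pr \<alpha> x \<noteq> \<zero>}" "x = finsum A (\<lambda>\<alpha>. pr \<alpha> x) {\<alpha>. pr \<alpha> x \<noteq> \<zero>}" if "x \<in> carrier A" for x
      by (rule conjunct1[OF X[OF that]], rule conjunct2[OF X[OF that]])
  qed (rule assms; assumption)+
qed

section \<open>The enveloping algebra\<close>

locale graded_basis =
  fixes V :: "('g::ab_group_add, 'v::ab_group_add, 'i) gspace"
  assumes commutative_factor: "commutative_factor (fac V)"
    and graded: "graded_vector_space (scal V) (part V)"
    and basis: "homogeneous_basis V"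
begin

abbreviation "I \<equiv> ind V"
abbreviation "\<gamma> \<equiv> deg V"
abbreviation "\<omega> \<equiv> fac V"
abbreviation "lin \<equiv> Vector_Spaces.linear (scal V) (scal V)"

lemma fac_add_left: "\<omega> (\<alpha> + \<beta>) \<eta> = \<omega> \<alpha> \<eta> * \<omega> \<beta> \<eta>"
  and fac_add_right: "\<omega> \<alpha> (\<beta> + \<eta>) = \<omega> \<alpha> \<beta> * \<omega> \<alpha> \<eta>"
  and fac_nonzero [simp]: "\<omega> \<alpha> \<beta> \<noteq> 0"
  and fac_inverse: "\<omega> \<alpha> \<beta> = inverse (\<omega> \<beta> \<alpha>)"
  using commutative_factor unfolding commutative_factor_def by blast+

lemma fac_swap: "\<omega> \<alpha> \<beta> * \<omega> \<beta> \<alpha> = 1"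
  using fac_inverse[of \<alpha> \<beta>] by simp

lemma fac_zero [simp]: "\<omega> 0 \<alpha> = 1" "\<omega> \<alpha> 0 = 1"
  using fac_add_left[of 0 0 \<alpha>] fac_add_right[of \<alpha> 0 0] by simp_all

lemma fac_minus: "\<omega> (- \<alpha>) \<beta> = \<omega> \<beta> \<alpha>" "\<omega> \<alpha> (- \<beta>) = \<omega> \<beta> \<alpha>"
proof -
  have "\<omega> (- \<alpha>) \<beta> * \<omega> \<alpha> \<beta> = 1" "\<omega> \<alpha> (- \<beta>) * \<omega> \<alpha> \<beta> = 1"
    using fac_add_left[of "- \<alpha>" \<alpha> \<beta>] fac_add_right[of \<alpha> "- \<beta>" \<beta>] by simp_all
  then show "\<omega> (- \<alpha>) \<beta> = \<omega> \<beta> \<alpha>" "\<omega> \<alpha> (- \<beta>) = \<omega> \<beta> \<alpha>"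
    using fac_swap[of \<beta> \<alpha>] by (metis fac_nonzero mult_right_cancel)+
qed

lemma fac_diff: "\<omega> (\<alpha> - \<beta>) \<eta> = \<omega> \<alpha> \<eta> * \<omega> \<eta> \<beta>" "\<omega> \<alpha> (\<beta> - \<eta>) = \<omega> \<alpha> \<beta> * \<omega> \<eta> \<alpha>"
  using fac_add_left[of \<alpha> "- \<beta>" \<eta>] fac_add_right[of \<alpha> \<beta> "- \<eta>"] by (simp_all add: fac_minus)

section \<open>Degrees of words and coordinates in the homogeneous basis\<close>

definition letter_deg :: "'i \<times> 'i => 'g" where
  "letter_deg = (\<lambda>(b, a). \<gamma> b - \<gamma> a)"

abbreviation "dg \<equiv> word_deg letter_deg"

definition word_fac :: "'i gword => 'i gfun" where
  "word_fac u v = \<omega> (dg u) (dg v)"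

lemma dg_simps [simp]: "dg [] = 0" "dg (l # w) = letter_deg l + dg w" "dg (u @ v) = dg u + dg v"
  by (simp_all add: word_deg_def)

lemma letter_deg_simp [simp]: "letter_deg (b, a) = \<gamma> b - \<gamma> a"
  by (simp add: letter_deg_def)

lemma dg_mset: "mset w = mset u + mset v ==> dg w = dg u + dg v"
proof -
  have "dg w = sum_mset (image_mset letter_deg (mset w))" for w by (induction w) simp_all
  then show "mset w = mset u + mset v ==> ?thesis" by simp
qed

sublocale wk: word_commutation word_fac
  by standard (simp_all add: word_fac_def fac_add_left fac_add_right fac_swap)

sublocale vs: finite_dimensional_vector_space "scal V" "bas V ` ind V"
  using basis by (simp add: homogeneous_basis_def)

lemma finite_I [simp]: "finite I"
  using vs.finite_Basis basis by (auto simp: homogeneous_basis_def intro: finite_imageD)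

lemma bas_inj: "a \<in> I ==> b \<in> I ==> bas V a = bas V b \<longleftrightarrow> a = b"
  using basis by (auto simp: homogeneous_basis_def inj_on_def)

lemma bas_part: "a \<in> I ==> bas V a \<in> part V (\<gamma> a)"
  using basis by (simp add: homogeneous_basis_def)

abbreviation "co \<equiv> dual_basis V"

lemma co_add: "co b (u + v) = co b u + co b v"
  and co_scale: "co b (scal V c v) = c * co b v"
  and co_zero [simp]: "co b 0 = 0"
  using vs.representation_add[OF vs.independent_Basis] vs.representation_scale[OF vs.independent_Basis]
    vs.representation_zero
  by (simp_all add: dual_basis_def vs.span_Basis)

lemma co_sum: "co b (sum f A) = (\<Sum>x\<in>A. co b (f x))"
  by (induction A rule: infinite_finite_induct) (simp_all add: co_add)

lemma co_bas: "a \<in> I ==> b \<in> I ==> co b (bas V a) = (if b = a then 1 else 0)"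
  using vs.representation_basis[OF vs.independent_Basis, of "bas V a"] bas_inj[of a b]
  by (auto simp: dual_basis_def)

lemma co_expand: "v = (\<Sum>b\<in>I. scal V (co b v) (bas V b))"
proof -
  have "v = (\<Sum>b\<in>bas V ` I. scal V (vs.representation (bas V ` I) v b) b)"
    using vs.sum_representation_eq[OF vs.independent_Basis _ vs.finite_Basis, of v] by (simp add: vs.span_Basis)
  also have "\<dots> = (\<Sum>b\<in>I. scal V (co b v) (bas V b))"
    using basis by (subst sum.reindex) (auto simp: homogeneous_basis_def dual_basis_def)
  finally show ?thesis .
qed

lemma co_eqI: "(\<And>b. b \<in> I ==> co b u = co b v) ==> u = v"
  using co_expand[of u] co_expand[of v] by (metis (no_types, lifting) sum.cong)

lemma part_subspace: "vs.subspace (part V \<alpha>)"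
  using graded by (simp add: graded_vector_space_def)

text \<open>Grouping the coordinates of \<open>v\<close> by the degrees of the basis vectors gives a
  homogeneous decomposition. For \<open>v\<close> in a single part the trivial decomposition is
  another one, and uniqueness identifies them.\<close>

lemma part_iff: "v \<in> part V \<beta> \<longleftrightarrow> (\<forall>b\<in>I. co b v \<noteq> 0 \<longrightarrow> \<gamma> b = \<beta>)"
proof
  assume v: "v \<in> part V \<beta>"
  define c where "c \<alpha> = (\<Sum>b | b \<in> I \<and> \<gamma> b = \<alpha>. scal V (co b v) (bas V b))" for \<alpha>
  have co_c: "co b (c \<alpha>) = (if \<gamma> b = \<alpha> then co b v else 0)" if "b \<in> I" for b \<alpha>
  proof -
    have "co b (c \<alpha>) = (\<Sum>a | a \<in> I \<and> \<gamma> a = \<alpha>. if b = a then co b v else 0)"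
      unfolding c_def co_sum using that by (intro sum.cong refl) (auto simp: co_scale co_bas)
    then show ?thesis using that by simp
  qed
  have c1: "\<forall>\<alpha>. c \<alpha> \<in> part V \<alpha>"
    unfolding c_def using bas_part
    by (auto intro!: vs.subspace_sum[OF part_subspace] vs.subspace_scale[OF part_subspace])
  have "{\<alpha>. c \<alpha> \<noteq> 0} \<subseteq> \<gamma> ` I"
  proof
    fix \<alpha> assume "\<alpha> \<in> {\<alpha>. c \<alpha> \<noteq> 0}"
    then have "{b. b \<in> I \<and> \<gamma> b = \<alpha>} \<noteq> {}" unfolding c_def by (auto simp del: Collect_empty_eq)
    then show "\<alpha> \<in> \<gamma> ` I" by blast
  qed
  then have c2: "finite {\<alpha>. c \<alpha> \<noteq> 0}" by (rule finite_subset) simp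
  have c3: "v = (\<Sum>\<alpha> | c \<alpha> \<noteq> 0. c \<alpha>)"
  proof (rule co_eqI)
    fix b assume b: "b \<in> I"
    have "co b (\<Sum>\<alpha> | c \<alpha> \<noteq> 0. c \<alpha>) = (\<Sum>\<alpha> | c \<alpha> \<noteq> 0. if \<gamma> b = \<alpha> then co b v else 0)"
      unfolding co_sum using b by (intro sum.cong refl) (simp add: co_c)
    also have "\<dots> = (if c (\<gamma> b) \<noteq> 0 then co b v else 0)"
      using c2 by simp
    also have "\<dots> = co b v" using co_c[OF b, of "\<gamma> b"] by auto
    finally show "co b v = co b (\<Sum>\<alpha> | c \<alpha> \<noteq> 0. c \<alpha>)" ..
  qed
  define c' where "c' \<alpha> = (if \<alpha> = \<beta> then v else 0)" for \<alpha>
  have d: "(\<forall>\<alpha>. c' \<alpha> \<in> part V \<alpha>)" "finite {\<alpha>. c' \<alpha> \<noteq> 0}" "v = (\<Sum>\<alpha> | c' \<alpha> \<noteq> 0. c' \<alpha>)"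
  proof -
    have fin: "{\<alpha>. c' \<alpha> \<noteq> 0} = (if v = 0 then {} else {\<beta>})" by (auto simp: c'_def)
    show "(\<forall>\<alpha>. c' \<alpha> \<in> part V \<alpha>)" using v vs.subspace_0[OF part_subspace] by (simp add: c'_def)
    show "finite {\<alpha>. c' \<alpha> \<noteq> 0}" "v = (\<Sum>\<alpha> | c' \<alpha> \<noteq> 0. c' \<alpha>)" unfolding fin by (auto simp: c'_def)
  qed
  have "\<exists>!c. (\<forall>\<alpha>. c \<alpha> \<in> part V \<alpha>) \<and> finite {\<alpha>. c \<alpha> \<noteq> 0} \<and> v = (\<Sum>\<alpha> | c \<alpha> \<noteq> 0. c \<alpha>)"
    using graded by (simp add: graded_vector_space_def)
  then have "c = c'" using c1 c2 c3 d by blast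
  show "\<forall>b\<in>I. co b v \<noteq> 0 \<longrightarrow> \<gamma> b = \<beta>"
  proof (intro ballI impI)
    fix b assume "b \<in> I" "co b v \<noteq> 0"
    then have "c (\<gamma> b) \<noteq> 0" using co_c[of b "\<gamma> b"] by auto
    then show "\<gamma> b = \<beta>" unfolding \<open>c = c'\<close> c'_def by (metis (full_types))
  qed
next
  assume a: "\<forall>b\<in>I. co b v \<noteq> 0 \<longrightarrow> \<gamma> b = \<beta>"
  have "scal V (co b v) (bas V b) \<in> part V \<beta>" if "b \<in> I" for b
  proof (cases "co b v = 0")
    case True then show ?thesis using vs.subspace_0[OF part_subspace] by simp
  next
    case False
    then show ?thesis using a that bas_part[OF that] vs.subspace_scale[OF part_subspace] by auto
  qed
  then show "v \<in> part V \<beta>"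
    by (subst co_expand) (rule vs.subspace_sum[OF part_subspace])
qed

abbreviation "End \<equiv> End_alg V"

lemma End_simps [simp]:
  "carrier End = {X. lin X}" "mult End = (\<circ>)" "one End = id"
  "zero End = (\<lambda>_. 0)" "add End = (\<lambda>X Y v. X v + Y v)" "module.smult End = (\<lambda>c X v. scal V c (X v))"
  by (simp_all add: End_alg_def)

definition entry :: "('v => 'v) => 'i => 'i => complex" where
  "entry X b a = co b (X (bas V a))"

lemma linear_co:
  assumes "lin X"
  shows "co b (X v) = (\<Sum>a\<in>I. entry X b a * co a v)"
proof -
  interpret X: Vector_Spaces.linear "scal V" "scal V" X by fact
  have "co b (X v) = co b (X (\<Sum>a\<in>I. scal V (co a v) (bas V a)))"
    by (simp flip: co_expand)
  also have "\<dots> = (\<Sum>a\<in>I. entry X b a * co a v)"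
    unfolding X.sum X.scale co_sum co_scale entry_def by (simp add: mult.commute)
  finally show ?thesis .
qed

lemma linear_eqI:
  assumes "lin X" "lin Y"
    and "\<And>a b. a \<in> I ==> b \<in> I ==> entry X b a = entry Y b a"
  shows "X = Y"
  using assms(3) by (intro ext co_eqI) (simp add: linear_co[OF assms(1)] linear_co[OF assms(2)])

lemma End_hpart:
  assumes "lin X"
  shows "X \<in> hpart End \<alpha> \<longleftrightarrow> (\<forall>a\<in>I. \<forall>b\<in>I. entry X b a \<noteq> 0 \<longrightarrow> \<gamma> b - \<gamma> a = \<alpha>)"
proof
  assume X: "X \<in> hpart End \<alpha>"
  show "\<forall>a\<in>I. \<forall>b\<in>I. entry X b a \<noteq> 0 \<longrightarrow> \<gamma> b - \<gamma> a = \<alpha>"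
  proof (intro ballI impI)
    fix a b assume ab: "a \<in> I" "b \<in> I" "entry X b a \<noteq> 0"
    have "X (bas V a) \<in> part V (\<alpha> + \<gamma> a)" using X bas_part[OF ab(1)] by (auto simp: End_alg_def)
    then show "\<gamma> b - \<gamma> a = \<alpha>" using ab unfolding part_iff entry_def by auto
  qed
next
  assume a: "\<forall>a\<in>I. \<forall>b\<in>I. entry X b a \<noteq> 0 \<longrightarrow> \<gamma> b - \<gamma> a = \<alpha>"
  have "X v \<in> part V (\<alpha> + \<beta>)" if v: "v \<in> part V \<beta>" for v \<beta>
    unfolding part_iff
  proof (intro ballI impI)
    fix b assume b: "b \<in> I" "co b (X v) \<noteq> 0"
    have "\<exists>a\<in>I. entry X b a * co a v \<noteq> 0"
    proof (rule ccontr)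
      assume "\<not> ?thesis"
      then have "co b (X v) = 0" unfolding linear_co[OF assms] by (intro sum.neutral) blast
      then show False using b by simp
    qed
    then obtain a where "a \<in> I" "entry X b a * co a v \<noteq> 0" by blast
    then show "\<gamma> b = \<alpha> + \<beta>" using a b v unfolding part_iff by (auto simp: algebra_simps)
  qed
  then show "X \<in> hpart End \<alpha>" using assms by (auto simp: End_alg_def)
qed

lemma linear_unit_matrix: "lin (unit_matrix V b a)"
  by standard (simp_all add: unit_matrix_def co_add co_scale vs.scale_left_distrib)

lemma entry_unit_matrix:
  "a \<in> I ==> b \<in> I ==> c \<in> I ==> d \<in> I ==> entry (unit_matrix V b a) d c = (if d = b \<and> c = a then 1 else 0)"
  by (simp add: entry_def unit_matrix_def co_scale co_bas)

lemma unit_matrix_hpart: "a \<in> I ==> b \<in> I ==> unit_matrix V b a \<in> hpart End (\<gamma> b - \<gamma> a)"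
  by (simp add: End_hpart[OF linear_unit_matrix] entry_unit_matrix)

lemma linear_compose: "lin X ==> lin Y ==>
    lin (\<lambda>v. X (Y v))"
  using Vector_Spaces.linear_compose[of "scal V" "scal V" Y "scal V" X] by (simp add: o_def)

lemma entry_compose:
  assumes "lin X"
  shows "entry (\<lambda>v. X (Y v)) b a = (\<Sum>c\<in>I. entry X b c * entry Y c a)"
  unfolding entry_def[of "\<lambda>v. X (Y v)"] linear_co[OF assms] entry_def[of Y] ..

section \<open>The free algebra on the matrix units and the commutation relations\<close>

definition L :: "('i \<times> 'i) set" where
  "L = I \<times> I"

abbreviation "F \<equiv> gl_tensor_algebra V"

lemma F_eq: "F = tensor_algebra L letter_deg"
  by (simp add: gl_tensor_algebra_def L_def letter_deg_def)

lemma F_simps [simp]: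
  "mult F = (*)" "one F = 1" "zero F = 0" "add F = (+)" "module.smult F = (\<lambda>c. pscale c)"
  by (simp_all add: F_eq)

lemma F_carrier: "carrier F = {x. \<forall>w\<in>wkeys x. set w \<subseteq> L}"
  and F_hpart: "hpart F \<alpha> = {x. \<forall>w\<in>wkeys x. set w \<subseteq> L \<and> dg w = \<alpha>}"
  by (simp_all add: F_eq)

lemma F_closed:
  shows "p \<in> carrier F ==> q \<in> carrier F ==> p + q \<in> carrier F" "p \<in> carrier F ==> q \<in> carrier F ==> p * q \<in> carrier F"
    "p \<in> carrier F ==> - p \<in> carrier F" "p \<in> carrier F ==> q \<in> carrier F ==> p - q \<in> carrier F"
    "p \<in> carrier F ==> pscale c p \<in> carrier F" "0 \<in> carrier F" "1 \<in> carrier F"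
    "set w \<subseteq> L ==> wsingle w c \<in> carrier F"
  unfolding F_carrier by (fact free_closed)+

lemma F_sum_closed: "(\<And>i. i \<in> A ==> f i \<in> carrier F) ==> sum f A \<in> carrier F"
  by (induction A rule: infinite_finite_induct) (auto intro: F_closed)

lemma F_induct [consumes 1, case_names zero single add]:
  assumes "p \<in> carrier F" "P 0" "\<And>w c. set w \<subseteq> L ==> P (wsingle w c)"
    "\<And>p q. p \<in> carrier F ==> q \<in> carrier F ==> P p ==> P q ==> P (p + q)"
  shows "P p"
  using assms(1) unfolding F_carrier mem_Collect_eq
proof (induction p rule: poly_induct_on)
  case (add p q)
  then show ?case using assms(4)[of p q] by (simp add: F_carrier)
qed (use assms in auto)

sublocale F: ring F
  unfolding F_eq by (rule ring_tensor_algebra)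

lemma F_a_minus: "p \<in> carrier F ==> q \<in> carrier F ==> p \<ominus>\<^bsub>F\<^esub> q = p - q"
  unfolding F_eq by (rule tensor_algebra_a_minus)

lemma word_eval_gl_embed: "word_eval \<phi> (gl_embed V X) = (\<Sum>b\<in>I. \<Sum>a\<in>I. entry X b a * \<phi> [(b, a)])"
  unfolding gl_embed_def word_eval_sum entry_def by (subst sum.swap) simp

lemma gl_embed_closed: "gl_embed V X \<in> carrier F"
  unfolding gl_embed_def by (intro F_sum_closed F_closed) (auto simp: L_def)

text \<open>The relation for the bracket of \<open>E\<^sub>b\<^sub>a\<close> and
  \<open>E\<^sub>d\<^sub>c\<close>, which is \<open>E\<^sub>b\<^sub>c\<close> if
  \<open>a = d\<close> minus \<omega> times \<open>E\<^sub>d\<^sub>a\<close> if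
  \<open>b = c\<close>. Words of lengths two and one occur together, so relations respect the degree
  but not the length.\<close>

definition rel :: "'i => 'i => 'i => 'i => 'i gword \<Rightarrow>\<^sub>0 complex" where
  "rel b a d c = wsingle [(b, a), (d, c)] 1 -
     wsingle [(d, c), (b, a)] (\<omega> (\<gamma> b - \<gamma> a) (\<gamma> d - \<gamma> c)) -
     (if a = d then wsingle [(b, c)] 1 else 0) +
     (if b = c then wsingle [(d, a)] (\<omega> (\<gamma> b - \<gamma> a) (\<gamma> d - \<gamma> c)) else 0)"

lemma word_eval_rel:
  "word_eval \<phi> (rel b a d c) = \<phi> [(b, a), (d, c)] - \<omega> (\<gamma> b - \<gamma> a) (\<gamma> d - \<gamma> c) * \<phi> [(d, c), (b, a)] -
     (if a = d then \<phi> [(b, c)] else 0) + (if b = c then \<omega> (\<gamma> b - \<gamma> a) (\<gamma> d - \<gamma> c) * \<phi> [(d, a)] else 0)"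
  by (simp add: rel_def)

lemma rel_closed: "a \<in> I ==> b \<in> I ==> c \<in> I ==> d \<in> I ==> rel b a d c \<in> carrier F"
  unfolding rel_def by (cases "a = d"; cases "b = c"; simp; intro F_closed) (simp_all add: L_def)

definition bracket_rel :: "('v => 'v) => ('v => 'v) => complex => 'i gword \<Rightarrow>\<^sub>0 complex" where
  "bracket_rel X Y k = gl_embed V X * gl_embed V Y - pscale k (gl_embed V Y * gl_embed V X)
     - gl_embed V (\<lambda>v. X (Y v) - scal V k (Y (X v)))"

lemma bracket_rel_closed: "bracket_rel X Y k \<in> carrier F"
  unfolding bracket_rel_def by (intro F_closed gl_embed_closed)

text \<open>Both sides are bilinear in the matrix entries. The factor \<open>k\<close> has to fit
  only those pairs of matrix units that occur with nonzero entries, which is what homogeneity of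
  \<open>X\<close> and \<open>Y\<close> provides.\<close>

lemma bracket_rel_expand:
  assumes X: "lin X" and Y: "lin Y"
    and k: "\<And>a b c d. a \<in> I ==> b \<in> I ==> c \<in> I ==> d \<in> I ==> entry X b a \<noteq> 0 ==> entry Y d c \<noteq> 0 ==>
       \<omega> (\<gamma> b - \<gamma> a) (\<gamma> d - \<gamma> c) = k"
  shows "bracket_rel X Y k = (\<Sum>b\<in>I. \<Sum>a\<in>I. \<Sum>d\<in>I. \<Sum>c\<in>I.
     pscale (entry X b a * entry Y d c) (rel b a d c))"
proof (rule poly_word_eval_eqI)
  fix \<phi> :: "'i gfun"
  let ?X = "entry X" and ?Y = "entry Y"
  have sub: "entry (\<lambda>v. X (Y v) - scal V k (Y (X v))) b c = (\<Sum>a\<in>I. ?X b a * ?Y a c) - k * (\<Sum>a\<in>I. ?Y b a * ?X a c)" for b c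
  proof -
    have "entry (\<lambda>v. X (Y v) - scal V k (Y (X v))) b c = entry (\<lambda>v. X (Y v)) b c - k * entry (\<lambda>v. Y (X v)) b c"
      using co_add[of b "X (Y (bas V c)) - scal V k (Y (X (bas V c)))" "scal V k (Y (X (bas V c)))"]
      by (simp add: entry_def co_scale)
    then show ?thesis by (simp add: entry_compose X Y)
  qed
  have 1: "(\<Sum>b\<in>I. \<Sum>a\<in>I. \<Sum>d\<in>I. \<Sum>c\<in>I. ?X b a * ?Y d c * (if a = d then \<phi> [(b, c)] else 0)) =
      (\<Sum>b\<in>I. \<Sum>c\<in>I. (\<Sum>a\<in>I. ?X b a * ?Y a c) * \<phi> [(b, c)])"
  proof (rule sum.cong[OF refl])
    fix b assume "b \<in> I"
    have "(\<Sum>a\<in>I. \<Sum>d\<in>I. \<Sum>c\<in>I. ?X b a * ?Y d c * (if a = d then \<phi> [(b, c)] else 0)) =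
        (\<Sum>a\<in>I. \<Sum>d\<in>I. if a = d then \<Sum>c\<in>I. ?X b a * ?Y a c * \<phi> [(b, c)] else 0)"
      by (intro sum.cong refl) auto
    also have "\<dots> = (\<Sum>a\<in>I. \<Sum>c\<in>I. ?X b a * ?Y a c * \<phi> [(b, c)])" by (rule sum.cong[OF refl]) simp
    also have "\<dots> = (\<Sum>c\<in>I. (\<Sum>a\<in>I. ?X b a * ?Y a c) * \<phi> [(b, c)])"
      by (subst sum.swap) (simp add: sum_distrib_right)
    finally show "(\<Sum>a\<in>I. \<Sum>d\<in>I. \<Sum>c\<in>I. ?X b a * ?Y d c * (if a = d then \<phi> [(b, c)] else 0)) =
        (\<Sum>c\<in>I. (\<Sum>a\<in>I. ?X b a * ?Y a c) * \<phi> [(b, c)])" .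
  qed
  have 2: "(\<Sum>b\<in>I. \<Sum>a\<in>I. \<Sum>d\<in>I. \<Sum>c\<in>I. ?X b a * ?Y d c * (if b = c then k * \<phi> [(d, a)] else 0)) =
      (\<Sum>d\<in>I. \<Sum>a\<in>I. k * (\<Sum>b\<in>I. ?Y d b * ?X b a) * \<phi> [(d, a)])"
  proof -
    have "(\<Sum>b\<in>I. \<Sum>a\<in>I. \<Sum>d\<in>I. \<Sum>c\<in>I. ?X b a * ?Y d c * (if b = c then k * \<phi> [(d, a)] else 0)) =
        (\<Sum>b\<in>I. \<Sum>a\<in>I. \<Sum>d\<in>I. \<Sum>c\<in>I. if b = c then ?X b a * ?Y d b * (k * \<phi> [(d, a)]) else 0)"
      by (intro sum.cong refl) auto
    also have "\<dots> = (\<Sum>b\<in>I. \<Sum>a\<in>I. \<Sum>d\<in>I. ?X b a * ?Y d b * (k * \<phi> [(d, a)]))" by (intro sum.cong refl) simp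
    also have "\<dots> = (\<Sum>a\<in>I. \<Sum>b\<in>I. \<Sum>d\<in>I. ?X b a * ?Y d b * (k * \<phi> [(d, a)]))" by (rule sum.swap)
    also have "\<dots> = (\<Sum>a\<in>I. \<Sum>d\<in>I. \<Sum>b\<in>I. ?X b a * ?Y d b * (k * \<phi> [(d, a)]))"
      by (intro sum.cong refl sum.swap)
    also have "\<dots> = (\<Sum>d\<in>I. \<Sum>a\<in>I. \<Sum>b\<in>I. ?X b a * ?Y d b * (k * \<phi> [(d, a)]))" by (rule sum.swap)
    finally show ?thesis by (simp add: sum_distrib_left sum_distrib_right mult_ac)
  qed
  have 3: "word_eval \<phi> (gl_embed V X * gl_embed V Y) = (\<Sum>b\<in>I. \<Sum>a\<in>I. \<Sum>d\<in>I. \<Sum>c\<in>I. ?X b a * ?Y d c * \<phi> [(b, a), (d, c)])"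
    by (simp add: word_eval_mult word_eval_gl_embed sum_distrib_left mult.assoc)
  have 4: "k * word_eval \<phi> (gl_embed V Y * gl_embed V X) =
      (\<Sum>b\<in>I. \<Sum>a\<in>I. \<Sum>d\<in>I. \<Sum>c\<in>I. ?X b a * ?Y d c * (k * \<phi> [(d, c), (b, a)]))"
  proof -
    have "k * word_eval \<phi> (gl_embed V Y * gl_embed V X) =
        (\<Sum>d\<in>I. \<Sum>c\<in>I. \<Sum>b\<in>I. \<Sum>a\<in>I. ?X b a * ?Y d c * (k * \<phi> [(d, c), (b, a)]))"
      by (simp add: word_eval_mult word_eval_gl_embed sum_distrib_left mult_ac)
    also have "\<dots> = (\<Sum>d\<in>I. \<Sum>b\<in>I. \<Sum>c\<in>I. \<Sum>a\<in>I. ?X b a * ?Y d c * (k * \<phi> [(d, c), (b, a)]))"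
      by (intro sum.cong refl sum.swap)
    also have "\<dots> = (\<Sum>b\<in>I. \<Sum>d\<in>I. \<Sum>a\<in>I. \<Sum>c\<in>I. ?X b a * ?Y d c * (k * \<phi> [(d, c), (b, a)]))"
      by (subst sum.swap) (intro sum.cong refl sum.swap)
    also have "\<dots> = (\<Sum>b\<in>I. \<Sum>a\<in>I. \<Sum>d\<in>I. \<Sum>c\<in>I. ?X b a * ?Y d c * (k * \<phi> [(d, c), (b, a)]))"
      by (intro sum.cong refl sum.swap)
    finally show ?thesis .
  qed
  have "word_eval \<phi> (\<Sum>b\<in>I. \<Sum>a\<in>I. \<Sum>d\<in>I. \<Sum>c\<in>I. pscale (?X b a * ?Y d c) (rel b a d c)) =
     (\<Sum>b\<in>I. \<Sum>a\<in>I. \<Sum>d\<in>I. \<Sum>c\<in>I. ?X b a * ?Y d c * word_eval \<phi> (rel b a d c))"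
    by (simp add: word_eval_sum)
  also have "\<dots> = (\<Sum>b\<in>I. \<Sum>a\<in>I. \<Sum>d\<in>I. \<Sum>c\<in>I. ?X b a * ?Y d c * \<phi> [(b, a), (d, c)] -
      ?X b a * ?Y d c * (k * \<phi> [(d, c), (b, a)]) - ?X b a * ?Y d c * (if a = d then \<phi> [(b, c)] else 0) +
      ?X b a * ?Y d c * (if b = c then k * \<phi> [(d, a)] else 0))"
  proof (intro sum.cong refl)
    fix b a d c assume abcd: "b \<in> I" "a \<in> I" "d \<in> I" "c \<in> I"
    show "?X b a * ?Y d c * word_eval \<phi> (rel b a d c) = ?X b a * ?Y d c * \<phi> [(b, a), (d, c)] -
      ?X b a * ?Y d c * (k * \<phi> [(d, c), (b, a)]) - ?X b a * ?Y d c * (if a = d then \<phi> [(b, c)] else 0) +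
      ?X b a * ?Y d c * (if b = c then k * \<phi> [(d, a)] else 0)"
    proof (cases "?X b a = 0 \<or> ?Y d c = 0")
      case False
      then have "\<omega> (\<gamma> b - \<gamma> a) (\<gamma> d - \<gamma> c) = k" using k abcd by blast
      then show ?thesis by (simp only: word_eval_rel) (simp add: algebra_simps)
    qed auto
  qed
  also have "\<dots> = word_eval \<phi> (bracket_rel X Y k)"
    unfolding sum.distrib sum_subtractf 1 2 bracket_rel_def word_eval_diff word_eval_pscale 3[symmetric] 4[symmetric]
    by (simp add: word_eval_gl_embed sub left_diff_distrib sum_subtractf mult.assoc)
  finally show "word_eval \<phi> (bracket_rel X Y k) = word_eval \<phi> (\<Sum>b\<in>I. \<Sum>a\<in>I. \<Sum>d\<in>I. \<Sum>c\<in>I.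
      pscale (?X b a * ?Y d c) (rel b a d c))" ..
qed

lemma bracket_rel_unit_matrix:
  assumes "a \<in> I" "b \<in> I" "c \<in> I" "d \<in> I"
  shows "bracket_rel (unit_matrix V b a) (unit_matrix V d c) (\<omega> (\<gamma> b - \<gamma> a) (\<gamma> d - \<gamma> c)) = rel b a d c"
proof -
  have "bracket_rel (unit_matrix V b a) (unit_matrix V d c) (\<omega> (\<gamma> b - \<gamma> a) (\<gamma> d - \<gamma> c)) =
    (\<Sum>b'\<in>I. \<Sum>a'\<in>I. \<Sum>d'\<in>I. \<Sum>c'\<in>I. pscale (entry (unit_matrix V b a) b' a' * entry (unit_matrix V d c) d' c') (rel b' a' d' c'))"
    using assms by (intro bracket_rel_expand linear_unit_matrix) (auto simp: entry_unit_matrix split: if_splits)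
  also have "\<dots> = (\<Sum>b'\<in>I. \<Sum>a'\<in>I. \<Sum>d'\<in>I. \<Sum>c'\<in>I.
      if c = c' then if d = d' then if a = a' then if b = b' then rel b a d c else 0 else 0 else 0 else 0)"
    using assms by (intro sum.cong refl poly_mapping_eqI) (auto simp: entry_unit_matrix)
  also have "\<dots> = rel b a d c" using assms by simp
  finally show ?thesis .
qed

abbreviation "J \<equiv> env_ideal V"

lemma J_eq: "J = Idl\<^bsub>F\<^esub> {bracket_rel X Y (\<omega> \<alpha> \<beta>) | X Y \<alpha> \<beta>. X \<in> hpart End \<alpha> \<and> Y \<in> hpart End \<beta>}"
  by (simp add: env_ideal_def bracket_rel_def)

lemma J_ideal: "ideal J F"
  unfolding J_eq by (rule F.genideal_ideal) (use bracket_rel_closed in blast)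

lemma rel_J: "a \<in> I ==> b \<in> I ==> c \<in> I ==> d \<in> I ==> rel b a d c \<in> J"
proof -
  assume I: "a \<in> I" "b \<in> I" "c \<in> I" "d \<in> I"
  have "{bracket_rel X Y (\<omega> \<alpha> \<beta>) | X Y \<alpha> \<beta>. X \<in> hpart End \<alpha> \<and> Y \<in> hpart End \<beta>} \<subseteq> J"
    unfolding J_eq by (rule F.genideal_self) (use bracket_rel_closed in blast)
  moreover have "rel b a d c \<in> {bracket_rel X Y (\<omega> \<alpha> \<beta>) | X Y \<alpha> \<beta>. X \<in> hpart End \<alpha> \<and> Y \<in> hpart End \<beta>}"
    unfolding bracket_rel_unit_matrix[OF I, symmetric] using unit_matrix_hpart I by blast
  ultimately show ?thesis by blast
qed

text \<open>To test a map on the ideal it suffices to insert the commutation relations of matrix units into words.\<close>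

lemma J_test:
  fixes G :: "('i gword \<Rightarrow>\<^sub>0 complex) => 'b::comm_monoid_add"
  assumes G_add: "\<And>p q. p \<in> carrier F ==> q \<in> carrier F ==> G (p + q) = G p + G q" and G_zero: "G 0 = 0"
    and Z: "0 \<in> Z" "\<And>x y. x \<in> Z ==> y \<in> Z ==> x + y \<in> Z"
    and test: "\<And>x y k a b c d. set x \<subseteq> L ==> set y \<subseteq> L ==> a \<in> I ==> b \<in> I ==> c \<in> I ==> d \<in> I ==>
      G (wsingle x k * rel b a d c * wsingle y 1) \<in> Z"
    and p: "p \<in> J"
  shows "G p \<in> Z"
proof -
  \<comment> \<open>These elements form an ideal, which therefore contains \<open>J\<close> as soon
    as it contains the generators; \<open>x\<close> and \<open>y\<close> equal to 1 give the
    claim.\<close>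
  define N where "N = {p \<in> carrier F. \<forall>x\<in>carrier F. \<forall>y\<in>carrier F. G (x * p * y) \<in> Z}"
  have N_ideal: "ideal N F"
  proof (rule idealI[OF F.ring_axioms])
    show "subgroup N (add_monoid F)"
    proof (rule subgroup.intro)
      fix p assume p: "p \<in> N"
      then have pF: "p \<in> carrier F" by (simp add: N_def)
      have "\<ominus>\<^bsub>F\<^esub> p = - p" using pF F_closed(3)[of p] by (intro F.minus_equality) auto
      moreover have "G (x * (- p) * y) \<in> Z" if "x \<in> carrier F" "y \<in> carrier F" for x y
      proof -
        \<comment> \<open>\<open>Z\<close> is closed under sums only; the sign is absorbed by the
          left factor, which ranges over the whole free algebra.\<close>
        have "x * (- p) * y = (- x) * p * y" by simp
        moreover have "G ((- x) * p * y) \<in> Z" using p that F_closed(3) unfolding N_def by blast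
        ultimately show ?thesis by (simp only:)
      qed
      ultimately have "\<ominus>\<^bsub>F\<^esub> p \<in> N" using pF F_closed(3)[OF pF] unfolding N_def by simp
      then show "inv\<^bsub>add_monoid F\<^esub> p \<in> N" by (simp add: a_inv_def)
    next
      fix p q assume pq: "p \<in> N" "q \<in> N"
      have "G (x * (p + q) * y) \<in> Z" if "x \<in> carrier F" "y \<in> carrier F" for x y
      proof -
        have "x * p * y \<in> carrier F" "x * q * y \<in> carrier F"
          using that pq unfolding N_def by (auto intro!: F_closed)
        then have "G (x * (p + q) * y) = G (x * p * y) + G (x * q * y)"
          using G_add by (simp add: distrib_left distrib_right)
        then show ?thesis using that pq Z(2) by (simp add: N_def)
      qed
      then show "p \<otimes>\<^bsub>add_monoid F\<^esub> q \<in> N" using pq F_closed(1) by (simp add: N_def)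
    qed (auto simp: N_def G_zero Z F_closed)
  next
    fix p x assume px: "p \<in> N" "x \<in> carrier F"
    have "G (y * (x * p) * z) \<in> Z" "G (y * (p * x) * z) \<in> Z" if "y \<in> carrier F" "z \<in> carrier F" for y z
    proof -
      have "G ((y * x) * p * z) \<in> Z" "G (y * p * (x * z)) \<in> Z" using px that F_closed(2) unfolding N_def by blast+
      then show "G (y * (x * p) * z) \<in> Z" "G (y * (p * x) * z) \<in> Z" by (simp_all add: mult.assoc)
    qed
    then show "x \<otimes>\<^bsub>F\<^esub> p \<in> N" "p \<otimes>\<^bsub>F\<^esub> x \<in> N" using px F_closed(2) by (simp_all add: N_def)
  qed
  have rel_test: "G (x * pscale k (rel b a d c) * y) \<in> Z"
    if abcd: "a \<in> I" "b \<in> I" "c \<in> I" "d \<in> I" and xy: "x \<in> carrier F" "y \<in> carrier F" for a b c d x y k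
  proof -
    have r: "rel b a d c \<in> carrier F" using abcd by (rule rel_closed)
    have "G (wsingle w k' * pscale k (rel b a d c) * y) \<in> Z" if w: "set w \<subseteq> L" for w k'
      using xy(2)
    proof (induction y rule: F_induct)
      case (single v k'')
      have "wsingle w k' * pscale k (rel b a d c) * wsingle v k'' =
          wsingle w (k' * k * k'') * rel b a d c * wsingle v 1"
      proof -
        have 1: "wsingle v k'' = pscale k'' (wsingle v 1)"
          using single_pscale[of v k'' 1] by simp
        have 2: "wsingle w (k' * k * k'') = pscale (k'' * k) (wsingle w k')"
          using single_pscale[of w "k'' * k" k'] by (simp add: mult_ac)
        show ?thesis unfolding 1 2 by (simp only: pscale_mult pscale_pscale)
      qed
      then show ?case using test[OF w single abcd] by simp
    next
      case (add p q)
      have "wsingle w k' * pscale k (rel b a d c) \<in> carrier F"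
        using w r by (intro F_closed)
      then show ?case using add G_add Z(2) F_closed(2) by (simp add: distrib_left)
    qed (simp add: G_zero Z)
    with xy(1) show ?thesis
    proof (induction x rule: F_induct)
      case (add p q)
      have "pscale k (rel b a d c) * y \<in> carrier F" using r xy by (intro F_closed)
      then show ?case using add G_add Z(2) F_closed(2) by (simp add: distrib_right mult.assoc)
    qed (simp_all add: G_zero Z)
  qed
  have sum_test: "G (x * (\<Sum>i\<in>A. f i) * y) \<in> Z"
    if "\<And>i. i \<in> A ==> f i \<in> carrier F" "\<And>i. i \<in> A ==> G (x * f i * y) \<in> Z" "x \<in> carrier F" "y \<in> carrier F"
    for A :: "'i set" and f x y
    using that(1,2)
  proof (induction A rule: infinite_finite_induct)
    case (insert i A)
    then have "x * f i * y \<in> carrier F" "x * sum f A * y \<in> carrier F"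
      using that(3,4) by (auto intro!: F_closed F_sum_closed)
    then show ?case using insert G_add Z(2) by (simp add: distrib_left distrib_right)
  qed (simp_all add: G_zero Z)
  have "bracket_rel X Y (\<omega> \<alpha> \<beta>) \<in> N" if XY: "X \<in> hpart End \<alpha>" "Y \<in> hpart End \<beta>" for X Y \<alpha> \<beta>
  proof -
    have lin: "lin X" "lin Y"
      using XY by (auto simp: End_alg_def)
    have eq: "bracket_rel X Y (\<omega> \<alpha> \<beta>) = (\<Sum>b\<in>I. \<Sum>a\<in>I. \<Sum>d\<in>I. \<Sum>c\<in>I.
        pscale (entry X b a * entry Y d c) (rel b a d c))"
      using XY unfolding End_hpart[OF lin(1)] End_hpart[OF lin(2)] by (intro bracket_rel_expand lin) blast
    have "G (x * bracket_rel X Y (\<omega> \<alpha> \<beta>) * y) \<in> Z" if "x \<in> carrier F" "y \<in> carrier F" for x y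
      unfolding eq using that by (intro sum_test rel_test F_sum_closed F_closed rel_closed) auto
    then show ?thesis using bracket_rel_closed by (simp add: N_def)
  qed
  then have "J \<subseteq> N" unfolding J_eq by (intro F.genideal_minimal N_ideal) blast
  then have "G (1 * p * 1) \<in> Z" using p F_closed(7) unfolding N_def by blast
  then show ?thesis by simp
qed

end

lemma word_eval_one: "word_eval \<phi> 1 = \<phi> []"
proof -
  have "word_eval \<phi> (wsingle 0 1) = \<phi> 0" using word_eval_single[of \<phi> 0 1] by (simp only: mult_1_left)
  then show ?thesis unfolding single_one by (simp only: zero_list_def)
qed

lemma single_Nil: "wsingle [] (1 :: complex) = 1"
  unfolding zero_list_def[symmetric] by simp

context graded_basis
begin

section \<open>The quotient by the commutation relations\<close>

abbreviation "U \<equiv> env_alg V"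
abbreviation "cl \<equiv> env_class V"

definition wcl :: "'i gword => 'i env" where
  "wcl w = cl (wsingle w 1)"

lemma cl_eq_iff: "p \<in> carrier F ==> q \<in> carrier F ==> cl p = cl q \<longleftrightarrow> p - q \<in> J"
  unfolding env_class_def using F.quotient_eq_iff_same_a_r_cos[OF J_ideal, of p q] F_a_minus[of p q] by simp

lemma cl_hom: "cl \<in> Ring.ring_hom F (F Quot J)"
  using ideal.rcos_ring_hom[OF J_ideal] by (simp add: env_class_def[abs_def])

lemma env_alg_simps:
  "carrier U = carrier (F Quot J)" "mult U = mult (F Quot J)" "one U = one (F Quot J)"
  "zero U = zero (F Quot J)" "add U = add (F Quot J)"
  "module.smult U = (\<lambda>c X. cl (c \<odot>\<^bsub>F\<^esub> \<one>\<^bsub>F\<^esub>) \<otimes>\<^bsub>F Quot J\<^esub> X)" "hpart U = (\<lambda>\<alpha>. cl ` hpart F \<alpha>)"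
  by (simp_all add: env_alg_def Let_def)

lemma U_carrier: "carrier U = cl ` carrier F"
  unfolding env_alg_simps FactRing_def A_RCOSETS_def' env_class_def by auto

lemma cl_closed: "p \<in> carrier F ==> cl p \<in> carrier U"
  by (simp add: U_carrier)

lemma ring_U: "ring U"
  by (rule ring_transport[OF ideal.quotient_is_ring[OF J_ideal]]) (simp_all add: env_alg_simps)

lemma U_simps:
  "p \<in> carrier F ==> q \<in> carrier F ==> cl p \<otimes>\<^bsub>U\<^esub> cl q = cl (p * q)"
  "p \<in> carrier F ==> q \<in> carrier F ==> cl p \<oplus>\<^bsub>U\<^esub> cl q = cl (p + q)"
  "\<one>\<^bsub>U\<^esub> = cl 1" "\<zero>\<^bsub>U\<^esub> = cl 0" "p \<in> carrier F ==> c \<odot>\<^bsub>U\<^esub> cl p = cl (pscale c p)"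
proof -
  show 1: "cl p \<otimes>\<^bsub>U\<^esub> cl q = cl (p * q)" "cl p \<oplus>\<^bsub>U\<^esub> cl q = cl (p + q)" if "p \<in> carrier F" "q \<in> carrier F" for p q
    using ring_hom_mult[OF cl_hom that] ring_hom_add[OF cl_hom that] by (simp_all add: env_alg_simps)
  show "\<one>\<^bsub>U\<^esub> = cl 1" "\<zero>\<^bsub>U\<^esub> = cl 0"
    using ring_hom_one[OF cl_hom] ring_hom_zero[OF cl_hom F.ring_axioms ideal.quotient_is_ring[OF J_ideal]]
    by (simp_all add: env_alg_simps)
  show "c \<odot>\<^bsub>U\<^esub> cl p = cl (pscale c p)" if "p \<in> carrier F"
  proof -
    have "pscale c 1 \<in> carrier F" by (intro F_closed)
    from 1(1)[OF this that] have "cl (pscale c 1) \<otimes>\<^bsub>F Quot J\<^esub> cl p = cl (pscale c 1 * p)"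
      by (simp only: env_alg_simps)
    then show ?thesis by (simp add: env_alg_simps(6) pscale_mult)
  qed
qed

lemma U_zero_smult: "x \<in> carrier U ==> 0 \<odot>\<^bsub>U\<^esub> x = cl 0"
proof -
  assume "x \<in> carrier U"
  then obtain p where p: "p \<in> carrier F" "x = cl p" by (auto simp: U_carrier)
  have "pscale 0 p = 0"
    by (rule poly_mapping_eqI) (simp only: lookup_pscale lookup_zero mult_zero_left)
  then show ?thesis unfolding p(2) U_simps(5)[OF p(1)] by (rule arg_cong)
qed

text \<open>If the coset of \<open>p\<close> is that of some \<open>q\<close> in the free algebra,
  then \<open>p\<close> and \<open>q\<close> differ by a member of the ideal. Hence functionals that
  vanish off the carrier vanish on words with letters outside \<open>L\<close>.\<close>

lemma cl_carrierD:
  assumes "cl p \<in> carrier U"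
  shows "p \<in> carrier F"
proof -
  interpret J: ideal J F by (rule J_ideal)
  obtain q where q: "q \<in> carrier F" "cl p = cl q" using assms by (auto simp: U_carrier)
  have "0 + p \<in> cl p" unfolding env_class_def a_r_coset_def' using J.additive_subgroup_axioms
    by (auto intro!: bexI[of _ 0] dest: additive_subgroup.zero_closed)
  then have "p \<in> cl q" using q by simp
  then show ?thesis unfolding env_class_def a_r_coset_def' using q J.Icarr F_closed(1) by auto
qed

lemma cl_neg: "p \<in> carrier F ==> \<ominus>\<^bsub>U\<^esub> cl p = cl (- p)"
proof -
  interpret U: ring U by (rule ring_U)
  assume p: "p \<in> carrier F"
  then have "cl (- p) \<oplus>\<^bsub>U\<^esub> cl p = \<zero>\<^bsub>U\<^esub>" using U_simps(2,4) F_closed(3) by simp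
  then show ?thesis using p F_closed(3) by (intro U.minus_equality) (auto intro: cl_closed)
qed

definition comp :: "'g => ('i gword \<Rightarrow>\<^sub>0 complex) => 'i gword \<Rightarrow>\<^sub>0 complex" where
  "comp \<alpha> p = (\<Sum>w | w \<in> wkeys p \<and> dg w = \<alpha>. wsingle w (wlookup p w))"

lemma lookup_comp: "wlookup (comp \<alpha> p) w = (if dg w = \<alpha> then wlookup p w else 0)"
proof -
  have "wlookup (comp \<alpha> p) w =
      (\<Sum>v | v \<in> wkeys p \<and> dg v = \<alpha>. if v = w then wlookup p w else 0)"
    unfolding comp_def lookup_sum by (intro sum.cong refl) (auto simp: lookup_single when_def)
  also have "\<dots> = (if dg w = \<alpha> then wlookup p w else 0)"
    by (simp add: in_keys_iff)
  finally show ?thesis .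
qed

lemma comp_add: "comp \<alpha> (p + q) = comp \<alpha> p + comp \<alpha> q"
  by (rule poly_mapping_eqI) (simp add: lookup_comp lookup_add)

lemma comp_diff: "comp \<alpha> (p - q) = comp \<alpha> p - comp \<alpha> q"
  by (rule poly_mapping_eqI) (simp add: lookup_comp lookup_minus)

lemma comp_zero: "comp \<alpha> 0 = 0"
  by (simp add: comp_def)

lemma comp_pscale: "comp \<alpha> (pscale c p) = pscale c (comp \<alpha> p)"
  by (rule poly_mapping_eqI) (simp add: lookup_comp)

lemma word_eval_comp: "word_eval \<phi> (comp \<alpha> p) = word_eval (\<lambda>w. if dg w = \<alpha> then \<phi> w else 0) p"
proof -
  have "word_eval \<phi> (comp \<alpha> p) = (\<Sum>w\<in>wkeys p. wlookup (comp \<alpha> p) w * \<phi> w)"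
    by (rule word_eval_superset) (auto simp: in_keys_iff lookup_comp split: if_splits)
  then show ?thesis unfolding word_eval_def by (simp add: lookup_comp if_distrib if_distribR cong: if_cong)
qed

lemma comp_hpart: "p \<in> carrier F ==> comp \<alpha> p \<in> hpart F \<alpha>"
  unfolding F_hpart F_carrier by (auto simp: in_keys_iff lookup_comp split: if_splits)

lemma hpart_carrier_F: "p \<in> hpart F \<alpha> ==> p \<in> carrier F"
  unfolding F_hpart F_carrier by auto

lemma comp_closed: "p \<in> carrier F ==> comp \<alpha> p \<in> carrier F"
  using comp_hpart hpart_carrier_F by blast

lemma comp_same: "p \<in> hpart F \<alpha> ==> comp \<beta> p = (if \<beta> = \<alpha> then p else 0)"
  by (intro poly_mapping_eqI) (auto simp: lookup_comp F_hpart in_keys_iff)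

lemma rel_keys_dg: "z \<in> wkeys (rel b a d c) ==> dg z = \<gamma> b - \<gamma> a + (\<gamma> d - \<gamma> c)"
proof -
  assume "z \<in> wkeys (rel b a d c)"
  then have "z = [(b, a), (d, c)] \<or> z = [(d, c), (b, a)] \<or> (a = d \<and> z = [(b, c)]) \<or> (b = c \<and> z = [(d, a)])"
    by (auto simp: rel_def in_keys_iff lookup_add lookup_minus lookup_single when_def split: if_splits)
  then show ?thesis by auto
qed

text \<open>Multiples of a relation by words on both sides are homogeneous, so a component
  projection keeps or kills them whole.\<close>

lemma rel_hom: "comp \<alpha> (wsingle x k * rel b a d c * wsingle y 1) =
   (if dg x + (\<gamma> b - \<gamma> a + (\<gamma> d - \<gamma> c)) + dg y = \<alpha> then wsingle x k * rel b a d c * wsingle y 1 else 0)"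
proof (rule poly_word_eval_eqI)
  fix \<phi> :: "'i gfun"
  define D where "D = dg x + (\<gamma> b - \<gamma> a + (\<gamma> d - \<gamma> c)) + dg y"
  have E: "word_eval \<psi> (wsingle x k * rel b a d c * wsingle y 1) =
      k * word_eval (\<lambda>z. \<psi> (x @ z @ y)) (rel b a d c)" for \<psi>
    by (simp add: word_eval_mult)
  have "word_eval (\<lambda>z. if dg (x @ z @ y) = \<alpha> then \<phi> (x @ z @ y) else 0) (rel b a d c) =
      word_eval (\<lambda>z. if D = \<alpha> then \<phi> (x @ z @ y) else 0) (rel b a d c)"
    by (intro word_eval_cong) (simp add: rel_keys_dg D_def add.assoc)
  also have "\<dots> = (if D = \<alpha> then word_eval (\<lambda>z. \<phi> (x @ z @ y)) (rel b a d c) else 0)"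
    by (simp add: word_eval_def)
  finally show "word_eval \<phi> (comp \<alpha> (wsingle x k * rel b a d c * wsingle y 1)) =
    word_eval \<phi> (if dg x + (\<gamma> b - \<gamma> a + (\<gamma> d - \<gamma> c)) + dg y = \<alpha>
      then wsingle x k * rel b a d c * wsingle y 1 else 0)"
    unfolding D_def[symmetric] word_eval_comp E by (simp only: if_distrib[of "word_eval \<phi>"] E word_eval_zero) auto
qed

lemma J_zero: "0 \<in> J" and J_add: "p \<in> J ==> q \<in> J ==> p + q \<in> J"
  and J_mult: "p \<in> J ==> x \<in> carrier F ==> x * p \<in> J" "p \<in> J ==> x \<in> carrier F ==> p * x \<in> J"
  and J_carrier: "p \<in> J ==> p \<in> carrier F"
proof -
  interpret J: ideal J F by (rule J_ideal)
  show "0 \<in> J" "p \<in> J ==> q \<in> J ==> p + q \<in> J" "p \<in> J ==> x \<in> carrier F ==> x * p \<in> J"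
    "p \<in> J ==> x \<in> carrier F ==> p * x \<in> J" "p \<in> J ==> p \<in> carrier F"
    using J.zero_closed J.a_closed[of p q] J.I_l_closed[of p x] J.I_r_closed[of p x] J.Icarr by simp_all
qed

text \<open>An ideal generated by homogeneous elements is graded. This is what makes the projections
  of the quotient well defined.\<close>

lemma J_comp: "p \<in> J ==> comp \<alpha> p \<in> J"
proof (rule J_test[of "comp \<alpha>" J])
  fix x y k a b c d assume xy: "set x \<subseteq> L" "set y \<subseteq> L" "a \<in> I" "b \<in> I" "c \<in> I" "d \<in> I"
  then have "wsingle x k * rel b a d c * wsingle y 1 \<in> J"
    by (intro J_mult rel_J F_closed)
  then show "comp \<alpha> (wsingle x k * rel b a d c * wsingle y 1) \<in> J"
    unfolding rel_hom using J_zero by simp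
qed (simp_all add: comp_add comp_zero J_zero J_add)

definition rep :: "'i env => 'i gword \<Rightarrow>\<^sub>0 complex" where
  "rep x = (SOME p. p \<in> carrier F \<and> cl p = x)"

lemma rep: "x \<in> carrier U ==> rep x \<in> carrier F \<and> cl (rep x) = x"
  unfolding rep_def by (rule someI_ex) (auto simp: U_carrier)

lemma rep_cl_J: "p \<in> carrier F ==> rep (cl p) - p \<in> J"
  using rep[OF cl_closed] cl_eq_iff by blast

definition prU :: "'g => 'i env => 'i env" where
  "prU \<alpha> x = cl (comp \<alpha> (rep x))"

lemma prU_cl: "p \<in> carrier F ==> prU \<alpha> (cl p) = cl (comp \<alpha> p)"
  unfolding prU_def using rep[OF cl_closed, of p] J_comp[OF rep_cl_J, of p \<alpha>]
  by (subst cl_eq_iff) (simp_all add: comp_closed comp_diff)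

lemma hpartU_iff: "x \<in> hpart U \<alpha> \<longleftrightarrow> (\<exists>p\<in>hpart F \<alpha>. x = cl p)"
  by (auto simp: env_alg_simps)

sublocale U: graded_algebra U prU
proof (rule graded_algebraI[OF ring_U])
  interpret U: ring U by (rule ring_U)
  fix x assume x: "x \<in> carrier U"
  then obtain p where p: "p \<in> carrier F" "x = cl p" by (auto simp: U_carrier)
  show "c \<odot>\<^bsub>U\<^esub> x \<in> carrier U" for c
    using p U_simps(5) F_closed(5) cl_closed by simp
  show "prU \<alpha> x \<in> hpart U \<alpha>" for \<alpha>
    unfolding p(2) prU_cl[OF p(1)] hpartU_iff using comp_hpart[OF p(1)] by blast
  show "prU \<alpha> (c \<odot>\<^bsub>U\<^esub> x) = c \<odot>\<^bsub>U\<^esub> prU \<alpha> x" for \<alpha> c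
    using p U_simps(5) F_closed(5) comp_closed by (simp add: prU_cl comp_pscale)
  have fs: "finsum U (\<lambda>\<alpha>. cl (f \<alpha>)) S = cl (sum f S)" if "finite S" "\<And>\<alpha>. f \<alpha> \<in> carrier F" for f S
    using that(1)
  proof (induction S rule: finite_induct)
    case (insert s S)
    then show ?case using that(2) cl_closed U_simps(2) F_sum_closed[of S f] by (simp add: Pi_def)
  qed (simp add: U_simps)
  show "\<exists>S. finite S \<and> (\<forall>\<alpha>. \<alpha> \<notin> S \<longrightarrow> prU \<alpha> x = \<zero>\<^bsub>U\<^esub>) \<and> x = finsum U (\<lambda>\<alpha>. prU \<alpha> x) S"
  proof (intro exI conjI allI impI)
    let ?S = "dg ` wkeys p"
    show "finite ?S" by simp
    fix \<alpha> assume "\<alpha> \<notin> ?S"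
    then have "comp \<alpha> p = 0" by (intro poly_mapping_eqI) (auto simp: lookup_comp in_keys_iff)
    then show "prU \<alpha> x = \<zero>\<^bsub>U\<^esub>" using p by (simp add: prU_cl U_simps)
  next
    let ?S = "dg ` wkeys p"
    have "(\<Sum>\<alpha>\<in>?S. comp \<alpha> p) = p"
    proof (rule poly_mapping_eqI)
      fix w
      have "wlookup (\<Sum>\<alpha>\<in>?S. comp \<alpha> p) w = (\<Sum>\<alpha>\<in>?S. if dg w = \<alpha> then wlookup p w else 0)"
        by (simp add: lookup_sum lookup_comp)
      then show "wlookup (\<Sum>\<alpha>\<in>?S. comp \<alpha> p) w = wlookup p w"
        by (auto simp: in_keys_iff image_iff)
    qed
    then show "x = finsum U (\<lambda>\<alpha>. prU \<alpha> x) ?S"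
      using fs[of ?S "\<lambda>\<alpha>. comp \<alpha> p"] p comp_closed by (simp add: prU_cl)
  qed
  fix y assume y: "y \<in> carrier U"
  then obtain q where q: "q \<in> carrier F" "y = cl q" by (auto simp: U_carrier)
  show "prU \<alpha> (x \<oplus>\<^bsub>U\<^esub> y) = prU \<alpha> x \<oplus>\<^bsub>U\<^esub> prU \<alpha> y" for \<alpha>
    using p q F_closed(1) by (simp add: U_simps prU_cl comp_add comp_closed)
  show "(c \<odot>\<^bsub>U\<^esub> x) \<otimes>\<^bsub>U\<^esub> y = c \<odot>\<^bsub>U\<^esub> (x \<otimes>\<^bsub>U\<^esub> y)" "x \<otimes>\<^bsub>U\<^esub> (c \<odot>\<^bsub>U\<^esub> y) = c \<odot>\<^bsub>U\<^esub> (x \<otimes>\<^bsub>U\<^esub> y)" for c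
    using p q F_closed(2,5) by (simp_all add: U_simps pscale_mult)
next
  fix x \<alpha> assume "x \<in> hpart U \<alpha>"
  then obtain p where p: "p \<in> hpart F \<alpha>" "x = cl p" by (auto simp: hpartU_iff)
  show "x \<in> carrier U" using p hpart_carrier_F cl_closed by blast
  show "prU \<beta> x = (if \<beta> = \<alpha> then x else \<zero>\<^bsub>U\<^esub>)" for \<beta>
    using p hpart_carrier_F[OF p(1)] by (simp add: prU_cl comp_same U_simps)
qed

lemma wcl_closed: "set w \<subseteq> L ==> wcl w \<in> carrier U"
  unfolding wcl_def by (intro cl_closed F_closed)

lemma wcl_hpart: "set w \<subseteq> L ==> wcl w \<in> hpart U (dg w)"
  unfolding wcl_def hpartU_iff F_hpart by (intro bexI[of _ "wsingle w 1"]) auto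

lemma wcl_append: "set u \<subseteq> L ==> set v \<subseteq> L ==> wcl u \<otimes>\<^bsub>U\<^esub> wcl v = wcl (u @ v)"
  unfolding wcl_def using U_simps(1)[of "wsingle u 1" "wsingle v 1"] F_closed(8)
  by (simp add: mult_single plus_list_def)

lemma wcl_Nil: "wcl [] = \<one>\<^bsub>U\<^esub>"
  unfolding wcl_def U_simps zero_list_def[symmetric] by simp

lemma linear_functional_cl:
  assumes f: "linear_functional U f" and p: "p \<in> carrier F"
  shows "f (cl p) = word_eval (\<lambda>w. f (wcl w)) p"
  using p
proof (induction p rule: F_induct)
  case zero
  then show ?case using U.linear_functional_zero[OF f] by (simp add: U_simps)
next
  case (single w c)
  have "c \<odot>\<^bsub>U\<^esub> wcl w = cl (wsingle w c)"
    unfolding wcl_def using U_simps(5)[OF F_closed(8)[OF single]] single_pscale[of w c 1] by simp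
  moreover have "f (c \<odot>\<^bsub>U\<^esub> wcl w) = c * f (wcl w)"
    using f wcl_closed[OF single] by (simp add: linear_functional_def)
  ultimately show ?case by simp
next
  case (add p q)
  have "f (cl p \<oplus>\<^bsub>U\<^esub> cl q) = f (cl p) + f (cl q)"
    using f cl_closed add by (simp add: linear_functional_def)
  then show ?case using add U_simps(2) by simp
qed

section \<open>Functionals as functions on words\<close>

definition wf :: "('i env => complex) => 'i gfun" where
  "wf f w = f (wcl w)"

text \<open>The dual of the enveloping algebra in coordinates: \<open>wf\<close> and
  \<open>ofw\<close> are mutually inverse bijections between it and \<open>WU\<close>. The support
  condition reflects that elements of the dual vanish off the carrier.\<close>

definition WU :: "'i gfun set" where
  "WU = {\<phi>. (\<forall>w. \<phi> w \<noteq> 0 \<longrightarrow> set w \<subseteq> L) \<and> (\<forall>p\<in>J. word_eval \<phi> p = 0)}"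

definition ofw :: "'i gfun => 'i env => complex" where
  "ofw \<phi> x = (if x \<in> carrier U then word_eval \<phi> (rep x) else 0)"

abbreviation "Udual \<equiv> dual_space U"

lemma dual_cl: "f \<in> Udual ==> p \<in> carrier F ==> f (cl p) = word_eval (wf f) p"
  unfolding wf_def dual_space_def using linear_functional_cl by blast

lemma dual_outside: "f \<in> Udual ==> x \<notin> carrier U ==> f x = 0"
  by (simp add: dual_space_def)

lemma dual_eqI: "f \<in> Udual ==> g \<in> Udual ==> wf f = wf g ==> f = g"
proof
  fix x assume fg: "f \<in> Udual" "g \<in> Udual" "wf f = wf g"
  show "f x = g x"
  proof (cases "x \<in> carrier U")
    case True
    then show ?thesis using fg dual_cl rep by metis
  qed (simp add: fg dual_outside)
qed

lemma wf_WU: "f \<in> Udual ==> wf f \<in> WU"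
  unfolding WU_def
proof (intro CollectI conjI allI impI ballI)
  assume f: "f \<in> Udual"
  show "word_eval (wf f) p = 0" if "p \<in> J" for p
  proof -
    have "cl p = cl 0" using that J_carrier F_closed(6) by (subst cl_eq_iff) auto
    then show ?thesis using dual_cl[OF f J_carrier[OF that]] dual_cl[OF f F_closed(6)] by simp
  qed
  fix w assume "wf f w \<noteq> 0"
  then have "wcl w \<in> carrier U" using f dual_outside unfolding wf_def by blast
  then have "wsingle w (1::complex) \<in> carrier F" unfolding wcl_def by (rule cl_carrierD)
  then show "set w \<subseteq> L" by (simp add: F_carrier)
qed

lemma ofw_cl: "\<phi> \<in> WU ==> p \<in> carrier F ==> ofw \<phi> (cl p) = word_eval \<phi> p"
  using rep_cl_J[of p] cl_closed[of p] by (auto simp: ofw_def WU_def dest!: bspec)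

lemma ofw_dual: "\<phi> \<in> WU ==> ofw \<phi> \<in> Udual"
  unfolding dual_space_def linear_functional_def
proof (intro CollectI conjI ballI allI impI)
  assume \<phi>: "\<phi> \<in> WU"
  fix x assume "x \<in> carrier U"
  then obtain p where p: "p \<in> carrier F" "x = cl p" by (auto simp: U_carrier)
  show "ofw \<phi> (c \<odot>\<^bsub>U\<^esub> x) = c * ofw \<phi> x" for c
    using p \<phi> F_closed(5) by (simp add: U_simps ofw_cl)
  fix y assume "y \<in> carrier U"
  then obtain q where q: "q \<in> carrier F" "y = cl q" by (auto simp: U_carrier)
  show "ofw \<phi> (x \<oplus>\<^bsub>U\<^esub> y) = ofw \<phi> x + ofw \<phi> y"
    using p q \<phi> F_closed(1) by (simp add: U_simps ofw_cl)
qed (simp add: ofw_def)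

lemma wf_ofw: "\<phi> \<in> WU ==> wf (ofw \<phi>) = \<phi>"
proof
  fix w assume \<phi>: "\<phi> \<in> WU"
  show "wf (ofw \<phi>) w = \<phi> w"
  proof (cases "set w \<subseteq> L")
    case True
    then show ?thesis using ofw_cl[OF \<phi> F_closed(8)[OF True]] by (simp add: wf_def wcl_def)
  next
    case False
    then have "wf (ofw \<phi>) w = 0" "\<phi> w = 0" using \<phi> wf_WU[OF ofw_dual[OF \<phi>]] unfolding WU_def by blast+
    then show ?thesis by simp
  qed
qed

lemma WU_I:
  assumes "\<And>w. \<phi> w \<noteq> 0 ==> set w \<subseteq> L"
    and "\<And>x y a b c d. set x \<subseteq> L ==> set y \<subseteq> L ==> a \<in> I ==> b \<in> I ==> c \<in> I ==> d \<in> I ==>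
      word_eval (\<lambda>z. \<phi> (x @ z @ y)) (rel b a d c) = 0"
  shows "\<phi> \<in> WU"
proof -
  have "word_eval \<phi> p \<in> {0}" if "p \<in> J" for p
    by (rule J_test[OF _ _ _ _ _ that, where G = "word_eval \<phi>" and Z = "{0}"])
      (simp_all add: word_eval_mult assms(2))
  then show ?thesis using assms(1) unfolding WU_def by blast
qed

text \<open>A functional of degree \<beta> pairs nontrivially with degree \<open>- \<beta>\<close>
  only, which is the origin of the minus signs in \<open>wpart\<close> and
  \<open>R_hpart\<close>.\<close>

lemma functional_degree_iff:
  assumes f: "f \<in> Udual"
  shows "functional_degree V \<beta> f \<longleftrightarrow> (\<forall>w. wf f w \<noteq> 0 \<longrightarrow> dg w = - \<beta>)"
proof
  assume d: "functional_degree V \<beta> f"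
  show "\<forall>w. wf f w \<noteq> 0 \<longrightarrow> dg w = - \<beta>"
  proof (intro allI impI)
    fix w assume w: "wf f w \<noteq> 0"
    then have "set w \<subseteq> L" using wf_WU[OF f] by (simp add: WU_def)
    then show "dg w = - \<beta>" using w d wcl_hpart unfolding functional_degree_def wf_def by blast
  qed
next
  assume d: "\<forall>w. wf f w \<noteq> 0 \<longrightarrow> dg w = - \<beta>"
  show "functional_degree V \<beta> f"
    unfolding functional_degree_def
  proof (intro allI impI ballI)
    fix \<alpha> x assume \<alpha>: "\<alpha> \<noteq> - \<beta>" "x \<in> hpart U \<alpha>"
    then obtain p where p: "p \<in> hpart F \<alpha>" "x = cl p" by (auto simp: hpartU_iff)
    have "f x = word_eval (wf f) p" using dual_cl[OF f hpart_carrier_F[OF p(1)]] p by simp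
    also have "\<dots> = word_eval (\<lambda>w. 0) p"
      using p(1) d \<alpha>(1) unfolding F_hpart by (intro word_eval_cong) auto
    finally show "f x = 0" by (simp add: word_eval_def)
  qed
qed

subsection \<open>Action, counit, coproduct and antipode\<close>

text \<open>The matrix entries of a product of matrix units; up to the choice of indices outside \<open>I\<close> this is the
  indicator of the words that form a path from \<open>b\<close> to \<open>a\<close>.\<close>

fun rho :: "'i gword => 'i => 'i => complex" where
  "rho [] b a = (if b = a then 1 else 0)"
| "rho ((d, c) # w) b a = (if b = d then rho w c a else 0)"

text \<open>Matrix multiplication. The condition on \<open>u\<close> keeps the intermediate index
  inside \<open>I\<close>, where the sum can find it.\<close>

lemma rho_append: "set u \<subseteq> L ==> b \<in> I ==> rho (u @ v) b a = (\<Sum>c\<in>I. rho u b c * rho v c a)"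
proof (induction u arbitrary: b)
  case Nil
  have "(\<Sum>c\<in>I. rho [] b c * rho v c a) = (\<Sum>c\<in>I. if b = c then rho v b a else 0)"
    by (intro sum.cong refl) auto
  then show ?case using Nil by simp
next
  case (Cons l u)
  then show ?case by (cases l) (auto simp: L_def)
qed

lemma rho_dg: "rho w b a \<noteq> 0 ==> dg w = \<gamma> b - \<gamma> a"
  by (induction w b a rule: rho.induct) (auto split: if_splits)

lemma rho_rel: "rho (x @ (b, a) # (d, c) # y) p q = (if a = d then rho (x @ (b, c) # y) p q else 0)"
  by (induction x p q rule: rho.induct) auto

text \<open>The product of \<open>E\<^sub>b\<^sub>a\<close> and \<open>E\<^sub>d\<^sub>c\<close> is
  zero unless \<open>a = d\<close>, so the bracket relation holds identically for matrices.\<close>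

lemma word_eval_rho_rel: "word_eval (\<lambda>z. rho (x @ z @ y) p q) (rel b a d c) = 0"
  by (simp add: word_eval_rel rho_rel)

lemma word_eval_rho_J: "r \<in> J ==> word_eval (\<lambda>w. rho w b a) r = 0"
proof -
  assume r: "r \<in> J"
  have "word_eval (\<lambda>w. rho w b a) r \<in> {0}"
    by (rule J_test[OF _ _ _ _ _ r, where G = "word_eval (\<lambda>w. rho w b a)" and Z = "{0}"])
      (simp_all add: word_eval_mult word_eval_rho_rel)
  then show ?thesis by simp
qed

definition act :: "('i gword \<Rightarrow>\<^sub>0 complex) => 'v => 'v" where
  "act p v = (\<Sum>b\<in>I. \<Sum>a\<in>I. scal V (word_eval (\<lambda>w. rho w b a) p * co a v) (bas V b))"

lemma linear_act: "lin (act p)"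
  by standard (simp_all add: act_def co_add co_scale distrib_left vs.scale_left_distrib sum.distrib
    vs.scale_sum_right mult.left_commute)

lemma linear_scale: "lin X ==> lin (\<lambda>v. scal V c (X v))"
proof -
  assume "lin X"
  then interpret X: Vector_Spaces.linear "scal V" "scal V" X .
  show ?thesis by standard (simp_all add: X.add X.scale vs.scale_right_distrib vs.scale_left_commute)
qed

lemma linear_add: "lin X ==> lin Y ==>
    lin (\<lambda>v. X v + Y v)"
proof -
  assume "lin X" "lin Y"
  then interpret X: Vector_Spaces.linear "scal V" "scal V" X + Y: Vector_Spaces.linear "scal V" "scal V" Y .
  show ?thesis by standard (simp_all add: X.add X.scale Y.add Y.scale vs.scale_right_distrib)
qed

lemma linear_id: "lin id"
  by standard simp_all

lemma entry_simps: "entry (\<lambda>v. scal V c (X v)) b a = c * entry X b a" "entry (\<lambda>v. X v + Y v) b a = entry X b a + entry Y b a"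
  by (simp_all add: entry_def co_scale co_add)

lemma entry_id: "a \<in> I ==> b \<in> I ==> entry id b a = (if b = a then 1 else 0)"
  by (simp add: entry_def co_bas)

lemma entry_act: "a \<in> I ==> b \<in> I ==> entry (act p) b a = word_eval (\<lambda>w. rho w b a) p"
proof -
  assume ab: "a \<in> I" "b \<in> I"
  have "entry (act p) b a = (\<Sum>b'\<in>I. \<Sum>a'\<in>I. if a' = a then if b' = b then word_eval (\<lambda>w. rho w b a) p else 0 else 0)"
    unfolding entry_def act_def co_sum co_scale using ab by (intro sum.cong refl) (auto simp: co_bas)
  then show ?thesis using ab by simp
qed

lemma word_eval_rho_mult:
  assumes "p \<in> carrier F" "b \<in> I"
  shows "word_eval (\<lambda>w. rho w b a) (p * q) = (\<Sum>c\<in>I. word_eval (\<lambda>w. rho w b c) p * word_eval (\<lambda>w. rho w c a) q)"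
proof -
  have "word_eval (\<lambda>w. rho w b a) (p * q) = word_eval (\<lambda>u. \<Sum>c\<in>I. rho u b c * word_eval (\<lambda>v. rho v c a) q) p"
    unfolding word_eval_mult using assms
    by (intro word_eval_cong) (simp add: rho_append F_carrier word_eval_fun_sum word_eval_fun_scale)
  also have "\<dots> = (\<Sum>c\<in>I. word_eval (\<lambda>u. word_eval (\<lambda>v. rho v c a) q * rho u b c) p)"
    by (simp add: word_eval_fun_sum mult.commute)
  also have "\<dots> = (\<Sum>c\<in>I. word_eval (\<lambda>w. rho w b c) p * word_eval (\<lambda>w. rho w c a) q)"
    unfolding word_eval_fun_scale by (simp only: mult.commute)
  finally show ?thesis .
qed

text \<open>The condition under the choice operator, as a predicate. Existence makes the chosen map
  usable, and \<open>entry_env_action\<close> computes it; coproduct, antipode and matrix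
  coefficients are treated in the same way.\<close>

definition is_action :: "('i env => 'v => 'v) => bool" where
  "is_action \<rho> \<longleftrightarrow> \<rho> \<in> alg_hom U End \<and> (\<forall>X\<in>carrier End. \<rho> (gl_env V X) = X)"

lemma gl_embed_unit_matrix: "a \<in> I ==> b \<in> I ==> gl_embed V (unit_matrix V b a) = wsingle [(b, a)] 1"
proof (rule poly_word_eval_eqI)
  fix \<phi> :: "'i gfun" assume ab: "a \<in> I" "b \<in> I"
  have "word_eval \<phi> (gl_embed V (unit_matrix V b a)) = (\<Sum>b'\<in>I. \<Sum>a'\<in>I. if a' = a then if b' = b then \<phi> [(b, a)] else 0 else 0)"
    unfolding word_eval_gl_embed using ab by (intro sum.cong refl) (auto simp: entry_unit_matrix)
  then show "word_eval \<phi> (gl_embed V (unit_matrix V b a)) = word_eval \<phi> (wsingle [(b, a)] 1)"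
    using ab by simp
qed

lemma gl_env_unit_matrix: "a \<in> I ==> b \<in> I ==> gl_env V (unit_matrix V b a) = wcl [(b, a)]"
  by (simp add: gl_env_def wcl_def gl_embed_unit_matrix)

lemma is_action_ex: "is_action (\<lambda>x. act (rep x))"
proof -
  have act_cl: "act (rep (cl p)) = act p" if "p \<in> carrier F" for p
    using that by (intro linear_eqI linear_act)
      (use word_eval_rho_J[OF rep_cl_J[OF that]] in \<open>simp add: entry_act\<close>)
  show ?thesis unfolding is_action_def alg_hom_def
  proof (intro conjI CollectI ballI allI ring_hom_memI)
    show "act (rep x) \<in> carrier End" for x by (simp add: linear_act)
    fix x assume "x \<in> carrier U"
    then obtain p where p: "p \<in> carrier F" "x = cl p" by (auto simp: U_carrier)
    show "act (rep (c \<odot>\<^bsub>U\<^esub> x)) = c \<odot>\<^bsub>End\<^esub> act (rep x)" for c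
    proof -
      have "act (pscale c p) = (\<lambda>v. scal V c (act p v))"
        by (intro linear_eqI linear_act linear_scale) (simp add: entry_simps entry_act)
      then show ?thesis using p F_closed(5) by (simp add: U_simps act_cl)
    qed
    fix y assume "y \<in> carrier U"
    then obtain q where q: "q \<in> carrier F" "y = cl q" by (auto simp: U_carrier)
    show "act (rep (x \<otimes>\<^bsub>U\<^esub> y)) = act (rep x) \<otimes>\<^bsub>End\<^esub> act (rep y)"
    proof -
      have "act (p * q) = (\<lambda>v. act p (act q v))"
        using p by (intro linear_eqI[OF linear_act linear_compose[OF linear_act linear_act]])
          (simp add: entry_act entry_compose linear_act word_eval_rho_mult)
      then show ?thesis using p q F_closed(2) by (simp add: U_simps act_cl o_def)
    qed
    show "act (rep (x \<oplus>\<^bsub>U\<^esub> y)) = act (rep x) \<oplus>\<^bsub>End\<^esub> act (rep y)"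
    proof -
      have "act (p + q) = (\<lambda>v. act p v + act q v)"
        by (intro linear_eqI linear_act linear_add) (simp add: entry_simps entry_act)
      then show ?thesis using p q F_closed(1) by (simp add: U_simps act_cl)
    qed
  next
    have "act 1 = id"
      by (intro linear_eqI linear_act linear_id)
        (simp add: entry_act entry_id word_eval_one)
    then show "act (rep \<one>\<^bsub>U\<^esub>) = \<one>\<^bsub>End\<^esub>" by (simp add: U_simps act_cl F_closed)
  next
    fix X assume X: "X \<in> carrier End"
    have "act (gl_embed V X) = X"
    proof (intro linear_eqI linear_act)
      fix a b assume ab: "a \<in> I" "b \<in> I"
      have "entry (act (gl_embed V X)) b a = (\<Sum>d\<in>I. \<Sum>c\<in>I. if c = a then if d = b then entry X b a else 0 else 0)"
        unfolding entry_act[OF ab] word_eval_gl_embed by (intro sum.cong refl) auto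
      then show "entry (act (gl_embed V X)) b a = entry X b a" using ab by simp
    qed (use X in simp)
    then show "act (rep (gl_env V X)) = X" by (simp add: gl_env_def act_cl gl_embed_closed)
  qed
qed

lemma env_action: "is_action (env_action V)"
proof -
  have "env_action V = (SOME x. is_action x)" unfolding env_action_def is_action_def ..
  then show ?thesis using someI[of is_action, OF is_action_ex] by (simp only:)
qed

text \<open>The matrix units generate the enveloping algebra, so a homomorphism with prescribed
  values on them is determined on words, and by linearity everywhere.\<close>

lemma entry_env_action:
  assumes "p \<in> carrier F" "a \<in> I" "b \<in> I"
  shows "entry (env_action V (cl p)) b a = word_eval (\<lambda>w. rho w b a) p"
proof -
  have hom: "env_action V \<in> Ring.ring_hom U End" and sm: "\<And>c x. x \<in> carrier U ==> env_action V (c \<odot>\<^bsub>U\<^esub> x) = c \<odot>\<^bsub>End\<^esub> env_action V x"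
    and gl: "\<And>X. X \<in> carrier End ==> env_action V (gl_env V X) = X"
    using env_action by (auto simp: is_action_def alg_hom_def)
  have "entry (env_action V (wcl w)) b a = rho w b a" if "set w \<subseteq> L" "b \<in> I" for w b
    using that
  proof (induction w arbitrary: b)
    case Nil
    then show ?case using ring_hom_one[OF hom] assms(2) by (simp add: wcl_Nil entry_def co_bas)
  next
    case (Cons l w)
    obtain d c where l: "l = (d, c)" by force
    have dc: "d \<in> I" "c \<in> I" "set w \<subseteq> L" using Cons l by (auto simp: L_def)
    have "env_action V (wcl [l] \<otimes>\<^bsub>U\<^esub> wcl w) = env_action V (wcl [l]) \<otimes>\<^bsub>End\<^esub> env_action V (wcl w)"
      using Cons.prems by (intro ring_hom_mult[OF hom] wcl_closed) auto
    moreover have "env_action V (wcl [l]) = unit_matrix V d c"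
      using gl[of "unit_matrix V d c"] dc by (simp add: l linear_unit_matrix gl_env_unit_matrix)
    moreover have "wcl [l] \<otimes>\<^bsub>U\<^esub> wcl w = wcl (l # w)" using Cons.prems by (subst wcl_append) auto
    ultimately have "entry (env_action V (wcl (l # w))) b a =
        (\<Sum>e\<in>I. entry (unit_matrix V d c) b e * entry (env_action V (wcl w)) e a)"
      by (simp add: o_def entry_compose linear_unit_matrix)
    also have "\<dots> = (\<Sum>e\<in>I. if e = c then if b = d then rho w c a else 0 else 0)"
      using Cons dc by (intro sum.cong refl) (auto simp: entry_unit_matrix)
    finally show ?case using dc by (simp add: l)
  qed
  note words = this
  show ?thesis using assms(1)
  proof (induction p rule: F_induct)
    case zero
    have "env_action V (cl 0) = (\<lambda>v. 0)"
      using sm[OF cl_closed[OF F_closed(6)], of 0] unfolding U_zero_smult[OF cl_closed[OF F_closed(6)]] by simp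
    then show ?case by (simp add: entry_def)
  next
    case (single w c)
    have "cl (wsingle w c) = c \<odot>\<^bsub>U\<^esub> wcl w"
      unfolding wcl_def using U_simps(5)[OF F_closed(8)[OF single]] single_pscale[of w c 1] by simp
    then have "env_action V (cl (wsingle w c)) = (\<lambda>v. scal V c (env_action V (wcl w) v))"
      using sm[OF wcl_closed[OF single]] by simp
    then have "entry (env_action V (cl (wsingle w c))) b a = c * entry (env_action V (wcl w)) b a"
      by (simp add: entry_def co_scale)
    then show ?case using words[OF single assms(3)] by simp
  next
    case (add p q)
    have "env_action V (cl p \<oplus>\<^bsub>U\<^esub> cl q) = env_action V (cl p) \<oplus>\<^bsub>End\<^esub> env_action V (cl q)"
      using add cl_closed by (intro ring_hom_add[OF hom])
    then have "entry (env_action V (cl (p + q))) b a = entry (env_action V (cl p)) b a + entry (env_action V (cl q)) b a"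
      using add by (simp add: U_simps entry_def co_add)
    then show ?case using add by simp
  qed
qed

lemma linear_env_action: "x \<in> carrier U ==> lin (env_action V x)"
  using env_action ring_hom_closed[of "env_action V" U End x] by (auto simp: is_action_def alg_hom_def)

text \<open>A relation inserted between two words never involves the empty word.\<close>

lemma unit_word_WU: "unit_word \<in> WU"
  by (rule WU_I) (auto simp: unit_word_def word_eval_rel split: if_splits)

text \<open>A multiplicative functional that vanishes on the matrix units vanishes on every nonempty
  word.\<close>

lemma counit_eq: "counit V = ofw unit_word"
  unfolding counit_def Let_def
proof (rule the_equality)
  have "word_eval unit_word (p * q) = word_eval unit_word p * word_eval unit_word q" for p q :: "'i gword \<Rightarrow>\<^sub>0 complex"
  proof -
    have "unit_word (u @ v) = unit_word u * unit_word v" for u v :: "'i gword"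
      by (simp add: unit_word_def)
    then show ?thesis
      by (simp add: word_eval_mult word_eval_fun_scale mult.commute[of _ "word_eval _ q"])
  qed
  moreover have "ofw unit_word \<one>\<^bsub>U\<^esub> = 1"
    unfolding U_simps ofw_cl[OF unit_word_WU F_closed(7)] by (simp add: word_eval_one unit_word_def)
  moreover have "ofw unit_word (gl_env V X) = 0" for X
    unfolding gl_env_def ofw_cl[OF unit_word_WU gl_embed_closed] word_eval_gl_embed by (simp add: unit_word_def)
  ultimately show "ofw unit_word \<in> Udual \<and> ofw unit_word \<one>\<^bsub>U\<^esub> = 1 \<and>
      (\<forall>x\<in>carrier U. \<forall>y\<in>carrier U. ofw unit_word (x \<otimes>\<^bsub>U\<^esub> y) = ofw unit_word x * ofw unit_word y) \<and>
      (\<forall>X\<in>carrier End. ofw unit_word (gl_env V X) = 0)"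
    unfolding U_carrier by (auto simp: ofw_dual unit_word_WU U_simps ofw_cl F_closed)
next
  fix e assume e: "e \<in> Udual \<and> e \<one>\<^bsub>U\<^esub> = 1 \<and>
      (\<forall>x\<in>carrier U. \<forall>y\<in>carrier U. e (x \<otimes>\<^bsub>U\<^esub> y) = e x * e y) \<and> (\<forall>X\<in>carrier End. e (gl_env V X) = 0)"
  have "wf e w = unit_word w" for w
  proof (cases "set w \<subseteq> L")
    case False
    then show ?thesis using wf_WU[of e] e by (auto simp: WU_def unit_word_def)
  next
    case True
    then show ?thesis
    proof (cases w)
      case Nil
      then show ?thesis using e by (simp add: wf_def wcl_Nil unit_word_def)
    next
      case (Cons l v)
      obtain d c where l: "l = (d, c)" by force
      have dc: "d \<in> I" "c \<in> I" using True Cons l by (auto simp: L_def)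
      have "e (wcl [l]) = 0" using e gl_env_unit_matrix[OF dc(2,1)] linear_unit_matrix l
        by (metis End_simps(1) mem_Collect_eq)
      moreover have "wcl w = wcl [l] \<otimes>\<^bsub>U\<^esub> wcl v" using True Cons by (subst wcl_append) auto
      moreover have "wcl [l] \<in> carrier U" "wcl v \<in> carrier U" using True Cons by (auto intro!: wcl_closed)
      ultimately show ?thesis using e Cons by (simp add: wf_def unit_word_def)
    qed
  qed
  then show "e = ofw unit_word"
    using e by (intro dual_eqI) (auto simp: ofw_dual unit_word_WU wf_ofw)
qed

section \<open>The coproduct on words and its descent to the quotient\<close>

abbreviation "UU \<equiv> tensor_alg (fac V) U U"
abbreviation "bil \<equiv> bilinear_forms U U"

sublocale UU: graded_algebra_pair U prU U prU ..

definition cop :: "('i gword \<Rightarrow>\<^sub>0 complex) => ('i env, 'i env) tensor" where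
  "cop p = (\<lambda>\<beta>. if \<beta> \<in> bil then word_eval (split_sum word_fac (\<lambda>u v. \<beta> (wcl u) (wcl v))) p else 0)"

lemma UU_closed:
  "(\<lambda>_. 0) \<in> carrier UU" "x \<in> carrier UU ==> y \<in> carrier UU ==> (\<lambda>\<beta>. x \<beta> + y \<beta>) \<in> carrier UU"
  "x \<in> carrier UU ==> (\<lambda>\<beta>. c * x \<beta>) \<in> carrier UU"
  unfolding tensor_carrier using fscale.span_zero fscale.span_add[of x _ y] fscale.span_scale[of x _ c]
  by (simp_all add: zero_fun_def plus_fun_def)

lemma split_sum_tensor_closed:
  assumes "\<And>u v. set u \<subseteq> L ==> set v \<subseteq> L ==> T u v \<in> carrier UU" "set w \<subseteq> L"
  shows "(\<lambda>\<beta>. split_sum word_fac (\<lambda>u v. T u v \<beta>) w) \<in> carrier UU"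
  using assms
proof (induction w arbitrary: T)
  case (Cons l w)
  have "(\<lambda>\<beta>. split_sum word_fac (\<lambda>u v. T (l # u) v \<beta>) w) \<in> carrier UU"
    using Cons.prems by (intro Cons.IH) auto
  moreover have "(\<lambda>\<beta>. split_sum word_fac (\<lambda>u v. word_fac [l] u * T u (l # v) \<beta>) w) \<in> carrier UU"
    using Cons.prems by (intro Cons.IH[of "\<lambda>u v \<beta>. word_fac [l] u * T u (l # v) \<beta>"] UU_closed) auto
  ultimately show ?case unfolding split_sum.simps by (rule UU_closed(2))
qed simp

lemma cop_closed: "p \<in> carrier F ==> cop p \<in> carrier UU"
proof (induction p rule: F_induct)
  case (single w c)
  have "(\<lambda>\<beta>. c * split_sum word_fac (\<lambda>u v. tens U U (wcl u) (wcl v) \<beta>) w) \<in> carrier UU"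
    using single wcl_closed
    by (intro UU_closed(3) split_sum_tensor_closed) (auto simp: tensor_carrier intro!: fscale.span_base)
  moreover have "cop (wsingle w c) = (\<lambda>\<beta>. c * split_sum word_fac (\<lambda>u v. tens U U (wcl u) (wcl v) \<beta>) w)"
    by (auto simp: cop_def tens_def split_sum_zero)
  ultimately show ?case by simp
next
  case (add p q)
  have "cop (p + q) = (\<lambda>\<beta>. cop p \<beta> + cop q \<beta>)" by (auto simp: cop_def)
  then show ?case using add UU_closed(2) by simp
qed (auto simp: cop_def[abs_def] UU_closed cong: if_cong)

text \<open>\<open>split_sum_append\<close> read in the tensor square: the factor
  \<open>word_fac v u'\<close> paid there for exchanging the middle words is the twist in the
  product of homogeneous tensors.\<close>

lemma cop_mult:
  assumes p: "p \<in> carrier F" and q: "q \<in> carrier F"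
  shows "cop (p * q) = tensor_mult (fac V) U U (cop p) (cop q)"
proof
  fix \<beta>
  show "cop (p * q) \<beta> = tensor_mult (fac V) U U (cop p) (cop q) \<beta>"
  proof (cases "\<beta> \<in> bil")
    case \<beta>: True
    let ?m = "mult_form (fac V) U U \<beta>"
    have m: "?m (wcl u) (wcl v) (wcl u') (wcl v') = word_fac v u' * \<beta> (wcl (u @ u')) (wcl (v @ v'))"
      if "set u \<subseteq> L" "set v \<subseteq> L" "set u' \<subseteq> L" "set v' \<subseteq> L" for u v u' v'
      using UU.mult_form_homogeneous[OF \<beta> wcl_closed[OF that(1)] wcl_hpart[OF that(3)] wcl_hpart[OF that(2)]
          wcl_closed[OF that(4)], of "fac V"] that
      by (simp add: word_fac_def wcl_append)
    have in1: "split_sum word_fac (\<lambda>u' v'. ?m (wcl u) (wcl v) (wcl u') (wcl v')) y =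
        split_sum word_fac (\<lambda>u' v'. word_fac v u' * \<beta> (wcl (u @ u')) (wcl (v @ v'))) y"
      if "set u \<subseteq> L" "set v \<subseteq> L" "set y \<subseteq> L" for u v y
      using that by (intro split_sum_cong_set m) auto
    have in2: "cop q (?m (wcl u) (wcl v)) = word_eval (split_sum word_fac
        (\<lambda>u' v'. word_fac v u' * \<beta> (wcl (u @ u')) (wcl (v @ v')))) q"
      if "set u \<subseteq> L" "set v \<subseteq> L" for u v
      using UU.mult_form_bilinear[OF \<beta> wcl_closed[OF that(1)] wcl_closed[OF that(2)], of "fac V"] q in1[OF that]
      by (simp add: cop_def) (intro word_eval_cong, auto simp: F_carrier)
    have "tensor_mult (fac V) U U (cop p) (cop q) \<beta> = cop p (\<lambda>a b. cop q (?m a b))"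
      using \<beta> by (simp add: tensor_mult_eq)
    also have "\<dots> = word_eval (split_sum word_fac (\<lambda>u v. cop q (?m (wcl u) (wcl v)))) p"
      using UU.mult_form_eval_bilinear[OF \<beta> cop_closed[OF q]] by (simp add: cop_def)
    also have "\<dots> = word_eval (\<lambda>x. word_eval (\<lambda>y. split_sum word_fac (\<lambda>u v. \<beta> (wcl u) (wcl v)) (x @ y)) q) p"
    proof (rule word_eval_cong)
      fix x assume "x \<in> wkeys p"
      then have x: "set x \<subseteq> L" using p by (simp add: F_carrier)
      have "split_sum word_fac (\<lambda>u v. cop q (?m (wcl u) (wcl v))) x =
          split_sum word_fac (\<lambda>u v. word_eval (split_sum word_fac
            (\<lambda>u' v'. word_fac v u' * \<beta> (wcl (u @ u')) (wcl (v @ v')))) q) x"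
        using x by (intro split_sum_cong_set in2) auto
      also have "\<dots> = word_eval (\<lambda>y. split_sum word_fac (\<lambda>u v. split_sum word_fac
            (\<lambda>u' v'. word_fac v u' * \<beta> (wcl (u @ u')) (wcl (v @ v'))) y) x) q"
        unfolding word_eval_def split_sum_sum split_sum_scale ..
      finally show "split_sum word_fac (\<lambda>u v. cop q (?m (wcl u) (wcl v))) x =
          word_eval (\<lambda>y. split_sum word_fac (\<lambda>u v. \<beta> (wcl u) (wcl v)) (x @ y)) q"
        by (simp add: wk.split_sum_append)
    qed
    finally show ?thesis using \<beta> by (simp add: cop_def word_eval_mult)
  qed (simp add: cop_def tensor_mult_eq)
qed

lemma word_eval_bil:
  assumes "\<beta> \<in> bil" "p \<in> carrier F" "x \<in> carrier U"
  shows "word_eval (\<lambda>w. \<beta> (wcl w) x) p = \<beta> (cl p) x" "word_eval (\<lambda>w. \<beta> x (wcl w)) p = \<beta> x (cl p)"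
  using linear_functional_cl[OF bilinear_formsD(1)[OF assms(1,3)] assms(2)]
    linear_functional_cl[OF bilinear_formsD(2)[OF assms(1,3)] assms(2)] by simp_all

lemma split_sum_short:
  "split_sum word_fac B [l] = B [l] [] + B [] [l]"
  "split_sum word_fac B [l, l'] = B [l, l'] [] + B [l] [l'] + word_fac [l] [l'] * B [l'] [l] + B [] [l, l']"
  by (simp_all add: split_sum.simps)

lemma bil_zero:
  assumes "\<beta> \<in> bil" "x \<in> carrier U"
  shows "\<beta> (cl 0) x = 0" "\<beta> x (cl 0) = 0"
  using U.linear_functional_zero[OF bilinear_formsD(1)[OF assms]] U.linear_functional_zero[OF bilinear_formsD(2)[OF assms]]
  by (simp_all add: U_simps)

text \<open>Relations are primitive: when the splittings of the two-letter words are written out,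
  the mixed terms cancel because \<omega> and its transpose are inverse to each other. What remains
  is the class of the relation in either factor, and it is zero.\<close>

lemma cop_rel:
  assumes I: "a \<in> I" "b \<in> I" "c \<in> I" "d \<in> I"
  shows "cop (rel b a d c) = (\<lambda>_. 0)"
proof
  fix \<beta>
  show "cop (rel b a d c) \<beta> = 0"
  proof (cases "\<beta> \<in> bil")
    case \<beta>: True
    have 1: "wcl [] \<in> carrier U" by (rule wcl_closed) simp
    have z: "cl (rel b a d c) = cl 0"
      using rel_J[OF I] rel_closed[OF I] F_closed(6) by (simp add: cl_eq_iff)
    let ?k = "\<omega> (\<gamma> b - \<gamma> a) (\<gamma> d - \<gamma> c)" and ?k' = "\<omega> (\<gamma> d - \<gamma> c) (\<gamma> b - \<gamma> a)"
    have k: "?k * (?k' * x) = x" for x using fac_swap[of "\<gamma> b - \<gamma> a" "\<gamma> d - \<gamma> c"] by (simp add: mult.assoc[symmetric])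
    have "cop (rel b a d c) \<beta> = word_eval (\<lambda>w. \<beta> (wcl w) (wcl [])) (rel b a d c) + word_eval (\<lambda>w. \<beta> (wcl []) (wcl w)) (rel b a d c)"
      using \<beta> by (simp add: cop_def word_eval_rel split_sum_short word_fac_def algebra_simps k fac_swap)
    also have "\<dots> = 0"
      unfolding word_eval_bil[OF \<beta> rel_closed[OF I] 1] z using bil_zero[OF \<beta> 1] by simp
    finally show ?thesis .
  qed (simp add: cop_def)
qed

lemma cop_add: "cop (p + q) = (\<lambda>\<beta>. cop p \<beta> + cop q \<beta>)"
  by (auto simp: cop_def)

lemma cop_pscale: "cop (pscale c p) = (\<lambda>\<beta>. c * cop p \<beta>)"
  by (auto simp: cop_def)

lemma cop_J: "p \<in> J ==> cop p \<beta> = 0"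
proof -
  assume p: "p \<in> J"
  have zl: "tensor_mult (fac V) U U (\<lambda>_. 0) z = (\<lambda>_. 0)" for z by (auto simp: tensor_mult_eq)
  have "cop p \<beta> \<in> {0}"
  proof (rule J_test[OF _ _ _ _ _ p, where G = "\<lambda>p. cop p \<beta>" and Z = "{0}"])
    fix x y k a b c d assume xy: "set x \<subseteq> L" "set y \<subseteq> L" and I: "a \<in> I" "b \<in> I" "c \<in> I" "d \<in> I"
    have x: "wsingle x k \<in> carrier F" "wsingle y (1::complex) \<in> carrier F"
      using xy by (auto intro: F_closed)
    have "cop (wsingle x k * rel b a d c) = (\<lambda>_. 0)"
      unfolding cop_mult[OF x(1) rel_closed[OF I]] cop_rel[OF I]
      by (auto simp: tensor_mult_eq cop_def split_sum_zero)
    then have "cop (wsingle x k * rel b a d c * wsingle y 1) = (\<lambda>_. 0)"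
      using cop_mult[OF F_closed(2)[OF x(1) rel_closed[OF I]] x(2)] zl by simp
    then show "cop (wsingle x k * rel b a d c * wsingle y 1) \<beta> \<in> {0}" by simp
  qed (auto simp: cop_add, simp add: cop_def)
  then show ?thesis by simp
qed

definition is_coproduct :: "('i env => ('i env, 'i env) tensor) => bool" where
  "is_coproduct \<Delta> \<longleftrightarrow> \<Delta> \<in> alg_hom U UU \<and>
       (\<forall>X\<in>carrier End.
          \<Delta> (gl_env V X) = tens U U (gl_env V X) \<one>\<^bsub>U\<^esub> \<oplus>\<^bsub>UU\<^esub> tens U U \<one>\<^bsub>U\<^esub> (gl_env V X))"

lemma UU_simps: "mult UU = tensor_mult (fac V) U U" "one UU = tens U U \<one>\<^bsub>U\<^esub> \<one>\<^bsub>U\<^esub>"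
  "add UU = (\<lambda>x y \<beta>. x \<beta> + y \<beta>)" "module.smult UU = (\<lambda>c x \<beta>. c * x \<beta>)"
  by (simp_all add: tensor_alg_def)

lemma cop_cl: "p \<in> carrier F ==> cop (rep (cl p)) = cop p"
proof
  fix \<beta> assume p: "p \<in> carrier F"
  have "cop (rep (cl p)) \<beta> = cop (p + (rep (cl p) - p)) \<beta>" by simp
  also have "\<dots> = cop p \<beta>" unfolding cop_add using cop_J[OF rep_cl_J[OF p], of \<beta>] by simp
  finally show "cop (rep (cl p)) \<beta> = cop p \<beta>" .
qed

lemma cop_one: "cop 1 = tens U U \<one>\<^bsub>U\<^esub> \<one>\<^bsub>U\<^esub>"
  by (auto simp: cop_def tens_def wcl_Nil word_eval_one)

lemma cop_gl_embed: "cop (gl_embed V X) = (\<lambda>\<beta>. tens U U (gl_env V X) \<one>\<^bsub>U\<^esub> \<beta> + tens U U \<one>\<^bsub>U\<^esub> (gl_env V X) \<beta>)"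
proof
  fix \<beta>
  show "cop (gl_embed V X) \<beta> = tens U U (gl_env V X) \<one>\<^bsub>U\<^esub> \<beta> + tens U U \<one>\<^bsub>U\<^esub> (gl_env V X) \<beta>"
  proof (cases "\<beta> \<in> bil")
    case \<beta>: True
    have 1: "wcl [] \<in> carrier U" by (rule wcl_closed) simp
    have "cop (gl_embed V X) \<beta> = word_eval (\<lambda>w. \<beta> (wcl w) (wcl [])) (gl_embed V X) + word_eval (\<lambda>w. \<beta> (wcl []) (wcl w)) (gl_embed V X)"
      using \<beta> by (simp add: cop_def word_eval_gl_embed split_sum_short distrib_left sum.distrib)
    then show ?thesis
      unfolding word_eval_bil[OF \<beta> gl_embed_closed 1] using \<beta> by (simp add: tens_def gl_env_def wcl_Nil)
  qed (simp add: cop_def tens_def)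
qed

lemma is_coproduct_ex: "is_coproduct (\<lambda>x. cop (rep x))"
  unfolding is_coproduct_def alg_hom_def
proof (intro conjI CollectI ballI allI ring_hom_memI)
  fix x assume "x \<in> carrier U"
  then obtain p where p: "p \<in> carrier F" "x = cl p" by (auto simp: U_carrier)
  show "cop (rep x) \<in> carrier UU" using p by (simp add: cop_cl cop_closed)
  show "cop (rep (c \<odot>\<^bsub>U\<^esub> x)) = c \<odot>\<^bsub>UU\<^esub> cop (rep x)" for c
    using p F_closed(5) by (simp add: U_simps cop_cl UU_simps cop_pscale)
  fix y assume "y \<in> carrier U"
  then obtain q where q: "q \<in> carrier F" "y = cl q" by (auto simp: U_carrier)
  show "cop (rep (x \<otimes>\<^bsub>U\<^esub> y)) = cop (rep x) \<otimes>\<^bsub>UU\<^esub> cop (rep y)"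
    using p q F_closed(2) by (simp add: U_simps cop_cl UU_simps cop_mult)
  show "cop (rep (x \<oplus>\<^bsub>U\<^esub> y)) = cop (rep x) \<oplus>\<^bsub>UU\<^esub> cop (rep y)"
    using p q F_closed(1) by (simp add: U_simps cop_cl UU_simps cop_add)
next
  show "cop (rep \<one>\<^bsub>U\<^esub>) = \<one>\<^bsub>UU\<^esub>" by (simp add: U_simps(3) cop_cl F_closed UU_simps) (simp add: cop_one U_simps(3))
  show "cop (rep (gl_env V X)) = tens U U (gl_env V X) \<one>\<^bsub>U\<^esub> \<oplus>\<^bsub>UU\<^esub> tens U U \<one>\<^bsub>U\<^esub> (gl_env V X)" for X
    using cop_gl_embed[of X] cop_cl[OF gl_embed_closed, of X] by (simp add: gl_env_def UU_simps)
qed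

lemma coproduct: "is_coproduct (coproduct V)"
proof -
  have "coproduct V = (SOME x. is_coproduct x)" unfolding coproduct_def is_coproduct_def Let_def ..
  then show ?thesis using someI[of is_coproduct, OF is_coproduct_ex] by (simp only:)
qed

lemma coproduct_cl:
  assumes "p \<in> carrier F"
  shows "coproduct V (cl p) = cop p"
proof -
  have hom: "coproduct V \<in> Ring.ring_hom U UU" and sm: "\<And>c x. x \<in> carrier U ==> coproduct V (c \<odot>\<^bsub>U\<^esub> x) = c \<odot>\<^bsub>UU\<^esub> coproduct V x"
    and gl: "\<And>X. X \<in> carrier End ==> coproduct V (gl_env V X) = cop (gl_embed V X)"
    using coproduct by (auto simp: is_coproduct_def alg_hom_def cop_gl_embed UU_simps)
  have words: "coproduct V (wcl w) = cop (wsingle w 1)" if "set w \<subseteq> L" for w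
    using that
  proof (induction w)
    case Nil
    then show ?case using ring_hom_one[OF hom] cop_one
      by (simp add: wcl_Nil UU_simps single_Nil)
  next
    case (Cons l w)
    obtain d c where l: "l = (d, c)" by force
    have dc: "d \<in> I" "c \<in> I" "set w \<subseteq> L" "set [l] \<subseteq> L" using Cons l by (auto simp: L_def)
    have "coproduct V (wcl [l] \<otimes>\<^bsub>U\<^esub> wcl w) = coproduct V (wcl [l]) \<otimes>\<^bsub>UU\<^esub> coproduct V (wcl w)"
      using dc by (intro ring_hom_mult[OF hom] wcl_closed)
    moreover have "coproduct V (wcl [l]) = cop (wsingle [l] 1)"
      using gl[of "unit_matrix V d c"] dc by (simp add: l linear_unit_matrix gl_env_unit_matrix gl_embed_unit_matrix)
    moreover have "wcl [l] \<otimes>\<^bsub>U\<^esub> wcl w = wcl (l # w)" using dc by (subst wcl_append) auto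
    ultimately have "coproduct V (wcl (l # w)) = cop (wsingle [l] 1 * wsingle w 1)"
      using Cons.IH[OF dc(3)] cop_mult[OF F_closed(8)[OF dc(4)] F_closed(8)[OF dc(3)]] by (simp add: UU_simps)
    then show ?case by (simp add: mult_single plus_list_def)
  qed
  show ?thesis using assms
  proof (induction p rule: F_induct)
    case zero
    have "coproduct V (cl 0) = (\<lambda>\<beta>. 0)"
      using sm[OF cl_closed[OF F_closed(6)], of 0] unfolding U_zero_smult[OF cl_closed[OF F_closed(6)]] by (simp add: UU_simps)
    then show ?case by (auto simp: cop_def)
  next
    case (single w c)
    have "cl (wsingle w c) = c \<odot>\<^bsub>U\<^esub> wcl w"
      unfolding wcl_def using U_simps(5)[OF F_closed(8)[OF single]] single_pscale[of w c 1] by simp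
    then show ?case using sm[OF wcl_closed[OF single]] words[OF single] by (auto simp: UU_simps cop_def)
  next
    case (add p q)
    have "coproduct V (cl p \<oplus>\<^bsub>U\<^esub> cl q) = coproduct V (cl p) \<oplus>\<^bsub>UU\<^esub> coproduct V (cl q)"
      using add cl_closed by (intro ring_hom_add[OF hom])
    then show ?case using add by (simp add: U_simps UU_simps cop_add)
  qed
qed

text \<open>The scalar of the antipode on a word: a sign for each letter, and a commutation factor
  for each pair, since reversal makes every letter pass all later ones.\<close>

fun anti :: "'i gfun" where
  "anti [] = 1"
| "anti (l # w) = - word_fac [l] w * anti w"

lemma anti_append: "anti (u @ v) = word_fac u v * anti u * anti v"
  by (induction u) (simp_all add: wk.k_Cons_left wk.k_letter_left_append)

definition antipode_poly :: "('i gword \<Rightarrow>\<^sub>0 complex) => 'i gword \<Rightarrow>\<^sub>0 complex" where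
  "antipode_poly p = (\<Sum>w\<in>wkeys p. wsingle (rev w) (wlookup p w * anti w))"

lemma word_eval_antipode_poly: "word_eval \<phi> (antipode_poly p) = word_eval (\<lambda>w. anti w * \<phi> (rev w)) p"
  unfolding antipode_poly_def word_eval_sum word_eval_def[of _ p] by (simp add: mult.assoc)

lemma antipode_poly_closed: "p \<in> carrier F ==> antipode_poly p \<in> carrier F"
  unfolding antipode_poly_def by (intro F_sum_closed F_closed) (auto simp: F_carrier)

lemma antipode_poly_add: "antipode_poly (p + q) = antipode_poly p + antipode_poly q"
  by (rule poly_word_eval_eqI) (simp add: word_eval_antipode_poly)

lemma antipode_poly_zero: "antipode_poly 0 = 0"
  by (simp add: antipode_poly_def)

lemma antipode_poly_pscale: "antipode_poly (pscale c p) = pscale c (antipode_poly p)"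
  by (rule poly_word_eval_eqI) (simp add: word_eval_antipode_poly)

lemma antipode_poly_mult:
  assumes "p \<in> hpart F \<alpha>" "q \<in> hpart F \<beta>"
  shows "antipode_poly (p * q) = pscale (\<omega> \<alpha> \<beta>) (antipode_poly q * antipode_poly p)"
proof (rule poly_word_eval_eqI)
  fix \<phi> :: "'i gfun"
  have "word_eval \<phi> (antipode_poly (p * q)) =
      word_eval (\<lambda>u. word_eval (\<lambda>v. anti (u @ v) * \<phi> (rev v @ rev u)) q) p"
    by (simp add: word_eval_antipode_poly word_eval_mult)
  also have "\<dots> = word_eval (\<lambda>u. word_eval (\<lambda>v. \<omega> \<alpha> \<beta> * (anti u * (anti v * \<phi> (rev v @ rev u)))) q) p"
    using assms by (intro word_eval_cong) (auto simp: F_hpart anti_append word_fac_def)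
  also have "\<dots> = \<omega> \<alpha> \<beta> * (\<Sum>u\<in>wkeys p. \<Sum>v\<in>wkeys q. wlookup p u *
     (wlookup q v * (anti u * (anti v * \<phi> (rev v @ rev u)))))"
    unfolding word_eval_def by (simp add: sum_distrib_left mult_ac)
  also have "\<dots> = \<omega> \<alpha> \<beta> * (\<Sum>v\<in>wkeys q. \<Sum>u\<in>wkeys p. wlookup p u *
     (wlookup q v * (anti u * (anti v * \<phi> (rev v @ rev u)))))"
    by (subst sum.swap) (rule refl)
  also have "\<dots> = word_eval \<phi> (pscale (\<omega> \<alpha> \<beta>) (antipode_poly q * antipode_poly p))"
    unfolding word_eval_pscale word_eval_mult word_eval_antipode_poly
    unfolding word_eval_def by (simp add: sum_distrib_left mult_ac)
  finally show "word_eval \<phi> (antipode_poly (p * q)) = \<dots>" .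
qed

text \<open>Reversal exchanges the two quadratic terms, with coefficients that match because the
  factors \<omega> cancel, and the linear terms change sign. Thus relations go to their negatives
  and the ideal is preserved.\<close>

lemma antipode_poly_rel: "antipode_poly (rel b a d c) = - rel b a d c"
proof (rule poly_word_eval_eqI)
  fix \<phi> :: "'i gfun"
  have k: "\<omega> (\<gamma> b - \<gamma> a) (\<gamma> d - \<gamma> c) * (\<omega> (\<gamma> d - \<gamma> c) (\<gamma> b - \<gamma> a) * x) = x" for x
    using fac_swap[of "\<gamma> b - \<gamma> a" "\<gamma> d - \<gamma> c"] by (simp add: mult.assoc[symmetric])
  show "word_eval \<phi> (antipode_poly (rel b a d c)) = word_eval \<phi> (- rel b a d c)"
    by (simp add: word_eval_antipode_poly word_eval_rel word_fac_def k)
qed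

lemma antipode_poly_J: "p \<in> J ==> antipode_poly p \<in> J"
proof (rule J_test[of antipode_poly J])
  fix x y a b c d and k :: complex
  assume xy: "set x \<subseteq> L" "set y \<subseteq> L" and I: "a \<in> I" "b \<in> I" "c \<in> I" "d \<in> I"
  let ?r = "rel b a d c" and ?x = "wsingle x k" and ?y = "wsingle y 1 :: 'i gword \<Rightarrow>\<^sub>0 complex"
  have x: "?x \<in> hpart F (dg x)" "?y \<in> hpart F (dg y)" using xy by (auto simp: F_hpart)
  have r: "?r \<in> hpart F (\<gamma> b - \<gamma> a + (\<gamma> d - \<gamma> c))"
  proof -
    have "?r = comp (\<gamma> b - \<gamma> a + (\<gamma> d - \<gamma> c)) ?r"
      using rel_hom[of "\<gamma> b - \<gamma> a + (\<gamma> d - \<gamma> c)" "[]" 1 b a d c "[]"] by (simp add: single_Nil)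
    then show ?thesis using comp_hpart[OF rel_closed[OF I]] by metis
  qed
  have xr: "?x * ?r \<in> hpart F (dg x + (\<gamma> b - \<gamma> a + (\<gamma> d - \<gamma> c)))"
  proof -
    have "?x * ?r = comp (dg x + (\<gamma> b - \<gamma> a + (\<gamma> d - \<gamma> c))) (?x * ?r)"
      using rel_hom[of "dg x + (\<gamma> b - \<gamma> a + (\<gamma> d - \<gamma> c))" x k b a d c "[]"] by (simp add: single_Nil)
    moreover have "?x * ?r \<in> carrier F" using xy I by (intro F_closed rel_closed)
    ultimately show ?thesis using comp_hpart by metis
  qed
  have neg: "- ?r \<in> J" using J_mult(1)[OF rel_J[OF I], of "- 1"] F_closed(3)[OF F_closed(7)] by simp
  have J_pscale: "pscale c p \<in> J" if "p \<in> J" for c p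
    using J_mult(1)[OF that F_closed(5)[OF F_closed(7)], of c] by (simp add: pscale_mult)
  have cx: "antipode_poly ?x \<in> carrier F" "antipode_poly ?y \<in> carrier F"
    using x hpart_carrier_F antipode_poly_closed by blast+
  have "antipode_poly (?x * ?r) \<in> J"
    unfolding antipode_poly_mult[OF x(1) r] antipode_poly_rel using neg cx by (intro J_pscale J_mult)
  then show "antipode_poly (?x * ?r * ?y) \<in> J"
    unfolding antipode_poly_mult[OF xr x(2)] using cx by (intro J_pscale J_mult)
qed (simp_all add: antipode_poly_add antipode_poly_zero J_zero J_add)

definition is_antipode :: "('i env => 'i env) => bool" where
  "is_antipode S \<longleftrightarrow> S \<in> carrier U \<rightarrow> carrier U \<and> S \<one>\<^bsub>U\<^esub> = \<one>\<^bsub>U\<^esub> \<and>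
       (\<forall>x\<in>carrier U. \<forall>y\<in>carrier U. S (x \<oplus>\<^bsub>U\<^esub> y) = S x \<oplus>\<^bsub>U\<^esub> S y) \<and>
       (\<forall>c. \<forall>x\<in>carrier U. S (c \<odot>\<^bsub>U\<^esub> x) = c \<odot>\<^bsub>U\<^esub> S x) \<and>
       (\<forall>X\<in>carrier End. S (gl_env V X) = \<ominus>\<^bsub>U\<^esub> gl_env V X) \<and>
       (\<forall>\<alpha> \<beta>. \<forall>x\<in>hpart U \<alpha>. \<forall>y\<in>hpart U \<beta>.
          S (x \<otimes>\<^bsub>U\<^esub> y) = fac V \<alpha> \<beta> \<odot>\<^bsub>U\<^esub> (S y \<otimes>\<^bsub>U\<^esub> S x))"

lemma is_antipode_ex: "is_antipode (\<lambda>x. cl (antipode_poly (rep x)))"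
proof -
  have S_cl: "cl (antipode_poly (rep (cl p))) = cl (antipode_poly p)" if "p \<in> carrier F" for p
  proof -
    have "antipode_poly (rep (cl p)) = antipode_poly (rep (cl p) - p) + antipode_poly p"
      by (simp flip: antipode_poly_add)
    then show ?thesis using antipode_poly_J[OF rep_cl_J[OF that]] that rep[OF cl_closed[OF that]]
      by (subst cl_eq_iff) (auto intro: antipode_poly_closed F_closed(1) J_carrier)
  qed
  show ?thesis unfolding is_antipode_def
  proof (intro conjI ballI allI Pi_I)
    fix x assume "x \<in> carrier U"
    then obtain p where p: "p \<in> carrier F" "x = cl p" by (auto simp: U_carrier)
    show "cl (antipode_poly (rep x)) \<in> carrier U" using p by (simp add: S_cl cl_closed antipode_poly_closed)
    show "cl (antipode_poly (rep (c \<odot>\<^bsub>U\<^esub> x))) = c \<odot>\<^bsub>U\<^esub> cl (antipode_poly (rep x))" for c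
      using p F_closed(5) by (simp add: U_simps S_cl antipode_poly_pscale antipode_poly_closed)
    fix y assume "y \<in> carrier U"
    then obtain q where q: "q \<in> carrier F" "y = cl q" by (auto simp: U_carrier)
    show "cl (antipode_poly (rep (x \<oplus>\<^bsub>U\<^esub> y))) = cl (antipode_poly (rep x)) \<oplus>\<^bsub>U\<^esub> cl (antipode_poly (rep y))"
      using p q F_closed(1) by (simp add: U_simps S_cl antipode_poly_add antipode_poly_closed)
  next
    have "antipode_poly 1 = 1"
      by (rule poly_word_eval_eqI) (simp add: word_eval_antipode_poly word_eval_one)
    then show "cl (antipode_poly (rep \<one>\<^bsub>U\<^esub>)) = \<one>\<^bsub>U\<^esub>" by (simp add: U_simps S_cl F_closed)
  next
    fix X
    have "antipode_poly (gl_embed V X) = - gl_embed V X"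
      by (rule poly_word_eval_eqI) (simp add: word_eval_antipode_poly word_eval_gl_embed sum_negf)
    then show "cl (antipode_poly (rep (gl_env V X))) = \<ominus>\<^bsub>U\<^esub> gl_env V X"
      by (simp add: gl_env_def S_cl gl_embed_closed cl_neg)
  next
    fix \<alpha> \<beta> x y assume "x \<in> hpart U \<alpha>" "y \<in> hpart U \<beta>"
    then obtain p q where p: "p \<in> hpart F \<alpha>" "x = cl p" and q: "q \<in> hpart F \<beta>" "y = cl q"
      by (auto simp: hpartU_iff)
    note c = hpart_carrier_F[OF p(1)] hpart_carrier_F[OF q(1)]
    show "cl (antipode_poly (rep (x \<otimes>\<^bsub>U\<^esub> y))) =
       fac V \<alpha> \<beta> \<odot>\<^bsub>U\<^esub> (cl (antipode_poly (rep y)) \<otimes>\<^bsub>U\<^esub> cl (antipode_poly (rep x)))"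
      unfolding p(2) q(2) using c F_closed(2)[OF c] F_closed(2)[OF antipode_poly_closed[OF c(2)] antipode_poly_closed[OF c(1)]]
      by (simp add: U_simps S_cl antipode_poly_mult[OF p(1) q(1)] antipode_poly_closed)
  qed
qed

lemma antipode: "is_antipode (antipode V)"
proof -
  have "antipode V = (SOME x. is_antipode x)" unfolding antipode_def is_antipode_def Let_def ..
  then show ?thesis using someI[of is_antipode, OF is_antipode_ex] by (simp only:)
qed

lemma antipode_cl:
  assumes "p \<in> carrier F"
  shows "antipode V (cl p) = cl (antipode_poly p)"
proof -
  note S = antipode[unfolded is_antipode_def]
  have S1: "antipode V \<one>\<^bsub>U\<^esub> = \<one>\<^bsub>U\<^esub>" using S by blast
  have Sadd: "antipode V (x \<oplus>\<^bsub>U\<^esub> y) = antipode V x \<oplus>\<^bsub>U\<^esub> antipode V y" if "x \<in> carrier U" "y \<in> carrier U" for x y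
    using S that by blast
  have Ssm: "antipode V (c \<odot>\<^bsub>U\<^esub> x) = c \<odot>\<^bsub>U\<^esub> antipode V x" if "x \<in> carrier U" for x c
    using S that by blast
  have Sgl: "antipode V (gl_env V X) = \<ominus>\<^bsub>U\<^esub> gl_env V X" if "X \<in> carrier End" for X
    using S that by blast
  have Smult: "antipode V (x \<otimes>\<^bsub>U\<^esub> y) = fac V \<alpha> \<beta> \<odot>\<^bsub>U\<^esub> (antipode V y \<otimes>\<^bsub>U\<^esub> antipode V x)"
    if "x \<in> hpart U \<alpha>" "y \<in> hpart U \<beta>" for x y \<alpha> \<beta>
    using S that by blast
  have words: "antipode V (wcl w) = cl (wsingle (rev w) (anti w))" if "set w \<subseteq> L" for w
    using that
  proof (induction w)
    case Nil
    then show ?case using S1 by (simp add: wcl_Nil U_simps single_Nil)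
  next
    case (Cons l w)
    obtain d c where l: "l = (d, c)" by force
    have dc: "d \<in> I" "c \<in> I" "set w \<subseteq> L" "set [l] \<subseteq> L" "set (rev w) \<subseteq> L" using Cons l by (auto simp: L_def)
    have "antipode V (wcl [l] \<otimes>\<^bsub>U\<^esub> wcl w) = fac V (dg [l]) (dg w) \<odot>\<^bsub>U\<^esub> (antipode V (wcl w) \<otimes>\<^bsub>U\<^esub> antipode V (wcl [l]))"
      using dc by (intro Smult wcl_hpart)
    moreover have "antipode V (wcl [l]) = cl (wsingle [l] (- 1))"
      using Sgl[of "unit_matrix V d c"] dc cl_neg[OF F_closed(8)[OF dc(4)], of 1] 
      by (simp add: l linear_unit_matrix gl_env_unit_matrix wcl_def single_uminus)
    moreover have "wcl [l] \<otimes>\<^bsub>U\<^esub> wcl w = wcl (l # w)" using dc by (subst wcl_append) auto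
    ultimately have "antipode V (wcl (l # w)) = fac V (dg [l]) (dg w) \<odot>\<^bsub>U\<^esub>
       (cl (wsingle (rev w) (anti w)) \<otimes>\<^bsub>U\<^esub> cl (wsingle [l] (- 1)))"
      using Cons.IH[OF dc(3)] by simp
    also have "\<dots> = cl (pscale (fac V (dg [l]) (dg w)) (wsingle (rev w) (anti w) * wsingle [l] (- 1)))"
      using F_closed(8)[OF dc(4)] F_closed(8)[OF dc(5)] F_closed(2) by (simp add: U_simps)
    also have "pscale (fac V (dg [l]) (dg w)) (wsingle (rev w) (anti w) * wsingle [l] (- 1)) =
        wsingle (rev (l # w)) (anti (l # w))"
      by (simp add: mult_single plus_list_def word_fac_def flip: single_pscale)
    finally show ?case .
  qed
  show ?thesis using assms
  proof (induction p rule: F_induct)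
    case zero
    have "antipode V (cl 0) = cl 0"
    proof -
      have c: "cl 0 \<in> carrier U" "antipode V (cl 0) \<in> carrier U"
        using S cl_closed[OF F_closed(6)] by auto
      then show ?thesis using Ssm[OF c(1), of 0] unfolding U_zero_smult[OF c(1)] U_zero_smult[OF c(2)] by simp
    qed
    then show ?case by (simp add: antipode_poly_zero)
  next
    case (single w c)
    have "cl (wsingle w c) = c \<odot>\<^bsub>U\<^esub> wcl w"
      unfolding wcl_def using U_simps(5)[OF F_closed(8)[OF single]] single_pscale[of w c 1] by simp
    moreover have "antipode_poly (wsingle w c) = pscale c (wsingle (rev w) (anti w))"
      by (rule poly_word_eval_eqI) (simp add: word_eval_antipode_poly)
    moreover have "wsingle (rev w) (anti w) \<in> carrier F" using single by (intro F_closed) auto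
    ultimately show ?case using Ssm[OF wcl_closed[OF single], of c] words[OF single] by (simp add: U_simps)
  next
    case (add p q)
    then show ?case using Sadd[OF cl_closed cl_closed, of p q]
      by (simp add: U_simps antipode_poly_add antipode_poly_closed)
  qed
qed

end

lemma word_eval_mult_right: "word_eval \<phi> (p * q) = word_eval (\<lambda>v. word_eval (\<lambda>u. \<phi> (u @ v)) p) q"
  unfolding word_eval_mult unfolding word_eval_def sum_distrib_left by (subst sum.swap) (simp add: mult_ac)

lemma linear_functional_scale_right: "linear_functional A f ==> linear_functional A (\<lambda>x. f x * c)"
  using linear_functional_scale[of A f c] by (simp add: mult.commute)

context graded_basis
begin

section \<open>The product of the finite dual on words\<close>

abbreviation "A0 \<equiv> finite_dual_alg V"

abbreviation wmult :: "'i gfun => 'i gfun => 'i gfun"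
    (infixl \<open>\<cdot>\<close> 70) where
  "f \<cdot> g \<equiv> wk.shuffle f g"

lemma A0_simps: "carrier A0 = finite_dual V" "one A0 = ofw unit_word" "zero A0 = (\<lambda>_. 0)"
  "add A0 = (\<lambda>f g x. f x + g x)" "module.smult A0 = (\<lambda>c f x. c * f x)"
  "hpart A0 = (\<lambda>\<gamma>. {f \<in> finite_dual V. functional_degree V \<gamma> f})"
  "mult A0 f g = (\<lambda>x. if x \<in> carrier U then coproduct V x (functional_pairing V f g) else 0)"
  by (simp_all add: finite_dual_alg_def counit_eq)

lemma dual_linear: "f \<in> Udual ==> linear_functional U f"
  by (simp add: dual_space_def)

lemma functional_pairing_bil:
  assumes f: "f \<in> Udual" and g: "g \<in> Udual"
  shows "functional_pairing V f g \<in> bil"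
  unfolding bilinear_forms_def
proof (intro CollectI conjI ballI)
  fix y
  show "linear_functional U (\<lambda>x. functional_pairing V f g x y)"
    unfolding functional_pairing_def Let_def
    by (rule U.linear_functional_sum_hsupp[where
          G = "\<lambda>\<alpha> x'. \<Sum>\<eta>\<in>hsupp U y. \<omega> (- \<eta>) \<alpha> * f x' * g (hcomp U \<eta> y)"])
      (intro linear_functional_sum linear_functional_scale linear_functional_scale_right dual_linear[OF f])
next
  fix x
  show "linear_functional U (functional_pairing V f g x)"
    unfolding functional_pairing_def Let_def
    by (intro linear_functional_sum U.linear_functional_sum_hsupp[where
          G = "\<lambda>\<eta> y'. \<omega> (- \<eta>) \<alpha> * f (hcomp U \<alpha> x) * g y'" for \<alpha>] linear_functional_scale dual_linear[OF g])
qed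

text \<open>The factor \<open>\<omega> (- \<eta>) \<alpha>\<close> of the definition becomes
  \<open>word_fac u v\<close>, because negating one argument of \<omega> amounts to exchanging
  both.\<close>

lemma functional_pairing_wcl:
  assumes f: "f \<in> Udual" and g: "g \<in> Udual" and uv: "set u \<subseteq> L" "set v \<subseteq> L"
  shows "functional_pairing V f g (wcl u) (wcl v) = word_fac u v * wf f u * wf g v"
proof -
  have z: "f \<zero>\<^bsub>U\<^esub> = 0" "g \<zero>\<^bsub>U\<^esub> = 0" using U.linear_functional_zero dual_linear f g by blast+
  have "functional_pairing V f g (wcl u) (wcl v) =
      (\<Sum>\<eta>\<in>hsupp U (wcl v). \<omega> (- \<eta>) (dg u) * f (wcl u) * g (hcomp U \<eta> (wcl v)))"
    unfolding functional_pairing_def Let_def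
    by (rule U.sum_hsupp_homogeneous[OF wcl_hpart[OF uv(1)], where
          G = "\<lambda>\<alpha> x'. \<Sum>\<eta>\<in>hsupp U (wcl v). \<omega> (- \<eta>) \<alpha> * f x' * g (hcomp U \<eta> (wcl v))"]) (simp add: z)
  also have "\<dots> = \<omega> (- dg v) (dg u) * f (wcl u) * g (wcl v)"
    by (rule U.sum_hsupp_homogeneous[OF wcl_hpart[OF uv(2)], where
          G = "\<lambda>\<eta> y'. \<omega> (- \<eta>) (dg u) * f (wcl u) * g y'"]) (simp add: z)
  finally show ?thesis by (simp add: word_fac_def wf_def fac_minus)
qed

lemma WU_support: "\<phi> \<in> WU ==> \<phi> w \<noteq> 0 ==> set w \<subseteq> L"
  by (simp add: WU_def)

lemma fdual_mult_cl:
  assumes f: "f \<in> Udual" and g: "g \<in> Udual" and p: "p \<in> carrier F"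
  shows "(f \<otimes>\<^bsub>A0\<^esub> g) (cl p) = word_eval (wf f \<cdot> wf g) p"
proof -
  have "(f \<otimes>\<^bsub>A0\<^esub> g) (cl p) = word_eval (split_sum word_fac (\<lambda>u v. functional_pairing V f g (wcl u) (wcl v))) p"
    using functional_pairing_bil[OF f g] p by (simp add: A0_simps cl_closed coproduct_cl cop_def)
  also have "\<dots> = word_eval (wf f \<cdot> wf g) p"
    using p unfolding wk.shuffle_def
    by (intro word_eval_cong split_sum_cong_set functional_pairing_wcl[OF f g]) (auto simp: F_carrier)
  finally show ?thesis .
qed

text \<open>Through \<open>wf\<close> the product of functionals becomes the shuffle product with
  factor \<open>word_fac\<close>, where all later computations take place.\<close>

lemma fdual_mult:
  assumes f: "f \<in> Udual" and g: "g \<in> Udual"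
  shows "f \<otimes>\<^bsub>A0\<^esub> g \<in> Udual" "wf (f \<otimes>\<^bsub>A0\<^esub> g) = wf f \<cdot> wf g"
proof -
  show d: "f \<otimes>\<^bsub>A0\<^esub> g \<in> Udual"
    unfolding dual_space_def linear_functional_def
  proof (intro CollectI conjI ballI allI impI)
    fix x assume "x \<in> carrier U"
    then obtain p where p: "p \<in> carrier F" "x = cl p" by (auto simp: U_carrier)
    show "(f \<otimes>\<^bsub>A0\<^esub> g) (c \<odot>\<^bsub>U\<^esub> x) = c * (f \<otimes>\<^bsub>A0\<^esub> g) x" for c
      using p F_closed(5) by (simp add: U_simps fdual_mult_cl[OF f g])
    fix y assume "y \<in> carrier U"
    then obtain q where q: "q \<in> carrier F" "y = cl q" by (auto simp: U_carrier)
    show "(f \<otimes>\<^bsub>A0\<^esub> g) (x \<oplus>\<^bsub>U\<^esub> y) = (f \<otimes>\<^bsub>A0\<^esub> g) x + (f \<otimes>\<^bsub>A0\<^esub> g) y"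
      using p q F_closed(1) by (simp add: U_simps fdual_mult_cl[OF f g])
  qed (simp add: A0_simps)
  show "wf (f \<otimes>\<^bsub>A0\<^esub> g) = wf f \<cdot> wf g"
  proof
    fix w
    show "wf (f \<otimes>\<^bsub>A0\<^esub> g) w = (wf f \<cdot> wf g) w"
    proof (cases "set w \<subseteq> L")
      case True
      then show ?thesis using fdual_mult_cl[OF f g F_closed(8)[OF True, of 1]] unfolding wcl_def[symmetric]
        by (simp only: wf_def word_eval_single mult_1_left)
    next
      case False
      have "(wf f \<cdot> wf g) w = 0"
      proof (rule ccontr)
        assume "(wf f \<cdot> wf g) w \<noteq> 0"
        then obtain u v where "wf f u \<noteq> 0" "wf g v \<noteq> 0" "mset w = mset u + mset v" by (rule wk.shuffle_nonzeroE)
        then show False using False WU_support[OF wf_WU[OF f]] WU_support[OF wf_WU[OF g]]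
          by (metis set_mset_mset set_mset_union Un_subset_iff)
      qed
      moreover have "wf (f \<otimes>\<^bsub>A0\<^esub> g) w = 0" using False WU_support[OF wf_WU[OF d]] by blast
      ultimately show ?thesis by simp
    qed
  qed
qed

lemma WU_mult: "\<phi> \<in> WU ==> \<psi> \<in> WU ==> \<phi> \<cdot> \<psi> \<in> WU"
  using wf_WU[OF fdual_mult(1)[OF ofw_dual ofw_dual]] fdual_mult(2)[OF ofw_dual ofw_dual] wf_ofw by metis

lemma WU_add: "\<phi> \<in> WU ==> \<psi> \<in> WU ==> (\<lambda>w. \<phi> w + \<psi> w) \<in> WU"
  unfolding WU_def using word_eval_fun_add[of \<phi> \<psi>] by (simp, metis add_0)

lemma WU_scale: "\<phi> \<in> WU ==> (\<lambda>w. c * \<phi> w) \<in> WU"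
  unfolding WU_def by (auto simp: word_eval_fun_scale)

lemma WU_zero: "(\<lambda>w. 0) \<in> WU"
  using WU_scale[OF unit_word_WU, of 0] by simp

section \<open>Representative functions\<close>

abbreviation fspan :: "('a => complex) set => ('a => complex) set" where
  "fspan \<equiv> module.span (\<lambda>c f x. c * f x)"

lemma fspan_induct [consumes 1, case_names zero base add scale]:
  assumes "\<phi> \<in> fspan B" "P (\<lambda>_. 0)" "\<And>b. b \<in> B ==> P b" "\<And>x y. P x ==> P y ==> P (\<lambda>w. x w + y w)"
    "\<And>c x. P x ==> P (\<lambda>w. c * x w)"
  shows "P \<phi>"
  using assms(1)
proof (induction rule: fscale.span_induct)
  case base
  show ?case using assms(2-) unfolding fscale.subspace_def plus_fun_def zero_fun_def by auto
qed (use assms in auto)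

lemma fspan_closed:
  "(\<lambda>_. 0) \<in> fspan B" "b \<in> B ==> b \<in> fspan B" "x \<in> fspan B ==> y \<in> fspan B ==> (\<lambda>w. x w + y w) \<in> fspan B"
  "x \<in> fspan B ==> (\<lambda>w. c * x w) \<in> fspan B"
  using fscale.span_zero[of B] fscale.span_base[of b B] fscale.span_add[of x B y] fscale.span_scale[of x B c]
  by (simp_all add: zero_fun_def plus_fun_def)

text \<open>A finite set of homogeneous functions whose span is invariant under left and right
  translation by letters. It witnesses membership in the finite dual without naming an ideal: the
  ideal is the common kernel.\<close>

definition stable :: "'i gfun set => bool" where
  "stable B \<longleftrightarrow> finite B \<and> B \<subseteq> WU \<and> (\<forall>b\<in>B. \<exists>\<delta>. \<forall>w. b w \<noteq> 0 \<longrightarrow> dg w = \<delta>) \<and>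
     (\<forall>b\<in>B. \<forall>l\<in>L. (\<lambda>w. b (l # w)) \<in> fspan B \<and> (\<lambda>w. b (w @ [l])) \<in> fspan B)"

definition RF :: "'i gfun set" where
  "RF = {\<phi>. \<exists>B. stable B \<and> \<phi> \<in> fspan B}"

lemma stable_degree: "stable B ==> b \<in> B ==> \<exists>\<delta>. \<forall>w. b w \<noteq> 0 \<longrightarrow> dg w = \<delta>"
proof -
  assume B: "stable B" "b \<in> B"
  have "\<forall>b\<in>B. \<exists>\<delta>. \<forall>w. b w \<noteq> 0 \<longrightarrow> dg w = \<delta>" using B(1) unfolding stable_def by (elim conjE)
  from bspec[OF this B(2)] show ?thesis .
qed

lemma stable_span:
  assumes "stable B" "\<phi> \<in> fspan B"
  shows "\<phi> \<in> WU" and "l \<in> L ==> (\<lambda>w. \<phi> (l # w)) \<in> fspan B" and "l \<in> L ==> (\<lambda>w. \<phi> (w @ [l])) \<in> fspan B"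
proof -
  show "\<phi> \<in> WU" using assms(2)
    by (induction rule: fspan_induct) (use assms(1) in \<open>auto simp: stable_def intro: WU_zero WU_add WU_scale\<close>)
  show "(\<lambda>w. \<phi> (l # w)) \<in> fspan B" if "l \<in> L" using assms(2)
    by (induction rule: fspan_induct) (use assms(1) that in \<open>auto simp: stable_def intro: fspan_closed\<close>)
  show "(\<lambda>w. \<phi> (w @ [l])) \<in> fspan B" if "l \<in> L" using assms(2)
    by (induction rule: fspan_induct) (use assms(1) that in \<open>auto simp: stable_def intro: fspan_closed\<close>)
qed

lemma stable_translate:
  assumes "stable B" "\<phi> \<in> fspan B" "set u \<subseteq> L"
  shows "(\<lambda>w. \<phi> (u @ w)) \<in> fspan B" "(\<lambda>w. \<phi> (w @ u)) \<in> fspan B"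
proof -
  show "(\<lambda>w. \<phi> (u @ w)) \<in> fspan B" using assms(2,3)
  proof (induction u arbitrary: \<phi>)
    case (Cons l u)
    then show ?case using Cons.IH[OF stable_span(2)[OF assms(1) Cons.prems(1), of l]] by simp
  qed simp
  show "(\<lambda>w. \<phi> (w @ u)) \<in> fspan B" using assms(2,3)
  proof (induction u arbitrary: \<phi> rule: rev_induct)
    case (snoc l u)
    then show ?case using snoc.IH[OF stable_span(3)[OF assms(1) snoc.prems(1), of l]] by simp
  qed simp
qed

lemma finite_codimensionE:
  assumes "finite_codimension U K"
  obtains E where "finite E" "E \<subseteq> carrier U"
    "\<forall>x\<in>carrier U. \<exists>c. x \<ominus>\<^bsub>U\<^esub> finsum U (\<lambda>e. c e \<odot>\<^bsub>U\<^esub> e) E \<in> K"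
proof -
  obtain E where E: "finite E \<and> E \<subseteq> carrier U \<and>
      (\<forall>x\<in>carrier U. \<exists>c. x \<ominus>\<^bsub>U\<^esub> finsum U (\<lambda>e. c e \<odot>\<^bsub>U\<^esub> e) E \<in> K)"
    using assms unfolding finite_codimension_def by (elim exE)
  show thesis
    by (rule that[OF conjunct1[OF E] conjunct1[OF conjunct2[OF E]] conjunct2[OF conjunct2[OF E]]])
qed

text \<open>One functional at a time: either it vanishes on the kernel reached so far, or a vector
  \<open>k\<close> of that kernel with \<open>f k \<noteq> 0\<close> joins the spanning set and
  corrects the value of \<open>f\<close>.\<close>

lemma finite_codimension_common_kernel:
  assumes "finite B" "\<And>f. f \<in> B ==> linear_functional U f"
  shows "finite_codimension U {x \<in> carrier U. \<forall>f\<in>B. f x = 0}"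
  using assms
proof (induction B rule: finite_induct)
  case empty
  show ?case unfolding finite_codimension_def by (intro exI[of _ "{}"]) simp
next
  case (insert f B)
  let ?K = "{x \<in> carrier U. \<forall>f\<in>B. f x = 0}"
  obtain E where E: "finite E" "E \<subseteq> carrier U"
    and EK: "\<forall>x\<in>carrier U. \<exists>c. x \<ominus>\<^bsub>U\<^esub> finsum U (\<lambda>e. c e \<odot>\<^bsub>U\<^esub> e) E \<in> ?K"
    by (rule finite_codimensionE[OF insert.IH[OF insert.prems[OF insertI2]]], assumption, rule that)
  have lin: "linear_functional U g" if "g \<in> insert f B" for g by (rule insert.prems[OF that])
  have lin_diff: "g (x \<ominus>\<^bsub>U\<^esub> y) = g x - g y" if "g \<in> insert f B" "x \<in> carrier U" "y \<in> carrier U" for g x y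
  proof -
    have "g x = g ((x \<ominus>\<^bsub>U\<^esub> y) \<oplus>\<^bsub>U\<^esub> y)"
      using that by (simp add: a_minus_def U.a_assoc U.l_neg)
    also have "\<dots> = g (x \<ominus>\<^bsub>U\<^esub> y) + g y" using lin[OF that(1)] that by (simp add: linear_functional_def)
    finally show ?thesis by simp
  qed
  show ?case
  proof (cases "\<forall>k\<in>?K. f k = 0")
    case True
    then have eq: "{x \<in> carrier U. \<forall>g\<in>insert f B. g x = 0} = ?K" by auto
    show ?thesis unfolding finite_codimension_def eq by (rule exI[of _ E]) (intro conjI E EK)
  next
    case False
    then obtain k where k: "k \<in> carrier U" "\<forall>g\<in>B. g k = 0" "f k \<noteq> 0" by auto
    \<comment> \<open>\<open>k\<close> may already belong to \<open>E\<close>; it is taken out so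
      that its coefficient can be prescribed separately.\<close>
    define E' where "E' = E - {k}"
    have E': "finite E'" "E' \<subseteq> carrier U" "k \<notin> E'" using E by (auto simp: E'_def)
    have "\<exists>c. x \<ominus>\<^bsub>U\<^esub> finsum U (\<lambda>e. c e \<odot>\<^bsub>U\<^esub> e) (insert k E') \<in> {x \<in> carrier U. \<forall>g\<in>insert f B. g x = 0}"
      if x: "x \<in> carrier U" for x
    proof -
      obtain c where c: "x \<ominus>\<^bsub>U\<^esub> finsum U (\<lambda>e. c e \<odot>\<^bsub>U\<^esub> e) E \<in> ?K" using bspec[OF EK x] by (elim exE)
      have cl: "(\<lambda>e. c e \<odot>\<^bsub>U\<^esub> e) \<in> E' \<rightarrow> carrier U" for c :: "'i env => complex"
        using E'(2) by (auto intro: U.smult_closed)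
      have clE: "(\<lambda>e. c e \<odot>\<^bsub>U\<^esub> e) \<in> E \<rightarrow> carrier U" using E(2) by (auto intro: U.smult_closed)
      define s where "s = finsum U (\<lambda>e. c e \<odot>\<^bsub>U\<^esub> e) E'"
      have s: "s \<in> carrier U" unfolding s_def by (rule U.finsum_closed[OF cl])
      define c0 where "c0 = (if k \<in> E then c k else 0)"
      have zero: "0 \<odot>\<^bsub>U\<^esub> k = \<zero>\<^bsub>U\<^esub>"
        using U_zero_smult[OF k(1)] by (simp add: U_simps)
      have sum_E: "finsum U (\<lambda>e. c e \<odot>\<^bsub>U\<^esub> e) E = c0 \<odot>\<^bsub>U\<^esub> k \<oplus>\<^bsub>U\<^esub> s"
      proof (cases "k \<in> E")
        case True
        then have "E = insert k E'" by (auto simp: E'_def)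
        then show ?thesis using U.finsum_insert[OF E'(1,3) cl[of c]] k(1) True U.smult_closed by (simp add: c0_def s_def)
      next
        case False
        then have "E' = E" by (auto simp: E'_def)
        then show ?thesis using False s by (simp add: c0_def s_def zero)
      qed
      define r where "r = f x - f (c0 \<odot>\<^bsub>U\<^esub> k \<oplus>\<^bsub>U\<^esub> s)"
      \<comment> \<open>The new coefficient of \<open>k\<close> absorbs the remaining value
        \<open>r\<close> of \<open>f\<close>. The functionals in \<open>B\<close> do not notice the
        change, as they vanish at \<open>k\<close>.\<close>
      define c' where "c' = c(k := c0 + r / f k)"
      have "finsum U (\<lambda>e. c' e \<odot>\<^bsub>U\<^esub> e) (insert k E') = c' k \<odot>\<^bsub>U\<^esub> k \<oplus>\<^bsub>U\<^esub> finsum U (\<lambda>e. c' e \<odot>\<^bsub>U\<^esub> e) E'"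
        using k(1) by (intro U.finsum_insert E' cl U.smult_closed)
      also have "finsum U (\<lambda>e. c' e \<odot>\<^bsub>U\<^esub> e) E' = s"
        unfolding s_def using E'(3) cl[of c] by (intro U.finsum_cong') (auto simp: c'_def)
      finally have sum': "finsum U (\<lambda>e. c' e \<odot>\<^bsub>U\<^esub> e) (insert k E') = c' k \<odot>\<^bsub>U\<^esub> k \<oplus>\<^bsub>U\<^esub> s" .
      have gE: "g (c'' \<odot>\<^bsub>U\<^esub> k \<oplus>\<^bsub>U\<^esub> s) = c'' * g k + g s" if "g \<in> insert f B" for g c''
        using lin[OF that] k(1) s U.smult_closed by (simp add: linear_functional_def)
      have in_c: "c'' \<odot>\<^bsub>U\<^esub> k \<oplus>\<^bsub>U\<^esub> s \<in> carrier U" for c'' using k(1) s U.smult_closed by simp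
      have "f (x \<ominus>\<^bsub>U\<^esub> (c' k \<odot>\<^bsub>U\<^esub> k \<oplus>\<^bsub>U\<^esub> s)) = 0"
      proof -
        have "r = f x - (c0 * f k + f s)" unfolding r_def using gE[of f c0] by simp
        moreover have "c' k * f k = c0 * f k + r" using k(3) by (simp add: c'_def field_simps)
        ultimately show ?thesis using lin_diff[OF _ x in_c, of f "c' k"] gE[of f "c' k"] by simp
      qed
      moreover have "g (x \<ominus>\<^bsub>U\<^esub> (c' k \<odot>\<^bsub>U\<^esub> k \<oplus>\<^bsub>U\<^esub> s)) = 0" if "g \<in> B" for g
      proof -
        have "g (x \<ominus>\<^bsub>U\<^esub> (c0 \<odot>\<^bsub>U\<^esub> k \<oplus>\<^bsub>U\<^esub> s)) = 0" using c that unfolding sum_E by blast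
        then show ?thesis
          using lin_diff[OF _ x in_c, of g "c' k"] lin_diff[OF _ x in_c, of g c0] gE[of g "c' k"] gE[of g c0] k(2) that
          by simp
      qed
      ultimately have "x \<ominus>\<^bsub>U\<^esub> finsum U (\<lambda>e. c' e \<odot>\<^bsub>U\<^esub> e) (insert k E') \<in> {x \<in> carrier U. \<forall>g\<in>insert f B. g x = 0}"
        unfolding sum' using x in_c by simp
      then show ?thesis by (rule exI[of _ c'])
    qed
    then show ?thesis unfolding finite_codimension_def using E' k(1) by (intro exI[of _ "insert k E'"]) simp
  qed
qed

text \<open>The common kernel of \<open>B\<close> is a two-sided ideal by translation invariance,
  graded because the members of \<open>B\<close> are homogeneous, and of finite codimension because
  \<open>B\<close> is finite.\<close>

lemma stable_finite_dual:
  assumes B: "stable B" and b: "b \<in> B"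
  shows "ofw b \<in> finite_dual V"
proof -
  have WU: "b \<in> WU" if "b \<in> B" for b using B that by (auto simp: stable_def)
  have eval: "ofw b (cl p) = word_eval b p" if "b \<in> B" "p \<in> carrier F" for b p
    using ofw_cl[OF WU] that by blast
  define K where "K = {x \<in> carrier U. \<forall>f\<in>ofw ` B. f x = 0}"
  have K_cl: "cl p \<in> K \<longleftrightarrow> (\<forall>b\<in>B. word_eval b p = 0)" if "p \<in> carrier F" for p
    using that by (auto simp: K_def eval cl_closed)
  have span0: "word_eval \<phi> p = 0" if "\<phi> \<in> fspan B" "\<forall>b\<in>B. word_eval b p = 0" for \<phi> p
    using that(1)
  proof (induction rule: fspan_induct)
    case zero show ?case by (simp add: word_eval_def)
  qed (use that(2) in \<open>auto simp: word_eval_fun_add word_eval_fun_scale\<close>)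
  have mult0: "word_eval b (q * p) = 0" "word_eval b (p * q) = 0"
    if "b \<in> B" "q \<in> carrier F" "\<forall>b\<in>B. word_eval b p = 0" for b p q
  proof -
    have q: "set u \<subseteq> L" if "u \<in> wkeys q" for u using that \<open>q \<in> carrier F\<close> by (simp add: F_carrier)
    note st = stable_translate[OF B fspan_closed(2)[OF that(1)]]
    have "word_eval b (q * p) = word_eval (\<lambda>u. 0) q"
      unfolding word_eval_mult[of b q p] by (intro word_eval_cong span0[OF _ that(3)] st q)
    moreover have "word_eval b (p * q) = word_eval (\<lambda>u. 0) q"
      unfolding word_eval_mult_right[of b p q] by (intro word_eval_cong span0[OF _ that(3)] st q)
    ultimately show "word_eval b (q * p) = 0" "word_eval b (p * q) = 0" by (simp_all add: word_eval_def)
  qed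
  have K_obtain: "\<exists>p. p \<in> carrier F \<and> x = cl p" if "x \<in> K" for x
  proof -
    have "x \<in> carrier U" using that by (simp add: K_def)
    then show ?thesis unfolding U_carrier by blast
  qed
  have U_obtain: "\<exists>p. p \<in> carrier F \<and> x = cl p" if "x \<in> carrier U" for x
    using that unfolding U_carrier by blast
  have "ideal K U"
  proof (rule idealI[OF U.ring_axioms])
    show "subgroup K (add_monoid U)"
    proof (rule subgroup.intro)
      show "K \<subseteq> carrier (add_monoid U)" by (auto simp: K_def)
      show "\<one>\<^bsub>add_monoid U\<^esub> \<in> K" using K_cl[OF F_closed(6)] by (simp add: U_simps)
      fix x assume x: "x \<in> K"
      then obtain p where p: "p \<in> carrier F" "x = cl p" using K_obtain by blast
      have "\<ominus>\<^bsub>U\<^esub> x \<in> K" using x p F_closed(3) by (simp add: cl_neg K_cl)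
      then show "inv\<^bsub>add_monoid U\<^esub> x \<in> K" by (simp add: a_inv_def)
      fix y assume y: "y \<in> K"
      then obtain q where q: "q \<in> carrier F" "y = cl q" using K_obtain by blast
      show "x \<otimes>\<^bsub>add_monoid U\<^esub> y \<in> K" using x y p q F_closed(1) by (simp add: U_simps K_cl)
    qed
    fix x y assume x: "x \<in> K" "y \<in> carrier U"
    then obtain p q where p: "p \<in> carrier F" "x = cl p" and q: "q \<in> carrier F" "y = cl q"
      using K_obtain[OF x(1)] U_obtain[OF x(2)] by blast
    have p0: "\<forall>b\<in>B. word_eval b p = 0" using x p K_cl by blast
    show "y \<otimes>\<^bsub>U\<^esub> x \<in> K" "x \<otimes>\<^bsub>U\<^esub> y \<in> K"
      using mult0[OF _ q(1) p0] p q F_closed(2) by (simp_all add: U_simps K_cl)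
  qed
  moreover have "hcomp U \<alpha> x \<in> K" if "x \<in> K" for x \<alpha>
  proof -
    obtain p where p: "p \<in> carrier F" "x = cl p" using K_obtain[OF \<open>x \<in> K\<close>] by blast
    have "word_eval b (comp \<alpha> p) = 0" if "b \<in> B" for b
    proof -
      obtain \<delta> where \<delta>: "\<forall>w. b w \<noteq> 0 \<longrightarrow> dg w = \<delta>" using stable_degree[OF B \<open>b \<in> B\<close>] by (elim exE)
      have "(\<lambda>w. if dg w = \<alpha> then b w else 0) = (if \<alpha> = \<delta> then b else (\<lambda>w. 0))"
        using \<delta> by (intro ext) (simp, metis)
      moreover have "word_eval b p = 0" using K_cl[OF p(1)] \<open>x \<in> K\<close> p(2) that by blast
      ultimately show ?thesis
        unfolding word_eval_comp by (cases "\<alpha> = \<delta>") (simp_all add: word_eval_def[of "\<lambda>w. 0"])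
    qed
    then show ?thesis using p cl_closed by (simp add: U.hcomp_eq prU_cl K_cl comp_closed)
  qed
  moreover have "finite_codimension U K"
    unfolding K_def using B ofw_dual[OF WU] dual_linear by (intro finite_codimension_common_kernel) (auto simp: stable_def)
  ultimately have K: "graded_ideal U K" "finite_codimension U K" by (auto simp: graded_ideal_def)
  obtain \<delta> where \<delta>: "\<forall>w. b w \<noteq> 0 \<longrightarrow> dg w = \<delta>" using stable_degree[OF B b] by (elim exE)
  have "functional_degree V (- \<delta>) (ofw b)"
    using \<delta> by (simp add: functional_degree_iff ofw_dual WU b wf_ofw)
  moreover have "\<forall>x\<in>K. ofw b x = 0" using b by (auto simp: K_def)
  ultimately show ?thesis
    unfolding finite_dual_def using K ofw_dual[OF WU[OF b]] by (intro fscale.span_base) blast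
qed

lemma ofw_add: "ofw (\<lambda>w. \<phi> w + \<psi> w) = (\<lambda>x. ofw \<phi> x + ofw \<psi> x)"
  by (auto simp: ofw_def word_eval_fun_add)

lemma ofw_scale: "ofw (\<lambda>w. c * \<phi> w) = (\<lambda>x. c * ofw \<phi> x)"
  by (auto simp: ofw_def word_eval_fun_scale)

lemma RF_WU: "\<phi> \<in> RF ==> \<phi> \<in> WU"
  unfolding RF_def using stable_span(1) by blast

lemma RF_finite_dual: "\<phi> \<in> RF ==> ofw \<phi> \<in> finite_dual V"
proof -
  assume "\<phi> \<in> RF"
  then obtain B where B: "stable B" "\<phi> \<in> fspan B" by (auto simp: RF_def)
  from B(2) show ?thesis
  proof (induction rule: fspan_induct)
    case zero
    have "ofw (\<lambda>_. 0) = (\<lambda>_. 0)" by (auto simp: ofw_def word_eval_def)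
    then show ?case unfolding finite_dual_def by (simp add: fspan_closed)
  next
    case (base b)
    then show ?case using stable_finite_dual[OF B(1)] by blast
  next
    case (add x y)
    then show ?case unfolding ofw_add finite_dual_def by (rule fspan_closed)
  next
    case (scale c x)
    then show ?case unfolding ofw_scale finite_dual_def by (rule fspan_closed)
  qed
qed

lemma finite_dual_dual: "f \<in> finite_dual V ==> f \<in> Udual"
  unfolding finite_dual_def
proof (induction rule: fspan_induct)
  case (add x y)
  then show ?case by (simp add: dual_space_def linear_functional_add)
next
  case (scale c x)
  then show ?case by (simp add: dual_space_def linear_functional_scale)
qed (auto simp: dual_space_def linear_functional_def)

lemma stable_Un: "stable B ==> stable B' ==> stable (B \<union> B')"
proof -
  assume B: "stable B" "stable B'"
  have sub: "fspan B \<subseteq> fspan (B \<union> B')" "fspan B' \<subseteq> fspan (B \<union> B')"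
    by (intro fscale.span_mono Un_upper1 Un_upper2)+
  show ?thesis
    unfolding stable_def
  proof (intro conjI ballI)
    show "finite (B \<union> B')" "B \<union> B' \<subseteq> WU" using B by (simp_all add: stable_def)
    fix b assume b: "b \<in> B \<union> B'"
    then show "\<exists>\<delta>. \<forall>w. b w \<noteq> 0 \<longrightarrow> dg w = \<delta>"
      using stable_degree[OF B(1), of b] stable_degree[OF B(2), of b] by (elim UnE)
    fix l assume l: "l \<in> L"
    show "(\<lambda>w. b (l # w)) \<in> fspan (B \<union> B')" "(\<lambda>w. b (w @ [l])) \<in> fspan (B \<union> B')"
      using b stable_span(2,3)[OF B(1) fspan_closed(2) l, of b] stable_span(2,3)[OF B(2) fspan_closed(2) l, of b] sub
      by (elim UnE; meson subsetD)+
  qed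
qed

lemma RF_scale: "\<phi> \<in> RF ==> (\<lambda>w. c * \<phi> w) \<in> RF"
  unfolding RF_def using fspan_closed(4) by blast

lemma RF_add: "\<phi> \<in> RF ==> \<psi> \<in> RF ==> (\<lambda>w. \<phi> w + \<psi> w) \<in> RF"
proof -
  assume "\<phi> \<in> RF" "\<psi> \<in> RF"
  then obtain B B' where B: "stable B" "\<phi> \<in> fspan B" "stable B'" "\<psi> \<in> fspan B'" by (auto simp: RF_def)
  then have "\<phi> \<in> fspan (B \<union> B')" "\<psi> \<in> fspan (B \<union> B')"
    using fscale.span_mono[of B "B \<union> B'"] fscale.span_mono[of B' "B \<union> B'"] by blast+
  then show ?thesis unfolding RF_def using stable_Un[OF B(1,3)] fspan_closed(3) by blast
qed

lemma RF_unit: "unit_word \<in> RF"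
proof -
  have "stable {unit_word}"
    unfolding stable_def using unit_word_WU fspan_closed(1)[of "{unit_word}"] by (auto simp: unit_word_def[abs_def])
  then show ?thesis unfolding RF_def using fspan_closed(2) by blast
qed

text \<open>The pairwise products of two stable sets form a stable set: translations act on products
  as twisted derivations, and on homogeneous functions the twist is a scalar.\<close>

lemma RF_mult: "\<phi> \<in> RF ==> \<psi> \<in> RF ==> \<phi> \<cdot> \<psi> \<in> RF"
proof -
  assume "\<phi> \<in> RF" "\<psi> \<in> RF"
  then obtain B B' where B: "stable B" "\<phi> \<in> fspan B" "stable B'" "\<psi> \<in> fspan B'" by (auto simp: RF_def)
  define C where "C = (\<lambda>(b, b'). b \<cdot> b') ` (B \<times> B')"
  have C: "x \<cdot> y \<in> fspan C" if "x \<in> fspan B" "y \<in> fspan B'" for x y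
    using that(1)
  proof (induction rule: fspan_induct)
    case (base b)
    from that(2) show ?case
    proof (induction rule: fspan_induct)
      case (base b')
      then have "b \<cdot> b' \<in> C" using \<open>b \<in> B\<close> unfolding C_def by (auto simp: image_iff)
      then show ?case by (rule fspan_closed(2))
    qed (simp_all add: wk.shuffle_zero_right wk.shuffle_add_right wk.shuffle_scale_right fspan_closed(1,3,4))
  qed (simp_all add: wk.shuffle_zero_left wk.shuffle_add_left wk.shuffle_scale_left fspan_closed(1,3,4))
  have "stable C"
    unfolding stable_def
  proof (intro conjI ballI)
    show "finite C" using B by (auto simp: C_def stable_def)
    show "C \<subseteq> WU" using B WU_mult by (auto simp: C_def stable_def)
    fix z assume "z \<in> C"
    then obtain b b' where z: "z = b \<cdot> b'" "b \<in> B" "b' \<in> B'" by (auto simp: C_def)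
    obtain \<delta> \<delta>' where d: "\<forall>w. b w \<noteq> 0 \<longrightarrow> dg w = \<delta>" "\<forall>w. b' w \<noteq> 0 \<longrightarrow> dg w = \<delta>'"
      using stable_degree[OF B(1) z(2)] stable_degree[OF B(3) z(3)] by (elim exE)
    show "\<exists>\<delta>. \<forall>w. z w \<noteq> 0 \<longrightarrow> dg w = \<delta>"
    proof (intro exI allI impI)
      fix w assume "z w \<noteq> 0"
      then obtain u v where "b u \<noteq> 0" "b' v \<noteq> 0" "mset w = mset u + mset v" unfolding z by (rule wk.shuffle_nonzeroE)
      then show "dg w = \<delta> + \<delta>'" using d dg_mset by simp
    qed
    fix l assume l: "l \<in> L"
    have b: "b \<in> fspan B" "b' \<in> fspan B'" using z fspan_closed(2) by auto
    have 1: "(\<lambda>v. word_fac [l] v * b' v) = (\<lambda>v. \<omega> (letter_deg l) \<delta>' * b' v)"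
    proof
      fix v show "word_fac [l] v * b' v = \<omega> (letter_deg l) \<delta>' * b' v"
        using d(2) by (cases "b' v = 0") (simp_all add: word_fac_def)
    qed
    have 2: "(\<lambda>u. word_fac u [l] * b u) = (\<lambda>v. \<omega> \<delta> (letter_deg l) * b v)"
    proof
      fix v show "word_fac v [l] * b v = \<omega> \<delta> (letter_deg l) * b v"
        using d(1) by (cases "b v = 0") (simp_all add: word_fac_def)
    qed
    show "(\<lambda>w. z (l # w)) \<in> fspan C"
      unfolding z(1) wk.shuffle_Cons 1
      by (intro fspan_closed(3) C fspan_closed(4) stable_span(2)[OF B(1) b(1) l] stable_span(2)[OF B(3) b(2) l] b)
    show "(\<lambda>w. z (w @ [l])) \<in> fspan C"
      unfolding z(1) wk.shuffle_snoc 2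
      by (intro fspan_closed(3) C fspan_closed(4) stable_span(3)[OF B(1) b(1) l] stable_span(3)[OF B(3) b(2) l] b)
  qed
  then show ?thesis unfolding RF_def using C B by blast
qed

section \<open>Matrix coefficients\<close>

text \<open>Cut off to words over \<open>L\<close>, the support required of elements of the
  dual.\<close>

definition rhoL :: "'i => 'i => 'i gfun" where
  "rhoL b a w = (if set w \<subseteq> L then rho w b a else 0)"

text \<open>Matrix entries of the representation composed with the antipode.\<close>

definition antiL :: "'i => 'i => 'i gfun" where
  "antiL a c w = (if set w \<subseteq> L then anti w * rho (rev w) a c else 0)"

lemma rhoL_dg: "rhoL b a w \<noteq> 0 ==> dg w = \<gamma> b - \<gamma> a"
  using rho_dg[of w b a] by (auto simp: rhoL_def split: if_splits)

lemma dg_rev: "dg (rev w) = dg w"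
  by (induction w) (simp_all add: add.commute)

lemma antiL_dg: "antiL a c w \<noteq> 0 ==> dg w = \<gamma> a - \<gamma> c"
  using rho_dg[of "rev w" a c] by (auto simp: antiL_def dg_rev split: if_splits)

lemma rhoL_WU: "rhoL b a \<in> WU"
  unfolding WU_def
proof (intro CollectI conjI allI impI ballI)
  fix p assume p: "p \<in> J"
  have "word_eval (rhoL b a) p = word_eval (\<lambda>w. rho w b a) p"
    using J_carrier[OF p] by (intro word_eval_cong) (auto simp: rhoL_def F_carrier)
  then show "word_eval (rhoL b a) p = 0" using word_eval_rho_J[OF p] by simp
qed (simp add: rhoL_def split: if_splits)

lemma antiL_WU: "antiL a c \<in> WU"
  unfolding WU_def
proof (intro CollectI conjI allI impI ballI)
  fix p assume p: "p \<in> J"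
  have "word_eval (antiL a c) p = word_eval (\<lambda>w. anti w * rho (rev w) a c) p"
    using J_carrier[OF p] by (intro word_eval_cong) (auto simp: antiL_def F_carrier)
  also have "\<dots> = word_eval (\<lambda>w. rho w a c) (antipode_poly p)" by (simp add: word_eval_antipode_poly)
  finally show "word_eval (antiL a c) p = 0" using word_eval_rho_J[OF antipode_poly_J[OF p]] by simp
qed (simp add: antiL_def split: if_splits)

lemma rho_snoc: "set w \<subseteq> L ==> b \<in> I ==> (d, c) \<in> L ==> rho (w @ [(d, c)]) b a = (if c = a then rho w b d else 0)"
proof -
  assume w: "set w \<subseteq> L" "b \<in> I" "(d, c) \<in> L"
  have "rho (w @ [(d, c)]) b a = (\<Sum>e\<in>I. if e = d then if c = a then rho w b d else 0 else 0)"
    unfolding rho_append[OF w(1,2)] by (intro sum.cong refl) auto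
  then show ?thesis using w by (simp add: L_def)
qed

text \<open>Removing an outer letter from a path leaves a path with a new end, or the value is
  zero.\<close>

lemma stable_rhoL: "stable ((\<lambda>(b, a). rhoL b a) ` (I \<times> I))"
  unfolding stable_def
proof (intro conjI ballI)
  let ?B = "(\<lambda>(b, a). rhoL b a) ` (I \<times> I)"
  fix f assume "f \<in> ?B"
  then obtain b a where f: "f = rhoL b a" "b \<in> I" "a \<in> I" by auto
  show "\<exists>\<delta>. \<forall>w. f w \<noteq> 0 \<longrightarrow> dg w = \<delta>" using f rhoL_dg by blast
  fix l assume l: "l \<in> L"
  obtain d c where dc: "l = (d, c)" "d \<in> I" "c \<in> I" using l by (auto simp: L_def)
  have "(\<lambda>w. f (l # w)) = (if b = d then rhoL c a else (\<lambda>_. 0))"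
    using l by (auto simp: f dc rhoL_def)
  then show "(\<lambda>w. f (l # w)) \<in> fspan ?B" using f dc by (auto intro!: fspan_closed(1,2))
  have "(\<lambda>w. f (w @ [l])) = (if c = a then rhoL b d else (\<lambda>_. 0))"
    using l by (auto simp: f dc rhoL_def rho_snoc fun_eq_iff)
  then show "(\<lambda>w. f (w @ [l])) \<in> fspan ?B" using f dc by (auto intro!: fspan_closed(1,2))
qed (auto simp: rhoL_WU)

lemma stable_antiL: "stable ((\<lambda>(a, c). antiL a c) ` (I \<times> I))"
  unfolding stable_def
proof (intro conjI ballI)
  let ?B = "(\<lambda>(a, c). antiL a c) ` (I \<times> I)"
  fix f assume "f \<in> ?B"
  then obtain a c where f: "f = antiL a c" "a \<in> I" "c \<in> I" by auto
  show "\<exists>\<delta>. \<forall>w. f w \<noteq> 0 \<longrightarrow> dg w = \<delta>" using f antiL_dg by blast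
  fix l assume l: "l \<in> L"
  obtain d e where de: "l = (d, e)" "d \<in> I" "e \<in> I" using l by (auto simp: L_def)
  have eq: "(\<lambda>w. f (l # w)) = (if e = c then (\<lambda>w. (- \<omega> (letter_deg l) (\<gamma> a - \<gamma> d)) * antiL a d w) else (\<lambda>_. 0))"
  proof
    fix w
    have "word_fac [l] w * antiL a d w = \<omega> (letter_deg l) (\<gamma> a - \<gamma> d) * antiL a d w"
      using antiL_dg[of a d w] by (cases "antiL a d w = 0") (simp_all add: word_fac_def)
    moreover have "f (l # w) = (if e = c then - (word_fac [l] w * antiL a d w) else 0)"
      using l f by (cases "set w \<subseteq> L") (simp_all add: de antiL_def rho_snoc)
    ultimately show "f (l # w) = (if e = c then (\<lambda>w. (- \<omega> (letter_deg l) (\<gamma> a - \<gamma> d)) * antiL a d w) else (\<lambda>_. 0)) w"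
      by simp
  qed
  show "(\<lambda>w. f (l # w)) \<in> fspan ?B"
  proof (cases "e = c")
    case True
    have "antiL a d \<in> ?B" using f de by auto
    then show ?thesis unfolding eq if_P[OF True] by (intro fspan_closed(4) fspan_closed(2))
  next
    case False
    show ?thesis unfolding eq if_not_P[OF False] by (rule fspan_closed(1))
  qed
  have eq: "(\<lambda>w. f (w @ [l])) = (if a = d then (\<lambda>w. (- \<omega> (\<gamma> e - \<gamma> c) (letter_deg l)) * antiL e c w) else (\<lambda>_. 0))"
  proof
    fix w
    have "word_fac w [l] * antiL e c w = \<omega> (\<gamma> e - \<gamma> c) (letter_deg l) * antiL e c w"
      using antiL_dg[of e c w] by (cases "antiL e c w = 0") (simp_all add: word_fac_def)
    moreover have "f (w @ [l]) = (if a = d then - (word_fac w [l] * antiL e c w) else 0)"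
      using l f by (cases "set w \<subseteq> L") (simp_all add: de antiL_def anti_append)
    ultimately show "f (w @ [l]) = (if a = d then (\<lambda>w. (- \<omega> (\<gamma> e - \<gamma> c) (letter_deg l)) * antiL e c w) else (\<lambda>_. 0)) w"
      by simp
  qed
  show "(\<lambda>w. f (w @ [l])) \<in> fspan ?B"
  proof (cases "a = d")
    case True
    have "antiL e c \<in> ?B" using f de by auto
    then show ?thesis unfolding eq if_P[OF True] by (intro fspan_closed(4) fspan_closed(2))
  next
    case False
    show ?thesis unfolding eq if_not_P[OF False] by (rule fspan_closed(1))
  qed
qed (auto simp: antiL_WU)

text \<open>The scalar undoes the factor \<open>\<omega> (d(x), \<gamma> a)\<close> in the
  definition of the matrix coefficients: \<open>rhoL b a\<close> lives on words of degree
  \<open>\<gamma> b - \<gamma> a\<close>, where that factor is constant.\<close>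

definition tw :: "'i => 'i => 'i gfun" where
  "tw b a = (\<lambda>w. \<omega> (\<gamma> a - \<gamma> b) (\<gamma> a) * rhoL b a w)"

text \<open>The entries of the inverse of the matrix \<open>(tw b a)\<close>.\<close>

definition sw :: "'i => 'i => 'i gfun" where
  "sw a c = (\<lambda>w. \<omega> (\<gamma> c) (\<gamma> a - \<gamma> c) * antiL a c w)"

lemma rhoL_RF: "a \<in> I ==> b \<in> I ==> rhoL b a \<in> RF"
  unfolding RF_def using stable_rhoL by (intro CollectI exI conjI fspan_closed(2)) auto

lemma antiL_RF: "a \<in> I ==> c \<in> I ==> antiL a c \<in> RF"
  unfolding RF_def using stable_antiL by (intro CollectI exI conjI fspan_closed(2)) auto

lemma tw_RF: "a \<in> I ==> b \<in> I ==> tw b a \<in> RF"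
  unfolding tw_def by (intro RF_scale rhoL_RF)

lemma tw_dg: "tw b a w \<noteq> 0 ==> dg w = \<gamma> b - \<gamma> a"
  using rhoL_dg[of b a w] by (auto simp: tw_def)

lemma sw_dg: "sw a c w \<noteq> 0 ==> dg w = \<gamma> a - \<gamma> c"
  using antiL_dg[of a c w] by (auto simp: sw_def)

lemma hpart_rho:
  assumes p: "p \<in> hpart F \<alpha>"
  shows "\<omega> \<alpha> (\<gamma> a) * word_eval (tw b a) p = word_eval (\<lambda>w. rho w b a) p"
proof -
  have "word_eval (\<lambda>w. \<omega> \<alpha> (\<gamma> a) * tw b a w) p = word_eval (\<lambda>w. rho w b a) p"
  proof (rule word_eval_cong)
    fix w assume "w \<in> wkeys p"
    then have w: "set w \<subseteq> L" "dg w = \<alpha>" using p by (auto simp: F_hpart)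
    show "\<omega> \<alpha> (\<gamma> a) * tw b a w = rho w b a"
    proof (cases "rho w b a = 0")
      case False
      then have "\<alpha> = \<gamma> b - \<gamma> a" using rho_dg w by blast
      moreover have "\<omega> (\<gamma> b - \<gamma> a) (\<gamma> a) * \<omega> (\<gamma> a - \<gamma> b) (\<gamma> a) = 1"
        using fac_add_left[of "\<gamma> b - \<gamma> a" "\<gamma> a - \<gamma> b" "\<gamma> a"] by simp
      ultimately show ?thesis using w by (simp add: tw_def rhoL_def mult.assoc[symmetric])
    qed (simp add: tw_def rhoL_def)
  qed
  then show ?thesis by (simp add: word_eval_fun_scale)
qed

definition is_mcoeff :: "('i => 'i => 'i env => complex) => bool" where
  "is_mcoeff t \<longleftrightarrow> (\<forall>a\<in>ind V. \<forall>b\<in>ind V. t b a \<in> finite_dual V) \<and>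
     (\<forall>a\<in>ind V. \<forall>\<alpha>. \<forall>x\<in>hpart (env_alg V) \<alpha>.
        env_action V x (bas V a) =
          (\<Sum>b\<in>ind V. scal V (fac V \<alpha> (deg V a) * t b a x) (bas V b)))"

lemma co_sum_bas: "b \<in> I ==> co b (\<Sum>b\<in>I. scal V (c b) (bas V b)) = c b"
proof -
  assume b: "b \<in> I"
  have "co b (\<Sum>b\<in>I. scal V (c b) (bas V b)) = (\<Sum>b'\<in>I. if b' = b then c b else 0)"
    unfolding co_sum co_scale using b by (intro sum.cong refl) (auto simp: co_bas)
  then show ?thesis using b by simp
qed

lemma is_mcoeff_ex: "is_mcoeff (\<lambda>b a. ofw (tw b a))"
  unfolding is_mcoeff_def
proof (intro conjI ballI allI)
  show "ofw (tw b a) \<in> finite_dual V" if "a \<in> I" "b \<in> I" for a b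
    using that by (intro RF_finite_dual tw_RF)
  fix a \<alpha> x assume a: "a \<in> I" and "x \<in> hpart U \<alpha>"
  then obtain p where p: "p \<in> hpart F \<alpha>" "x = cl p" by (auto simp: hpartU_iff)
  note pF = hpart_carrier_F[OF p(1)]
  show "env_action V x (bas V a) = (\<Sum>b\<in>I. scal V (\<omega> \<alpha> (\<gamma> a) * ofw (tw b a) x) (bas V b))"
  proof (rule co_eqI)
    fix b assume b: "b \<in> I"
    have "co b (env_action V x (bas V a)) = word_eval (\<lambda>w. rho w b a) p"
      using entry_env_action[OF pF a b] by (simp add: entry_def p)
    also have "\<dots> = \<omega> \<alpha> (\<gamma> a) * ofw (tw b a) x"
      using hpart_rho[OF p(1)] ofw_cl[OF RF_WU[OF tw_RF[OF a b]] pF] by (simp add: p)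
    finally show "co b (env_action V x (bas V a)) = co b (\<Sum>b\<in>I. scal V (\<omega> \<alpha> (\<gamma> a) * ofw (tw b a) x) (bas V b))"
      by (simp add: co_sum_bas b)
  qed
qed

lemma mcoeff: "is_mcoeff (mcoeff V)"
proof -
  have "mcoeff V = (SOME x. is_mcoeff x)" unfolding mcoeff_def is_mcoeff_def ..
  then show ?thesis using someI[of is_mcoeff, OF is_mcoeff_ex] by (simp only:)
qed

text \<open>The defining equation fixes the chosen family on the classes of words, and these values
  determine a functional.\<close>

lemma mcoeff_eq:
  assumes ab: "a \<in> I" "b \<in> I"
  shows "mcoeff V b a = ofw (tw b a)"
proof (rule dual_eqI)
  note m = mcoeff[unfolded is_mcoeff_def]
  show d: "mcoeff V b a \<in> Udual" using m ab finite_dual_dual by blast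
  show "ofw (tw b a) \<in> Udual" using ab by (intro ofw_dual RF_WU tw_RF)
  have "wf (mcoeff V b a) w = tw b a w" for w
  proof (cases "set w \<subseteq> L")
    case False
    then show ?thesis using WU_support[OF wf_WU[OF d]] WU_support[OF RF_WU[OF tw_RF[OF ab]]] by metis
  next
    case True
    have "env_action V (wcl w) (bas V a) = (\<Sum>b\<in>I. scal V (\<omega> (dg w) (\<gamma> a) * mcoeff V b a (wcl w)) (bas V b))"
      using m ab wcl_hpart[OF True] by blast
    then have "co b (env_action V (wcl w) (bas V a)) = \<omega> (dg w) (\<gamma> a) * mcoeff V b a (wcl w)"
      using co_sum_bas[OF ab(2)] by simp
    moreover have "co b (env_action V (wcl w) (bas V a)) = rho w b a"
      using entry_env_action[OF F_closed(8)[OF True, of 1] ab] by (simp add: entry_def wcl_def)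
    moreover have "\<omega> (dg w) (\<gamma> a) * tw b a w = rho w b a"
      using hpart_rho[of "wsingle w 1" "dg w" a b] True by (simp add: F_hpart)
    ultimately have "\<omega> (dg w) (\<gamma> a) * wf (mcoeff V b a) w = \<omega> (dg w) (\<gamma> a) * tw b a w" by (simp add: wf_def)
    then show ?thesis by simp
  qed
  then show "wf (mcoeff V b a) = wf (ofw (tw b a))" using wf_ofw[OF RF_WU[OF tw_RF[OF ab]]] by auto
qed

section \<open>Matrix coefficients of the dual space\<close>

definition is_dual_mcoeff :: "('i => 'i => 'i env => complex) => bool" where
  "is_dual_mcoeff t \<longleftrightarrow> (\<forall>a\<in>ind V. \<forall>b\<in>ind V. t b a \<in> finite_dual V) \<and>
     (\<forall>a\<in>ind V. \<forall>\<alpha>. \<forall>x\<in>hpart (env_alg V) \<alpha>.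
        dual_action V \<alpha> (- deg V a) x (dual_basis V a) =
          (\<lambda>v. \<Sum>b\<in>ind V. fac V \<alpha> (- deg V a) * t b a x * dual_basis V b v))"

lemma entry_antipode:
  assumes p: "p \<in> carrier F" and ac: "a \<in> I" "c \<in> I"
  shows "entry (env_action V (antipode V (cl p))) a c = word_eval (antiL a c) p"
proof -
  have "word_eval (antiL a c) p = word_eval (\<lambda>w. anti w * rho (rev w) a c) p"
    using p by (intro word_eval_cong) (auto simp: antiL_def F_carrier)
  then show ?thesis
    using entry_env_action[OF antipode_poly_closed[OF p] ac(2,1)] by (simp add: antipode_cl[OF p] word_eval_antipode_poly)
qed

text \<open>The dual action composes a coordinate with the antipode, which exchanges rows and
  columns. The factor \<open>\<omega> \<alpha> (- \<gamma> a)\<close> occurs on both sides, so in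
  contrast to \<open>tw\<close> no scalar enters.\<close>

lemma is_dual_mcoeff_ex: "is_dual_mcoeff (\<lambda>c a. ofw (antiL a c))"
  unfolding is_dual_mcoeff_def
proof (intro conjI ballI allI)
  show "ofw (antiL a b) \<in> finite_dual V" if "a \<in> I" "b \<in> I" for a b
    using that by (intro RF_finite_dual antiL_RF)
  fix a \<alpha> x assume a: "a \<in> I" and "x \<in> hpart U \<alpha>"
  then obtain p where p: "p \<in> hpart F \<alpha>" "x = cl p" by (auto simp: hpartU_iff)
  note pF = hpart_carrier_F[OF p(1)]
  have lin: "lin (env_action V (antipode V x))"
    unfolding p(2) antipode_cl[OF pF] using pF by (intro linear_env_action cl_closed antipode_poly_closed)
  have e: "entry (env_action V (antipode V x)) a c = ofw (antiL a c) x" if "c \<in> I" for c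
    using entry_antipode[OF pF a that] ofw_cl[OF antiL_WU pF] by (simp add: p)
  show "dual_action V \<alpha> (- \<gamma> a) x (co a) = (\<lambda>v. \<Sum>b\<in>I. \<omega> \<alpha> (- \<gamma> a) * ofw (antiL a b) x * co b v)"
    unfolding dual_action_def linear_co[OF lin] using e by (simp add: sum_distrib_left mult.assoc)
qed

lemma dual_mcoeff: "is_dual_mcoeff (dual_mcoeff V)"
proof -
  have "dual_mcoeff V = (SOME x. is_dual_mcoeff x)" unfolding dual_mcoeff_def is_dual_mcoeff_def ..
  then show ?thesis using someI[of is_dual_mcoeff, OF is_dual_mcoeff_ex] by (simp only:)
qed

lemma dual_mcoeff_eq:
  assumes ac: "a \<in> I" "c \<in> I"
  shows "dual_mcoeff V c a = ofw (antiL a c)"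
proof (rule dual_eqI)
  note m = dual_mcoeff[unfolded is_dual_mcoeff_def]
  show d: "dual_mcoeff V c a \<in> Udual" using m ac finite_dual_dual by blast
  show "ofw (antiL a c) \<in> Udual" by (intro ofw_dual antiL_WU)
  have "wf (dual_mcoeff V c a) w = antiL a c w" for w
  proof (cases "set w \<subseteq> L")
    case False
    then show ?thesis using WU_support[OF wf_WU[OF d]] WU_support[OF antiL_WU] by metis
  next
    case True
    have "dual_action V (dg w) (- \<gamma> a) (wcl w) (co a) = (\<lambda>v. \<Sum>b\<in>I. \<omega> (dg w) (- \<gamma> a) * dual_mcoeff V b a (wcl w) * co b v)"
      using m ac wcl_hpart[OF True] by blast
    then have "dual_action V (dg w) (- \<gamma> a) (wcl w) (co a) (bas V c) =
        (\<Sum>b\<in>I. \<omega> (dg w) (- \<gamma> a) * dual_mcoeff V b a (wcl w) * co b (bas V c))" by simp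
    also have "\<dots> = (\<Sum>b\<in>I. if b = c then \<omega> (dg w) (- \<gamma> a) * dual_mcoeff V c a (wcl w) else 0)"
      using ac by (intro sum.cong refl) (auto simp: co_bas)
    finally have "\<omega> (dg w) (- \<gamma> a) * entry (env_action V (antipode V (wcl w))) a c = \<omega> (dg w) (- \<gamma> a) * dual_mcoeff V c a (wcl w)"
      using ac by (simp add: dual_action_def entry_def)
    then show ?thesis
      using entry_antipode[OF F_closed(8)[OF True, of 1] ac] by (simp add: wf_def wcl_def)
  qed
  then show "wf (dual_mcoeff V c a) = wf (ofw (antiL a c))" using wf_ofw[OF antiL_WU] by auto
qed

text \<open>The convolution of the identity with the antipode, in matrix entries. Splitting off the
  leading letter leaves two instances for the shorter word; both vanish unless that word is empty,
  and then they cancel.\<close>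

lemma antipode_rho:
  "set w \<subseteq> L ==> b \<in> I ==> c \<in> I ==>
     split_sum word_fac (\<lambda>u v. \<Sum>a\<in>I. rho u b a * (anti v * rho (rev v) a c)) w = (if w = [] \<and> b = c then 1 else 0)"
proof (induction w arbitrary: b c)
  case Nil
  have "(\<Sum>a\<in>I. rho [] b a * (anti [] * rho (rev []) a c)) = (\<Sum>a\<in>I. if a = b then (if b = c then 1 else 0) else 0)"
    by (intro sum.cong refl) auto
  then show ?case using Nil by simp
next
  case (Cons l w)
  obtain d e where l: "l = (d, e)" by force
  have de: "d \<in> I" "e \<in> I" "set w \<subseteq> L" "(d, e) \<in> L" using Cons.prems l by (auto simp: L_def)
  have 1: "(\<lambda>u v. \<Sum>a\<in>I. rho (l # u) b a * (anti v * rho (rev v) a c)) =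
      (\<lambda>u v. (if b = d then 1 else 0) * (\<Sum>a\<in>I. rho u e a * (anti v * rho (rev v) a c)))"
    by (simp add: l fun_eq_iff)
  have 2: "split_sum word_fac (\<lambda>u v. word_fac [l] u * (\<Sum>a\<in>I. rho u b a * (anti (l # v) * rho (rev (l # v)) a c))) w =
     split_sum word_fac (\<lambda>u v. word_fac [l] u * word_fac [l] v *
       ((if e = c then - 1 else 0) * (\<Sum>a\<in>I. rho u b a * (anti v * rho (rev v) a d)))) w"
  proof (rule split_sum_cong_set)
    fix u v assume "set u \<union> set v = set w"
    then have v: "set (rev v) \<subseteq> L" using de by auto
    have eq: "(\<Sum>a\<in>I. rho u b a * (anti (l # v) * rho (rev (l # v)) a c)) =
        (\<Sum>a\<in>I. word_fac [l] v * ((if e = c then - 1 else 0) * (rho u b a * (anti v * rho (rev v) a d))))"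
      using v de by (intro sum.cong refl) (auto simp: l rho_snoc)
    show "word_fac [l] u * (\<Sum>a\<in>I. rho u b a * (anti (l # v) * rho (rev (l # v)) a c)) =
       word_fac [l] u * word_fac [l] v * ((if e = c then - 1 else 0) * (\<Sum>a\<in>I. rho u b a * (anti v * rho (rev v) a d)))"
      unfolding eq sum_distrib_left[symmetric] mult.assoc ..
  qed
  show ?case
    unfolding split_sum.simps 1 2 wk.split_sum_weight_left split_sum_scale
      Cons.IH[OF de(3,2) Cons.prems(3)] Cons.IH[OF de(3) Cons.prems(2) de(1)]
    by simp
qed

text \<open>Convolution in the other order. For every splitting of the remaining word the two places
  of the leading letter contribute opposite terms, so the sum vanishes without induction.\<close>

lemma antipode_rho':
  "set w \<subseteq> L ==> b \<in> I ==> c \<in> I ==>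
     split_sum word_fac (\<lambda>u v. \<Sum>a\<in>I. anti u * rho (rev u) b a * rho v a c) w = (if w = [] \<and> b = c then 1 else 0)"
proof (cases w)
  case Nil
  assume b: "b \<in> I"
  have "(\<Sum>a\<in>I. anti [] * rho (rev []) b a * rho [] a c) = (\<Sum>a\<in>I. if a = b then (if b = c then 1 else 0) else 0)"
    by (intro sum.cong refl) auto
  then show ?thesis using Nil b by simp
next
  case (Cons l w')
  assume w: "set w \<subseteq> L" and b: "b \<in> I"
  obtain d e where l: "l = (d, e)" by force
  have de: "d \<in> I" "e \<in> I" "set w' \<subseteq> L" "(d, e) \<in> L" using w Cons l by (auto simp: L_def)
  have 1: "(\<Sum>a\<in>I. anti (l # u) * rho (rev (l # u)) b a * rho v a c) = - 1 * (word_fac [l] u * (anti u * rho (rev u) b d * rho v e c))"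
    if "set u \<subseteq> L" for u v
  proof -
    have "(\<Sum>a\<in>I. anti (l # u) * rho (rev (l # u)) b a * rho v a c) =
       (\<Sum>a\<in>I. if a = e then - 1 * (word_fac [l] u * (anti u * rho (rev u) b d * rho v e c)) else 0)"
      using that b de by (intro sum.cong refl) (auto simp: l rho_snoc)
    then show ?thesis using de by simp
  qed
  have 2: "(\<Sum>a\<in>I. anti u * rho (rev u) b a * rho (l # v) a c) = anti u * rho (rev u) b d * rho v e c" for u v
  proof -
    have "(\<Sum>a\<in>I. anti u * rho (rev u) b a * rho (l # v) a c) = (\<Sum>a\<in>I. if a = d then anti u * rho (rev u) b d * rho v e c else 0)"
      by (intro sum.cong refl) (auto simp: l)
    then show ?thesis using de by simp
  qed
  have "split_sum word_fac (\<lambda>u v. \<Sum>a\<in>I. anti (l # u) * rho (rev (l # u)) b a * rho v a c) w' =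
      split_sum word_fac (\<lambda>u v. - 1 * (word_fac [l] u * (anti u * rho (rev u) b d * rho v e c))) w'"
    using de(3) by (intro split_sum_cong_set 1) auto
  then show ?thesis
    unfolding Cons split_sum.simps 2 split_sum_scale by simp
qed

lemma shuffle_support:
  assumes "\<And>w. f w \<noteq> 0 ==> set w \<subseteq> L" "\<And>w. g w \<noteq> 0 ==> set w \<subseteq> L" "(f \<cdot> g) w \<noteq> 0"
  shows "set w \<subseteq> L"
proof -
  obtain u v where "f u \<noteq> 0" "g v \<noteq> 0" "mset w = mset u + mset v" using assms(3) by (rule wk.shuffle_nonzeroE)
  then show ?thesis using assms(1)[of u] assms(2)[of v] by (metis set_mset_mset set_mset_union Un_subset_iff)
qed

lemma tw_support: "tw b a w \<noteq> 0 ==> set w \<subseteq> L"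
  and sw_support: "sw b a w \<noteq> 0 ==> set w \<subseteq> L"
  by (auto simp: tw_def sw_def rhoL_def antiL_def split: if_splits)

text \<open>Common frame of both products of \<open>tw\<close> and \<open>sw\<close>: the scalars of
  the entries must combine with \<open>word_fac\<close> to a factor independent of the summation
  index \<open>a\<close>, which can leave the sum and is 1 for \<open>b = c\<close>.\<close>

lemma matrix_product_entry:
  assumes support: "\<And>a w. f a w \<noteq> 0 ==> set w \<subseteq> L" "\<And>a w. g a w \<noteq> 0 ==> set w \<subseteq> L"
    and fg: "\<And>a u v. set u \<subseteq> L ==> set v \<subseteq> L ==> word_fac u v * f a u * g a v = \<omega> (\<gamma> c) (\<gamma> b - \<gamma> c) * G a u v"
    and G: "\<And>w. set w \<subseteq> L ==> split_sum word_fac (\<lambda>u v. \<Sum>a\<in>I. G a u v) w = (if w = [] \<and> b = c then 1 else 0)"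
  shows "(\<lambda>w. \<Sum>a\<in>I. (f a \<cdot> g a) w) = (if b = c then unit_word else (\<lambda>_. 0))"
proof
  fix w
  show "(\<Sum>a\<in>I. (f a \<cdot> g a) w) = (if b = c then unit_word else (\<lambda>_. 0)) w"
  proof (cases "set w \<subseteq> L")
    case False
    have "(f a \<cdot> g a) w = 0" for a
    proof (rule ccontr)
      assume "(f a \<cdot> g a) w \<noteq> 0"
      then have "set w \<subseteq> L" by (rule shuffle_support[rotated 2]) (erule support(1), erule support(2))
      then show False using False by simp
    qed
    moreover have "w \<noteq> []" using False by auto
    ultimately show ?thesis by (simp add: unit_word_def)
  next
    case True
    have "(\<Sum>a\<in>I. (f a \<cdot> g a) w) = split_sum word_fac (\<lambda>u v. \<Sum>a\<in>I. word_fac u v * f a u * g a v) w"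
      by (simp add: wk.shuffle_def split_sum_sum)
    also have "\<dots> = split_sum word_fac (\<lambda>u v. \<omega> (\<gamma> c) (\<gamma> b - \<gamma> c) * (\<Sum>a\<in>I. G a u v)) w"
      unfolding sum_distrib_left using True by (intro split_sum_cong_set sum.cong refl fg) auto
    also have "\<dots> = \<omega> (\<gamma> c) (\<gamma> b - \<gamma> c) * (if w = [] \<and> b = c then 1 else 0)"
      unfolding split_sum_scale G[OF True] ..
    finally show ?thesis by (simp add: unit_word_def)
  qed
qed

text \<open>After bilinear expansion, the factors pairing \<open>\<gamma> b - \<gamma> a\<close>
  with \<open>\<gamma> a\<close> in both orders cancel, and the rest recombines to a factor free of
  \<open>a\<close>. This accounts for the scalar in the definition of \<open>sw\<close>.\<close>

lemma fac_entries:
  "\<omega> (\<gamma> b - \<gamma> a) (\<gamma> a - \<gamma> c) * \<omega> (\<gamma> a - \<gamma> b) (\<gamma> a) * \<omega> (\<gamma> c) (\<gamma> a - \<gamma> c) = \<omega> (\<gamma> c) (\<gamma> b - \<gamma> c)"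
  "\<omega> (\<gamma> b - \<gamma> a) (\<gamma> a - \<gamma> c) * \<omega> (\<gamma> a) (\<gamma> b - \<gamma> a) * \<omega> (\<gamma> c - \<gamma> a) (\<gamma> c) = \<omega> (\<gamma> c) (\<gamma> b - \<gamma> c)"
proof -
  have 1: "\<omega> (\<gamma> b - \<gamma> a) (\<gamma> a - \<gamma> c) = \<omega> (\<gamma> b - \<gamma> a) (\<gamma> a) * \<omega> (\<gamma> c) (\<gamma> b - \<gamma> a)" by (simp add: fac_diff(2))
  have 2: "\<omega> (\<gamma> c) (\<gamma> b - \<gamma> c) = \<omega> (\<gamma> c) (\<gamma> b - \<gamma> a) * \<omega> (\<gamma> c) (\<gamma> a - \<gamma> c)"
    using fac_add_right[of "\<gamma> c" "\<gamma> b - \<gamma> a" "\<gamma> a - \<gamma> c"] by simp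
  have 3: "\<omega> (\<gamma> c - \<gamma> a) (\<gamma> c) = \<omega> (\<gamma> c) (\<gamma> a - \<gamma> c)" using fac_minus(1)[of "\<gamma> a - \<gamma> c" "\<gamma> c"] by simp
  have 4: "\<omega> (\<gamma> a - \<gamma> b) (\<gamma> a) = \<omega> (\<gamma> a) (\<gamma> b - \<gamma> a)" using fac_minus(1)[of "\<gamma> b - \<gamma> a" "\<gamma> a"] by simp
  have eq: "x * y * z * t = y * t" if "x * z = 1" for x y z t :: complex
    using that by (metis mult.assoc mult.commute mult_1_left)
  show "\<omega> (\<gamma> b - \<gamma> a) (\<gamma> a - \<gamma> c) * \<omega> (\<gamma> a - \<gamma> b) (\<gamma> a) * \<omega> (\<gamma> c) (\<gamma> a - \<gamma> c) = \<omega> (\<gamma> c) (\<gamma> b - \<gamma> c)"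
    "\<omega> (\<gamma> b - \<gamma> a) (\<gamma> a - \<gamma> c) * \<omega> (\<gamma> a) (\<gamma> b - \<gamma> a) * \<omega> (\<gamma> c - \<gamma> a) (\<gamma> c) = \<omega> (\<gamma> c) (\<gamma> b - \<gamma> c)"
    unfolding 1 2 3 4 by (rule eq[OF fac_swap])+
qed

lemma tw_sw:
  assumes bc: "b \<in> I" "c \<in> I"
  shows "(\<lambda>w. \<Sum>a\<in>I. (tw b a \<cdot> sw a c) w) = (if b = c then unit_word else (\<lambda>_. 0))"
proof (rule matrix_product_entry[OF _ _ _ antipode_rho[OF _ bc]])
  fix a u v assume uv: "set u \<subseteq> L" "set v \<subseteq> L"
  show "word_fac u v * tw b a u * sw a c v = \<omega> (\<gamma> c) (\<gamma> b - \<gamma> c) * (rho u b a * (anti v * rho (rev v) a c))"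
  proof (cases "rho u b a = 0 \<or> rho (rev v) a c = 0")
    case False
    then have "dg u = \<gamma> b - \<gamma> a" "dg v = \<gamma> a - \<gamma> c" using rho_dg[of u] rho_dg[of "rev v"] by (auto simp: dg_rev)
    then show ?thesis
      unfolding fac_entries(1)[of b a c, symmetric] using uv
      by (simp add: tw_def sw_def rhoL_def antiL_def word_fac_def mult_ac)
  qed (auto simp: tw_def sw_def rhoL_def antiL_def)
qed (erule tw_support, erule sw_support)

lemma sw_tw:
  assumes bc: "b \<in> I" "c \<in> I"
  shows "(\<lambda>w. \<Sum>a\<in>I. (sw b a \<cdot> tw a c) w) = (if b = c then unit_word else (\<lambda>_. 0))"
proof (rule matrix_product_entry[OF _ _ _ antipode_rho'[OF _ bc]])
  fix a u v assume uv: "set u \<subseteq> L" "set v \<subseteq> L"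
  show "word_fac u v * sw b a u * tw a c v = \<omega> (\<gamma> c) (\<gamma> b - \<gamma> c) * (anti u * rho (rev u) b a * rho v a c)"
  proof (cases "rho (rev u) b a = 0 \<or> rho v a c = 0")
    case False
    then have "dg u = \<gamma> b - \<gamma> a" "dg v = \<gamma> a - \<gamma> c" using rho_dg[of "rev u"] rho_dg[of v] by (auto simp: dg_rev)
    then show ?thesis
      unfolding fac_entries(2)[of b a c, symmetric] using uv
      by (simp add: tw_def sw_def rhoL_def antiL_def word_fac_def mult_ac)
  qed (auto simp: tw_def sw_def rhoL_def antiL_def)
qed (erule sw_support, erule tw_support)

section \<open>Generated subalgebras\<close>

text \<open>The generated subalgebra on the side of functions on words, in a form that allows
  induction over its members.\<close>

inductive_set gen :: "'i gfun set => 'i gfun set" for X where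
  unit: "unit_word \<in> gen X"
| base: "x \<in> X ==> x \<in> gen X"
| add: "f \<in> gen X ==> g \<in> gen X ==> (\<lambda>w. f w + g w) \<in> gen X"
| scale: "f \<in> gen X ==> (\<lambda>w. c * f w) \<in> gen X"
| mult: "f \<in> gen X ==> g \<in> gen X ==> f \<cdot> g \<in> gen X"

lemma gen_RF: "f \<in> gen X ==> X \<subseteq> RF ==> f \<in> RF"
  by (induction rule: gen.induct) (auto intro: RF_unit RF_add RF_scale RF_mult)

lemma ofw_mult: "\<phi> \<in> WU ==> \<psi> \<in> WU ==> ofw \<phi> \<otimes>\<^bsub>A0\<^esub> ofw \<psi> = ofw (\<phi> \<cdot> \<psi>)"
  by (intro dual_eqI fdual_mult(1) ofw_dual WU_mult) (simp_all add: fdual_mult(2) ofw_dual wf_ofw WU_mult)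

lemma generated_carrier:
  assumes X: "X \<subseteq> RF"
  shows "carrier (generated_subalgebra A0 (ofw ` X)) = ofw ` gen X"
proof -
  let ?\<B> = "{B. subring B A0 \<and> (\<forall>c. \<forall>x\<in>B. c \<odot>\<^bsub>A0\<^esub> x \<in> B) \<and> ofw ` X \<subseteq> B}"
  have WU: "f \<in> WU" if "f \<in> gen X" for f using gen_RF[OF that X] RF_WU by blast
  have in_B: "ofw ` gen X \<in> ?\<B>"
  proof (intro CollectI conjI allI ballI)
    show "subring (ofw ` gen X) A0"
    proof (rule subring.intro)
      show "subgroup (ofw ` gen X) (add_monoid A0)"
      proof (rule subgroup.intro)
        show "ofw ` gen X \<subseteq> carrier (add_monoid A0)" using RF_finite_dual gen_RF[OF _ X] by (auto simp: A0_simps)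
        show "\<one>\<^bsub>add_monoid A0\<^esub> \<in> ofw ` gen X"
          using imageI[OF gen.scale[OF gen.unit, of 0 X], of ofw] ofw_scale[of 0 unit_word] by (simp add: A0_simps)
        fix f assume f: "f \<in> ofw ` gen X"
        then obtain \<phi> where \<phi>: "\<phi> \<in> gen X" "f = ofw \<phi>" by blast
        show "f \<otimes>\<^bsub>add_monoid A0\<^esub> g \<in> ofw ` gen X" if "g \<in> ofw ` gen X" for g
        proof -
          obtain \<psi> where \<psi>: "\<psi> \<in> gen X" "g = ofw \<psi>" using \<open>g \<in> ofw ` gen X\<close> by blast
          show ?thesis using imageI[OF gen.add[OF \<phi>(1) \<psi>(1)], of ofw] by (simp add: A0_simps \<phi>(2) \<psi>(2) ofw_add)
        qed
        have fin: "(\<lambda>x. - 1 * f x) \<in> finite_dual V"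
          unfolding \<phi>(2) ofw_scale[symmetric] by (intro RF_finite_dual gen_RF[OF gen.scale X] \<phi>)
        \<comment> \<open>The whole finite dual has not been shown to be a ring, so the additive
          inverse is computed from its description.\<close>
        have "inv\<^bsub>add_monoid A0\<^esub> f = (\<lambda>x. - 1 * f x)"
          unfolding m_inv_def
        proof (rule the_equality)
          show "(\<lambda>x. - 1 * f x) \<in> carrier (add_monoid A0) \<and> f \<otimes>\<^bsub>add_monoid A0\<^esub> (\<lambda>x. - 1 * f x) = \<one>\<^bsub>add_monoid A0\<^esub> \<and>
             (\<lambda>x. - 1 * f x) \<otimes>\<^bsub>add_monoid A0\<^esub> f = \<one>\<^bsub>add_monoid A0\<^esub>"
            using fin by (simp add: A0_simps)
          fix y assume "y \<in> carrier (add_monoid A0) \<and> f \<otimes>\<^bsub>add_monoid A0\<^esub> y = \<one>\<^bsub>add_monoid A0\<^esub> \<and> y \<otimes>\<^bsub>add_monoid A0\<^esub> f = \<one>\<^bsub>add_monoid A0\<^esub>"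
          then have "f x + y x = 0" for x by (simp add: A0_simps fun_eq_iff)
          then show "y = (\<lambda>x. - 1 * f x)" by (auto simp: fun_eq_iff eq_neg_iff_add_eq_0 add.commute)
        qed
        then show "inv\<^bsub>add_monoid A0\<^esub> f \<in> ofw ` gen X"
          unfolding \<phi>(2) using ofw_scale[of "- 1" \<phi>] gen.scale[OF \<phi>(1), of "- 1"] by (metis image_eqI)
      qed
      show "submonoid (ofw ` gen X) A0"
      proof (rule submonoid.intro)
        show "ofw ` gen X \<subseteq> carrier A0" using RF_finite_dual gen_RF[OF _ X] by (auto simp: A0_simps)
        show "\<one>\<^bsub>A0\<^esub> \<in> ofw ` gen X" using gen.unit by (auto simp: A0_simps)
        fix f g assume "f \<in> ofw ` gen X" "g \<in> ofw ` gen X"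
        then show "f \<otimes>\<^bsub>A0\<^esub> g \<in> ofw ` gen X" using ofw_mult WU gen.mult by auto
      qed
    qed
    show "ofw ` X \<subseteq> ofw ` gen X" using gen.base by blast
    fix c f assume "f \<in> ofw ` gen X"
    then obtain \<phi> where \<phi>: "\<phi> \<in> gen X" "f = ofw \<phi>" by blast
    then show "c \<odot>\<^bsub>A0\<^esub> f \<in> ofw ` gen X"
      using gen.scale[OF \<phi>(1), of c] by (auto simp: A0_simps ofw_scale[symmetric])
  qed
  have least: "ofw ` gen X \<subseteq> B" if "B \<in> ?\<B>" for B
  proof -
    have B: "subgroup B (add_monoid A0)" "submonoid B A0" "\<And>c x. x \<in> B ==> c \<odot>\<^bsub>A0\<^esub> x \<in> B" "ofw ` X \<subseteq> B"
      using that by (auto simp: subring_def)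
    have "ofw f \<in> B" if "f \<in> gen X" for f
      using that
    proof (induction rule: gen.induct)
      case unit
      then show ?case using submonoid.one_closed[OF B(2)] by (simp add: A0_simps)
    next
      case (base x)
      then show ?case using B(4) by blast
    next
      case (add f g)
      then show ?case using subgroup.m_closed[OF B(1), of "ofw f" "ofw g"] by (simp add: A0_simps ofw_add)
    next
      case (scale f c)
      then show ?case using B(3)[of "ofw f" c] by (simp add: A0_simps ofw_scale)
    next
      case (mult f g)
      then show ?case using submonoid.m_closed[OF B(2), of "ofw f" "ofw g"] ofw_mult[OF WU WU] by simp
    qed
    then show ?thesis by blast
  qed
  have "\<Inter>?\<B> = ofw ` gen X" by (rule subset_antisym[OF Inter_lower[OF in_B] Inter_greatest[OF least]])
  then show ?thesis by (simp add: generated_subalgebra_def Let_def)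
qed

end

section \<open>Inversions of a permutation\<close>

lemma split_sum_cong_mset:
  assumes "\<And>u v. mset u + mset v = mset w ==> \<beta> u v = \<beta>' u v"
  shows "split_sum k \<beta> w = split_sum k \<beta>' w"
  using assms
proof (induction w arbitrary: \<beta> \<beta>')
  case (Cons l w)
  have "split_sum k (\<lambda>u v. \<beta> (l # u) v) w = split_sum k (\<lambda>u v. \<beta>' (l # u) v) w"
    by (intro Cons.IH Cons.prems) simp
  moreover have "split_sum k (\<lambda>u v. k [l] u * \<beta> u (l # v)) w =
      split_sum k (\<lambda>u v. k [l] u * \<beta>' u (l # v)) w"
    by (intro Cons.IH arg_cong[where f = "(*) _"] Cons.prems) simp
  ultimately show ?case by (simp add: split_sum.simps)
qed simp

definition ordered_pairs :: "nat => (nat \<times> nat) set" where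
  "ordered_pairs n = {(i, j). i < j \<and> j < n}"

definition inversions :: "nat => (nat => nat) => (nat \<times> nat) set" where
  "inversions n \<sigma> = {(i, j). i < j \<and> j < n \<and> \<sigma> j < \<sigma> i}"

lemma finite_ordered_pairs [simp]: "finite (ordered_pairs n)"
  by (rule finite_subset[of _ "{..<n} \<times> {..<n}"]) (auto simp: ordered_pairs_def)

lemma inversions_subset: "inversions n \<sigma> \<subseteq> ordered_pairs n"
  by (auto simp: inversions_def ordered_pairs_def)

lemma finite_inversions [simp]: "finite (inversions n \<sigma>)"
  using finite_subset[OF inversions_subset] by simp

text \<open>Reordering by \<sigma> turns the pairs \<open>i < j\<close> into the pairs
  \<open>(k, l)\<close> with \<open>\<sigma> k < \<sigma> l\<close>. These are the ordered pairs
  with the inversions reversed, and each reversal replaces \<open>f i j\<close> by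
  \<open>f j i\<close>.\<close>

lemma prod_permuted_pairs:
  fixes f :: "nat => nat => 'a::field"
  assumes \<sigma>: "\<sigma> permutes {..<n}" and nz: "\<And>i j. i < n ==> j < n ==> i \<noteq> j ==> f i j \<noteq> 0"
  shows "(\<Prod>(i, j)\<in>ordered_pairs n. f (inv_into UNIV \<sigma> i) (inv_into UNIV \<sigma> j)) =
    (\<Prod>(i, j)\<in>ordered_pairs n. f i j) * (\<Prod>(i, j)\<in>inversions n \<sigma>. f j i / f i j)"
proof -
  define P where "P = {(k, l). k < n \<and> l < n \<and> \<sigma> k < \<sigma> l}"
  define N where "N = ordered_pairs n - inversions n \<sigma>"
  have inv: "\<sigma> (inv_into UNIV \<sigma> i) = i" "inv_into UNIV \<sigma> (\<sigma> i) = i" for i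
    using permutes_inverses[OF \<sigma>] by auto
  have lt: "\<sigma> i < n \<longleftrightarrow> i < n" "inv_into UNIV \<sigma> i < n \<longleftrightarrow> i < n" for i
    using permutes_in_image[OF \<sigma>, of i] permutes_in_image[OF permutes_inv[OF \<sigma>], of i] by auto
  have bij: "bij_betw (\<lambda>(i, j). (inv_into UNIV \<sigma> i, inv_into UNIV \<sigma> j)) (ordered_pairs n) P"
    by (rule bij_betw_byWitness[where f' = "\<lambda>(i, j). (\<sigma> i, \<sigma> j)"])
      (auto simp: ordered_pairs_def P_def inv lt intro: less_trans)
  have "(\<Prod>(i, j)\<in>ordered_pairs n. f (inv_into UNIV \<sigma> i) (inv_into UNIV \<sigma> j)) = (\<Prod>(k, l)\<in>P. f k l)"
    using prod.reindex_bij_betw[OF bij, of "\<lambda>(k, l). f k l"] by (simp add: case_prod_unfold)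
  also have "P = N \<union> prod.swap ` inversions n \<sigma>"
  proof (rule Set.set_eqI, rule iffI)
    fix x assume "x \<in> P"
    then obtain k l where x: "x = (k, l)" "k < n" "l < n" "\<sigma> k < \<sigma> l" by (auto simp: P_def)
    then consider "k < l" | "l < k" by (metis linorder_neqE_nat nat_less_le)
    then show "x \<in> N \<union> prod.swap ` inversions n \<sigma>"
      using x by cases (auto simp: N_def ordered_pairs_def inversions_def image_iff)
  next
    fix x assume "x \<in> N \<union> prod.swap ` inversions n \<sigma>"
    then show "x \<in> P"
    proof
      assume "x \<in> N"
      then obtain k l where x: "x = (k, l)" "k < l" "l < n" "\<not> \<sigma> l < \<sigma> k"
        by (auto simp: N_def ordered_pairs_def inversions_def)
      moreover have "\<sigma> k \<noteq> \<sigma> l" using x by (metis inv(2) nat_less_le)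
      ultimately show ?thesis by (auto simp: P_def)
    qed (auto simp: P_def inversions_def)
  qed
  also have "(\<Prod>(k, l)\<in>N \<union> prod.swap ` inversions n \<sigma>. f k l) =
      (\<Prod>(k, l)\<in>N. f k l) * (\<Prod>(k, l)\<in>prod.swap ` inversions n \<sigma>. f k l)"
    by (rule prod.union_disjoint) (simp_all add: N_def, auto simp: ordered_pairs_def inversions_def)
  also have "(\<Prod>(k, l)\<in>prod.swap ` inversions n \<sigma>. f k l) = (\<Prod>(i, j)\<in>inversions n \<sigma>. f j i)"
    by (subst prod.reindex) (auto simp: case_prod_unfold)
  also have "(\<Prod>(k, l)\<in>N. f k l) * (\<Prod>(i, j)\<in>inversions n \<sigma>. f j i) =
      ((\<Prod>(k, l)\<in>N. f k l) * (\<Prod>(i, j)\<in>inversions n \<sigma>. f i j)) * (\<Prod>(i, j)\<in>inversions n \<sigma>. f j i / f i j)"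
  proof -
    have "(\<Prod>(i, j)\<in>inversions n \<sigma>. f i j) * (\<Prod>(i, j)\<in>inversions n \<sigma>. f j i / f i j) =
        (\<Prod>(i, j)\<in>inversions n \<sigma>. f j i)"
      unfolding prod.distrib[symmetric] using nz
      by (intro prod.cong refl) (force simp: inversions_def)
    then show ?thesis by (simp add: mult.assoc)
  qed
  also have "(\<Prod>(k, l)\<in>N. f k l) * (\<Prod>(i, j)\<in>inversions n \<sigma>. f i j) = (\<Prod>(i, j)\<in>ordered_pairs n. f i j)"
    unfolding N_def using prod.subset_diff[OF inversions_subset finite_ordered_pairs] by metis
  finally show ?thesis .
qed

text \<open>Permuting the arguments of the Vandermonde product changes it by the parity of the
  inversions. Evaluating it at the inverse of the composition in one step and in two steps gives
  multiplicativity.\<close>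

lemma inversions_sign_compose:
  assumes \<sigma>: "\<sigma> permutes {..<n}" and \<pi>: "\<pi> permutes {..<n}"
  shows "((- 1) ^ card (inversions n (\<sigma> \<circ> \<pi>)) :: rat) =
    (- 1) ^ card (inversions n \<sigma>) * (- 1) ^ card (inversions n \<pi>)"
proof -
  define W :: "(nat => nat) => rat" where "W p = (\<Prod>(i, j)\<in>ordered_pairs n. of_nat (p j) - of_nat (p i))" for p
  have W: "W (q \<circ> inv_into UNIV p) = W q * (- 1) ^ card (inversions n p)"
    if p: "p permutes {..<n}" and q: "q permutes {..<n}" for p q
  proof -
    have inj: "q i = q j \<longleftrightarrow> i = j" for i j using permutes_inj[OF q] by (auto dest: injD)
    have "W (q \<circ> inv_into UNIV p) = (\<Prod>(i, j)\<in>ordered_pairs n. of_nat (q j) - of_nat (q i)) *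
        (\<Prod>(i, j)\<in>inversions n p. (of_nat (q i) - of_nat (q j)) / (of_nat (q j) - of_nat (q i)))"
      unfolding W_def o_def by (rule prod_permuted_pairs[OF p, where f = "\<lambda>i j. of_nat (q j) - of_nat (q i)"]) (simp add: inj)
    also have "(\<Prod>(i, j)\<in>inversions n p. (of_nat (q i) - of_nat (q j)) / (of_nat (q j) - of_nat (q i)) :: rat) =
        (\<Prod>(i, j)\<in>inversions n p. - 1)"
    proof (rule prod.cong[OF refl], clarify)
      fix i j assume "(i, j) \<in> inversions n p"
      then have "(of_nat (q j) - of_nat (q i) :: rat) \<noteq> 0" by (auto simp: inj inversions_def)
      then show "(of_nat (q i) - of_nat (q j)) / (of_nat (q j) - of_nat (q i)) = (- 1 :: rat)" by (simp add: field_simps)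
    qed
    finally show ?thesis by (simp add: W_def case_prod_unfold)
  qed
  have W0: "W id \<noteq> 0"
    unfolding W_def prod_zero_iff[OF finite_ordered_pairs] by (auto simp: ordered_pairs_def)
  have inv: "inv_into UNIV (\<sigma> \<circ> \<pi>) = inv_into UNIV \<pi> \<circ> inv_into UNIV \<sigma>"
    using \<sigma> \<pi> by (intro o_inv_distrib permutes_bij)
  have "W id * (- 1) ^ card (inversions n (\<sigma> \<circ> \<pi>)) = W (inv_into UNIV \<pi> \<circ> inv_into UNIV \<sigma>)"
    using W[OF permutes_compose[OF \<pi> \<sigma>] permutes_id] by (simp add: inv)
  also have "\<dots> = W (id \<circ> inv_into UNIV \<pi>) * (- 1) ^ card (inversions n \<sigma>)"
    using W[OF \<sigma> permutes_inv[OF \<pi>]] by simp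
  also have "W (id \<circ> inv_into UNIV \<pi>) = W id * (- 1) ^ card (inversions n \<pi>)"
    by (rule W[OF \<pi> permutes_id])
  finally have "W id * (- 1) ^ card (inversions n (\<sigma> \<circ> \<pi>)) =
      W id * ((- 1) ^ card (inversions n \<sigma>) * (- 1) ^ card (inversions n \<pi>))"
    by (simp only: mult_ac)
  then show ?thesis by (rule iffD1[OF mult_left_cancel[OF W0]])
qed

lemma inversions_transpose:
  assumes "a < b" "b < n"
  shows "odd (card (inversions n (transpose a b)))"
proof -
  have eq: "inversions n (transpose a b) = Pair a ` {a<..b} \<union> (\<lambda>i. (i, b)) ` {a<..<b}"
  proof (rule Set.set_eqI, rule iffI)
    fix x assume "x \<in> inversions n (transpose a b)"
    then show "x \<in> Pair a ` {a<..b} \<union> (\<lambda>i. (i, b)) ` {a<..<b}"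
      using assms by (auto simp: inversions_def transpose_def image_iff split: if_splits)
  next
    fix x assume "x \<in> Pair a ` {a<..b} \<union> (\<lambda>i. (i, b)) ` {a<..<b}"
    then show "x \<in> inversions n (transpose a b)"
      using assms by (auto simp: inversions_def transpose_def)
  qed
  have "card (inversions n (transpose a b)) = card (Pair a ` {a<..b}) + card ((\<lambda>i. (i, b)) ` {a<..<b})"
    unfolding eq by (rule card_Un_disjoint) auto
  also have "\<dots> = (b - a) + (b - a - 1)"
    by (simp add: card_image inj_on_def)
  finally show ?thesis using assms by simp
qed

text \<open>Links the inversions in the action on tensor powers with the sign in Leibniz'
  formula.\<close>

lemma sign_inversions:
  assumes "\<sigma> permutes {..<n}"
  shows "rat_of_int (sign \<sigma>) = (- 1) ^ card (inversions n \<sigma>)"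
  using assms finite_lessThan
proof (induction \<sigma> rule: permutes_induct)
  case id
  have "inversions n id = {}" by (auto simp: inversions_def)
  then show ?case by (simp only: sign_id of_int_1 card.empty power_0)
next
  case (swap a b p)
  have pp: "p permutes {..<n}" using swap by blast
  have t: "(- 1 :: rat) ^ card (inversions n (transpose a b)) = - 1"
  proof (cases "a < b")
    case True
    then show ?thesis using inversions_transpose[of a b n] swap by simp
  next
    case False
    then show ?thesis using inversions_transpose[of b a n] swap by (simp add: transpose_commute)
  qed
  have tp: "transpose a b permutes {..<n}" using swap by (intro permutes_swap_id)
  have sg: "sign (transpose a b \<circ> p) = sign (transpose a b) * sign p"
    by (rule sign_compose) (meson permutation_permutes finite_lessThan tp pp)+
  show ?case
    unfolding sg inversions_sign_compose[OF tp pp] t using swap by (simp add: sign_swap_id)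
qed

section \<open>Untwisting the commutation factor\<close>

context word_commutation
begin

text \<open>The splitting sum with the factor of the shuffle product included. By
  \<open>twisted_sum_Cons\<close> the weight then falls on a letter that joins \<open>u\<close> and
  passes \<open>v\<close>, instead of one that joins \<open>v\<close>.\<close>

definition twisted_sum :: "('l list => 'l list => complex) => 'l list => complex" where
  "twisted_sum \<beta> w = split_sum k (\<lambda>u v. k u v * \<beta> u v) w"

lemma twisted_sum_Nil [simp]: "twisted_sum \<beta> [] = \<beta> [] []"
  by (simp add: twisted_sum_def)

lemma twisted_sum_Cons:
  "twisted_sum \<beta> (l # w) = twisted_sum (\<lambda>u v. k [l] v * \<beta> (l # u) v) w + twisted_sum (\<lambda>u v. \<beta> u (l # v)) w"
proof -
  have 1: "(\<lambda>u v. k (l # u) v * \<beta> (l # u) v) = (\<lambda>u v. k u v * (k [l] v * \<beta> (l # u) v))"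
    by (simp add: fun_eq_iff k_Cons_left mult_ac)
  have 2: "(\<lambda>u v. k [l] u * (k u (l # v) * \<beta> u (l # v))) = (\<lambda>u v. k u v * \<beta> u (l # v))"
    by (simp add: fun_eq_iff k_Cons_left k_Cons_right mult.assoc k_letter_swap)
  show ?thesis unfolding twisted_sum_def split_sum.simps 1 2 ..
qed

lemma twisted_sum_scale: "twisted_sum (\<lambda>u v. c * \<beta> u v) w = c * twisted_sum \<beta> w"
  unfolding twisted_sum_def split_sum_scale[symmetric] by (simp add: mult_ac)

lemma twisted_sum_cong: "(\<And>u v. mset u + mset v = mset w ==> \<beta> u v = \<beta>' u v) ==> twisted_sum \<beta> w = twisted_sum \<beta>' w"
  unfolding twisted_sum_def by (rule split_sum_cong_mset) simp

lemma shuffle_twisted_sum: "shuffle f g w = twisted_sum (\<lambda>u v. f u * g v) w"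
  by (simp add: shuffle_def twisted_sum_def mult.assoc)

end

context graded_basis
begin

text \<open>Parity of a basis vector: by \<open>fac_self\<close> the value in question is 1 or -1,
  so these are the indices belonging to \<open>V\<^sub>-\<close>.\<close>

definition par :: "'i => bool" where
  "par a \<longleftrightarrow> \<omega> (\<gamma> a) (\<gamma> a) \<noteq> 1"

definition eps :: "'i => 'i => complex" where
  "eps a b = (if par a \<and> par b then - 1 else 1)"

lemma fac_self: "\<omega> \<alpha> \<alpha> = 1 \<or> \<omega> \<alpha> \<alpha> = - 1"
  using fac_swap[of \<alpha> \<alpha>] by (simp add: square_eq_1_iff)

text \<open>An arbitrary numbering, which only decides whether \<open>sg a b\<close> or
  \<open>sg b a\<close> carries the commutation factor.\<close>

definition num :: "'i => nat" where
  "num = (SOME f. inj_on f I)"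

lemma num_inj: "a \<in> I ==> b \<in> I ==> num a = num b \<longleftrightarrow> a = b"
proof -
  have "\<exists>f :: 'i => nat. inj_on f I" using finite_imp_inj_to_nat_seg[OF finite_I] by blast
  then have "inj_on num I" unfolding num_def by (rule someI_ex)
  then show "a \<in> I ==> b \<in> I ==> num a = num b \<longleftrightarrow> a = b" by (auto dest: inj_onD)
qed

text \<open>A bimultiplicative function on the free abelian group over \<open>I\<close> whose antisymmetrisation turns the
  commutation factor into the sign of supercommutation.\<close>

definition sg :: "'i => 'i => complex" where
  "sg a b = (if num a < num b then eps a b * \<omega> (\<gamma> b) (\<gamma> a) else 1)"

lemma sg_nonzero [simp]: "sg a b \<noteq> 0"
  by (simp add: sg_def eps_def)

lemma sg_self [simp]: "sg a a = 1"
  by (simp add: sg_def)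

lemma eps_sym: "eps a b = eps b a" and eps_sq [simp]: "eps a b * eps a b = 1" "eps a b * (eps a b * x) = x"
  and eps_nonzero [simp]: "eps a b \<noteq> 0"
  by (auto simp: eps_def)

text \<open>Off the diagonal one of the two values of \<open>sg\<close> is 1 and the other contains
  all of \<omega>; on the diagonal \<omega> is already the sign \<open>eps\<close>.\<close>

lemma fac_sg: "a \<in> I ==> b \<in> I ==> \<omega> (\<gamma> a) (\<gamma> b) = eps a b * sg b a / sg a b"
proof -
  assume ab: "a \<in> I" "b \<in> I"
  consider "num a < num b" | "num b < num a" | "a = b" using num_inj[OF ab] by linarith
  then show ?thesis
  proof cases
    case 1
    have "eps a b / (eps a b * \<omega> (\<gamma> b) (\<gamma> a)) = inverse (\<omega> (\<gamma> b) (\<gamma> a))" by (simp add: field_simps)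
    then show ?thesis using 1 fac_inverse[of "\<gamma> a" "\<gamma> b"] by (simp add: sg_def)
  next
    case 2
    then show ?thesis by (simp add: sg_def eps_sym[of b a])
  next
    case 3
    then show ?thesis using fac_self[of "\<gamma> a"] by (auto simp: eps_def par_def)
  qed
qed

text \<open>Bimultiplicative extension of \<open>sg\<close> to the free abelian group over
  \<open>I\<close>, whose elements are given as integer vectors.\<close>

definition sgh :: "('i => int) => ('i => int) => complex" where
  "sgh x y = (\<Prod>a\<in>I. \<Prod>b\<in>I. sg a b powi (x a * y b))"

definition unit_vec :: "'i => 'i => int" where
  "unit_vec a c = (if c = a then 1 else 0)"

lemma sgh_nonzero [simp]: "sgh x y \<noteq> 0"
  by (simp add: sgh_def)

lemma sgh_add_left: "sgh (\<lambda>c. x c + x' c) y = sgh x y * sgh x' y"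
  by (simp add: sgh_def distrib_right power_int_add prod.distrib)

lemma sgh_add_right: "sgh y (\<lambda>c. x c + x' c) = sgh y x * sgh y x'"
  by (simp add: sgh_def distrib_left power_int_add prod.distrib)

lemma sgh_zero [simp]: "sgh (\<lambda>c. 0) y = 1" "sgh y (\<lambda>c. 0) = 1"
  by (simp_all add: sgh_def)

lemma sgh_diff_left: "sgh (\<lambda>c. x c - x' c) y = sgh x y / sgh x' y"
  using sgh_add_left[of "\<lambda>c. x c - x' c" x' y] by (simp add: field_simps)

lemma sgh_diff_right: "sgh y (\<lambda>c. x c - x' c) = sgh y x / sgh y x'"
  using sgh_add_right[of y "\<lambda>c. x c - x' c" x'] by (simp add: field_simps)

lemma sgh_unit: "a \<in> I ==> b \<in> I ==> sgh (unit_vec a) (unit_vec b) = sg a b"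
proof -
  assume ab: "a \<in> I" "b \<in> I"
  have "sgh (unit_vec a) (unit_vec b) = (\<Prod>a'\<in>I. \<Prod>b'\<in>I. if b' = b then if a' = a then sg a b else 1 else 1)"
    unfolding sgh_def by (intro prod.cong refl) (auto simp: unit_vec_def)
  also have "\<dots> = sg a b" using ab by simp
  finally show ?thesis .
qed

definition letter_vec :: "'i \<times> 'i => 'i => int" where
  "letter_vec l c = unit_vec (fst l) c - unit_vec (snd l) c"

text \<open>Degree of a word in the free abelian group over \<open>I\<close>. It refines
  \<open>dg\<close>, by \<open>dv_eq_dg\<close>.\<close>

fun dv :: "'i gword => 'i => int" where
  "dv [] = (\<lambda>c. 0)"
| "dv (l # w) = (\<lambda>c. letter_vec l c + dv w c)"

lemma dv_sum_mset: "dv w c = sum_mset (image_mset (\<lambda>l. letter_vec l c) (mset w))"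
  by (induction w) simp_all

lemma dv_mset: "mset u + mset v = mset w ==> dv w = (\<lambda>c. dv u c + dv v c)"
proof
  fix c assume eq: "mset u + mset v = mset w"
  show "dv w c = dv u c + dv v c" unfolding dv_sum_mset eq[symmetric] by simp
qed

lemma dv_rev: "dv (rev w) = dv w"
  by (auto simp: fun_eq_iff dv_sum_mset)

definition lift_letter :: "'i \<times> 'i => ('i \<times> 'i) \<times> bool" where
  "lift_letter l = (l, par (fst l) \<noteq> par (snd l))"

definition lift_word :: "'i gword => (('i \<times> 'i) \<times> bool) list" where
  "lift_word w = map lift_letter w"

lemma lift_word_simps [simp]: "lift_word [] = []" "lift_word (l # w) = lift_letter l # lift_word w"
  "lift_word (u @ v) = lift_word u @ lift_word v" "map fst (lift_word w) = w"
  by (simp_all add: lift_word_def lift_letter_def o_def)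

lemma super_sign_letters: "super_sign [lift_letter (b, a)] [lift_letter (d, c)] = eps b d * eps a c * eps b c * eps a d"
  by (simp add: super_sign_def odd_word_def lift_letter_def eps_def)

text \<open>The ratios of \<open>sg\<close> in \<open>fac_sg\<close> are those between the values of
  \<open>sgh\<close> at two letters in both orders, so that of \<omega> only the sign of
  supercommutation is left.\<close>

lemma fac_letters:
  assumes I: "a \<in> I" "b \<in> I" "c \<in> I" "d \<in> I"
  shows "\<omega> (\<gamma> b - \<gamma> a) (\<gamma> d - \<gamma> c) * sgh (letter_vec (b, a)) (letter_vec (d, c)) =
    super_sign [lift_letter (b, a)] [lift_letter (d, c)] * sgh (letter_vec (d, c)) (letter_vec (b, a))"
proof -
  have s: "sgh (letter_vec (b, a)) (letter_vec (d, c)) = (sg b d / sg b c) / (sg a d / sg a c)"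
    if "a \<in> I" "b \<in> I" "c \<in> I" "d \<in> I" for a b c d
    using that by (simp add: letter_vec_def[abs_def] sgh_diff_left sgh_diff_right sgh_unit)
  have inv: "\<omega> (\<gamma> x) (\<gamma> y) = eps x y * sg y x / sg x y" if "x \<in> I" "y \<in> I" for x y
    using fac_sg that by blast
  have "\<omega> (\<gamma> b - \<gamma> a) (\<gamma> d - \<gamma> c) = \<omega> (\<gamma> b) (\<gamma> d) * \<omega> (\<gamma> c) (\<gamma> b) * (\<omega> (\<gamma> d) (\<gamma> a) * \<omega> (\<gamma> a) (\<gamma> c))"
    by (simp add: fac_diff mult_ac)
  also have "\<dots> = (eps b d * sg d b / sg b d) * (eps c b * sg b c / sg c b) * ((eps d a * sg a d / sg d a) * (eps a c * sg c a / sg a c))"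
    using I by (simp add: inv)
  finally show ?thesis
    unfolding s[OF I] s[OF I(3,4,1,2)] super_sign_letters eps_sym[of c b] eps_sym[of d a] by (simp add: field_simps)
qed

lemma fac_letter_word:
  assumes l: "l \<in> L" and w: "set w \<subseteq> L"
  shows "word_fac [l] w * sgh (letter_vec l) (dv w) = super_sign [lift_letter l] (lift_word w) * sgh (dv w) (letter_vec l)"
  using w
proof (induction w)
  case (Cons m w)
  obtain b a d c where lm: "l = (b, a)" "m = (d, c)" by force
  have I: "a \<in> I" "b \<in> I" "c \<in> I" "d \<in> I" using l Cons.prems lm by (auto simp: L_def)
  have m: "word_fac [l] [m] * sgh (letter_vec l) (letter_vec m) = super_sign [lift_letter l] [lift_letter m] * sgh (letter_vec m) (letter_vec l)"
    using fac_letters[OF I] by (simp add: lm word_fac_def)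
  have "word_fac [l] (m # w) = word_fac [l] [m] * word_fac [l] w"
    "super_sign [lift_letter l] (lift_letter m # lift_word w) = super_sign [lift_letter l] [lift_letter m] * super_sign [lift_letter l] (lift_word w)"
    using wk.k_append_right[of "[l]" "[m]" w] super.k_append_right[of "[lift_letter l]" "[lift_letter m]" "lift_word w"] by simp_all
  then have "word_fac [l] (m # w) * sgh (letter_vec l) (dv (m # w)) =
      (word_fac [l] [m] * sgh (letter_vec l) (letter_vec m)) * (word_fac [l] w * sgh (letter_vec l) (dv w))"
    by (simp add: sgh_add_right)
  also have "\<dots> = super_sign [lift_letter l] (lift_word (m # w)) * sgh (dv (m # w)) (letter_vec l)"
    using m Cons by (simp add: sgh_add_left super.k_append_right[of "[lift_letter l]" "[lift_letter m]" "lift_word w", simplified])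
  finally show ?case .
qed simp

text \<open>Product of \<open>sgh\<close> over all pairs of letters, the later letter in the left
  argument. Its dependence on the order of the letters is what absorbs \<omega>.\<close>

fun rt :: "'i gfun" where
  "rt [] = 1"
| "rt (l # w) = sgh (dv w) (letter_vec l) * rt w"

lemma rt_nonzero [simp]: "rt w \<noteq> 0"
  by (induction w) simp_all

text \<open>Induction on the leading letter \<open>l\<close>. If it joins \<open>u\<close>, its
  commutation factor with \<open>v\<close> is traded for a sign by \<open>fac_letter_word\<close>.
  In either case the factors with \<open>l\<close> combine to
  \<open>sgh (dv w) (letter_vec l)\<close>, as the degrees of \<open>u\<close> and \<open>v\<close>
  add up to that of \<open>w\<close>, and this is the factor gained by \<open>rt\<close>.\<close>

lemma twist_sum:
  "set w \<subseteq> L ==> wk.twisted_sum (\<lambda>u v. rt u * rt v * sgh (dv u) (dv v) * B (lift_word u) (lift_word v)) w =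
     rt w * super.twisted_sum B (lift_word w)"
proof (induction w arbitrary: B)
  case (Cons l w)
  have w: "set w \<subseteq> L" "l \<in> L" using Cons.prems by auto
  have A: "wk.twisted_sum (\<lambda>u v. word_fac [l] v * (rt (l # u) * rt v * sgh (dv (l # u)) (dv v) * B (lift_word (l # u)) (lift_word v))) w =
     wk.twisted_sum (\<lambda>u v. sgh (dv w) (letter_vec l) * (rt u * rt v * sgh (dv u) (dv v) *
       (super_sign [lift_letter l] (lift_word v) * B (lift_letter l # lift_word u) (lift_word v)))) w"
  proof (rule wk.twisted_sum_cong)
    fix u v assume uv: "mset u + mset v = mset w"
    then have v: "set v \<subseteq> L" using w by (metis Un_subset_iff set_mset_mset set_mset_union)
    have "word_fac [l] v * (rt (l # u) * rt v * sgh (dv (l # u)) (dv v) * B (lift_word (l # u)) (lift_word v)) =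
       (word_fac [l] v * sgh (letter_vec l) (dv v)) * (sgh (dv u) (letter_vec l) * (rt u * rt v * sgh (dv u) (dv v) * B (lift_letter l # lift_word u) (lift_word v)))"
      by (simp add: sgh_add_left mult_ac)
    then show "word_fac [l] v * (rt (l # u) * rt v * sgh (dv (l # u)) (dv v) * B (lift_word (l # u)) (lift_word v)) =
      sgh (dv w) (letter_vec l) * (rt u * rt v * sgh (dv u) (dv v) *
       (super_sign [lift_letter l] (lift_word v) * B (lift_letter l # lift_word u) (lift_word v)))"
      unfolding fac_letter_word[OF w(2) v] dv_mset[OF uv] by (simp add: sgh_add_left mult_ac)
  qed
  have B: "wk.twisted_sum (\<lambda>u v. rt u * rt (l # v) * sgh (dv u) (dv (l # v)) * B (lift_word u) (lift_word (l # v))) w =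
     wk.twisted_sum (\<lambda>u v. sgh (dv w) (letter_vec l) * (rt u * rt v * sgh (dv u) (dv v) *
       B (lift_word u) (lift_letter l # lift_word v))) w"
  proof (rule wk.twisted_sum_cong)
    fix u v assume uv: "mset u + mset v = mset w"
    show "rt u * rt (l # v) * sgh (dv u) (dv (l # v)) * B (lift_word u) (lift_word (l # v)) =
      sgh (dv w) (letter_vec l) * (rt u * rt v * sgh (dv u) (dv v) * B (lift_word u) (lift_letter l # lift_word v))"
      unfolding dv_mset[OF uv] by (simp add: sgh_add_left sgh_add_right mult_ac)
  qed
  show ?case
    unfolding wk.twisted_sum_Cons A B
    unfolding wk.twisted_sum_scale Cons.IH[OF w(1), of "\<lambda>u v. super_sign [lift_letter l] v * B (lift_letter l # u) v"]
      Cons.IH[OF w(1), of "\<lambda>u v. B u (lift_letter l # v)"]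
    unfolding lift_word_simps super.twisted_sum_Cons rt.simps
    by (simp add: algebra_simps)
qed simp

text \<open>Words in which each letter carries its correct parity; on all others the images under
  \<open>theta\<close> are zero.\<close>

definition lifted :: "(('i \<times> 'i) \<times> bool) list => bool" where
  "lifted w \<longleftrightarrow> (\<forall>l\<in>set w. fst l \<in> L \<and> l = lift_letter (fst l))"

lemma lifted_lift: "lifted (lift_word w) \<longleftrightarrow> set w \<subseteq> L"
  by (auto simp: lifted_def lift_word_def lift_letter_def)

lemma lifted_eq: "lifted w ==> w = lift_word (map fst w)"
  by (induction w) (simp_all add: lifted_def)

lemma lifted_set: "lifted w ==> set (map fst w) \<subseteq> L"
  by (auto simp: lifted_def)

text \<open>Dividing by \<open>rt\<close> turns the twisted shuffle product into the supercommutative one, up to a factor \<open>sgh\<close>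
  that depends only on the degrees in the free abelian group.\<close>

definition theta :: "'i gfun => ('i \<times> 'i) sfun" where
  "theta f = Sfun (\<lambda>w. if lifted w then f (map fst w) / rt (map fst w) else 0)"

lemma sfun_val_theta: "sfun_val (theta f) w = (if lifted w then f (map fst w) / rt (map fst w) else 0)"
  by (simp add: theta_def Sfun_inverse)

lemma theta_lift: "set w \<subseteq> L ==> sfun_val (theta f) (lift_word w) = f w / rt w"
  by (simp add: sfun_val_theta lifted_lift)

lemma sfun_eqI: "(\<And>w. sfun_val f w = sfun_val g w) ==> f = g"
  by (simp add: sfun_val_inject[symmetric] fun_eq_iff)

lemma theta_add: "theta (\<lambda>w. f w + g w) = theta f + theta g"
  by (rule sfun_eqI) (simp add: sfun_val_theta plus_sfun.rep_eq add_divide_distrib)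

lemma theta_zero: "theta (\<lambda>w. 0) = 0"
  by (rule sfun_eqI) (simp add: sfun_val_theta zero_sfun.rep_eq)

lemma theta_minus: "theta (\<lambda>w. - 1 * f w) = - theta f"
  by (rule sfun_eqI) (simp add: sfun_val_theta uminus_sfun.rep_eq)

lemma theta_sum: "theta (\<lambda>w. \<Sum>i\<in>A. f i w) = (\<Sum>i\<in>A. theta (f i))"
  by (induction A rule: infinite_finite_induct) (simp_all add: theta_zero theta_add)

lemma theta_unit: "theta unit_word = 1"
proof (rule sfun_eqI)
  fix w show "sfun_val (theta unit_word) w = sfun_val 1 w"
    by (cases w) (simp_all add: sfun_val_theta one_sfun.rep_eq unit_word_def lifted_def)
qed

lemma theta_inj:
  assumes "\<And>w. f w \<noteq> 0 ==> set w \<subseteq> L" "\<And>w. g w \<noteq> 0 ==> set w \<subseteq> L" "theta f = theta g"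
  shows "f = g"
proof
  fix w
  show "f w = g w"
  proof (cases "set w \<subseteq> L")
    case True
    then show ?thesis using theta_lift[OF True, of f] theta_lift[OF True, of g] assms(3) by simp
  next
    case False
    then have "f w = 0" "g w = 0" using assms(1,2) by blast+
    then show ?thesis by simp
  qed
qed

lemma theta_mult:
  assumes c: "\<And>u v. f u \<noteq> 0 ==> g v \<noteq> 0 ==> sgh (dv u) (dv v) = c"
  shows "theta f * theta g = theta (\<lambda>w. c * (f \<cdot> g) w)"
proof (rule sfun_eqI)
  fix w'
  show "sfun_val (theta f * theta g) w' = sfun_val (theta (\<lambda>w. c * (f \<cdot> g) w)) w'"
  proof (cases "lifted w'")
    case True
    define w where "w = map fst w'"
    have w': "w' = lift_word w" and w: "set w \<subseteq> L" using lifted_eq[OF True] lifted_set[OF True] by (simp_all add: w_def)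
    have "rt w * sfun_val (theta f * theta g) w' = rt w * super.twisted_sum (\<lambda>u v. sfun_val (theta f) u * sfun_val (theta g) v) (lift_word w)"
      by (simp add: times_sfun.rep_eq super.shuffle_twisted_sum w')
    also have "\<dots> = wk.twisted_sum (\<lambda>u v. rt u * rt v * sgh (dv u) (dv v) * (sfun_val (theta f) (lift_word u) * sfun_val (theta g) (lift_word v))) w"
      by (rule twist_sum[OF w, symmetric])
    also have "\<dots> = wk.twisted_sum (\<lambda>u v. c * (f u * g v)) w"
    proof (rule wk.twisted_sum_cong)
      fix u v assume "mset u + mset v = mset w"
      then have uv: "set u \<subseteq> L" "set v \<subseteq> L" using w by (metis Un_subset_iff set_mset_mset set_mset_union)+
      show "rt u * rt v * sgh (dv u) (dv v) * (sfun_val (theta f) (lift_word u) * sfun_val (theta g) (lift_word v)) = c * (f u * g v)"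
        using c[of u v] by (cases "f u = 0"; cases "g v = 0") (simp_all add: theta_lift uv)
    qed
    also have "\<dots> = c * (f \<cdot> g) w" unfolding wk.twisted_sum_scale wk.shuffle_twisted_sum ..
    also have "\<dots> = rt w * sfun_val (theta (\<lambda>w. c * (f \<cdot> g) w)) w'"
      by (simp add: w' theta_lift[OF w])
    finally show ?thesis by simp
  next
    case False
    have "sfun_val (theta f * theta g) w' = 0"
    proof (rule ccontr)
      assume "sfun_val (theta f * theta g) w' \<noteq> 0"
      then obtain u v where "sfun_val (theta f) u \<noteq> 0" "sfun_val (theta g) v \<noteq> 0" "mset w' = mset u + mset v"
        unfolding times_sfun.rep_eq by (rule super.shuffle_nonzeroE)
      moreover from this have "lifted u" "lifted v" by (auto simp: sfun_val_theta split: if_splits)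
      moreover have "set w' = set u \<union> set v" using \<open>mset w' = mset u + mset v\<close> by (metis set_mset_mset set_mset_union)
      ultimately show False using False by (auto simp: lifted_def)
    qed
    then show ?thesis using False by (simp add: sfun_val_theta)
  qed
qed

definition vhom :: "('i => int) => 'i gfun => bool" where
  "vhom x f \<longleftrightarrow> (\<forall>w. f w \<noteq> 0 \<longrightarrow> dv w = x)"

lemma theta_vhom_mult: "vhom x f ==> vhom y g ==> theta f * theta g = theta (\<lambda>w. sgh x y * (f \<cdot> g) w)"
  by (rule theta_mult) (simp add: vhom_def)

lemma vhom_mult: "vhom x f ==> vhom y g ==> vhom (\<lambda>c. x c + y c) (f \<cdot> g)"
  unfolding vhom_def
proof (intro allI impI)
  fix w assume fg: "\<forall>w. f w \<noteq> 0 \<longrightarrow> dv w = x" "\<forall>w. g w \<noteq> 0 \<longrightarrow> dv w = y" "(f \<cdot> g) w \<noteq> 0"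
  from fg(3) obtain u v where "f u \<noteq> 0" "g v \<noteq> 0" "mset w = mset u + mset v" by (rule wk.shuffle_nonzeroE)
  then show "dv w = (\<lambda>c. x c + y c)" using fg(1,2) dv_mset[of u v w] by simp
qed

lemma vhom_scale: "vhom x f ==> vhom x (\<lambda>w. c * f w)"
  by (simp add: vhom_def)

lemma vhom_unit: "vhom (\<lambda>c. 0) unit_word"
  by (simp add: vhom_def unit_word_def)

text \<open>\<open>theta\<close> respects products of homogeneous elements only, up to a scalar;
  this gives induction over sums of homogeneous members of the algebra.\<close>

inductive hsum :: "'i gfun set => 'i gfun => bool" for X where
  hsum_zero: "hsum X (\<lambda>w. 0)"
| hsum_base: "f \<in> gen X ==> vhom x f ==> hsum X f"
| hsum_add: "hsum X f ==> hsum X g ==> hsum X (\<lambda>w. f w + g w)"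

lemma hsum_scale: "hsum X f ==> hsum X (\<lambda>w. c * f w)"
proof (induction rule: hsum.induct)
  case (hsum_base f x)
  then show ?case using hsum.hsum_base[OF gen.scale vhom_scale] by blast
next
  case (hsum_add f g)
  then show ?case using hsum.hsum_add[of X "\<lambda>w. c * f w" "\<lambda>w. c * g w"] by (simp add: distrib_left)
qed (simp add: hsum.hsum_zero)

lemma hsum_mult: "hsum X f ==> hsum X g ==> hsum X (f \<cdot> g)"
proof (induction rule: hsum.induct)
  case (hsum_base f x)
  from hsum_base(3) show ?case
  proof (induction rule: hsum.induct)
    case (hsum_base g y)
    then show ?case using hsum.hsum_base[OF gen.mult vhom_mult] \<open>f \<in> gen X\<close> \<open>vhom x f\<close> by blast
  qed (simp_all add: wk.shuffle_zero_right wk.shuffle_add_right hsum.hsum_zero hsum.hsum_add)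
qed (simp_all add: wk.shuffle_zero_left wk.shuffle_add_left hsum.hsum_zero hsum.hsum_add)

lemma gen_hsum: "f \<in> gen X ==> (\<And>x. x \<in> X ==> \<exists>v. vhom v x) ==> hsum X f"
proof (induction rule: gen.induct)
  case unit
  show ?case by (rule hsum_base[OF gen.unit vhom_unit])
next
  case (base x)
  then show ?case using hsum_base[OF gen.base] by blast
qed (auto intro: hsum_add hsum_scale hsum_mult)

lemma gen_zero: "(\<lambda>w. 0) \<in> gen X"
  using gen.scale[OF gen.unit, of 0] by simp

text \<open>Although \<open>theta\<close> is not multiplicative, the image is closed under products:
  in an expansion into homogeneous summands each product is the image of a scalar multiple of a
  member. Hence the determinant argument applies to the images of \<open>T\<close> and of the
  coordinate algebra.\<close>

lemma subring_theta_gen: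
  assumes X: "\<And>x. x \<in> X ==> \<exists>v. vhom v x"
  shows "subring_set (theta ` gen X)"
  unfolding subring_set_def
proof (intro conjI ballI)
  show "1 \<in> theta ` gen X" using theta_unit gen.unit by (metis image_eqI)
  fix a assume "a \<in> theta ` gen X"
  then obtain f where f: "f \<in> gen X" "a = theta f" by blast
  show "- a \<in> theta ` gen X" unfolding f(2) theta_minus[symmetric] by (intro imageI gen.scale f(1))
  fix b assume "b \<in> theta ` gen X"
  then obtain g where g: "g \<in> gen X" "b = theta g" by blast
  show "a + b \<in> theta ` gen X" unfolding f(2) g(2) theta_add[symmetric] by (intro imageI gen.add f(1) g(1))
  have "hsum X f" "hsum X g" using gen_hsum f g X by blast+
  then have "theta f * theta g \<in> theta ` gen X"
  proof (induction rule: hsum.induct)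
    case hsum_zero
    show ?case using imageI[OF gen_zero, of theta] by (simp add: theta_zero)
  next
    case (hsum_base f x)
    from hsum_base(3) show ?case
    proof (induction rule: hsum.induct)
      case hsum_zero
      show ?case using imageI[OF gen_zero, of theta] by (simp add: theta_zero)
    next
      case (hsum_base g y)
      then show ?case unfolding theta_vhom_mult[OF \<open>vhom x f\<close> \<open>vhom y g\<close>]
        using \<open>f \<in> gen X\<close> by (intro imageI gen.scale gen.mult)
    next
      case (hsum_add g g')
      then obtain h h' where h: "h \<in> gen X" "h' \<in> gen X" "theta f * theta g = theta h" "theta f * theta g' = theta h'" by blast
      show ?case unfolding theta_add[of g g'] distrib_left h(3,4) unfolding theta_add[symmetric] by (intro imageI gen.add h)
    qed
  next
    case (hsum_add f f')
    then obtain h h' where h: "h \<in> gen X" "h' \<in> gen X" "theta f * theta g = theta h" "theta f' * theta g = theta h'" by blast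
    show ?case unfolding theta_add[of f f'] distrib_right h(3,4) unfolding theta_add[symmetric] by (intro imageI gen.add h)
  qed
  then show "a * b \<in> theta ` gen X" using f g by simp
qed

subsection \<open>The untwisted matrix of generators\<close>

lemma rho_dv: "rho w b a \<noteq> 0 ==> dv w = (\<lambda>c. unit_vec b c - unit_vec a c)"
  by (induction w b a rule: rho.induct) (auto simp: letter_vec_def fun_eq_iff split: if_splits)

lemma rho_parity: "rho w b a \<noteq> 0 ==> odd_word (lift_word w) \<longleftrightarrow> par b \<noteq> par a"
  by (induction w b a rule: rho.induct)
    (auto simp: odd_word_def lift_letter_def split: if_splits)

lemma odd_word_lift_rev: "odd_word (lift_word (rev w)) = odd_word (lift_word w)"
  by (simp add: odd_word_def lift_word_def rev_map[symmetric] rev_filter[symmetric] del: rev_map)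

lemma tw_vhom: "vhom (\<lambda>c. unit_vec b c - unit_vec a c) (tw b a)"
  using rho_dv by (auto simp: vhom_def tw_def rhoL_def split: if_splits)

lemma antiL_vhom: "vhom (\<lambda>c. unit_vec a c - unit_vec b c) (antiL a b)"
  using rho_dv[of "rev w" for w] by (auto simp: vhom_def antiL_def dv_rev split: if_splits)

lemma sw_vhom: "vhom (\<lambda>c. unit_vec a c - unit_vec b c) (sw a b)"
  unfolding sw_def by (rule vhom_scale[OF antiL_vhom])

text \<open>The scalar compensates \<open>sgh\<close> in matrix products: the degrees of the entries
  \<open>(b, a)\<close> and \<open>(a, c)\<close> give \<open>sg b a / sg b c * sg a c\<close>, of
  which only the factor free of \<open>a\<close> is left.\<close>

definition tau :: "'i => 'i => ('i \<times> 'i) sfun" where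
  "tau b a = theta (\<lambda>w. inverse (sg b a) * tw b a w)"

definition tau' :: "'i => 'i => ('i \<times> 'i) sfun" where
  "tau' a c = theta (\<lambda>w. inverse (sg a c) * sw a c w)"

lemma theta_parity:
  assumes "\<And>w. f w \<noteq> 0 ==> odd_word (lift_word w) = p"
  shows "if p then sfun_odd (theta f) else sfun_even (theta f)"
proof -
  have "odd_word w = p" if "sfun_val (theta f) w \<noteq> 0" for w
  proof -
    have "lifted w" "f (map fst w) \<noteq> 0" using that by (auto simp: sfun_val_theta split: if_splits)
    then show ?thesis using assms lifted_eq by metis
  qed
  then show ?thesis unfolding sfun_odd.rep_eq sfun_even.rep_eq by (cases p) auto
qed

lemma tau_parity: "if par b \<noteq> par a then sfun_odd (tau b a) else sfun_even (tau b a)"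
  unfolding tau_def by (rule theta_parity) (use rho_parity in \<open>auto simp: tw_def rhoL_def split: if_splits\<close>)

lemma tau'_parity: "if par b \<noteq> par a then sfun_odd (tau' b a) else sfun_even (tau' b a)"
  unfolding tau'_def
proof (rule theta_parity)
  fix w assume "inverse (sg b a) * sw b a w \<noteq> 0"
  then have "rho (rev w) b a \<noteq> 0" by (auto simp: sw_def antiL_def split: if_splits)
  then show "odd_word (lift_word w) = (par b \<noteq> par a)" using rho_parity[of "rev w" b a] odd_word_lift_rev by simp
qed

lemma tau_tau':
  assumes bc: "b \<in> I" "c \<in> I"
  shows "(\<Sum>a\<in>I. tau b a * tau' a c) = (if b = c then 1 else 0)"
proof -
  have "tau b a * tau' a c = theta (\<lambda>w. inverse (sg b c) * (tw b a \<cdot> sw a c) w)" if "a \<in> I" for a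
  proof -
    have s: "sgh (\<lambda>c. unit_vec b c - unit_vec a c) (\<lambda>d. unit_vec a d - unit_vec c d) = sg b a / sg b c * sg a c"
      using that bc by (simp add: sgh_diff_left sgh_diff_right sgh_unit)
    have "tau b a * tau' a c = theta (\<lambda>w. sgh (\<lambda>c. unit_vec b c - unit_vec a c) (\<lambda>d. unit_vec a d - unit_vec c d) *
        ((\<lambda>w. inverse (sg b a) * tw b a w) \<cdot> (\<lambda>w. inverse (sg a c) * sw a c w)) w)"
      unfolding tau_def tau'_def by (intro theta_vhom_mult vhom_scale tw_vhom sw_vhom)
    then show ?thesis unfolding s wk.shuffle_scale_left wk.shuffle_scale_right by (simp add: field_simps)
  qed
  then have "(\<Sum>a\<in>I. tau b a * tau' a c) = theta (\<lambda>w. inverse (sg b c) * (\<Sum>a\<in>I. (tw b a \<cdot> sw a c) w))"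
    by (simp add: theta_sum[symmetric] sum_distrib_left)
  also have "\<dots> = (if b = c then 1 else 0)"
    using tw_sw[OF bc] by (auto simp: fun_eq_iff theta_unit theta_zero intro: arg_cong[of _ _ theta])
  finally show ?thesis .
qed

subsection \<open>Coaction coefficients\<close>

fun ccw :: "'i list => 'i list => 'i gfun" where
  "ccw [] [] = unit_word"
| "ccw (b # u) (a # w) = (\<lambda>z. \<omega> (\<gamma> a - \<gamma> b) (word_deg \<gamma> u) * (tw b a \<cdot> ccw u w) z)"
| "ccw _ _ = (\<lambda>z. 0)"

definition tset :: "'i gfun set" where
  "tset = {tw b a | a b. a \<in> I \<and> b \<in> I}"

definition tsset :: "'i gfun set" where
  "tsset = tset \<union> {antiL a c | a c. a \<in> I \<and> c \<in> I}"

lemma tset_RF: "tset \<subseteq> RF" and tsset_RF: "tsset \<subseteq> RF"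
  using tw_RF antiL_RF by (auto simp: tset_def tsset_def)

lemma gen_mono: "X \<subseteq> Y ==> gen X \<subseteq> gen Y"
proof
  fix f assume XY: "X \<subseteq> Y" "f \<in> gen X"
  from XY(2) show "f \<in> gen Y"
    by (induction rule: gen.induct) (use XY(1) in \<open>auto intro: gen.intros\<close>)
qed

lemma coaction_coeff_eq:
  "set u \<subseteq> I ==> set w \<subseteq> I ==> coaction_coeff V u w = ofw (ccw u w) \<and> ccw u w \<in> gen tset"
proof (induction u w rule: ccw.induct)
  case (2 b u a w)
  have ab: "a \<in> I" "b \<in> I" and IH: "coaction_coeff V u w = ofw (ccw u w)" "ccw u w \<in> gen tset" using 2 by auto
  have t: "tw b a \<in> gen tset" using ab by (intro gen.base) (auto simp: tset_def)
  have "mcoeff V b a \<otimes>\<^bsub>A0\<^esub> coaction_coeff V u w = ofw (tw b a \<cdot> ccw u w)"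
    unfolding mcoeff_eq[OF ab] IH(1) using RF_WU[OF gen_RF[OF t tset_RF]] RF_WU[OF gen_RF[OF IH(2) tset_RF]] by (rule ofw_mult)
  then show ?case using gen.scale[OF gen.mult[OF t IH(2)]] by (simp add: A0_simps ofw_scale)
qed (auto simp: A0_simps gen.unit gen_zero ofw_def[abs_def] word_eval_def)

section \<open>Scalars of untwisted products of matrix entries\<close>

fun cnt :: "'i list => 'i => int" where
  "cnt [] = (\<lambda>c. 0)"
| "cnt (a # w) = (\<lambda>c. unit_vec a c + cnt w c)"

lemma ccw_vhom: "vhom (\<lambda>c. cnt u c - cnt w c) (ccw u w)"
proof (induction u w rule: ccw.induct)
  case (2 b u a w)
  have "(\<lambda>c. (unit_vec b c - unit_vec a c) + (cnt u c - cnt w c)) = (\<lambda>c. cnt (b # u) c - cnt (a # w) c)"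
    by (simp add: fun_eq_iff)
  then show ?case using vhom_scale[OF vhom_mult[OF tw_vhom 2], of b a] by simp
qed (simp_all add: vhom_unit, simp_all add: vhom_def)

text \<open>Product of \<open>sg\<close> over the pairs of positions \<open>i < j\<close>. In
  \<open>theta_ccw\<close> it is the only part of the scalar that depends on the order of the column
  indices.\<close>

fun row_prod :: "'i list => complex" where
  "row_prod [] = 1"
| "row_prod (a # w) = sgh (unit_vec a) (cnt w) * row_prod w"

fun col_prod :: "'i list => complex" where
  "col_prod [] = 1"
| "col_prod (b # u) = sgh (cnt u) (unit_vec b) * col_prod u"

fun tau_prod :: "'i list => 'i list => ('i \<times> 'i) sfun" where
  "tau_prod [] [] = 1"
| "tau_prod (b # u) (a # w) = tau b a * tau_prod u w"
| "tau_prod _ _ = 0"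

lemma row_prod_nonzero [simp]: "row_prod w \<noteq> 0" and col_prod_nonzero [simp]: "col_prod w \<noteq> 0"
  by (induction w) simp_all

text \<open>For \<open>a\<close> and \<open>b\<close> of equal parity the two signs
  \<open>eps\<close> cancel; inside a diagonal block nothing of supercommutation remains.\<close>

lemma fac_same_parity:
  assumes ab: "a \<in> I" "b \<in> I" "par a = par b" and u: "set u \<subseteq> I"
  shows "\<omega> (\<gamma> a - \<gamma> b) (word_deg \<gamma> u) = sgh (\<lambda>c. unit_vec b c - unit_vec a c) (cnt u) / sgh (cnt u) (\<lambda>c. unit_vec b c - unit_vec a c)"
  using u
proof (induction u)
  case (Cons c u)
  have c: "c \<in> I" using Cons by simp
  have "\<omega> (\<gamma> a - \<gamma> b) (\<gamma> c) = \<omega> (\<gamma> a) (\<gamma> c) * \<omega> (\<gamma> c) (\<gamma> b)" by (rule fac_diff)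
  also have "\<dots> = (eps a c * sg c a / sg a c) * (eps c b * sg b c / sg c b)" using ab c by (simp add: fac_sg)
  also have "\<dots> = (sg b c / sg a c) / (sg c b / sg c a)"
    using ab(3) by (simp add: eps_def)
  also have "\<dots> = sgh (\<lambda>c. unit_vec b c - unit_vec a c) (unit_vec c) / sgh (unit_vec c) (\<lambda>c. unit_vec b c - unit_vec a c)"
    using ab c by (simp add: sgh_diff_left sgh_diff_right sgh_unit)
  finally have 1: "\<omega> (\<gamma> a - \<gamma> b) (\<gamma> c) = sgh (\<lambda>c. unit_vec b c - unit_vec a c) (unit_vec c) / sgh (unit_vec c) (\<lambda>c. unit_vec b c - unit_vec a c)" .
  have "\<omega> (\<gamma> a - \<gamma> b) (word_deg \<gamma> (c # u)) = \<omega> (\<gamma> a - \<gamma> b) (\<gamma> c) * \<omega> (\<gamma> a - \<gamma> b) (word_deg \<gamma> u)"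
    by (simp add: word_deg_def fac_add_right)
  then show ?case using 1 Cons by (simp add: sgh_add_left sgh_add_right)
qed (simp add: word_deg_def)

text \<open>The commutation factor in the recursion of the coaction is swallowed by the
  \<open>sgh\<close> that appears when \<open>theta\<close> meets a product, leaving scalars
  attached to \<open>u\<close> and \<open>w\<close> alone and one that depends only on their letter
  counts.\<close>

lemma theta_ccw:
  assumes "length u = length w" "set u \<subseteq> I" "set w \<subseteq> I" "\<forall>a\<in>set u \<union> set w. par a = p"
  shows "tau_prod u w = theta (\<lambda>z. row_prod w * col_prod u / sgh (cnt u) (cnt w) * ccw u w z)"
  using assms
proof (induction u w rule: list_induct2)
  case Nil
  then show ?case by (simp add: theta_unit)
next
  case (Cons b u a w)
  let ?x = "\<lambda>c. unit_vec b c - unit_vec a c" and ?y = "\<lambda>c. cnt u c - cnt w c"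
  let ?k = "row_prod w * col_prod u / sgh (cnt u) (cnt w)"
  have ab: "a \<in> I" "b \<in> I" "par a = par b" "set u \<subseteq> I" using Cons by auto
  have IH: "tau_prod u w = theta (\<lambda>z. ?k * ccw u w z)" using Cons by simp
  have "tau b a * tau_prod u w = theta (\<lambda>z. sgh ?x ?y * ((\<lambda>w. inverse (sg b a) * tw b a w) \<cdot> (\<lambda>z. ?k * ccw u w z)) z)"
    unfolding IH tau_def by (intro theta_vhom_mult vhom_scale tw_vhom ccw_vhom)
  also have "\<dots> = theta (\<lambda>z. sgh ?x ?y * inverse (sg b a) * ?k * (tw b a \<cdot> ccw u w) z)"
    unfolding wk.shuffle_scale_left wk.shuffle_scale_right by (simp add: mult_ac)
  also have "sgh ?x ?y * inverse (sg b a) * ?k =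
     row_prod (a # w) * col_prod (b # u) / sgh (cnt (b # u)) (cnt (a # w)) * \<omega> (\<gamma> a - \<gamma> b) (word_deg \<gamma> u)"
    unfolding fac_same_parity[OF ab]
    using ab by (simp add: sgh_diff_left sgh_diff_right sgh_add_left sgh_add_right sgh_unit field_simps)
  finally show ?case by (simp add: mult.assoc)
qed

end

section \<open>Rings of fractions inside an overring\<close>

text \<open>Operations on fractions are unions over all representatives; they are computed by
  showing that every choice yields the same class.\<close>

lemma UN_constant_pairs:
  assumes "\<And>a d b e. (a, d) \<in> X ==> (b, e) \<in> Y ==> f a d b e = Z" "X \<noteq> {}" "Y \<noteq> {}"
  shows "(\<Union>(a, d)\<in>X. \<Union>(b, e)\<in>Y. f a d b e) = Z"
proof -
  obtain a d b e where ne: "(a, d) \<in> X" "(b, e) \<in> Y" using assms(2,3) by fast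
  show ?thesis
  proof (rule subset_antisym)
    show "(\<Union>(a, d)\<in>X. \<Union>(b, e)\<in>Y. f a d b e) \<subseteq> Z" using assms(1) by fast
    show "Z \<subseteq> (\<Union>(a, d)\<in>X. \<Union>(b, e)\<in>Y. f a d b e)" using assms(1)[OF ne] ne by fast
  qed
qed

lemma UN_constant_pair:
  assumes "\<And>a d. (a, d) \<in> X ==> f a d = Z" "X \<noteq> {}"
  shows "(\<Union>(a, d)\<in>X. f a d) = Z"
proof -
  obtain a d where ne: "(a, d) \<in> X" using assms(2) by fast
  show ?thesis
  proof (rule subset_antisym)
    show "(\<Union>(a, d)\<in>X. f a d) \<subseteq> Z" using assms(1) by fast
    show "Z \<subseteq> (\<Union>(a, d)\<in>X. f a d)" using assms(1)[OF ne] ne by fast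
  qed
qed

text \<open>Localisation described inside an overring: the members of \<open>D\<close> are central
  units of \<open>B\<close>, \<open>D_pr\<close> expresses that they have degree 0, and each element
  of \<open>B\<close> has a denominator in \<open>D\<close>.\<close>

locale central_fractions = B: graded_algebra B pr
  for B :: "('a, 'g::ab_group_add) galg" (structure) and pr :: "'g => 'a => 'a" +
  fixes A :: "('a, 'g) galg" and D :: "'a set"
  assumes A_sub: "carrier A \<subseteq> carrier B" and A_ring: "ring A"
    and A_ops: "mult A = mult B" "one A = one B" "zero A = zero B" "add A = add B" "module.smult A = module.smult B"
    and A_hpart: "\<And>\<alpha>. hpart A \<alpha> = hpart B \<alpha> \<inter> carrier A"
    and A_smult: "\<And>c x. x \<in> carrier A ==> c \<odot> x \<in> carrier A"
    and D_sub: "D \<subseteq> carrier A" and D_one: "\<one> \<in> D"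
    and D_mult: "\<And>d e. d \<in> D ==> e \<in> D ==> d \<otimes> e \<in> D"
    and D_central: "\<And>d x. d \<in> D ==> x \<in> carrier B ==> d \<otimes> x = x \<otimes> d"
    and D_unit: "\<And>d. d \<in> D ==> \<exists>e\<in>carrier B. e \<otimes> d = \<one>"
    and D_pr: "\<And>d x \<alpha>. d \<in> D ==> x \<in> carrier B ==> pr \<alpha> (d \<otimes> x) = d \<otimes> pr \<alpha> x"
    and clear: "\<And>x. x \<in> carrier B ==> \<exists>d\<in>D. d \<otimes> x \<in> carrier A"
begin

sublocale A: ring A by (rule A_ring)

lemma A_B: "a \<in> carrier A ==> a \<in> carrier B" and D_A: "d \<in> D ==> d \<in> carrier A" and D_B: "d \<in> D ==> d \<in> carrier B"
  using A_sub D_sub by auto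

lemma cancel:
  assumes d: "d \<in> D" and xy: "x \<in> carrier B" "y \<in> carrier B" "d \<otimes> x = d \<otimes> y"
  shows "x = y"
proof -
  obtain e where e: "e \<in> carrier B" "e \<otimes> d = \<one>" using D_unit[OF d] by blast
  have *: "e \<otimes> (d \<otimes> z) = z" if "z \<in> carrier B" for z
    using B.m_assoc[OF e(1) D_B[OF d] that] e that by simp
  show ?thesis using *[OF xy(1)] *[OF xy(2)] unfolding xy(3) by (rule trans[OF sym])
qed

lemma A_minus: "x \<in> carrier A ==> y \<in> carrier A ==> x \<ominus>\<^bsub>A\<^esub> y = x \<ominus> y"
proof -
  assume xy: "x \<in> carrier A" "y \<in> carrier A"
  have "\<ominus>\<^bsub>A\<^esub> y \<oplus>\<^bsub>A\<^esub> y = \<zero>\<^bsub>A\<^esub>" using A.l_neg[OF xy(2)] .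
  then have "\<ominus> y = \<ominus>\<^bsub>A\<^esub> y"
    unfolding A_ops by (rule B.minus_equality[OF _ A_B[OF xy(2)] A_B[OF A.a_inv_closed[OF xy(2)]]])
  then show ?thesis by (simp add: a_minus_def A_ops)
qed

definition embed :: "'a => ('a \<times> 'a) set" where
  "embed x = {(a, d). a \<in> carrier A \<and> d \<in> D \<and> a = d \<otimes> x}"

text \<open>Members of \<open>D\<close> are units of \<open>B\<close> and can be cancelled, so the
  condition \<open>u(ad' - a'd) = 0\<close> on fractions amounts to
  \<open>a' = d' x\<close>.\<close>

lemma fraction_eq:
  assumes x: "x \<in> carrier B" and d: "d \<in> D" and a: "d \<otimes> x \<in> carrier A"
  shows "fraction A D (d \<otimes> x) d = embed x"
proof -
  have "(\<exists>u\<in>D. u \<otimes>\<^bsub>A\<^esub> ((d \<otimes> x) \<otimes>\<^bsub>A\<^esub> d' \<ominus>\<^bsub>A\<^esub> a' \<otimes>\<^bsub>A\<^esub> d) = \<zero>\<^bsub>A\<^esub>) \<longleftrightarrow> a' = d' \<otimes> x"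
    if a': "a' \<in> carrier A" and d': "d' \<in> D" for a' d'
  proof -
    have in_A: "(d \<otimes> x) \<otimes> d' \<in> carrier A" "a' \<otimes> d \<in> carrier A"
      using A.m_closed[OF a D_A[OF d']] A.m_closed[OF a' D_A[OF d]] by (simp_all add: A_ops)
    note in_B = A_B[OF in_A(1)] A_B[OF in_A(2)]
    have eq: "(d \<otimes> x) \<otimes> d' = d \<otimes> (d' \<otimes> x)" "a' \<otimes> d = d \<otimes> a'"
      using x D_B[OF d] D_B[OF d'] A_B[OF a'] D_central[OF d' x] D_central[OF d A_B[OF a']] by (simp_all add: B.m_assoc)
    show ?thesis
    proof
      assume "\<exists>u\<in>D. u \<otimes>\<^bsub>A\<^esub> ((d \<otimes> x) \<otimes>\<^bsub>A\<^esub> d' \<ominus>\<^bsub>A\<^esub> a' \<otimes>\<^bsub>A\<^esub> d) = \<zero>\<^bsub>A\<^esub>"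
      then obtain u where u: "u \<in> D" "u \<otimes> ((d \<otimes> x) \<otimes> d' \<ominus> a' \<otimes> d) = \<zero>"
        unfolding A_ops A_minus[OF in_A] by (elim bexE)
      have "(d \<otimes> x) \<otimes> d' \<ominus> a' \<otimes> d = \<zero>"
        by (rule cancel[OF u(1)]) (use in_B u D_B[OF u(1)] in simp_all)
      then have "(d \<otimes> x) \<otimes> d' = a' \<otimes> d" using B.r_right_minus_eq[OF in_B] by simp
      then have "d \<otimes> a' = d \<otimes> (d' \<otimes> x)" unfolding eq by (rule sym)
      then show "a' = d' \<otimes> x" by (rule cancel[OF d A_B[OF a'] B.m_closed[OF D_B[OF d'] x]])
    next
      assume "a' = d' \<otimes> x"
      then have "(d \<otimes> x) \<otimes> d' = a' \<otimes> d" unfolding eq by simp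
      then have "(d \<otimes> x) \<otimes> d' \<ominus> a' \<otimes> d = \<zero>" using B.r_right_minus_eq[OF in_B] by simp
      then show "\<exists>u\<in>D. u \<otimes>\<^bsub>A\<^esub> ((d \<otimes> x) \<otimes>\<^bsub>A\<^esub> d' \<ominus>\<^bsub>A\<^esub> a' \<otimes>\<^bsub>A\<^esub> d) = \<zero>\<^bsub>A\<^esub>"
        unfolding A_ops A_minus[OF in_A] by (intro bexI[OF _ D_one]) simp
    qed
  qed
  then show ?thesis unfolding fraction_def embed_def by (intro Collect_cong) (simp add: case_prod_unfold, blast)
qed

lemma fraction_embed: "a \<in> carrier A ==> d \<in> D ==> x \<in> carrier B ==> a = d \<otimes> x ==> fraction A D a d = embed x"
  using fraction_eq by blast

lemma embedE:
  assumes "x \<in> carrier B"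
  obtains d where "d \<in> D" "d \<otimes> x \<in> carrier A" "(d \<otimes> x, d) \<in> embed x"
  using clear[OF assms] by (auto simp: embed_def)

lemma embed_nonempty: "x \<in> carrier B ==> embed x \<noteq> {}"
  using embedE by (metis empty_iff)

lemma embed_inj: "inj_on embed (carrier B)"
proof (rule inj_onI)
  fix x y assume xy: "x \<in> carrier B" "y \<in> carrier B" "embed x = embed y"
  obtain d where d: "d \<in> D" "(d \<otimes> x, d) \<in> embed x" using embedE[OF xy(1)] by metis
  then have "d \<otimes> x = d \<otimes> y" unfolding xy(3) by (simp add: embed_def)
  then show "x = y" using cancel d xy by blast
qed

lemma divide: "a \<in> carrier A ==> d \<in> D ==> \<exists>x\<in>carrier B. a = d \<otimes> x"
proof -
  assume a: "a \<in> carrier A" and d: "d \<in> D"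
  obtain e where e: "e \<in> carrier B" "e \<otimes> d = \<one>" using D_unit[OF d] by blast
  have "d \<otimes> (e \<otimes> a) = a"
    using B.m_assoc[OF D_B[OF d] e(1) A_B[OF a]] D_central[OF d e(1)] e(2) A_B[OF a] by simp
  then show ?thesis using e A_B[OF a] by (intro bexI[of _ "e \<otimes> a"]) simp_all
qed

abbreviation "Fr \<equiv> fraction_alg A D"

lemma Fr_carrier: "carrier Fr = embed ` carrier B"
proof (rule subset_antisym; rule subsetI)
  fix X assume "X \<in> carrier Fr"
  then obtain a d where X: "X = fraction A D a d" "a \<in> carrier A" "d \<in> D" by (auto simp: fraction_alg_def)
  obtain x where x: "x \<in> carrier B" "a = d \<otimes> x" using divide[OF X(2,3)] by blast
  show "X \<in> embed ` carrier B" unfolding X(1) fraction_embed[OF X(2,3) x] using x(1) by blast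
next
  fix X assume "X \<in> embed ` carrier B"
  then obtain x where x: "x \<in> carrier B" "X = embed x" by blast
  obtain d where d: "d \<in> D" "d \<otimes> x \<in> carrier A" using embedE[OF x(1)] by metis
  show "X \<in> carrier Fr" unfolding x(2) fraction_eq[OF x(1) d, symmetric] using d by (auto simp: fraction_alg_def)
qed

lemma embedD:
  assumes "(a, d) \<in> embed x"
  shows "a \<in> carrier A" "d \<in> D" "a = d \<otimes> x"
proof -
  have "a \<in> carrier A \<and> d \<in> D \<and> a = d \<otimes> x" using assms unfolding embed_def mem_Collect_eq case_prod_conv .
  then show "a \<in> carrier A" "d \<in> D" "a = d \<otimes> x" by blast+
qed

lemma swap_products:
  assumes "d \<in> D" "e \<in> D" "x \<in> carrier B" "y \<in> carrier B"
  shows "(d \<otimes> x) \<otimes> (e \<otimes> y) = (d \<otimes> e) \<otimes> (x \<otimes> y)"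
proof -
  note c = D_B[OF assms(1)] D_B[OF assms(2)] assms(3,4)
  have "x \<otimes> (e \<otimes> y) = e \<otimes> (x \<otimes> y)"
    using c by (simp flip: B.m_assoc add: D_central[OF assms(2,3)])
  then show ?thesis using c by (simp add: B.m_assoc)
qed

lemma Fr_mult: "x \<in> carrier B ==> y \<in> carrier B ==> embed x \<otimes>\<^bsub>Fr\<^esub> embed y = embed (x \<otimes> y)"
proof -
  assume xy: "x \<in> carrier B" "y \<in> carrier B"
  have "fraction A D (a \<otimes>\<^bsub>A\<^esub> b) (d \<otimes>\<^bsub>A\<^esub> e) = embed (x \<otimes> y)"
    if "(a, d) \<in> embed x" "(b, e) \<in> embed y" for a d b e
  proof (rule fraction_embed)
    note h = embedD[OF that(1)] and h' = embedD[OF that(2)]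
    show "a \<otimes>\<^bsub>A\<^esub> b \<in> carrier A" by (rule A.m_closed[OF h(1) h'(1)])
    show "d \<otimes>\<^bsub>A\<^esub> e \<in> D" unfolding A_ops by (rule D_mult[OF h(2) h'(2)])
    show "a \<otimes>\<^bsub>A\<^esub> b = d \<otimes>\<^bsub>A\<^esub> e \<otimes> (x \<otimes> y)" unfolding A_ops h(3) h'(3) by (rule swap_products[OF h(2) h'(2) xy])
  qed (use xy in simp)
  then show ?thesis unfolding fraction_alg_def using embed_nonempty xy by (simp add: UN_constant_pairs)
qed

lemma Fr_add: "x \<in> carrier B ==> y \<in> carrier B ==> embed x \<oplus>\<^bsub>Fr\<^esub> embed y = embed (x \<oplus> y)"
proof -
  assume xy: "x \<in> carrier B" "y \<in> carrier B"
  have "fraction A D (a \<otimes>\<^bsub>A\<^esub> e \<oplus>\<^bsub>A\<^esub> b \<otimes>\<^bsub>A\<^esub> d) (d \<otimes>\<^bsub>A\<^esub> e) = embed (x \<oplus> y)"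
    if "(a, d) \<in> embed x" "(b, e) \<in> embed y" for a d b e
  proof (rule fraction_embed)
    note h = embedD[OF that(1)] and h' = embedD[OF that(2)]
    show "a \<otimes>\<^bsub>A\<^esub> e \<oplus>\<^bsub>A\<^esub> b \<otimes>\<^bsub>A\<^esub> d \<in> carrier A"
      by (rule A.a_closed[OF A.m_closed[OF h(1) D_A[OF h'(2)]] A.m_closed[OF h'(1) D_A[OF h(2)]]])
    show "d \<otimes>\<^bsub>A\<^esub> e \<in> D" unfolding A_ops by (rule D_mult[OF h(2) h'(2)])
    have "d \<in> D" "e \<in> D" by (rule h(2), rule h'(2))
    note c = D_B[OF \<open>d \<in> D\<close>] D_B[OF \<open>e \<in> D\<close>] xy
    have "(d \<otimes> x) \<otimes> e = (d \<otimes> e) \<otimes> x" "(e \<otimes> y) \<otimes> d = (d \<otimes> e) \<otimes> y"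
      using swap_products[of d e x "\<one>"] swap_products[of e d y "\<one>"] D_central[OF \<open>d \<in> D\<close> c(2)] \<open>d \<in> D\<close> \<open>e \<in> D\<close> c by simp_all
    then show "a \<otimes>\<^bsub>A\<^esub> e \<oplus>\<^bsub>A\<^esub> b \<otimes>\<^bsub>A\<^esub> d = d \<otimes>\<^bsub>A\<^esub> e \<otimes> (x \<oplus> y)"
      unfolding A_ops h(3) h'(3) using c by (simp add: B.r_distr)
  qed (use xy in simp)
  then show ?thesis unfolding fraction_alg_def using embed_nonempty xy by (simp add: UN_constant_pairs)
qed

lemma Fr_smult: "x \<in> carrier B ==> c \<odot>\<^bsub>Fr\<^esub> embed x = embed (c \<odot> x)"
proof -
  assume x: "x \<in> carrier B"
  have "fraction A D (c \<odot>\<^bsub>A\<^esub> a) d = embed (c \<odot> x)" if "(a, d) \<in> embed x" for a d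
  proof (rule fraction_embed)
    note h = embedD[OF that(1)]
    show "c \<odot>\<^bsub>A\<^esub> a \<in> carrier A" unfolding A_ops by (rule A_smult[OF h(1)])
    show "d \<in> D" by (rule h(2))
    show "c \<odot>\<^bsub>A\<^esub> a = d \<otimes> (c \<odot> x)" unfolding A_ops h(3) B.smult_r_mult[OF D_B[OF h(2)] x] ..
  qed (rule B.smult_closed[OF x])
  then show ?thesis unfolding fraction_alg_def using embed_nonempty x by (simp add: UN_constant_pair)
qed

lemma Fr_one: "\<one>\<^bsub>Fr\<^esub> = embed \<one>" and Fr_zero: "\<zero>\<^bsub>Fr\<^esub> = embed \<zero>"
  using D_one D_A fraction_embed[of "\<one>" "\<one>" "\<one>"] fraction_embed[of "\<zero>" "\<one>" "\<zero>"] A.zero_closed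
  by (simp_all add: fraction_alg_def A_ops)

lemma embed_hom: "embed \<in> Ring.ring_hom B Fr"
  by (rule ring_hom_memI) (simp_all add: Fr_carrier Fr_mult Fr_add Fr_one)

lemma ring_Fr: "ring Fr"
  by (rule ring_transport[OF B.ring_hom_imp_img_ring[OF embed_hom]]) (simp_all add: Fr_carrier Fr_zero)

text \<open>Multiplication by a member of \<open>D\<close> is injective and commutes with the
  projections, so \<open>x\<close> is homogeneous exactly if its numerator is.\<close>

lemma Fr_hpart: "hpart Fr \<alpha> = embed ` hpart B \<alpha>"
proof (rule subset_antisym; rule subsetI)
  fix X assume "X \<in> hpart Fr \<alpha>"
  then obtain a d where X: "X = fraction A D a d" "a \<in> hpart B \<alpha>" "a \<in> carrier A" "d \<in> D"
    by (auto simp: fraction_alg_def A_hpart)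
  obtain x where x: "x \<in> carrier B" "a = d \<otimes> x" using divide[OF X(3,4)] by blast
  have "d \<otimes> pr \<alpha> x = d \<otimes> x" using D_pr[OF X(4) x(1), of \<alpha>] B.pr_same[OF X(2), of \<alpha>] x(2) by simp
  then have "pr \<alpha> x = x" using cancel[OF X(4) B.pr_closed[OF x(1)] x(1)] by blast
  then have "x \<in> hpart B \<alpha>" using B.pr_hpart[OF x(1), of \<alpha>] by simp
  then show "X \<in> embed ` hpart B \<alpha>" unfolding X(1) fraction_embed[OF X(3,4) x] by blast
next
  fix X assume "X \<in> embed ` hpart B \<alpha>"
  then obtain x where x: "x \<in> hpart B \<alpha>" "X = embed x" by blast
  note xB = B.hpart_carrier[OF x(1)]
  obtain d where d: "d \<in> D" "d \<otimes> x \<in> carrier A" using embedE[OF xB] by metis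
  have "pr \<alpha> (d \<otimes> x) = d \<otimes> x" using D_pr[OF d(1) xB, of \<alpha>] B.pr_same[OF x(1), of \<alpha>] by simp
  then have "d \<otimes> x \<in> hpart B \<alpha>" using B.pr_hpart[OF A_B[OF d(2)], of \<alpha>] by simp
  then show "X \<in> hpart Fr \<alpha>" unfolding x(2) fraction_eq[OF xB d, symmetric] using d by (auto simp: fraction_alg_def A_hpart)
qed

lemma embed_galg_iso: "embed \<in> galg_iso B Fr"
  unfolding galg_iso_def alg_hom_def ring_iso_def bij_betw_def
  using embed_hom embed_inj by (simp add: Fr_carrier Fr_smult Fr_hpart)

definition prFr :: "'g => ('a \<times> 'a) set => ('a \<times> 'a) set" where
  "prFr \<alpha> X = embed (pr \<alpha> (inv_into (carrier B) embed X))"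

lemma prFr_embed: "x \<in> carrier B ==> prFr \<alpha> (embed x) = embed (pr \<alpha> x)"
  by (simp add: prFr_def inv_into_f_f[OF embed_inj])

lemma embed_finsum:
  assumes "finite S" "\<And>i. f i \<in> carrier B"
  shows "finsum Fr (\<lambda>i. embed (f i)) S = embed (finsum B f S)"
proof -
  interpret Fr: ring Fr by (rule ring_Fr)
  show ?thesis using assms(1)
  proof (induction S rule: finite_induct)
    case (insert i S)
    have "finsum Fr (\<lambda>i. embed (f i)) (insert i S) = embed (f i) \<oplus>\<^bsub>Fr\<^esub> finsum Fr (\<lambda>i. embed (f i)) S"
      using assms(2) insert by (intro Fr.finsum_insert) (auto simp: Fr_carrier)
    moreover have "finsum B f (insert i S) = f i \<oplus> finsum B f S"
      using assms(2) insert by (intro B.finsum_insert) auto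
    moreover have "finsum B f S \<in> carrier B" using assms(2) by (intro B.finsum_closed) auto
    ultimately show ?case using insert assms(2) by (simp add: Fr_add)
  qed (simp add: Fr_zero)
qed

text \<open>The grading is transported along \<open>embed\<close>. The product in the tensor product
  with the endomorphisms refers to homogeneous components of fractions, so it is needed
  there.\<close>

lemma graded_algebra_Fr: "graded_algebra Fr prFr"
proof (rule graded_algebraI[OF ring_Fr])
  fix X assume "X \<in> carrier Fr"
  then obtain x where x: "x \<in> carrier B" "X = embed x" unfolding Fr_carrier by blast
  show "c \<odot>\<^bsub>Fr\<^esub> X \<in> carrier Fr" for c using x B.smult_closed by (simp add: Fr_smult Fr_carrier)
  show "prFr \<alpha> X \<in> hpart Fr \<alpha>" for \<alpha> using x B.pr_hpart by (simp add: prFr_embed Fr_hpart)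
  show "prFr \<alpha> (c \<odot>\<^bsub>Fr\<^esub> X) = c \<odot>\<^bsub>Fr\<^esub> prFr \<alpha> X" for c \<alpha>
    using x B.smult_closed B.pr_closed by (simp add: Fr_smult prFr_embed B.pr_smult)
  show "\<exists>S. finite S \<and> (\<forall>\<alpha>. \<alpha> \<notin> S \<longrightarrow> prFr \<alpha> X = \<zero>\<^bsub>Fr\<^esub>) \<and> X = finsum Fr (\<lambda>\<alpha>. prFr \<alpha> X) S"
  proof (intro exI conjI allI impI)
    let ?S = "{\<alpha>. pr \<alpha> x \<noteq> \<zero>}"
    show "finite ?S" by (rule B.pr_finite[OF x(1)])
    show "prFr \<alpha> X = \<zero>\<^bsub>Fr\<^esub>" if "\<alpha> \<notin> ?S" for \<alpha> using that x by (simp add: prFr_embed Fr_zero)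
    show "X = finsum Fr (\<lambda>\<alpha>. prFr \<alpha> X) ?S"
      unfolding x(2) prFr_embed[OF x(1)] embed_finsum[OF B.pr_finite[OF x(1)] B.pr_closed[OF x(1)]]
      by (rule arg_cong[OF B.pr_sum[OF x(1)]])
  qed
  fix Y assume "Y \<in> carrier Fr"
  then obtain y where y: "y \<in> carrier B" "Y = embed y" unfolding Fr_carrier by blast
  show "prFr \<alpha> (X \<oplus>\<^bsub>Fr\<^esub> Y) = prFr \<alpha> X \<oplus>\<^bsub>Fr\<^esub> prFr \<alpha> Y" for \<alpha>
    using x y B.pr_closed by (simp add: Fr_add prFr_embed B.pr_add)
  show "(c \<odot>\<^bsub>Fr\<^esub> X) \<otimes>\<^bsub>Fr\<^esub> Y = c \<odot>\<^bsub>Fr\<^esub> (X \<otimes>\<^bsub>Fr\<^esub> Y)" "X \<otimes>\<^bsub>Fr\<^esub> (c \<odot>\<^bsub>Fr\<^esub> Y) = c \<odot>\<^bsub>Fr\<^esub> (X \<otimes>\<^bsub>Fr\<^esub> Y)" for c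
    using x y B.smult_closed by (simp_all add: Fr_smult Fr_mult B.smult_l_mult B.smult_r_mult)
next
  fix X \<alpha> assume "X \<in> hpart Fr \<alpha>"
  then obtain x where x: "x \<in> hpart B \<alpha>" "X = embed x" unfolding Fr_hpart by blast
  note xB = B.hpart_carrier[OF x(1)]
  show "X \<in> carrier Fr" using x xB by (simp add: Fr_carrier)
  show "prFr \<beta> X = (if \<beta> = \<alpha> then X else \<zero>\<^bsub>Fr\<^esub>)" for \<beta>
    using x xB B.pr_same[OF x(1), of \<beta>] by (simp add: prFr_embed Fr_zero)
qed

end

context graded_basis
begin

section \<open>The endomorphism algebra as a graded algebra\<close>

definition matrix_map :: "('i => 'i => complex) => 'v => 'v" where
  "matrix_map m v = (\<Sum>b\<in>I. scal V (\<Sum>a\<in>I. m b a * co a v) (bas V b))"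

lemma linear_matrix_map: "lin (matrix_map m)"
proof -
  have "matrix_map m (u + v) = matrix_map m u + matrix_map m v" for u v
    by (rule co_eqI) (simp add: matrix_map_def co_sum_bas co_add distrib_left sum.distrib)
  moreover have "matrix_map m (scal V c v) = scal V c (matrix_map m v)" for c v
    by (rule co_eqI) (simp add: matrix_map_def co_sum_bas co_scale sum_distrib_left mult.left_commute)
  ultimately show ?thesis by unfold_locales auto
qed

lemma entry_matrix_map: "a \<in> I ==> b \<in> I ==> entry (matrix_map m) b a = m b a"
proof -
  assume ab: "a \<in> I" "b \<in> I"
  have "(\<Sum>a'\<in>I. m b a' * co a' (bas V a)) = (\<Sum>a'\<in>I. if a' = a then m b a else 0)"
    using ab by (intro sum.cong refl) (auto simp: co_bas)
  then show ?thesis using ab by (simp add: entry_def matrix_map_def co_sum_bas)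
qed

lemma linear_zero: "lin (\<lambda>v. 0)"
  by unfold_locales simp_all

lemma ring_End: "ring End"
proof (intro ringI abelian_groupI monoidI)
  fix X Y Z
  assume X: "X \<in> carrier End" and Y: "Y \<in> carrier End"
  then have lin: "lin X" "lin Y" by simp_all
  show "X \<oplus>\<^bsub>End\<^esub> Y \<in> carrier End" using linear_add[OF lin] by simp
  show "X \<oplus>\<^bsub>End\<^esub> Y = Y \<oplus>\<^bsub>End\<^esub> X" by (simp add: add.commute)
  show "X \<otimes>\<^bsub>End\<^esub> Y \<in> carrier End" using linear_compose[OF lin] by (simp add: o_def)
  show "X \<oplus>\<^bsub>End\<^esub> Y \<oplus>\<^bsub>End\<^esub> Z = X \<oplus>\<^bsub>End\<^esub> (Y \<oplus>\<^bsub>End\<^esub> Z)" by (simp add: add.assoc)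
  show "X \<otimes>\<^bsub>End\<^esub> Y \<otimes>\<^bsub>End\<^esub> Z = X \<otimes>\<^bsub>End\<^esub> (Y \<otimes>\<^bsub>End\<^esub> Z)" by (simp add: o_assoc)
  show "(X \<oplus>\<^bsub>End\<^esub> Y) \<otimes>\<^bsub>End\<^esub> Z = X \<otimes>\<^bsub>End\<^esub> Z \<oplus>\<^bsub>End\<^esub> Y \<otimes>\<^bsub>End\<^esub> Z" by (simp add: fun_eq_iff)
next
  fix X Y Z
  assume "X \<in> carrier End" "Y \<in> carrier End" "Z \<in> carrier End"
  then interpret Z: Vector_Spaces.linear "scal V" "scal V" Z by simp
  show "Z \<otimes>\<^bsub>End\<^esub> (X \<oplus>\<^bsub>End\<^esub> Y) = Z \<otimes>\<^bsub>End\<^esub> X \<oplus>\<^bsub>End\<^esub> Z \<otimes>\<^bsub>End\<^esub> Y" by (simp add: fun_eq_iff Z.add)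
next
  fix X assume "X \<in> carrier End"
  then have "lin X" by simp
  then have "(\<lambda>v. scal V (- 1) (X v)) \<in> carrier End" unfolding End_simps mem_Collect_eq by (rule linear_scale)
  moreover have "(\<lambda>v. scal V (- 1) (X v)) \<oplus>\<^bsub>End\<^esub> X = \<zero>\<^bsub>End\<^esub>" by (simp add: fun_eq_iff)
  ultimately show "\<exists>Y\<in>carrier End. Y \<oplus>\<^bsub>End\<^esub> X = \<zero>\<^bsub>End\<^esub>" by (intro bexI)
qed (simp_all add: linear_zero linear_id)

definition prEnd :: "'g => ('v => 'v) => 'v => 'v" where
  "prEnd \<alpha> X = matrix_map (\<lambda>b a. if \<gamma> b - \<gamma> a = \<alpha> then entry X b a else 0)"

lemma End_hpart_carrier: "X \<in> hpart End \<alpha> ==> X \<in> carrier End"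
  by (auto simp: End_alg_def)

lemma linear_sum_maps:
  assumes "\<And>i. i \<in> S ==> lin (f i)"
  shows "lin (\<lambda>v. \<Sum>i\<in>S. f i v)"
  using assms by (induction S rule: infinite_finite_induct) (simp_all add: linear_zero linear_add)

lemma entry_sum: "entry (\<lambda>v. \<Sum>i\<in>S. f i v) b a = (\<Sum>i\<in>S. entry (f i) b a)"
  by (simp add: entry_def co_sum)

lemma finsum_End:
  assumes "finite S" "\<And>i. lin (f i)"
  shows "finsum End f S = (\<lambda>v. \<Sum>i\<in>S. f i v)"
proof -
  interpret End: ring End by (rule ring_End)
  show ?thesis using assms(1)
  proof (induction S rule: finite_induct)
    case (insert i S)
    have "finsum End f (insert i S) = f i \<oplus>\<^bsub>End\<^esub> finsum End f S"
      using assms(2) insert by (intro End.finsum_insert) auto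
    then show ?case using insert by simp
  qed simp
qed

lemma graded_algebra_End: "graded_algebra End prEnd"
proof (rule graded_algebraI[OF ring_End])
  fix X assume "X \<in> carrier End"
  then have X: "lin X" by simp
  show "c \<odot>\<^bsub>End\<^esub> X \<in> carrier End" for c using linear_scale[OF X] by simp
  show "prEnd \<alpha> X \<in> hpart End \<alpha>" for \<alpha>
    unfolding prEnd_def by (simp add: End_hpart[OF linear_matrix_map] entry_matrix_map)
  show "prEnd \<alpha> (c \<odot>\<^bsub>End\<^esub> X) = c \<odot>\<^bsub>End\<^esub> prEnd \<alpha> X" for c \<alpha>
    unfolding prEnd_def End_simps
    by (rule linear_eqI[OF linear_matrix_map linear_scale[OF linear_matrix_map]]) (simp add: entry_matrix_map entry_simps)
  show "\<exists>S. finite S \<and> (\<forall>\<alpha>. \<alpha> \<notin> S \<longrightarrow> prEnd \<alpha> X = \<zero>\<^bsub>End\<^esub>) \<and> X = finsum End (\<lambda>\<alpha>. prEnd \<alpha> X) S"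
  proof (intro exI conjI allI impI)
    let ?S = "(\<lambda>(b, a). \<gamma> b - \<gamma> a) ` (I \<times> I)"
    show fin: "finite ?S" by simp
    show "prEnd \<alpha> X = \<zero>\<^bsub>End\<^esub>" if "\<alpha> \<notin> ?S" for \<alpha>
      unfolding prEnd_def End_simps
      by (rule linear_eqI[OF linear_matrix_map linear_zero]) (use that in \<open>auto simp: entry_matrix_map entry_def[of "\<lambda>v. 0"] image_iff\<close>)
    have lin: "lin (prEnd \<alpha> X)" for \<alpha> unfolding prEnd_def by (rule linear_matrix_map)
    have "X = (\<lambda>v. \<Sum>\<alpha>\<in>?S. prEnd \<alpha> X v)"
    proof (rule linear_eqI[OF X linear_sum_maps[OF lin]])
      fix a b assume ab: "a \<in> I" "b \<in> I"
      have "(\<Sum>\<alpha>\<in>?S. entry (prEnd \<alpha> X) b a) = (\<Sum>\<alpha>\<in>?S. if \<alpha> = \<gamma> b - \<gamma> a then entry X b a else 0)"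
        using ab by (intro sum.cong refl) (auto simp: prEnd_def entry_matrix_map)
      also have "\<dots> = entry X b a" using ab fin by (auto simp: image_iff)
      finally show "entry X b a = entry (\<lambda>v. \<Sum>\<alpha>\<in>?S. prEnd \<alpha> X v) b a" by (simp add: entry_sum)
    qed
    then show "X = finsum End (\<lambda>\<alpha>. prEnd \<alpha> X) ?S" using finsum_End[OF fin lin] by simp
  qed
  fix Y assume "Y \<in> carrier End"
  then have Y: "lin Y" by simp
  show "prEnd \<alpha> (X \<oplus>\<^bsub>End\<^esub> Y) = prEnd \<alpha> X \<oplus>\<^bsub>End\<^esub> prEnd \<alpha> Y" for \<alpha>
    unfolding prEnd_def End_simps
    by (rule linear_eqI[OF linear_matrix_map linear_add[OF linear_matrix_map linear_matrix_map]])
      (simp add: entry_matrix_map entry_simps)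
  show "(c \<odot>\<^bsub>End\<^esub> X) \<otimes>\<^bsub>End\<^esub> Y = c \<odot>\<^bsub>End\<^esub> (X \<otimes>\<^bsub>End\<^esub> Y)" for c by (simp add: fun_eq_iff)
  interpret X: Vector_Spaces.linear "scal V" "scal V" X by (rule X)
  show "X \<otimes>\<^bsub>End\<^esub> (c \<odot>\<^bsub>End\<^esub> Y) = c \<odot>\<^bsub>End\<^esub> (X \<otimes>\<^bsub>End\<^esub> Y)" for c by (simp add: fun_eq_iff X.scale)
next
  fix X \<alpha> assume X: "X \<in> hpart End \<alpha>"
  then show "X \<in> carrier End" by (rule End_hpart_carrier)
  then have lin: "lin X" by simp
  have d: "entry X b a \<noteq> 0 ==> \<gamma> b - \<gamma> a = \<alpha>" if "a \<in> I" "b \<in> I" for a b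
    using X that unfolding End_hpart[OF lin] by blast
  show "prEnd \<beta> X = (if \<beta> = \<alpha> then X else \<zero>\<^bsub>End\<^esub>)" for \<beta>
  proof (cases "\<beta> = \<alpha>")
    case True
    have "prEnd \<beta> X = X"
      unfolding prEnd_def by (rule linear_eqI[OF linear_matrix_map lin]) (use d True in \<open>auto simp: entry_matrix_map\<close>)
    then show ?thesis using True by simp
  next
    case False
    have "prEnd \<beta> X = (\<lambda>v. 0)"
      unfolding prEnd_def
      by (rule linear_eqI[OF linear_matrix_map linear_zero]) (use d False in \<open>auto simp: entry_matrix_map entry_def[of "\<lambda>v. 0"]\<close>)
    then show ?thesis using False by simp
  qed
qed

section \<open>Generated algebras of representative functions\<close>

text \<open>The finer degree counts row indices minus column indices. If these counts agree, moving
  the column indices to the other side gives equal multisets, and degrees may be summed over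
  multisets.\<close>

lemma dv_eq_dg:
  assumes "dv u = dv v"
  shows "dg u = dg v"
proof -
  have d: "dg w + sum_mset (image_mset \<gamma> (image_mset snd (mset w))) = sum_mset (image_mset \<gamma> (image_mset fst (mset w)))" for w
  proof (induction w)
    case (Cons l w)
    then show ?case by (cases l) (simp add: algebra_simps)
  qed simp
  have c: "int (count (image_mset fst (mset w)) c) - int (count (image_mset snd (mset w)) c) = dv w c" for w c
    by (induction w) (auto simp: letter_vec_def unit_vec_def)
  have "image_mset fst (mset u) + image_mset snd (mset v) = image_mset fst (mset v) + image_mset snd (mset u)"
  proof (rule multiset_eqI)
    fix x
    show "count (image_mset fst (mset u) + image_mset snd (mset v)) x = count (image_mset fst (mset v) + image_mset snd (mset u)) x"
      using c[of u x] c[of v x] assms by simp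
  qed
  then have "sum_mset (image_mset \<gamma> (image_mset fst (mset u) + image_mset snd (mset v))) =
      sum_mset (image_mset \<gamma> (image_mset fst (mset v) + image_mset snd (mset u)))" by (rule arg_cong)
  then have e: "sum_mset (image_mset \<gamma> (image_mset fst (mset u))) + sum_mset (image_mset \<gamma> (image_mset snd (mset v))) =
      sum_mset (image_mset \<gamma> (image_mset fst (mset v))) + sum_mset (image_mset \<gamma> (image_mset snd (mset u)))" by simp
  show ?thesis using e unfolding d[symmetric] by (simp add: algebra_simps)
qed

definition wpart :: "'g => 'i gfun => 'i gfun" where
  "wpart \<alpha> f = (\<lambda>w. if dg w = - \<alpha> then f w else 0)"

text \<open>A component for the grading by \<Gamma> collects whole summands homogeneous in the finer
  grading, so generated algebras contain the components of their members.\<close>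

lemma hsum_wpart: "hsum X f ==> (\<forall>\<alpha>. wpart \<alpha> f \<in> gen X) \<and> (\<exists>S. finite S \<and> (\<forall>w. f w \<noteq> 0 \<longrightarrow> - dg w \<in> S))"
proof (induction rule: hsum.induct)
  case hsum_zero
  show ?case using gen_zero by (auto simp: wpart_def)
next
  case (hsum_base f x)
  show ?case
  proof (cases "f = (\<lambda>w. 0)")
    case True
    then show ?thesis using gen_zero by (auto simp: wpart_def)
  next
    case False
    then obtain w0 where "f w0 \<noteq> 0" by auto
    then have d: "dg w = dg w0" if "f w \<noteq> 0" for w using hsum_base(2) that dv_eq_dg[of w w0] by (auto simp: vhom_def)
    have "wpart \<alpha> f = (if \<alpha> = - dg w0 then f else (\<lambda>w. 0))" for \<alpha>
    proof
      fix w show "wpart \<alpha> f w = (if \<alpha> = - dg w0 then f else (\<lambda>w. 0)) w"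
        using d[of w] by (cases "f w = 0") (auto simp: wpart_def)
    qed
    then have "\<forall>\<alpha>. wpart \<alpha> f \<in> gen X" using hsum_base(1) gen_zero by simp
    moreover have "\<forall>w. f w \<noteq> 0 \<longrightarrow> - dg w \<in> {- dg w0}" using d by auto
    ultimately show ?thesis by (intro conjI exI[of _ "{- dg w0}"]) simp_all
  qed
next
  case (hsum_add f g)
  obtain S S' where S: "finite S" "\<forall>w. f w \<noteq> 0 \<longrightarrow> - dg w \<in> S" "finite S'" "\<forall>w. g w \<noteq> 0 \<longrightarrow> - dg w \<in> S'" using hsum_add by blast
  have "wpart \<alpha> (\<lambda>w. f w + g w) = (\<lambda>w. wpart \<alpha> f w + wpart \<alpha> g w)" for \<alpha> by (auto simp: wpart_def)
  then have "\<forall>\<alpha>. wpart \<alpha> (\<lambda>w. f w + g w) \<in> gen X" using hsum_add by (simp add: gen.add)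
  moreover have "\<forall>w. f w + g w \<noteq> 0 \<longrightarrow> - dg w \<in> S \<union> S'" using S by (metis UnCI add_0)
  ultimately show ?case using S by (intro conjI exI[of _ "S \<union> S'"]) simp_all
qed

definition generators :: "'i gfun set => bool" where
  "generators X \<longleftrightarrow> X \<subseteq> RF \<and> (\<forall>x\<in>X. \<exists>v. vhom v x)"

text \<open>Generated subalgebras with an explicit carrier; \<open>tset\<close> gives
  \<open>T\<close> and \<open>tsset\<close> the coordinate algebra.\<close>

definition R :: "'i gfun set => ('i env => complex, 'g) galg" where
  "R X = A0\<lparr>carrier := ofw ` gen X, hpart := (\<lambda>\<alpha>. hpart A0 \<alpha> \<inter> ofw ` gen X)\<rparr>"

lemma generated_eq: "X \<subseteq> RF ==> generated_subalgebra A0 (ofw ` X) = R X"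
  using generated_carrier[of X] by (simp add: generated_subalgebra_def Let_def R_def)

lemma tset_generators: "generators tset"
  unfolding generators_def
proof (intro conjI ballI tset_RF)
  fix x assume "x \<in> tset"
  then obtain a b where "x = tw b a" by (auto simp: tset_def)
  then show "\<exists>v. vhom v x" using exI[of "\<lambda>v. vhom v (tw b a)", OF tw_vhom] by simp
qed

lemma tsset_generators: "generators tsset"
  unfolding generators_def
proof (intro conjI ballI tsset_RF)
  fix x assume "x \<in> tsset"
  then consider "x \<in> tset" | a c where "x = antiL a c" by (auto simp: tsset_def)
  then show "\<exists>v. vhom v x"
  proof cases
    case 1
    then show ?thesis using tset_generators by (simp add: generators_def)
  next
    case (2 a c)
    then show ?thesis using exI[of "\<lambda>v. vhom v (antiL a c)", OF antiL_vhom] by simp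
  qed
qed

lemma ofw_tset: "ofw ` tset = {mcoeff V b a | a b. a \<in> I \<and> b \<in> I}"
proof (rule subset_antisym; rule subsetI)
  fix x assume "x \<in> ofw ` tset"
  then obtain a b where "a \<in> I" "b \<in> I" "x = ofw (tw b a)" by (auto simp: tset_def)
  then have "x = mcoeff V b a \<and> a \<in> I \<and> b \<in> I" by (simp add: mcoeff_eq)
  then show "x \<in> {mcoeff V b a | a b. a \<in> I \<and> b \<in> I}" by blast
next
  fix x assume "x \<in> {mcoeff V b a | a b. a \<in> I \<and> b \<in> I}"
  then obtain a b where ab: "a \<in> I" "b \<in> I" "x = mcoeff V b a" by blast
  then show "x \<in> ofw ` tset" unfolding ab(3) mcoeff_eq[OF ab(1,2)] by (intro imageI) (auto simp: tset_def)
qed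

lemma ofw_antiL_set: "ofw ` {antiL a c | a c. a \<in> I \<and> c \<in> I} = {dual_mcoeff V b a | a b. a \<in> I \<and> b \<in> I}"
proof (rule subset_antisym; rule subsetI)
  fix x assume "x \<in> ofw ` {antiL a c | a c. a \<in> I \<and> c \<in> I}"
  then obtain a c where "a \<in> I" "c \<in> I" "x = ofw (antiL a c)" by auto
  then have "x = dual_mcoeff V c a \<and> a \<in> I \<and> c \<in> I" by (simp add: dual_mcoeff_eq)
  then show "x \<in> {dual_mcoeff V b a | a b. a \<in> I \<and> b \<in> I}" by blast
next
  fix x assume "x \<in> {dual_mcoeff V b a | a b. a \<in> I \<and> b \<in> I}"
  then obtain a b where ab: "a \<in> I" "b \<in> I" "x = dual_mcoeff V b a" by blast
  then show "x \<in> ofw ` {antiL a c | a c. a \<in> I \<and> c \<in> I}" unfolding ab(3) dual_mcoeff_eq[OF ab(1,2)] by (intro imageI) auto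
qed

lemma matrix_coeff_alg_eq: "matrix_coeff_alg V = R tset"
  unfolding matrix_coeff_alg_def ofw_tset[symmetric] by (rule generated_eq[OF tset_RF])

lemma coordinate_alg_eq: "coordinate_alg V = R tsset"
  unfolding coordinate_alg_def ofw_tset[symmetric] ofw_antiL_set[symmetric] image_Un[symmetric] tsset_def[symmetric]
  by (rule generated_eq[OF tsset_RF])

lemma R_simps: "carrier (R X) = ofw ` gen X" "one (R X) = ofw unit_word" "zero (R X) = (\<lambda>_. 0)"
  "add (R X) = (\<lambda>f g x. f x + g x)" "module.smult (R X) = (\<lambda>c f x. c * f x)"
  "hpart (R X) = (\<lambda>\<alpha>. hpart A0 \<alpha> \<inter> ofw ` gen X)" "mult (R X) = mult A0"
  by (simp_all add: R_def A0_simps)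

lemma ofw_zero: "ofw (\<lambda>w. 0) = (\<lambda>_. 0)"
  by (auto simp: ofw_def word_eval_def)

lemma gen_WU: "generators X ==> f \<in> gen X ==> f \<in> WU"
  using gen_RF RF_WU by (auto simp: generators_def)

lemma gen_support: "generators X ==> f \<in> gen X ==> f w \<noteq> 0 ==> set w \<subseteq> L"
  using WU_support gen_WU by blast

lemma R_mult: "generators X ==> f \<in> gen X ==> g \<in> gen X ==> ofw f \<otimes>\<^bsub>R X\<^esub> ofw g = ofw (f \<cdot> g)"
  by (simp add: R_simps ofw_mult gen_WU)

lemma ring_R: "generators X ==> ring (R X)"
proof -
  assume X: "generators X"
  note m = R_mult[OF X]
  show ?thesis
  proof (intro ringI abelian_groupI monoidI)
    show "\<zero>\<^bsub>R X\<^esub> \<in> carrier (R X)" using imageI[OF gen_zero, of ofw X] by (simp add: R_simps ofw_zero)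
    show "\<one>\<^bsub>R X\<^esub> \<in> carrier (R X)" using gen.unit by (simp add: R_simps)
    fix x assume "x \<in> carrier (R X)"
    then obtain f where f: "f \<in> gen X" "x = ofw f" by (auto simp: R_simps)
    show "\<zero>\<^bsub>R X\<^esub> \<oplus>\<^bsub>R X\<^esub> x = x" by (simp add: R_simps)
    show "\<one>\<^bsub>R X\<^esub> \<otimes>\<^bsub>R X\<^esub> x = x" "x \<otimes>\<^bsub>R X\<^esub> \<one>\<^bsub>R X\<^esub> = x"
      using m[OF gen.unit f(1)] m[OF f(1) gen.unit] by (simp_all add: R_simps f)
    have neg: "ofw (\<lambda>w. - 1 * f w) \<in> carrier (R X)" unfolding R_simps by (intro imageI gen.scale f(1))
    have sum0: "ofw (\<lambda>w. - 1 * f w) \<oplus>\<^bsub>R X\<^esub> x = \<zero>\<^bsub>R X\<^esub>" unfolding ofw_scale f(2) by (simp add: R_simps)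
    show "\<exists>y\<in>carrier (R X). y \<oplus>\<^bsub>R X\<^esub> x = \<zero>\<^bsub>R X\<^esub>" 
      by (rule bexI[where P = "\<lambda>y. y \<oplus>\<^bsub>R X\<^esub> x = \<zero>\<^bsub>R X\<^esub>", OF sum0 neg])
    fix y assume "y \<in> carrier (R X)"
    then obtain g where g: "g \<in> gen X" "y = ofw g" by (auto simp: R_simps)
    show "x \<oplus>\<^bsub>R X\<^esub> y \<in> carrier (R X)" using imageI[OF gen.add[OF f(1) g(1)], of ofw] by (simp add: R_simps f g ofw_add)
    show "x \<oplus>\<^bsub>R X\<^esub> y = y \<oplus>\<^bsub>R X\<^esub> x" by (simp add: R_simps add.commute)
    show "x \<otimes>\<^bsub>R X\<^esub> y \<in> carrier (R X)" unfolding f(2) g(2) m[OF f(1) g(1)] unfolding R_simps by (intro imageI gen.mult f(1) g(1))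
    fix z assume "z \<in> carrier (R X)"
    then obtain k where k: "k \<in> gen X" "z = ofw k" by (auto simp: R_simps)
    show "x \<oplus>\<^bsub>R X\<^esub> y \<oplus>\<^bsub>R X\<^esub> z = x \<oplus>\<^bsub>R X\<^esub> (y \<oplus>\<^bsub>R X\<^esub> z)" by (simp add: R_simps add.assoc)
    show "x \<otimes>\<^bsub>R X\<^esub> y \<otimes>\<^bsub>R X\<^esub> z = x \<otimes>\<^bsub>R X\<^esub> (y \<otimes>\<^bsub>R X\<^esub> z)"
      unfolding f(2) g(2) k(2) m[OF f(1) g(1)] m[OF g(1) k(1)] m[OF gen.mult[OF f(1) g(1)] k(1)] m[OF f(1) gen.mult[OF g(1) k(1)]]
        wk.shuffle_assoc ..
    have a: "ofw p \<oplus>\<^bsub>R X\<^esub> ofw q = ofw (\<lambda>w. p w + q w)" for p q by (simp add: R_simps ofw_add)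
    show "(x \<oplus>\<^bsub>R X\<^esub> y) \<otimes>\<^bsub>R X\<^esub> z = x \<otimes>\<^bsub>R X\<^esub> z \<oplus>\<^bsub>R X\<^esub> y \<otimes>\<^bsub>R X\<^esub> z"
      unfolding f(2) g(2) k(2) a m[OF gen.add[OF f(1) g(1)] k(1)] m[OF f(1) k(1)] m[OF g(1) k(1)] wk.shuffle_add_left ..
    show "z \<otimes>\<^bsub>R X\<^esub> (x \<oplus>\<^bsub>R X\<^esub> y) = z \<otimes>\<^bsub>R X\<^esub> x \<oplus>\<^bsub>R X\<^esub> z \<otimes>\<^bsub>R X\<^esub> y"
      unfolding f(2) g(2) k(2) a m[OF k(1) gen.add[OF f(1) g(1)]] m[OF k(1) f(1)] m[OF k(1) g(1)] wk.shuffle_add_right ..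
  qed
qed

lemma R_hpart: "generators X ==> f \<in> gen X ==> ofw f \<in> hpart (R X) \<alpha> \<longleftrightarrow> (\<forall>w. f w \<noteq> 0 \<longrightarrow> dg w = - \<alpha>)"
proof -
  assume X: "generators X" and f: "f \<in> gen X"
  have "f \<in> RF" using gen_RF f X by (simp add: generators_def)
  then show ?thesis
    using RF_finite_dual[of f] functional_degree_iff[OF ofw_dual[OF gen_WU[OF X f]]] wf_ofw[OF gen_WU[OF X f]] f
    by (simp add: R_simps A0_simps)
qed

definition prW :: "'g => ('i env => complex) => 'i env => complex" where
  "prW \<alpha> x = ofw (wpart \<alpha> (wf x))"

lemma prW_ofw: "f \<in> WU ==> prW \<alpha> (ofw f) = ofw (wpart \<alpha> f)"
  by (simp add: prW_def wf_ofw)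

lemma finsum_R:
  assumes X: "generators X" and S: "finite S" "\<And>i. f i \<in> gen X"
  shows "finsum (R X) (\<lambda>i. ofw (f i)) S = ofw (\<lambda>w. \<Sum>i\<in>S. f i w)"
proof -
  interpret RX: ring "R X" by (rule ring_R[OF X])
  show ?thesis using S(1)
  proof (induction S rule: finite_induct)
    case empty
    show ?case by (simp add: R_simps ofw_zero)
  next
    case (insert i S)
    have "finsum (R X) (\<lambda>i. ofw (f i)) (insert i S) = ofw (f i) \<oplus>\<^bsub>R X\<^esub> finsum (R X) (\<lambda>i. ofw (f i)) S"
      using S(2) insert by (intro RX.finsum_insert) (auto simp: R_simps)
    then show ?case using insert by (simp add: R_simps ofw_add)
  qed
qed

lemma graded_algebra_R: "generators X ==> graded_algebra (R X) prW"
proof -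
  assume X: "generators X"
  have hs: "hsum X f" if "f \<in> gen X" for f using gen_hsum[OF that] X by (simp add: generators_def)
  have wp: "wpart \<alpha> f \<in> gen X" if "f \<in> gen X" for f \<alpha> using hsum_wpart[OF hs[OF that]] by blast
  have pr: "prW \<alpha> (ofw f) = ofw (wpart \<alpha> f)" if "f \<in> gen X" for f \<alpha> using prW_ofw[OF gen_WU[OF X that]] .
  show ?thesis
  proof (rule graded_algebraI[OF ring_R[OF X]])
    fix x assume "x \<in> carrier (R X)"
    then obtain f where f: "f \<in> gen X" "x = ofw f" by (auto simp: R_simps)
    have sm: "c \<odot>\<^bsub>R X\<^esub> x = ofw (\<lambda>w. c * f w)" for c by (simp add: R_simps f ofw_scale)
    show "c \<odot>\<^bsub>R X\<^esub> x \<in> carrier (R X)" for c unfolding sm unfolding R_simps by (intro imageI gen.scale f(1))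
    show "prW \<alpha> x \<in> hpart (R X) \<alpha>" for \<alpha>
      unfolding f(2) pr[OF f(1)] R_hpart[OF X wp[OF f(1)]] by (simp add: wpart_def)
    show "prW \<alpha> (c \<odot>\<^bsub>R X\<^esub> x) = c \<odot>\<^bsub>R X\<^esub> prW \<alpha> x" for c \<alpha>
    proof -
      have "wpart \<alpha> (\<lambda>w. c * f w) = (\<lambda>w. c * wpart \<alpha> f w)" by (auto simp: wpart_def)
      then show ?thesis unfolding sm pr[OF gen.scale[OF f(1)]] unfolding f(2) pr[OF f(1)] by (simp add: R_simps ofw_scale)
    qed
    obtain S where S: "finite S" "\<forall>w. f w \<noteq> 0 \<longrightarrow> - dg w \<in> S" using hsum_wpart[OF hs[OF f(1)]] by blast
    show "\<exists>S. finite S \<and> (\<forall>\<alpha>. \<alpha> \<notin> S \<longrightarrow> prW \<alpha> x = \<zero>\<^bsub>R X\<^esub>) \<and> x = finsum (R X) (\<lambda>\<alpha>. prW \<alpha> x) S"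
    proof (intro exI conjI allI impI)
      show "finite S" by fact
      show "prW \<alpha> x = \<zero>\<^bsub>R X\<^esub>" if "\<alpha> \<notin> S" for \<alpha>
      proof -
        have "wpart \<alpha> f = (\<lambda>w. 0)"
        proof
          fix w show "wpart \<alpha> f w = 0" using S(2) that by (cases "f w = 0") (auto simp: wpart_def)
        qed
        then show ?thesis unfolding f(2) pr[OF f(1)] by (simp add: R_simps ofw_zero)
      qed
      have "(\<lambda>w. \<Sum>\<alpha>\<in>S. wpart \<alpha> f w) = f"
      proof
        fix w
        have "(\<Sum>\<alpha>\<in>S. wpart \<alpha> f w) = (\<Sum>\<alpha>\<in>S. if \<alpha> = - dg w then f w else 0)"
          by (intro sum.cong refl) (auto simp: wpart_def)
        then show "(\<Sum>\<alpha>\<in>S. wpart \<alpha> f w) = f w" using S by auto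
      qed
      then show "x = finsum (R X) (\<lambda>\<alpha>. prW \<alpha> x) S"
        unfolding f(2) pr[OF f(1)] finsum_R[OF X S(1) wp[OF f(1)]] by simp
    qed
    fix y assume "y \<in> carrier (R X)"
    then obtain g where g: "g \<in> gen X" "y = ofw g" by (auto simp: R_simps)
    have a: "ofw p \<oplus>\<^bsub>R X\<^esub> ofw q = ofw (\<lambda>w. p w + q w)" for p q by (simp add: R_simps ofw_add)
    show "prW \<alpha> (x \<oplus>\<^bsub>R X\<^esub> y) = prW \<alpha> x \<oplus>\<^bsub>R X\<^esub> prW \<alpha> y" for \<alpha>
    proof -
      have "wpart \<alpha> (\<lambda>w. f w + g w) = (\<lambda>w. wpart \<alpha> f w + wpart \<alpha> g w)" by (auto simp: wpart_def)
      then show ?thesis unfolding f(2) g(2) a pr[OF f(1)] pr[OF g(1)] pr[OF gen.add[OF f(1) g(1)]] by simp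
    qed
    have s: "c \<odot>\<^bsub>R X\<^esub> ofw p = ofw (\<lambda>w. c * p w)" for c p by (simp add: R_simps ofw_scale)
    show "(c \<odot>\<^bsub>R X\<^esub> x) \<otimes>\<^bsub>R X\<^esub> y = c \<odot>\<^bsub>R X\<^esub> (x \<otimes>\<^bsub>R X\<^esub> y)" for c
      unfolding f(2) g(2) s R_mult[OF X gen.scale[OF f(1)] g(1)] R_mult[OF X f(1) g(1)] wk.shuffle_scale_left ..
    show "x \<otimes>\<^bsub>R X\<^esub> (c \<odot>\<^bsub>R X\<^esub> y) = c \<odot>\<^bsub>R X\<^esub> (x \<otimes>\<^bsub>R X\<^esub> y)" for c
      unfolding f(2) g(2) s R_mult[OF X f(1) gen.scale[OF g(1)]] R_mult[OF X f(1) g(1)] wk.shuffle_scale_right ..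
  next
    fix x \<alpha> assume x: "x \<in> hpart (R X) \<alpha>"
    then show xc: "x \<in> carrier (R X)" by (simp add: R_simps)
    obtain f where f: "f \<in> gen X" "x = ofw f" using xc by (auto simp: R_simps)
    have d: "\<forall>w. f w \<noteq> 0 \<longrightarrow> dg w = - \<alpha>" using x unfolding f(2) R_hpart[OF X f(1)] .
    show "prW \<beta> x = (if \<beta> = \<alpha> then x else \<zero>\<^bsub>R X\<^esub>)" for \<beta>
    proof -
      have "wpart \<beta> f = (if \<beta> = \<alpha> then f else (\<lambda>w. 0))"
      proof
        fix w show "wpart \<beta> f w = (if \<beta> = \<alpha> then f else (\<lambda>w. 0)) w"
          using d by (cases "f w = 0") (auto simp: wpart_def)
      qed
      then show ?thesis unfolding f(2) pr[OF f(1)] by (simp add: R_simps ofw_zero)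
    qed
  qed
qed

end

lemma sum_fun_apply: "(\<Sum>i\<in>S. f i) x = (\<Sum>i\<in>S. f i x)" for f :: "_ => _ => complex"
  by (induction S rule: infinite_finite_induct) (simp_all add: plus_fun_def zero_fun_def)

lemma sign_inversions_complex:
  assumes "\<sigma> permutes {..<n}"
  shows "(of_int (sign \<sigma>) :: complex) = (- 1) ^ card (inversions n \<sigma>)"
proof -
  have "rat_of_int (sign \<sigma>) = rat_of_int ((- 1) ^ card (inversions n \<sigma>))" using sign_inversions[OF assms] by simp
  then have "sign \<sigma> = (- 1) ^ card (inversions n \<sigma>)" by (simp only: of_int_eq_iff)
  then show ?thesis by simp
qed

lemma permute_list_eq_self:
  assumes "distinct xs" "\<pi> permutes {..<length xs}" "permute_list \<pi> xs = xs"
  shows "\<pi> = id"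
proof
  fix i
  show "\<pi> i = id i"
  proof (cases "i < length xs")
    case True
    then have "\<pi> i < length xs" using permutes_in_image[OF assms(2), of i] by simp
    moreover have "xs ! \<pi> i = xs ! i" using permute_list_nth[OF assms(2) True] assms(3) by simp
    ultimately show ?thesis using nth_eq_iff_index_eq[OF assms(1)] True by simp
  next
    case False
    then show ?thesis using permutes_not_in[OF assms(2), of i] by simp
  qed
qed

lemma ordered_pairs_Suc:
  "ordered_pairs (Suc n) = (\<lambda>j. (0, Suc j)) ` {..<n} \<union> map_prod Suc Suc ` ordered_pairs n"
proof (rule Set.set_eqI)
  fix p :: "nat \<times> nat"
  obtain i j where p: "p = (i, j)" by (cases p)
  show "p \<in> ordered_pairs (Suc n) \<longleftrightarrow> p \<in> (\<lambda>j. (0, Suc j)) ` {..<n} \<union> map_prod Suc Suc ` ordered_pairs n"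
    unfolding p by (cases i; cases j) (auto simp: ordered_pairs_def image_iff)
qed

lemma prod_ordered_pairs_Suc:
  "(\<Prod>(i, j)\<in>ordered_pairs (Suc n). f i j) = (\<Prod>j<n. f 0 (Suc j)) * (\<Prod>(i, j)\<in>ordered_pairs n. f (Suc i) (Suc j))"
proof -
  have "(\<Prod>(i, j)\<in>ordered_pairs (Suc n). f i j) =
      (\<Prod>(i, j)\<in>(\<lambda>j. (0, Suc j)) ` {..<n}. f i j) * (\<Prod>(i, j)\<in>map_prod Suc Suc ` ordered_pairs n. f i j)"
    unfolding ordered_pairs_Suc by (rule prod.union_disjoint) (simp_all, auto)
  also have "(\<Prod>(i, j)\<in>(\<lambda>j. (0, Suc j)) ` {..<n}. f i j) = (\<Prod>j<n. f 0 (Suc j))"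
    by (subst prod.reindex) (auto simp: inj_on_def)
  also have "(\<Prod>(i, j)\<in>map_prod Suc Suc ` ordered_pairs n. f i j) = (\<Prod>(i, j)\<in>ordered_pairs n. f (Suc i) (Suc j))"
    by (subst prod.reindex) (auto simp: inj_on_def case_prod_unfold)
  finally show ?thesis .
qed

context graded_basis
begin

section \<open>Minors\<close>

lemma sgn_ind_iff: "a \<in> sgn_ind V 1 \<longleftrightarrow> a \<in> I \<and> \<not> par a" "a \<in> sgn_ind V (- 1) \<longleftrightarrow> a \<in> I \<and> par a"
  using fac_self[of "\<gamma> a"] by (auto simp: sgn_ind_def par_def)

lemma sgn_dim_card: "sgn_dim V \<epsilon> = card (sgn_ind V \<epsilon>)"
proof -
  have "vs.span (\<Union>\<alpha>\<in>{\<alpha>. fac V \<alpha> \<alpha> = \<epsilon>}. part V \<alpha>) = vs.span (bas V ` sgn_ind V \<epsilon>)"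
  proof (rule subset_antisym)
    show "vs.span (\<Union>\<alpha>\<in>{\<alpha>. fac V \<alpha> \<alpha> = \<epsilon>}. part V \<alpha>) \<subseteq> vs.span (bas V ` sgn_ind V \<epsilon>)"
    proof (rule vs.span_minimal[OF subsetI vs.subspace_span])
      fix v assume "v \<in> (\<Union>\<alpha>\<in>{\<alpha>. fac V \<alpha> \<alpha> = \<epsilon>}. part V \<alpha>)"
      then obtain \<alpha> where \<alpha>: "fac V \<alpha> \<alpha> = \<epsilon>" "v \<in> part V \<alpha>" by blast
      have "scal V (co b v) (bas V b) \<in> vs.span (bas V ` sgn_ind V \<epsilon>)" if "b \<in> I" for b
      proof (cases "co b v = 0")
        case True
        then show ?thesis by (simp add: vs.span_zero)
      next
        case False
        then have "\<gamma> b = \<alpha>" using \<alpha>(2) that unfolding part_iff by blast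
        then have "b \<in> sgn_ind V \<epsilon>" using \<alpha>(1) that by (simp add: sgn_ind_def)
        then show ?thesis by (intro vs.span_scale vs.span_base imageI)
      qed
      then show "v \<in> vs.span (bas V ` sgn_ind V \<epsilon>)" by (subst co_expand) (rule vs.span_sum)
    qed
    show "vs.span (bas V ` sgn_ind V \<epsilon>) \<subseteq> vs.span (\<Union>\<alpha>\<in>{\<alpha>. fac V \<alpha> \<alpha> = \<epsilon>}. part V \<alpha>)"
      by (rule vs.span_mono) (auto simp: sgn_ind_def intro: bas_part)
  qed
  then have "sgn_dim V \<epsilon> = vs.dim (vs.span (bas V ` sgn_ind V \<epsilon>))"
    by (simp add: sgn_dim_def sgn_space_def)
  also have "\<dots> = card (bas V ` sgn_ind V \<epsilon>)"
    by (rule vs.dim_span_eq_card_independent[OF vs.independent_mono[OF vs.independent_Basis]]) (auto simp: sgn_ind_def)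
  also have "\<dots> = card (sgn_ind V \<epsilon>)"
    by (rule card_image) (auto simp: sgn_ind_def inj_on_def bas_inj)
  finally show ?thesis .
qed

section \<open>Symmetrised words and their coaction\<close>

definition perm_fac :: "'i list => (nat => nat) => complex" where
  "perm_fac xs \<sigma> = (\<Prod>(i, j)\<in>inversions (length xs) \<sigma>. \<omega> (\<gamma> (xs ! i)) (\<gamma> (xs ! j)))"

abbreviation "moved xs \<sigma> \<equiv> permute_list (inv_into UNIV \<sigma>) xs"

lemma perm_action_single:
  "perm_action V \<sigma> (wsingle w 1) = wsingle (moved w \<sigma>) (perm_fac w \<sigma>)"
  by (simp add: perm_action_def perm_fac_def inversions_def)

lemma perm_fac_id: "perm_fac xs id = 1"
proof -
  have "inversions (length xs) id = {}" by (auto simp: inversions_def)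
  then show ?thesis unfolding perm_fac_def by (simp only: prod.empty)
qed

text \<open>One operator for both cases: \<chi> is the sign for the antisymmetrizer and 1 for the
  symmetrizer.\<close>

definition chi_symmetrizer ::
    "((nat => nat) => complex) => nat => ('i list \<Rightarrow>\<^sub>0 complex) => 'i list \<Rightarrow>\<^sub>0 complex" where
  "chi_symmetrizer \<chi> r x = (\<Sum>\<sigma> | \<sigma> permutes {..<r}. pscale (\<chi> \<sigma>) (perm_action V \<sigma> x))"

lemma symmetrizers_eq:
  "antisymmetrizer V r = chi_symmetrizer (\<lambda>\<sigma>. of_int (sign \<sigma>)) r" "symmetrizer V r = chi_symmetrizer (\<lambda>\<sigma>. 1) r"
proof -
  have one: "pscale 1 p = p" for p :: "'i list \<Rightarrow>\<^sub>0 complex"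
    by (rule poly_mapping_eqI) (simp only: lookup_pscale mult_1_left)
  show "antisymmetrizer V r = chi_symmetrizer (\<lambda>\<sigma>. of_int (sign \<sigma>)) r" "symmetrizer V r = chi_symmetrizer (\<lambda>\<sigma>. 1) r"
    unfolding fun_eq_iff antisymmetrizer_def symmetrizer_def chi_symmetrizer_def one by simp_all
qed

definition chi_orbit :: "((nat => nat) => complex) => 'i list => 'i list \<Rightarrow>\<^sub>0 complex" where
  "chi_orbit \<chi> xs = (\<Sum>\<sigma> | \<sigma> permutes {..<length xs}. wsingle (moved xs \<sigma>) (\<chi> \<sigma> * perm_fac xs \<sigma>))"

lemma chi_symmetrizer_single: "chi_symmetrizer \<chi> (length xs) (wsingle xs 1) = chi_orbit \<chi> xs"
  unfolding chi_symmetrizer_def chi_orbit_def perm_action_single single_pscale ..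

lemma moved_eq_self:
  assumes "distinct xs" "\<sigma> permutes {..<length xs}"
  shows "moved xs \<sigma> = xs \<longleftrightarrow> \<sigma> = id"
proof
  assume "moved xs \<sigma> = xs"
  then have "inv_into UNIV \<sigma> = id" using permute_list_eq_self[OF assms(1) permutes_inv[OF assms(2)]] by blast
  then show "\<sigma> = id" using permutes_inv_inv[OF assms(2)] by (metis inv_id)
qed (simp add: inv_id)

text \<open>The letters are distinct, so only the identity restores their order. With
  \<open>\<chi> id = 1\<close> the symmetrised word is therefore not zero.\<close>

lemma lookup_chi_orbit:
  assumes xs: "distinct xs"
  shows "wlookup (chi_orbit \<chi> xs) xs = \<chi> id"
proof -
  have "wlookup (chi_orbit \<chi> xs) xs =
      (\<Sum>\<sigma> | \<sigma> permutes {..<length xs}. if \<sigma> = id then \<chi> id else 0)"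
    unfolding chi_orbit_def lookup_sum
  proof (rule sum.cong[OF refl])
    fix \<sigma> assume "\<sigma> \<in> {\<sigma>. \<sigma> permutes {..<length xs}}"
    then have "moved xs \<sigma> = xs \<longleftrightarrow> \<sigma> = id" using moved_eq_self[OF xs] by simp
    then show "wlookup (wsingle (moved xs \<sigma>) (\<chi> \<sigma> * perm_fac xs \<sigma>)) xs = (if \<sigma> = id then \<chi> id else 0)"
      using perm_fac_id[of xs] by (simp only: lookup_single when_def) (cases "\<sigma> = id"; simp only: if_True if_False mult_1_right refl)
  qed
  then show ?thesis using finite_permutations[of "{..<length xs}"] permutes_id[of "{..<length xs}"] by (simp del: id_apply)
qed

definition minor :: "((nat => nat) => complex) => 'i list => 'i gfun" where
  "minor \<chi> xs = (\<lambda>y. \<Sum>\<sigma> | \<sigma> permutes {..<length xs}. \<chi> \<sigma> * perm_fac xs \<sigma> * ccw xs (moved xs \<sigma>) y)"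

lemma ofw_sum: "ofw (\<lambda>w. \<Sum>i\<in>S. f i w) x = (\<Sum>i\<in>S. ofw (f i) x)"
  by (simp add: ofw_def word_eval_fun_sum)

lemma lookup_sgn_proj:
  assumes "set xs \<subseteq> sgn_ind V \<epsilon>"
  shows "wlookup (sgn_proj V \<epsilon> x) xs = wlookup x xs"
proof -
  have "wlookup (sgn_proj V \<epsilon> x) xs =
      (\<Sum>w | w \<in> wkeys x \<and> set w \<subseteq> sgn_ind V \<epsilon>. if w = xs then wlookup x xs else 0)"
    unfolding sgn_proj_def lookup_sum by (intro sum.cong refl) (auto simp: lookup_single when_def)
  then show ?thesis using assms by (auto simp: in_keys_iff)
qed

text \<open>The defining equation of \<open>D\<close> is evaluated at the bilinear form that
  multiplies the coefficient at \<open>xs\<close> with the value at \<open>z\<close>, which turns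
  tensors into numbers. The unknown normalisation of \<Lambda> occurs on both sides and
  cancels.\<close>

lemma coaction_minor_eq:
  assumes xs: "distinct xs" "set xs = sgn_ind V \<epsilon>" and \<chi>: "\<chi> id = 1"
    and \<Lambda>: "chi_symmetrizer \<chi> (length xs) ` sgn_tensor_power V \<epsilon> (length xs) = range (\<lambda>c. pscale c \<Lambda>)"
    and D: "coaction_minor V \<epsilon> \<Lambda> D"
  shows "D = ofw (minor \<chi> xs)"
proof
  fix z
  let ?A = "V_tensor_algebra V" and ?T = "matrix_coeff_alg V"
  have xsI: "set xs \<subseteq> I" using xs(2) by (auto simp: sgn_ind_def)
  have "wsingle xs 1 \<in> sgn_tensor_power V \<epsilon> (length xs)" using xs by (simp add: sgn_tensor_power_def)
  then have "chi_orbit \<chi> xs \<in> range (\<lambda>c. pscale c \<Lambda>)"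
    unfolding \<Lambda>[symmetric] chi_symmetrizer_single[symmetric] by (rule imageI)
  \<comment> \<open>Comparison at \<open>xs\<close> shows that \<open>c\<close> is the inverse of
    the coefficient of \<Lambda> there.\<close>
  then obtain c where c: "chi_orbit \<chi> xs = pscale c \<Lambda>" by blast
  have c1: "c * wlookup \<Lambda> xs = 1"
    using lookup_chi_orbit[OF xs(1), of \<chi>] \<chi> by (simp add: c)
  define \<beta> where "\<beta> = (\<lambda>(x :: 'i list \<Rightarrow>\<^sub>0 complex) (f :: 'i env => complex). wlookup x xs * f z)"
  have bil: "\<beta> \<in> bilinear_forms ?A ?T"
    by (simp add: bilinear_forms_def linear_functional_def V_tensor_algebra_def matrix_coeff_alg_eq R_simps \<beta>_def
        lookup_add algebra_simps)
  define \<phi> where "\<phi> w = (if length w = length xs then coaction_coeff V xs w z else 0)" for w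
  have proj: "(\<lambda>a b. \<beta> (sgn_proj V \<epsilon> a) b) = \<beta>"
    using lookup_sgn_proj[of xs \<epsilon>] xs(2) by (simp add: \<beta>_def)
  have "tensor_map ?A ?T (sgn_proj V \<epsilon>) (\<lambda>f. f) (coaction V \<Lambda>) \<beta> = tens ?A ?T \<Lambda> D \<beta>"
    using D by (simp add: coaction_minor_def Let_def)
  then have D1: "coaction V \<Lambda> \<beta> = wlookup \<Lambda> xs * D z"
    using bil proj by (simp add: tensor_map_def tens_def) (simp add: \<beta>_def)
  have "coaction V \<Lambda> \<beta> = (\<Sum>w\<in>wkeys \<Lambda>. \<Sum>u | set u \<subseteq> I \<and> length u = length w.
      if u = xs then wlookup \<Lambda> w * coaction_coeff V xs w z else 0)"
    unfolding coaction_def Let_def sum_fun_apply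
  proof (intro sum.cong refl)
    fix w u :: "'i list"
    show "wlookup \<Lambda> w * tens ?A ?T (wsingle u 1) (coaction_coeff V u w) \<beta> =
      (if u = xs then wlookup \<Lambda> w * coaction_coeff V xs w z else 0)"
      using bil by (simp add: tens_def) (simp add: \<beta>_def lookup_single when_def)
  qed
  also have "\<dots> = word_eval \<phi> \<Lambda>"
    unfolding word_eval_def
  proof (intro sum.cong refl)
    fix w :: "'i list"
    have "finite {u. set u \<subseteq> I \<and> length u = length w}" by (rule finite_lists_length_eq) simp
    then show "(\<Sum>u | set u \<subseteq> I \<and> length u = length w. if u = xs then wlookup \<Lambda> w * coaction_coeff V xs w z else 0) =
        wlookup \<Lambda> w * \<phi> w"
      using xsI by (auto simp: \<phi>_def)
  qed
  finally have "c * (wlookup \<Lambda> xs * D z) = word_eval \<phi> (chi_orbit \<chi> xs)"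
    unfolding D1 c by simp
  then have "D z = word_eval \<phi> (chi_orbit \<chi> xs)" using c1 by (simp add: mult.assoc[symmetric])
  also have "\<dots> = (\<Sum>\<sigma> | \<sigma> permutes {..<length xs}. \<chi> \<sigma> * perm_fac xs \<sigma> * \<phi> (moved xs \<sigma>))"
    by (simp add: chi_orbit_def word_eval_sum)
  also have "\<dots> = (\<Sum>\<sigma> | \<sigma> permutes {..<length xs}. ofw (\<lambda>y. \<chi> \<sigma> * perm_fac xs \<sigma> * ccw xs (moved xs \<sigma>) y) z)"
  proof (intro sum.cong refl)
    fix \<sigma> assume "\<sigma> \<in> {\<sigma>. \<sigma> permutes {..<length xs}}"
    then have "inv_into UNIV \<sigma> permutes {..<length xs}" using permutes_inv by blast
    then have "set (moved xs \<sigma>) \<subseteq> I" using xsI by simp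
    then have "coaction_coeff V xs (moved xs \<sigma>) = ofw (ccw xs (moved xs \<sigma>))" using coaction_coeff_eq[OF xsI] by blast
    then show "\<chi> \<sigma> * perm_fac xs \<sigma> * \<phi> (moved xs \<sigma>) = ofw (\<lambda>y. \<chi> \<sigma> * perm_fac xs \<sigma> * ccw xs (moved xs \<sigma>) y) z"
      unfolding ofw_scale by (simp add: \<phi>_def)
  qed
  also have "\<dots> = ofw (minor \<chi> xs) z"
    unfolding minor_def ofw_sum ..
  finally show "D z = ofw (minor \<chi> xs) z" .
qed

section \<open>Minors as determinants of the untwisted matrix\<close>

lemma moved_props:
  assumes "\<sigma> permutes {..<length xs}"
  shows "mset (moved xs \<sigma>) = mset xs" "set (moved xs \<sigma>) = set xs" "length (moved xs \<sigma>) = length xs"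
  using permutes_inv[OF assms] by simp_all

lemma cnt_count: "cnt w c = int (count (mset w) c)"
  by (induction w) (auto simp: unit_vec_def)

lemma cnt_moved: "\<sigma> permutes {..<length xs} ==> cnt (moved xs \<sigma>) = cnt xs"
  by (simp add: fun_eq_iff cnt_count moved_props)

lemma gen_sum: "(\<And>i. i \<in> S ==> f i \<in> gen X) ==> (\<lambda>w. \<Sum>i\<in>S. f i w) \<in> gen X"
  by (induction S rule: infinite_finite_induct) (simp_all add: gen_zero gen.add)

lemma minor_gen:
  assumes "set xs \<subseteq> I"
  shows "minor \<chi> xs \<in> gen tset"
  unfolding minor_def
proof (rule gen_sum, rule gen.scale)
  fix \<sigma> assume "\<sigma> \<in> {\<sigma>. \<sigma> permutes {..<length xs}}"
  then have "\<sigma> permutes {..<length xs}" by simp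
  then have "set (moved xs \<sigma>) \<subseteq> I" unfolding moved_props(2)[OF \<open>\<sigma> permutes {..<length xs}\<close>] by (intro assms)
  then show "ccw xs (moved xs \<sigma>) \<in> gen tset" using coaction_coeff_eq[OF assms] by blast
qed

text \<open>Row and column indices of a minor are the same letters, so it has degree 0 even in the
  finer grading. Minors are therefore central, and \<open>theta\<close> is exactly multiplicative on
  products with them.\<close>

lemma minor_vhom: "vhom (\<lambda>c. 0) (minor \<chi> xs)"
  unfolding vhom_def
proof (intro allI impI)
  fix w assume "minor \<chi> xs w \<noteq> 0"
  then obtain \<sigma> where \<sigma>: "\<sigma> permutes {..<length xs}" "\<chi> \<sigma> * perm_fac xs \<sigma> * ccw xs (moved xs \<sigma>) w \<noteq> 0"
    unfolding minor_def using sum.not_neutral_contains_not_neutral by (metis (no_types, lifting) mem_Collect_eq)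
  then have "ccw xs (moved xs \<sigma>) w \<noteq> 0" by auto
  then show "dv w = (\<lambda>c. 0)" using ccw_vhom[of xs "moved xs \<sigma>"] cnt_moved[OF \<sigma>(1)] by (simp add: vhom_def)
qed

lemma sgh_unit_cnt: "a \<in> I ==> set w \<subseteq> I ==> sgh (unit_vec a) (cnt w) = (\<Prod>j<length w. sg a (w ! j))"
proof (induction w)
  case (Cons b w)
  then have "sgh (unit_vec a) (cnt (b # w)) = sg a b * (\<Prod>j<length w. sg a (w ! j))"
    by (simp add: sgh_add_right sgh_unit)
  then show ?case by (simp add: prod.lessThan_Suc_shift del: prod.lessThan_Suc)
qed simp

lemma row_prod_pairs: "set w \<subseteq> I ==> row_prod w = (\<Prod>(i, j)\<in>ordered_pairs (length w). sg (w ! i) (w ! j))"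
proof (induction w)
  case Nil
  have "ordered_pairs 0 = {}" by (auto simp: ordered_pairs_def)
  then show ?case by simp
next
  case (Cons a w)
  then show ?case
    using prod_ordered_pairs_Suc[of "\<lambda>i j. sg ((a # w) ! i) ((a # w) ! j)" "length w"] by (simp add: sgh_unit_cnt)
qed

text \<open>Rearranging the columns changes \<open>row_prod\<close> by a ratio of \<open>sg\<close>
  for each inversion, which is \<omega> up to the sign \<open>eps\<close>. For odd indices these
  signs multiply to the sign of \<sigma>, which is how the plain symmetrizer on
  \<open>V\<^sub>-\<close> produces a determinant.\<close>

lemma row_prod_moved:
  assumes xs: "distinct xs" "set xs \<subseteq> I" "\<forall>a\<in>set xs. par a = p" and \<sigma>: "\<sigma> permutes {..<length xs}"
  shows "row_prod (moved xs \<sigma>) = row_prod xs * ((if p then of_int (sign \<sigma>) else 1) * perm_fac xs \<sigma>)"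
proof -
  define s :: complex where "s = (if p then - 1 else 1)"
  note inv = permutes_inv[OF \<sigma>]
  have "row_prod (moved xs \<sigma>) = (\<Prod>(i, j)\<in>ordered_pairs (length xs). sg (moved xs \<sigma> ! i) (moved xs \<sigma> ! j))"
    using row_prod_pairs[of "moved xs \<sigma>"] moved_props[OF \<sigma>] xs(2) by simp
  also have "\<dots> = (\<Prod>(i, j)\<in>ordered_pairs (length xs). sg (xs ! inv_into UNIV \<sigma> i) (xs ! inv_into UNIV \<sigma> j))"
    by (rule prod.cong[OF refl]) (auto simp: ordered_pairs_def permute_list_nth[OF inv])
  also have "\<dots> = (\<Prod>(i, j)\<in>ordered_pairs (length xs). sg (xs ! i) (xs ! j)) *
      (\<Prod>(i, j)\<in>inversions (length xs) \<sigma>. sg (xs ! j) (xs ! i) / sg (xs ! i) (xs ! j))"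
    by (rule prod_permuted_pairs[OF \<sigma>, where f = "\<lambda>i j. sg (xs ! i) (xs ! j)"]) simp
  also have "(\<Prod>(i, j)\<in>ordered_pairs (length xs). sg (xs ! i) (xs ! j)) = row_prod xs"
    by (rule row_prod_pairs[OF xs(2), symmetric])
  also have "(\<Prod>(i, j)\<in>inversions (length xs) \<sigma>. sg (xs ! j) (xs ! i) / sg (xs ! i) (xs ! j)) =
      (\<Prod>(i, j)\<in>inversions (length xs) \<sigma>. s * \<omega> (\<gamma> (xs ! i)) (\<gamma> (xs ! j)))"
  proof (rule prod.cong[OF refl], clarify)
    fix i j assume "(i, j) \<in> inversions (length xs) \<sigma>"
    then have "xs ! i \<in> set xs" "xs ! j \<in> set xs" by (auto simp: inversions_def)
    then have ab: "xs ! i \<in> I" "xs ! j \<in> I" "eps (xs ! i) (xs ! j) = s" using xs by (auto simp: eps_def s_def)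
    show "sg (xs ! j) (xs ! i) / sg (xs ! i) (xs ! j) = s * \<omega> (\<gamma> (xs ! i)) (\<gamma> (xs ! j))"
      unfolding fac_sg[OF ab(1,2)] ab(3) by (simp add: s_def)
  qed
  also have "\<dots> = s ^ card (inversions (length xs) \<sigma>) * perm_fac xs \<sigma>"
    unfolding perm_fac_def by (simp add: case_prod_unfold prod.distrib)
  also have "s ^ card (inversions (length xs) \<sigma>) = (if p then of_int (sign \<sigma>) else 1)"
    using sign_inversions_complex[OF \<sigma>] by (simp add: s_def)
  finally show ?thesis .
qed

lemma sign_square: "of_int (sign \<sigma>) * (of_int (sign \<sigma>) * x) = (x :: complex)"
  by (simp add: sign_def)

lemma theta_sign: "theta (\<lambda>w. of_int (sign \<sigma>) * f w) = of_int (sign \<sigma>) * theta f"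
  using theta_minus[of f] by (simp add: sign_def)

lemma efun_val_sign: "efun_val (of_int (sign \<sigma>) * x) = of_int (sign \<sigma>) * efun_val x"
  by (simp add: sign_def)

lemma tau_prod_efun:
  assumes "length u = length w" "\<forall>a\<in>set u \<union> set w. par a = p"
  shows "tau_prod u w = efun_val (\<Prod>i<length u. Efun (tau (u ! i) (w ! i)))"
  using assms
proof (induction u w rule: list_induct2)
  case (Cons b u a w)
  have "sfun_even (tau b a)" using tau_parity[of b a] Cons.prems by simp
  then show ?case using Cons by (simp add: prod.lessThan_Suc_shift del: prod.lessThan_Suc)
qed simp

abbreviation "tau_mat xs \<equiv> mat (length xs) (length xs) (\<lambda>(i, j). Efun (tau (xs ! i) (xs ! j)))"

text \<open>Entries between indices of one parity are even, so their products can be formed in the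
  commutative ring. \<open>moved\<close> uses the inverse permutation, which has the same
  sign.\<close>

lemma det_tau_mat:
  assumes "\<forall>a\<in>set xs. par a = p"
  shows "efun_val (det (tau_mat xs)) = (\<Sum>\<sigma> | \<sigma> permutes {..<length xs}. of_int (sign \<sigma>) * tau_prod xs (moved xs \<sigma>))"
proof -
  have "det (tau_mat xs) = (\<Sum>\<pi> | \<pi> permutes {..<length xs}. of_int (sign \<pi>) * (\<Prod>i<length xs. tau_mat xs $$ (i, \<pi> i)))"
    using det_def'[of "tau_mat xs" "length xs"] by (simp add: lessThan_atLeast0)
  then have "efun_val (det (tau_mat xs)) =
      (\<Sum>\<pi> | \<pi> permutes {..<length xs}. of_int (sign \<pi>) * efun_val (\<Prod>i<length xs. tau_mat xs $$ (i, \<pi> i)))"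
    by (simp only: efun_val_sum efun_val_sign)
  also have "\<dots> = (\<Sum>\<pi> | \<pi> permutes {..<length xs}. of_int (sign \<pi>) * tau_prod xs (permute_list \<pi> xs))"
  proof (intro sum.cong refl arg_cong[where f = "(*) _"])
    fix \<pi> assume "\<pi> \<in> {\<pi>. \<pi> permutes {..<length xs}}"
    then have \<pi>: "\<pi> permutes {..<length xs}" by simp
    have "tau_prod xs (permute_list \<pi> xs) = efun_val (\<Prod>i<length xs. Efun (tau (xs ! i) (permute_list \<pi> xs ! i)))"
      using assms \<pi> by (intro tau_prod_efun[where p = p]) auto
    also have "(\<Prod>i<length xs. Efun (tau (xs ! i) (permute_list \<pi> xs ! i))) = (\<Prod>i<length xs. tau_mat xs $$ (i, \<pi> i))"
      using permutes_in_image[OF \<pi>] by (intro prod.cong refl) (simp add: permute_list_nth[OF \<pi>])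
    finally show "efun_val (\<Prod>i<length xs. tau_mat xs $$ (i, \<pi> i)) = tau_prod xs (permute_list \<pi> xs)" ..
  qed
  also have "\<dots> = (\<Sum>\<pi> | \<pi> permutes {..<length xs}. of_int (sign (inv_into UNIV \<pi>)) * tau_prod xs (moved xs \<pi>))"
    by (rule sum_permutations_inverse)
  also have "\<dots> = (\<Sum>\<sigma> | \<sigma> permutes {..<length xs}. of_int (sign \<sigma>) * tau_prod xs (moved xs \<sigma>))"
  proof (intro sum.cong refl)
    fix \<sigma> assume "\<sigma> \<in> {\<sigma>. \<sigma> permutes {..<length xs}}"
    then have "permutation \<sigma>" unfolding permutation_permutes by (intro exI[of _ "{..<length xs}"]) simp
    then show "of_int (sign (inv_into UNIV \<sigma>)) * tau_prod xs (moved xs \<sigma>) = of_int (sign \<sigma>) * tau_prod xs (moved xs \<sigma>)"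
      by (simp add: sign_inverse)
  qed
  finally show ?thesis .
qed

text \<open>The scalar \<kappa> is that of \<open>theta_ccw\<close> for the identity permutation;
  \<open>row_prod_moved\<close> accounts for its change under the others.\<close>

lemma theta_minor:
  assumes xs: "distinct xs" "set xs \<subseteq> I" "\<forall>a\<in>set xs. par a = p"
    and \<chi>: "\<And>\<sigma>. \<chi> \<sigma> = (if p then 1 else of_int (sign \<sigma>))"
  obtains \<kappa> where "\<kappa> \<noteq> 0" "theta (\<lambda>y. \<kappa> * minor \<chi> xs y) = efun_val (det (tau_mat xs))"
proof
  define K where "K = col_prod xs / sgh (cnt xs) (cnt xs)"
  show "row_prod xs * K \<noteq> 0" by (simp add: K_def)
  have "theta (\<lambda>y. row_prod xs * K * minor \<chi> xs y) =
      (\<Sum>\<sigma> | \<sigma> permutes {..<length xs}. theta (\<lambda>y. row_prod xs * K * (\<chi> \<sigma> * perm_fac xs \<sigma> * ccw xs (moved xs \<sigma>) y)))"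
    unfolding minor_def sum_distrib_left theta_sum ..
  also have "\<dots> = (\<Sum>\<sigma> | \<sigma> permutes {..<length xs}. of_int (sign \<sigma>) * tau_prod xs (moved xs \<sigma>))"
  proof (intro sum.cong refl)
    fix \<sigma> assume "\<sigma> \<in> {\<sigma>. \<sigma> permutes {..<length xs}}"
    then have \<sigma>: "\<sigma> permutes {..<length xs}" by simp
    have "row_prod xs * (\<chi> \<sigma> * perm_fac xs \<sigma>) = of_int (sign \<sigma>) * row_prod (moved xs \<sigma>)"
      unfolding row_prod_moved[OF xs \<sigma>] \<chi> by (cases p) (simp_all add: mult_ac sign_square)
    then have eq: "row_prod xs * K * (\<chi> \<sigma> * perm_fac xs \<sigma> * c) = of_int (sign \<sigma>) * (row_prod (moved xs \<sigma>) * K * c)" for c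
      by (metis (no_types, lifting) mult.assoc mult.commute)
    have "theta (\<lambda>y. row_prod xs * K * (\<chi> \<sigma> * perm_fac xs \<sigma> * ccw xs (moved xs \<sigma>) y)) =
       of_int (sign \<sigma>) * theta (\<lambda>y. row_prod (moved xs \<sigma>) * K * ccw xs (moved xs \<sigma>) y)"
      unfolding theta_sign[symmetric] by (rule arg_cong[where f = theta]) (rule ext, rule eq)
    also have "theta (\<lambda>y. row_prod (moved xs \<sigma>) * K * ccw xs (moved xs \<sigma>) y) = tau_prod xs (moved xs \<sigma>)"
      using theta_ccw[of xs "moved xs \<sigma>" p] moved_props[OF \<sigma>] cnt_moved[OF \<sigma>] xs by (simp add: K_def)
    finally show "theta (\<lambda>y. row_prod xs * K * (\<chi> \<sigma> * perm_fac xs \<sigma> * ccw xs (moved xs \<sigma>) y)) =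
        of_int (sign \<sigma>) * tau_prod xs (moved xs \<sigma>)" .
  qed
  also have "\<dots> = efun_val (det (tau_mat xs))" by (rule det_tau_mat[OF xs(3), symmetric])
  finally show "theta (\<lambda>y. row_prod xs * K * minor \<chi> xs y) = efun_val (det (tau_mat xs))" .
qed

section \<open>Clearing denominators\<close>

primrec wpow :: "'i gfun => nat => 'i gfun" where
  "wpow d 0 = unit_word"
| "wpow d (Suc k) = wpow d k \<cdot> d"

lemma wpow_gen: "d \<in> gen X ==> wpow d k \<in> gen X"
  by (induction k) (auto intro: gen.intros)

lemma wpow_vhom: "vhom (\<lambda>c. 0) d ==> vhom (\<lambda>c. 0) (wpow d k)"
proof (induction k)
  case (Suc k)
  then show ?case using vhom_mult[of "\<lambda>c. 0" "wpow d k" "\<lambda>c. 0" d] by simp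
qed (simp add: vhom_unit)

lemma vhom_zero_dg: "vhom (\<lambda>c. 0) d ==> d w \<noteq> 0 ==> dg w = 0"
  using dv_eq_dg[of w "[]"] by (simp add: vhom_def)

lemma vhom_zero_central: "vhom (\<lambda>c. 0) d ==> d \<cdot> f = f \<cdot> d"
  using wk.shuffle_commute[of d f 1] vhom_zero_dg[of d] by (simp add: word_fac_def)

lemma vhom_zero_mult: "vhom (\<lambda>c. 0) d ==> vhom (\<lambda>c. 0) e ==> vhom (\<lambda>c. 0) (d \<cdot> e)"
  using vhom_mult[of "\<lambda>c. 0" d "\<lambda>c. 0" e] by simp

lemma theta_zero_mult: "vhom (\<lambda>c. 0) d ==> theta d * theta f = theta (d \<cdot> f)"
  using theta_mult[of d f 1] by (simp add: vhom_def)

lemma wpow_add: "wpow d (k + l) = wpow d k \<cdot> wpow d l"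
  by (induction l) (simp_all add: wk.shuffle_assoc)

lemma wpow_mult:
  assumes "vhom (\<lambda>c. 0) d" "vhom (\<lambda>c. 0) e"
  shows "wpow (d \<cdot> e) k = wpow d k \<cdot> wpow e k"
proof (induction k)
  case (Suc k)
  have "wpow e k \<cdot> (d \<cdot> e) = d \<cdot> (wpow e k \<cdot> e)"
    using vhom_zero_central[OF assms(1), of "wpow e k"] by (metis wk.shuffle_assoc)
  then show ?case using Suc by (simp add: wk.shuffle_assoc)
qed simp

text \<open>The elements that a power of the central \<open>d\<close> carries into the smaller
  algebra are closed under all operations, so it suffices to clear the generators.\<close>

lemma gen_clear:
  assumes d: "vhom (\<lambda>c. 0) d" "d \<in> gen X"
    and base: "\<And>y. y \<in> Y ==> \<exists>k. wpow d k \<cdot> y \<in> gen X" and f: "f \<in> gen Y"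
  shows "\<exists>k. wpow d k \<cdot> f \<in> gen X"
  using f
proof (induction rule: gen.induct)
  case unit
  have "wpow d 0 \<cdot> unit_word \<in> gen X" by (simp add: gen.unit)
  then show ?case by blast
next
  case (base x)
  then show ?case by (rule assms(3))
next
  case (add f g)
  then obtain k l where kl: "wpow d k \<cdot> f \<in> gen X" "wpow d l \<cdot> g \<in> gen X" by blast
  have "wpow d (l + k) \<cdot> f \<in> gen X" "wpow d (k + l) \<cdot> g \<in> gen X"
    unfolding wpow_add wk.shuffle_assoc by (intro gen.mult wpow_gen d(2) kl)+
  then have "wpow d (k + l) \<cdot> (\<lambda>w. f w + g w) \<in> gen X"
    unfolding wk.shuffle_add_right by (intro gen.add) (simp_all only: add.commute)
  then show ?case by blast
next
  case (scale f c)
  then obtain k where "wpow d k \<cdot> f \<in> gen X" by blast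
  then have "wpow d k \<cdot> (\<lambda>w. c * f w) \<in> gen X" unfolding wk.shuffle_scale_right by (rule gen.scale)
  then show ?case by blast
next
  case (mult f g)
  then obtain k l where kl: "wpow d k \<cdot> f \<in> gen X" "wpow d l \<cdot> g \<in> gen X" by blast
  have "(wpow d k \<cdot> wpow d l) \<cdot> (f \<cdot> g) = wpow d k \<cdot> ((wpow d l \<cdot> f) \<cdot> g)" by (simp add: wk.shuffle_assoc)
  also have "wpow d l \<cdot> f = f \<cdot> wpow d l" by (rule vhom_zero_central[OF wpow_vhom[OF d(1)]])
  also have "wpow d k \<cdot> ((f \<cdot> wpow d l) \<cdot> g) = (wpow d k \<cdot> f) \<cdot> (wpow d l \<cdot> g)" by (simp add: wk.shuffle_assoc)
  finally have "wpow d (k + l) \<cdot> (f \<cdot> g) \<in> gen X" unfolding wpow_add using gen.mult[OF kl] by simp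
  then show ?case by blast
qed

lemma tsset_mono: "f \<in> gen tset ==> f \<in> gen tsset"
  using gen_mono[of tset tsset] by (auto simp: tsset_def)

lemma gen_unscale: "(\<lambda>w. c * f w) \<in> gen X ==> c \<noteq> 0 ==> f \<in> gen X"
  using gen.scale[of "\<lambda>w. c * f w" X "inverse c"] by (simp add: mult.assoc[symmetric])

lemma antiL_sw: "antiL a c = (\<lambda>w. inverse (\<omega> (\<gamma> c) (\<gamma> a - \<gamma> c)) * sw a c w)"
  by (simp add: sw_def mult.assoc[symmetric])

lemma sw_gen: "a \<in> I ==> c \<in> I ==> sw a c \<in> gen tsset"
  unfolding sw_def by (intro gen.scale gen.base) (auto simp: tsset_def)

lemma tw_gen: "a \<in> I ==> b \<in> I ==> tw b a \<in> gen tset"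
  by (intro gen.base) (auto simp: tset_def)

lemma theta_gen_imp:
  assumes "theta (\<lambda>w. c * f w) \<in> theta ` gen X" "c \<noteq> 0" "generators X" "\<And>w. f w \<noteq> 0 ==> set w \<subseteq> L"
  shows "f \<in> gen X"
proof -
  obtain g where g: "g \<in> gen X" "theta (\<lambda>w. c * f w) = theta g" using assms(1) by blast
  have "(\<lambda>w. c * f w) = g"
    by (rule theta_inj[OF _ gen_support[OF assms(3) g(1)] g(2)]) (use assms(4) in auto)
  then show ?thesis using gen_unscale[of c f X] g(1) assms(2) by simp
qed

text \<open>The supermatrix theorem for \<open>tau\<close> and \<open>tau'\<close>, with the indices
  of \<open>V\<^sub>+\<close> listed before those of \<open>V\<^sub>-\<close>, pulled back along
  \<open>theta\<close>, which is injective on functions supported on words over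
  \<open>L\<close>.\<close>

lemma minors_invert:
  assumes ps: "distinct ps" "set ps = {a \<in> I. \<not> par a}" and ms: "distinct ms" "set ms = {a \<in> I. par a}"
  defines "dp \<equiv> minor (\<lambda>\<sigma>. of_int (sign \<sigma>)) ps" and "dm \<equiv> minor (\<lambda>\<sigma>. 1) ms"
  shows "\<exists>u\<in>gen tsset. dp \<cdot> u = unit_word" "\<exists>u\<in>gen tsset. dm \<cdot> u = unit_word"
    "\<And>f. f \<in> gen tsset ==> \<exists>k. wpow (dp \<cdot> dm) k \<cdot> f \<in> gen tset"
proof -
  define xs where "xs = ps @ ms"
  define m q where "m = length ps" and "q = length ms"
  have sub: "set ps \<subseteq> I" "set ms \<subseteq> I" using ps ms by auto
  have xs: "distinct xs" "set xs = I" "length xs = m + q" using ps ms by (auto simp: xs_def m_def q_def)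
  have nth: "xs ! i \<in> I" if "i < m + q" for i using nth_mem[of i xs] that xs by simp
  have par: "par (xs ! i) \<longleftrightarrow> \<not> i < m" if "i < m + q" for i
  proof (cases "i < m")
    case True
    then have "xs ! i \<in> set ps" by (simp add: xs_def m_def nth_append)
    then show ?thesis using ps True by simp
  next
    case False
    then have "xs ! i \<in> set ms" using that by (simp add: xs_def m_def q_def nth_append)
    then show ?thesis using ms False by simp
  qed
  let ?t = "\<lambda>i j. tau (xs ! i) (xs ! j)" and ?s = "\<lambda>i j. tau' (xs ! i) (xs ! j)"
  let ?T = "theta ` gen tset" and ?T' = "theta ` gen tsset"
  have vh: "\<exists>v. vhom v x" if "generators X" "x \<in> X" for x X using that by (simp add: generators_def)
  have T: "subring_set ?T" by (rule subring_theta_gen[OF vh[OF tset_generators]])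
  have T': "subring_set ?T'" by (rule subring_theta_gen[OF vh[OF tsset_generators]])
  have tT: "tau b a \<in> ?T" if "a \<in> I" "b \<in> I" for a b
    unfolding tau_def using that by (intro imageI gen.scale tw_gen)
  have tT': "tau b a \<in> ?T'" if "a \<in> I" "b \<in> I" for a b
    unfolding tau_def using that by (intro imageI gen.scale tsset_mono tw_gen)
  have sT': "tau' b a \<in> ?T'" if "a \<in> I" "b \<in> I" for a b
    unfolding tau'_def using that by (intro imageI gen.scale sw_gen)
  have even: "sfun_even (?t i j) \<and> sfun_even (?s i j)" if "i < m + q" "j < m + q" "i < m \<longleftrightarrow> j < m" for i j
    using tau_parity[of "xs ! i" "xs ! j"] tau'_parity[of "xs ! i" "xs ! j"] par that by simp
  have odd: "sfun_odd (?t i j) \<and> sfun_odd (?s i j)" if "i < m + q" "j < m + q" "i < m \<longleftrightarrow> \<not> j < m" for i j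
    using tau_parity[of "xs ! i" "xs ! j"] tau'_parity[of "xs ! i" "xs ! j"] par that by simp
  have ts: "(\<Sum>a<m + q. ?t i a * ?s a j) = (if i = j then 1 else 0)" if ij: "i < m + q" "j < m + q" for i j
  proof -
    have "(\<Sum>a<m + q. ?t i a * ?s a j) = (\<Sum>a\<in>I. tau (xs ! i) a * tau' a (xs ! j))"
      by (rule sum.reindex_bij_betw[OF bij_betw_nth[OF xs(1)], of _ _ "\<lambda>a. tau (xs ! i) a * tau' a (xs ! j)"]) (simp_all add: xs)
    then show ?thesis using tau_tau'[OF nth[OF ij(1)] nth[OF ij(2)]] nth_eq_iff_index_eq[OF xs(1)] ij xs(3) by simp
  qed
  have A: "mat m m (\<lambda>(i, j). Efun (?t i j)) = tau_mat ps"
    by (rule eq_matI) (simp_all add: xs_def m_def nth_append)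
  have B: "mat q q (\<lambda>(i, j). Efun (?t (m + i) (m + j))) = tau_mat ms"
    by (rule eq_matI) (simp_all add: xs_def m_def q_def nth_append)
  have inv1: "\<exists>u\<in>?T'. sfun_even u \<and> efun_val (det (tau_mat ps)) * u = 1"
    using supermatrix_inverse_entries(1)[where t = ?t and s = ?s and m = m and q = q and T = ?T and T' = ?T']
      even odd ts T tT nth T' tT' sT' unfolding A by simp
  have inv2: "\<exists>u\<in>?T'. sfun_even u \<and> efun_val (det (tau_mat ms)) * u = 1"
    using supermatrix_inverse_entries(2)[where t = ?t and s = ?s and m = m and q = q and T = ?T and T' = ?T']
      even odd ts T tT nth T' tT' sT' unfolding B by simp
  have inv3: "\<exists>k. efun_val (det (tau_mat ps) * det (tau_mat ms)) ^ k * ?s i j \<in> ?T" if "i < m + q" "j < m + q" for i j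
    using supermatrix_inverse_entries(3)[where t = ?t and s = ?s and m = m and q = q and T = ?T and T' = ?T']
      even odd ts T tT nth T' tT' sT' that unfolding A B by simp
  obtain \<kappa> where \<kappa>: "\<kappa> \<noteq> 0" "theta (\<lambda>y. \<kappa> * dp y) = efun_val (det (tau_mat ps))"
    unfolding dp_def by (rule theta_minor[OF ps(1) sub(1), where p = False and \<chi> = "\<lambda>\<sigma>. of_int (sign \<sigma>)"]) (use ps in auto)
  obtain \<mu> where \<mu>: "\<mu> \<noteq> 0" "theta (\<lambda>y. \<mu> * dm y) = efun_val (det (tau_mat ms))"
    unfolding dm_def by (rule theta_minor[OF ms(1) sub(2), where p = True and \<chi> = "\<lambda>\<sigma>. 1"]) (use ms in auto)
  have v: "vhom (\<lambda>c. 0) dp" "vhom (\<lambda>c. 0) dm" unfolding dp_def dm_def by (rule minor_vhom)+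
  have g: "dp \<in> gen tset" "dm \<in> gen tset" unfolding dp_def dm_def by (rule minor_gen[OF sub(1)], rule minor_gen[OF sub(2)])
  \<comment> \<open>The scalar between minor and determinant is moved to the inverse; since the
    minor has degree 0, its product with the inverse is respected by \<open>theta\<close>.\<close>
  have unit: "\<exists>u\<in>gen tsset. d \<cdot> u = unit_word"
    if d: "vhom (\<lambda>c. 0) d" "d \<in> gen tset" and u: "\<exists>u\<in>?T'. sfun_even u \<and> theta (\<lambda>y. \<kappa> * d y) * u = 1" for d \<kappa>
  proof -
    obtain f where f: "f \<in> gen tsset" "theta (\<lambda>y. \<kappa> * d y) * theta f = 1" using u by blast
    have eq: "(\<lambda>y. \<kappa> * d y) \<cdot> f = d \<cdot> (\<lambda>y. \<kappa> * f y)" by (simp add: wk.shuffle_scale_left wk.shuffle_scale_right)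
    have "theta ((\<lambda>y. \<kappa> * d y) \<cdot> f) = theta unit_word"
      using theta_zero_mult[OF vhom_scale[OF d(1)], of \<kappa> f] f(2) by (simp add: theta_unit)
    then have "theta (d \<cdot> (\<lambda>y. \<kappa> * f y)) = theta unit_word" unfolding eq .
    then have "d \<cdot> (\<lambda>y. \<kappa> * f y) = unit_word"
    proof (rule theta_inj[rotated 2])
      show "set w \<subseteq> L" if "(d \<cdot> (\<lambda>y. \<kappa> * f y)) w \<noteq> 0" for w
        using gen_support[OF tsset_generators gen.mult[OF tsset_mono[OF d(2)] gen.scale[OF f(1)]] that] .
      show "set w \<subseteq> L" if "unit_word w \<noteq> 0" for w
        using gen_support[OF tsset_generators gen.unit that] .
    qed
    then show ?thesis using gen.scale[OF f(1)] by blast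
  qed
  show "\<exists>u\<in>gen tsset. dp \<cdot> u = unit_word" by (rule unit[OF v(1) g(1) inv1[folded \<kappa>(2)]])
  show "\<exists>u\<in>gen tsset. dm \<cdot> u = unit_word" by (rule unit[OF v(2) g(2) inv2[folded \<mu>(2)]])
  define d where "d = dp \<cdot> dm"
  have dv: "vhom (\<lambda>c. 0) d" unfolding d_def by (rule vhom_zero_mult[OF v])
  have dg: "d \<in> gen tset" unfolding d_def by (rule gen.mult[OF g])
  have pow: "efun_val (det (tau_mat ps) * det (tau_mat ms)) ^ k = theta (\<lambda>w. (\<kappa> * \<mu>) ^ k * wpow d k w)" for k
  proof (induction k)
    case (Suc k)
    have "theta (\<lambda>y. \<kappa> * dp y) * theta (\<lambda>y. \<mu> * dm y) = theta ((\<lambda>y. \<kappa> * dp y) \<cdot> (\<lambda>y. \<mu> * dm y))"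
      by (rule theta_zero_mult[OF vhom_scale[OF v(1)]])
    also have "(\<lambda>y. \<kappa> * dp y) \<cdot> (\<lambda>y. \<mu> * dm y) = (\<lambda>w. \<kappa> * \<mu> * d w)"
      unfolding wk.shuffle_scale_left wk.shuffle_scale_right d_def by (simp only: mult.assoc)
    finally have "efun_val (det (tau_mat ps) * det (tau_mat ms)) = theta (\<lambda>w. \<kappa> * \<mu> * d w)"
      unfolding \<kappa>(2) \<mu>(2) by simp
    then have "efun_val (det (tau_mat ps) * det (tau_mat ms)) ^ Suc k =
        theta (\<lambda>w. (\<kappa> * \<mu>) ^ k * wpow d k w) * theta (\<lambda>w. \<kappa> * \<mu> * d w)"
      unfolding power_Suc2 Suc by simp
    also have "\<dots> = theta ((\<lambda>w. (\<kappa> * \<mu>) ^ k * wpow d k w) \<cdot> (\<lambda>w. \<kappa> * \<mu> * d w))"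
      by (rule theta_zero_mult[OF vhom_scale[OF wpow_vhom[OF dv]]])
    also have "(\<lambda>w. (\<kappa> * \<mu>) ^ k * wpow d k w) \<cdot> (\<lambda>w. \<kappa> * \<mu> * d w) = (\<lambda>w. (\<kappa> * \<mu>) ^ Suc k * wpow d (Suc k) w)"
      unfolding wk.shuffle_scale_left wk.shuffle_scale_right wpow.simps power_Suc2 by (simp only: mult.assoc)
    finally show ?case .
  qed (simp add: theta_unit)
  have clear_sw: "\<exists>k. wpow d k \<cdot> sw a c \<in> gen tset" if ac: "a \<in> I" "c \<in> I" for a c
  proof -
    obtain i j where ij: "i < m + q" "j < m + q" "xs ! i = a" "xs ! j = c" using ac xs by (metis in_set_conv_nth)
    obtain k where k: "theta (\<lambda>w. (\<kappa> * \<mu>) ^ k * wpow d k w) * tau' a c \<in> ?T" using inv3[OF ij(1,2)] pow ij(3,4) by auto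
    have "theta (\<lambda>w. (\<kappa> * \<mu>) ^ k * wpow d k w) * tau' a c = theta (\<lambda>w. (\<kappa> * \<mu>) ^ k * inverse (sg a c) * (wpow d k \<cdot> sw a c) w)"
      unfolding tau'_def theta_zero_mult[OF vhom_scale[OF wpow_vhom[OF dv]]]
      unfolding wk.shuffle_scale_left wk.shuffle_scale_right by (simp only: mult.assoc)
    then have "theta (\<lambda>w. (\<kappa> * \<mu>) ^ k * inverse (sg a c) * (wpow d k \<cdot> sw a c) w) \<in> ?T" using k by simp
    then have "wpow d k \<cdot> sw a c \<in> gen tset"
    proof (rule theta_gen_imp[OF _ _ tset_generators])
      show "(\<kappa> * \<mu>) ^ k * inverse (sg a c) \<noteq> 0" using \<kappa>(1) \<mu>(1) by simp
      show "set w \<subseteq> L" if "(wpow d k \<cdot> sw a c) w \<noteq> 0" for w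
        using gen_support[OF tsset_generators gen.mult[OF tsset_mono[OF wpow_gen[OF dg]] sw_gen[OF ac]] that] .
    qed
    then show ?thesis by blast
  qed
  have base: "\<exists>k. wpow d k \<cdot> y \<in> gen tset" if "y \<in> tsset" for y
  proof -
    consider "y \<in> tset" | a c where "y = antiL a c" "a \<in> I" "c \<in> I" using \<open>y \<in> tsset\<close> by (auto simp: tsset_def)
    then show ?thesis
    proof cases
      case 1
      then have "wpow d 0 \<cdot> y \<in> gen tset" by (simp add: gen.base)
      then show ?thesis by blast
    next
      case (2 a c)
      obtain k where "wpow d k \<cdot> sw a c \<in> gen tset" using clear_sw[OF 2(2,3)] by blast
      then have "wpow d k \<cdot> antiL a c \<in> gen tset" unfolding antiL_sw wk.shuffle_scale_right by (rule gen.scale)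
      then show ?thesis unfolding 2(1) by blast
    qed
  qed
  show "\<exists>k. wpow (dp \<cdot> dm) k \<cdot> f \<in> gen tset" if "f \<in> gen tsset" for f
    unfolding d_def[symmetric] by (rule gen_clear[OF dv dg base that])
qed

end

context graded_basis
begin

section \<open>The coordinate algebra as a ring of fractions\<close>

lemma gen_wpart: "generators X ==> f \<in> gen X ==> wpart \<alpha> f \<in> gen X"
proof -
  assume X: "generators X" and f: "f \<in> gen X"
  have "hsum X f" by (rule gen_hsum[OF f]) (use X in \<open>simp add: generators_def\<close>)
  then show ?thesis using hsum_wpart by blast
qed

lemma wpart_mult:
  assumes g: "vhom (\<lambda>c. 0) g"
  shows "wpart \<alpha> (g \<cdot> f) = g \<cdot> wpart \<alpha> f"
proof
  fix w
  show "wpart \<alpha> (g \<cdot> f) w = (g \<cdot> wpart \<alpha> f) w"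
  proof (cases "dg w = - \<alpha>")
    case True
    have "(g \<cdot> f) w = (g \<cdot> wpart \<alpha> f) w"
      unfolding wk.shuffle_def
    proof (rule split_sum_cong_mset)
      fix u v assume uv: "mset u + mset v = mset w"
      show "word_fac u v * g u * f v = word_fac u v * g u * wpart \<alpha> f v"
      proof (cases "g u = 0")
        case False
        then have "dg v = - \<alpha>" using dg_mset[OF uv[symmetric]] vhom_zero_dg[OF g False] True by simp
        then show ?thesis by (simp add: wpart_def)
      qed simp
    qed
    then show ?thesis using True by (simp add: wpart_def)
  next
    case False
    have "(g \<cdot> wpart \<alpha> f) w = 0"
    proof (rule ccontr)
      assume "(g \<cdot> wpart \<alpha> f) w \<noteq> 0"
      then obtain u v where uv: "g u \<noteq> 0" "wpart \<alpha> f v \<noteq> 0" "mset w = mset u + mset v" by (rule wk.shuffle_nonzeroE)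
      have "dg v = - \<alpha>" using uv(2) by (auto simp: wpart_def split: if_splits)
      then show False using dg_mset[OF uv(3)] vhom_zero_dg[OF g uv(1)] False by simp
    qed
    then show ?thesis using False by (simp add: wpart_def)
  qed
qed

lemma wpow_inverse:
  assumes d: "vhom (\<lambda>c. 0) d" and u: "d \<cdot> u = unit_word"
  shows "wpow d k \<cdot> wpow u k = unit_word"
proof (induction k)
  case (Suc k)
  have "(wpow d k \<cdot> d) \<cdot> (wpow u k \<cdot> u) = wpow d k \<cdot> ((d \<cdot> wpow u k) \<cdot> u)" by (simp only: wk.shuffle_assoc)
  also have "d \<cdot> wpow u k = wpow u k \<cdot> d" by (rule vhom_zero_central[OF d])
  also have "wpow d k \<cdot> ((wpow u k \<cdot> d) \<cdot> u) = (wpow d k \<cdot> wpow u k) \<cdot> (d \<cdot> u)" by (simp only: wk.shuffle_assoc)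
  finally show ?case using Suc u by simp
qed simp

lemma R_pow:
  assumes X: "generators X" and d: "d \<in> gen X"
  shows "ofw d [^]\<^bsub>R X\<^esub> (k :: nat) = ofw (wpow d k)"
proof -
  interpret RX: ring "R X" by (rule ring_R[OF X])
  show ?thesis
  proof (induction k)
    case (Suc k)
    then show ?case using R_mult[OF X wpow_gen[OF d] d] by simp
  qed (simp add: R_simps)
qed

definition wpowers :: "'i gfun => 'i gfun => 'i gfun set" where
  "wpowers d e = {wpow d i \<cdot> wpow e j | i j. True}"

lemma minor_powers_eq:
  assumes "d \<in> gen tset" "e \<in> gen tset"
  shows "minor_powers V (ofw d) (ofw e) = ofw ` wpowers d e"
proof -
  note X = tset_generators
  have eq: "(ofw d [^]\<^bsub>R tset\<^esub> i) \<otimes>\<^bsub>R tset\<^esub> (ofw e [^]\<^bsub>R tset\<^esub> j) = ofw (wpow d i \<cdot> wpow e j)" for i j :: nat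
    unfolding R_pow[OF X assms(1)] R_pow[OF X assms(2)] by (rule R_mult[OF X wpow_gen[OF assms(1)] wpow_gen[OF assms(2)]])
  show ?thesis unfolding minor_powers_def Let_def matrix_coeff_alg_eq eq wpowers_def by blast
qed

text \<open>Denominators arise as powers of \<open>d \<cdot> e\<close>; centrality rewrites them as
  \<open>wpow d k \<cdot> wpow e k\<close>, which belongs to the multiplicative set.\<close>

lemma central_fractions_minors:
  assumes v: "vhom (\<lambda>c. 0) d" "vhom (\<lambda>c. 0) e" and g: "d \<in> gen tset" "e \<in> gen tset"
    and inv: "\<exists>u\<in>gen tsset. d \<cdot> u = unit_word" "\<exists>u\<in>gen tsset. e \<cdot> u = unit_word"
    and cl: "\<And>f. f \<in> gen tsset ==> \<exists>k. wpow (d \<cdot> e) k \<cdot> f \<in> gen tset"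
  shows "central_fractions (R tsset) prW (R tset) (ofw ` wpowers d e)"
proof (intro central_fractions.intro graded_algebra_R tsset_generators central_fractions_axioms.intro ring_R tset_generators)
  note X = tsset_generators
  have sub: "ofw ` gen tset \<subseteq> ofw ` gen tsset" using tsset_mono by blast
  show "carrier (R tset) \<subseteq> carrier (R tsset)" using sub by (simp add: R_simps)
  show "mult (R tset) = mult (R tsset)" "one (R tset) = one (R tsset)" "zero (R tset) = zero (R tsset)"
    "add (R tset) = add (R tsset)" "module.smult (R tset) = module.smult (R tsset)" by (simp_all add: R_simps)
  show "hpart (R tset) \<alpha> = hpart (R tsset) \<alpha> \<inter> carrier (R tset)" for \<alpha> using sub by (auto simp: R_simps)
  show "c \<odot>\<^bsub>R tsset\<^esub> x \<in> carrier (R tset)" if x: "x \<in> carrier (R tset)" for c x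
  proof -
    obtain f where f: "f \<in> gen tset" "x = ofw f" using x by (auto simp: R_simps)
    show ?thesis using imageI[OF gen.scale[OF f(1), of c], of ofw] by (simp add: R_simps f(2) ofw_scale)
  qed
  have wg: "f \<in> gen tset" "vhom (\<lambda>c. 0) f" if f: "f \<in> wpowers d e" for f
  proof -
    obtain i j where f': "f = wpow d i \<cdot> wpow e j" using f by (auto simp: wpowers_def)
    show "f \<in> gen tset" unfolding f' by (intro gen.mult wpow_gen g)
    show "vhom (\<lambda>c. 0) f" unfolding f' by (intro vhom_zero_mult wpow_vhom v)
  qed
  show "ofw ` wpowers d e \<subseteq> carrier (R tset)" using wg(1) by (auto simp: R_simps)
  have "unit_word = wpow d 0 \<cdot> wpow e 0" by simp
  then have "unit_word \<in> wpowers d e" unfolding wpowers_def by blast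
  then show "\<one>\<^bsub>R tsset\<^esub> \<in> ofw ` wpowers d e" by (simp add: R_simps)
  show "x \<otimes>\<^bsub>R tsset\<^esub> y \<in> ofw ` wpowers d e" if xy: "x \<in> ofw ` wpowers d e" "y \<in> ofw ` wpowers d e" for x y
  proof -
    obtain f f' where f: "f \<in> wpowers d e" "x = ofw f" "f' \<in> wpowers d e" "y = ofw f'" using xy by blast
    obtain i j k l where eq: "f = wpow d i \<cdot> wpow e j" "f' = wpow d k \<cdot> wpow e l" using f by (auto simp: wpowers_def)
    have "f \<cdot> f' = wpow d i \<cdot> ((wpow e j \<cdot> wpow d k) \<cdot> wpow e l)" unfolding eq by (simp only: wk.shuffle_assoc)
    also have "wpow e j \<cdot> wpow d k = wpow d k \<cdot> wpow e j" by (rule vhom_zero_central[OF wpow_vhom[OF v(2)]])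
    also have "wpow d i \<cdot> ((wpow d k \<cdot> wpow e j) \<cdot> wpow e l) = wpow d (i + k) \<cdot> wpow e (j + l)"
      unfolding wpow_add by (simp only: wk.shuffle_assoc)
    finally have "f \<cdot> f' \<in> wpowers d e" unfolding wpowers_def by blast
    then show ?thesis
      unfolding f(2,4) R_mult[OF X tsset_mono[OF wg(1)[OF f(1)]] tsset_mono[OF wg(1)[OF f(3)]]] by (rule imageI)
  qed
  fix x assume "x \<in> ofw ` wpowers d e"
  then obtain f where f: "f \<in> wpowers d e" "x = ofw f" by blast
  note fg = tsset_mono[OF wg(1)[OF f(1)]] and fv = wg(2)[OF f(1)]
  show "x \<otimes>\<^bsub>R tsset\<^esub> y = y \<otimes>\<^bsub>R tsset\<^esub> x" if y: "y \<in> carrier (R tsset)" for y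
  proof -
    obtain h where h: "h \<in> gen tsset" "y = ofw h" using y by (auto simp: R_simps)
    show ?thesis unfolding f(2) h(2) R_mult[OF X fg h(1)] R_mult[OF X h(1) fg] vhom_zero_central[OF fv] ..
  qed
  show "\<exists>z\<in>carrier (R tsset). z \<otimes>\<^bsub>R tsset\<^esub> x = \<one>\<^bsub>R tsset\<^esub>"
  proof -
    obtain i j where ij: "f = wpow d i \<cdot> wpow e j" using f by (auto simp: wpowers_def)
    obtain u u' where u: "u \<in> gen tsset" "d \<cdot> u = unit_word" "u' \<in> gen tsset" "e \<cdot> u' = unit_word" using inv by blast
    have h: "wpow u' j \<cdot> wpow u i \<in> gen tsset" by (intro gen.mult wpow_gen u)
    have "f \<cdot> (wpow u' j \<cdot> wpow u i) = wpow d i \<cdot> ((wpow e j \<cdot> wpow u' j) \<cdot> wpow u i)"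
      unfolding ij by (simp only: wk.shuffle_assoc)
    also have "\<dots> = unit_word" using wpow_inverse[OF v(1) u(2)] wpow_inverse[OF v(2) u(4)] by simp
    finally have "(wpow u' j \<cdot> wpow u i) \<cdot> f = unit_word" unfolding vhom_zero_central[OF fv] .
    then have "ofw (wpow u' j \<cdot> wpow u i) \<otimes>\<^bsub>R tsset\<^esub> x = \<one>\<^bsub>R tsset\<^esub>"
      unfolding f(2) R_mult[OF X h fg] by (simp add: R_simps)
    moreover have "ofw (wpow u' j \<cdot> wpow u i) \<in> carrier (R tsset)" unfolding R_simps by (rule imageI[OF h])
    ultimately show ?thesis by blast
  qed
  show "prW \<alpha> (x \<otimes>\<^bsub>R tsset\<^esub> y) = x \<otimes>\<^bsub>R tsset\<^esub> prW \<alpha> y" if y: "y \<in> carrier (R tsset)" for y \<alpha>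
  proof -
    obtain h where h: "h \<in> gen tsset" "y = ofw h" using y by (auto simp: R_simps)
    show ?thesis
      unfolding f(2) h(2) R_mult[OF X fg h(1)] prW_ofw[OF gen_WU[OF X h(1)]] prW_ofw[OF gen_WU[OF X gen.mult[OF fg h(1)]]]
        R_mult[OF X fg gen_wpart[OF X h(1)]] wpart_mult[OF fv] ..
  qed
next
  note X = tsset_generators
  fix x assume "x \<in> carrier (R tsset)"
  then obtain f where f: "f \<in> gen tsset" "x = ofw f" by (auto simp: R_simps)
  obtain k where k: "wpow (d \<cdot> e) k \<cdot> f \<in> gen tset" using cl[OF f(1)] by blast
  have "wpow (d \<cdot> e) k \<in> wpowers d e" unfolding wpow_mult[OF v] wpowers_def by blast
  moreover have "ofw (wpow (d \<cdot> e) k) \<otimes>\<^bsub>R tsset\<^esub> x \<in> carrier (R tset)"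
    unfolding f(2) R_mult[OF X tsset_mono[OF wpow_gen[OF gen.mult[OF g]]] f(1)] using k by (simp add: R_simps)
  ultimately show "\<exists>d\<in>ofw ` wpowers d e. d \<otimes>\<^bsub>R tsset\<^esub> x \<in> carrier (R tset)" by blast
qed

section \<open>The generic matrix and its inverse\<close>

definition frac_word :: "('i env => complex) set => 'i gfun => (('i env => complex) \<times> ('i env => complex)) set" where
  "frac_word D f = central_fractions.embed (R tsset) (R tset) D (ofw f)"

text \<open>The element t of the theorem with an arbitrary matrix \<open>m\<close> in place of the
  matrix coefficients, so that its inverse has the same form.\<close>

definition frac_matrix :: "('i env => complex) set => ('i => 'i => 'i gfun) =>
    ((('i env => complex) \<times> ('i env => complex)) set, 'v => 'v) tensor" where
  "frac_matrix D m = (\<Sum>a\<in>I. \<Sum>b\<in>I. (\<lambda>\<beta>. \<omega> (\<gamma> b) (\<gamma> a - \<gamma> b) *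
     tens (fraction_alg (R tset) D) End (frac_word D (m b a)) (unit_matrix V b a) \<beta>))"

definition homogeneous_matrix :: "('i => 'i => 'i gfun) => bool" where
  "homogeneous_matrix m \<longleftrightarrow> (\<forall>a\<in>I. \<forall>b\<in>I. m b a \<in> gen tsset \<and> (\<forall>w. m b a w \<noteq> 0 \<longrightarrow> dg w = \<gamma> b - \<gamma> a))"

lemma unit_matrix_compose:
  assumes "a \<in> I" "b \<in> I" "c \<in> I" "d \<in> I"
  shows "unit_matrix V b a \<circ> unit_matrix V d c = (if a = d then unit_matrix V b c else (\<lambda>v. 0))"
  using assms by (auto simp: fun_eq_iff unit_matrix_def co_scale co_bas)

lemma linear_functional_End_sum:
  assumes f: "linear_functional End f" and X: "\<And>i. lin (X i)"
  shows "f (\<lambda>v. \<Sum>i\<in>S. X i v) = (\<Sum>i\<in>S. f (X i))"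
proof -
  have z: "f (\<lambda>v. 0) = 0" using graded_algebra.linear_functional_zero[OF graded_algebra_End f] by simp
  have "f (\<lambda>v. X i v + Y v) = f (X i) + f Y" if "lin Y" for i Y
    using f X[of i] that by (simp add: linear_functional_def)
  then show ?thesis using linear_sum_maps[of _ X, OF X]
    by (induction S rule: infinite_finite_induct) (simp_all add: z)
qed

context
  fixes D :: "('i env => complex) set"
  assumes D: "central_fractions (R tsset) prW (R tset) D"
begin

interpretation cf: central_fractions "R tsset" prW "R tset" D by (rule D)
interpretation pair: graded_algebra_pair cf.Fr cf.prFr End prEnd
  by (rule graded_algebra_pair.intro[OF cf.graded_algebra_Fr graded_algebra_End])

abbreviation (input) "FE \<equiv> tensor_alg \<omega> cf.Fr End"

lemma frac_word_props:
  assumes f: "f \<in> gen tsset"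
  shows "frac_word D f \<in> carrier cf.Fr"
    and "g \<in> gen tsset ==> frac_word D f \<otimes>\<^bsub>cf.Fr\<^esub> frac_word D g = frac_word D (f \<cdot> g)"
    and "g \<in> gen tsset ==> frac_word D (\<lambda>w. f w + g w) = frac_word D f \<oplus>\<^bsub>cf.Fr\<^esub> frac_word D g"
    and "(\<And>w. f w \<noteq> 0 ==> dg w = - \<alpha>) ==> frac_word D f \<in> hpart cf.Fr \<alpha>"
proof -
  note X = tsset_generators
  have c: "ofw h \<in> carrier (R tsset)" if "h \<in> gen tsset" for h using that by (simp add: R_simps)
  show "frac_word D f \<in> carrier cf.Fr" unfolding frac_word_def cf.Fr_carrier by (intro imageI c f)
  show "frac_word D f \<otimes>\<^bsub>cf.Fr\<^esub> frac_word D g = frac_word D (f \<cdot> g)" if g: "g \<in> gen tsset"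
    unfolding frac_word_def cf.Fr_mult[OF c[OF f] c[OF g]] R_mult[OF X f g] ..
  show "frac_word D (\<lambda>w. f w + g w) = frac_word D f \<oplus>\<^bsub>cf.Fr\<^esub> frac_word D g" if g: "g \<in> gen tsset"
    unfolding frac_word_def cf.Fr_add[OF c[OF f] c[OF g]] by (simp add: R_simps ofw_add)
  show "frac_word D f \<in> hpart cf.Fr \<alpha>" if "\<And>w. f w \<noteq> 0 ==> dg w = - \<alpha>"
    unfolding frac_word_def cf.Fr_hpart using R_hpart[OF X f, of \<alpha>] that by (intro imageI) blast
qed

lemma frac_word_zero: "frac_word D (\<lambda>w. 0) = \<zero>\<^bsub>cf.Fr\<^esub>" and frac_word_one: "frac_word D unit_word = \<one>\<^bsub>cf.Fr\<^esub>"
  unfolding frac_word_def cf.Fr_zero cf.Fr_one by (simp_all add: R_simps ofw_zero)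

lemma frac_word_sum:
  assumes f: "linear_functional cf.Fr f" and g: "\<And>i. i \<in> S ==> g i \<in> gen tsset"
  shows "f (frac_word D (\<lambda>w. \<Sum>i\<in>S. g i w)) = (\<Sum>i\<in>S. f (frac_word D (g i)))"
  using g
proof (induction S rule: infinite_finite_induct)
  case (insert i S)
  have gi: "g i \<in> gen tsset" and gS: "(\<lambda>w. \<Sum>i\<in>S. g i w) \<in> gen tsset" using insert.prems by (auto intro: gen_sum)
  have "frac_word D (\<lambda>w. \<Sum>i\<in>insert i S. g i w) = frac_word D (g i) \<oplus>\<^bsub>cf.Fr\<^esub> frac_word D (\<lambda>w. \<Sum>i\<in>S. g i w)"
    unfolding frac_word_props(3)[OF gi gS, symmetric] using insert.hyps by simp
  then show ?case using f frac_word_props(1)[OF gi] frac_word_props(1)[OF gS] insert by (simp add: linear_functional_def)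
qed (use pair.A.linear_functional_zero[OF f] in \<open>simp_all add: frac_word_zero\<close>)

lemma frac_matrix_apply:
  "frac_matrix D m \<beta> = (\<Sum>a\<in>I. \<Sum>b\<in>I. \<omega> (\<gamma> b) (\<gamma> a - \<gamma> b) *
     tens cf.Fr End (frac_word D (m b a)) (unit_matrix V b a) \<beta>)"
  unfolding frac_matrix_def sum_fun_apply ..

lemma frac_matrix_carrier: "homogeneous_matrix m ==> frac_matrix D m \<in> carrier FE"
  unfolding frac_matrix_def tensor_carrier
proof (intro fscale.span_sum fscale.span_scale fscale.span_base)
  fix a b assume "homogeneous_matrix m" "a \<in> I" "b \<in> I"
  then have "frac_word D (m b a) \<in> carrier cf.Fr" by (intro frac_word_props(1)) (simp add: homogeneous_matrix_def)
  moreover have "unit_matrix V b a \<in> carrier End" by (simp add: linear_unit_matrix)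
  ultimately show "tens cf.Fr End (frac_word D (m b a)) (unit_matrix V b a) \<in>
      {tens cf.Fr End x y | x y. x \<in> carrier cf.Fr \<and> y \<in> carrier End}" by blast
qed

lemma frac_matrix_bil:
  "\<beta> \<in> bilinear_forms cf.Fr End ==>
    frac_matrix D m \<beta> = (\<Sum>a\<in>I. \<Sum>b\<in>I. \<omega> (\<gamma> b) (\<gamma> a - \<gamma> b) * \<beta> (frac_word D (m b a)) (unit_matrix V b a))"
  by (simp add: frac_matrix_apply tens_def)

text \<open>The weights in t are made for this: they cancel the twist
  \<open>\<omega> (\<gamma> b - \<gamma> a) (\<gamma> c - \<gamma> a)\<close> that arises when
  \<open>unit_matrix V b a\<close> passes the entry \<open>(a, c)\<close>, of degree
  \<open>\<gamma> c - \<gamma> a\<close>.\<close>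

lemma fac_matrix_product:
  "\<omega> (\<gamma> b) (\<gamma> a - \<gamma> b) * (\<omega> (\<gamma> a) (\<gamma> c - \<gamma> a) * \<omega> (\<gamma> b - \<gamma> a) (\<gamma> c - \<gamma> a)) = \<omega> (\<gamma> b) (\<gamma> c - \<gamma> b)"
proof -
  have "\<omega> (\<gamma> a) (\<gamma> c - \<gamma> a) * \<omega> (\<gamma> b - \<gamma> a) (\<gamma> c - \<gamma> a) = \<omega> (\<gamma> b) (\<gamma> c - \<gamma> a)"
    using fac_add_left[of "\<gamma> a" "\<gamma> b - \<gamma> a" "\<gamma> c - \<gamma> a"] by simp
  then show ?thesis using fac_add_right[of "\<gamma> b" "\<gamma> a - \<gamma> b" "\<gamma> c - \<gamma> a"] by simp
qed

text \<open>Homogeneous entries turn the twist of the tensor product into a scalar, which the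
  weights absorb; what is left is ordinary matrix multiplication over the shuffle algebra.\<close>

lemma frac_matrix_mult:
  assumes m: "homogeneous_matrix m" and n: "homogeneous_matrix n"
  shows "frac_matrix D m \<otimes>\<^bsub>FE\<^esub> frac_matrix D n = frac_matrix D (\<lambda>b c w. \<Sum>a\<in>I. (m b a \<cdot> n a c) w)"
proof
  fix \<beta>
  have mg: "m b a \<in> gen tsset" and ng: "n b a \<in> gen tsset" if "a \<in> I" "b \<in> I" for a b
    using m n that by (simp_all add: homogeneous_matrix_def)
  have nh: "frac_word D (n b a) \<in> hpart cf.Fr (\<gamma> a - \<gamma> b)" if "a \<in> I" "b \<in> I" for a b
    by (rule frac_word_props(4)[OF ng[OF that]]) (use n that in \<open>simp add: homogeneous_matrix_def\<close>)
  have mult: "frac_matrix D m \<otimes>\<^bsub>FE\<^esub> frac_matrix D n = tensor_mult \<omega> cf.Fr End (frac_matrix D m) (frac_matrix D n)"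
    by (simp add: tensor_alg_def)
  have Ec: "unit_matrix V b a \<in> carrier End" for a b by (simp add: linear_unit_matrix)
  show "(frac_matrix D m \<otimes>\<^bsub>FE\<^esub> frac_matrix D n) \<beta> = frac_matrix D (\<lambda>b c w. \<Sum>a\<in>I. (m b a \<cdot> n a c) w) \<beta>"
  proof (cases "\<beta> \<in> bilinear_forms cf.Fr End")
    case False
    then show ?thesis unfolding mult tensor_mult_eq frac_matrix_apply by (simp add: tens_def)
  next
    case True
    note \<beta> = True
    let ?G = "\<lambda>x y. frac_matrix D n (mult_form \<omega> cf.Fr End \<beta> x y)"
    \<comment> \<open>The outer tensor can be expanded only after the inner evaluation is known to
      be a bilinear form.\<close>
    have G: "?G \<in> bilinear_forms cf.Fr End" by (rule pair.mult_form_eval_bilinear[OF \<beta> frac_matrix_carrier[OF n]])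
    have inner: "?G (frac_word D (m b a)) (unit_matrix V b a) =
        (\<Sum>c\<in>I. \<omega> (\<gamma> a) (\<gamma> c - \<gamma> a) * \<omega> (\<gamma> b - \<gamma> a) (\<gamma> c - \<gamma> a) * \<beta> (frac_word D (m b a \<cdot> n a c)) (unit_matrix V b c))"
      if ab: "a \<in> I" "b \<in> I" for a b
    proof -
      note mc = frac_word_props(1)[OF mg[OF ab]]
      have "?G (frac_word D (m b a)) (unit_matrix V b a) = (\<Sum>c\<in>I. \<Sum>d\<in>I. \<omega> (\<gamma> d) (\<gamma> c - \<gamma> d) *
          mult_form \<omega> cf.Fr End \<beta> (frac_word D (m b a)) (unit_matrix V b a) (frac_word D (n d c)) (unit_matrix V d c))"
        by (rule frac_matrix_bil[OF pair.mult_form_bilinear[OF \<beta> mc Ec]])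
      also have "\<dots> = (\<Sum>c\<in>I. \<Sum>d\<in>I. if d = a then \<omega> (\<gamma> a) (\<gamma> c - \<gamma> a) * \<omega> (\<gamma> b - \<gamma> a) (\<gamma> c - \<gamma> a) *
          \<beta> (frac_word D (m b a \<cdot> n a c)) (unit_matrix V b c) else 0)"
      proof (intro sum.cong refl)
        fix c d assume cd: "c \<in> I" "d \<in> I"
        have "\<beta> (frac_word D (m b a) \<otimes>\<^bsub>cf.Fr\<^esub> frac_word D (n d c)) (unit_matrix V b a \<otimes>\<^bsub>End\<^esub> unit_matrix V d c) =
            (if d = a then \<beta> (frac_word D (m b a \<cdot> n a c)) (unit_matrix V b c) else 0)"
        proof (cases "d = a")
          case True
          then show ?thesis using frac_word_props(2)[OF mg[OF ab] ng[OF cd]] unit_matrix_compose[OF ab cd] by simp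
        next
          case False
          have "frac_word D (m b a) \<otimes>\<^bsub>cf.Fr\<^esub> frac_word D (n d c) \<in> carrier cf.Fr"
            using mc frac_word_props(1)[OF ng[OF cd]] by simp
          then have "\<beta> (frac_word D (m b a) \<otimes>\<^bsub>cf.Fr\<^esub> frac_word D (n d c)) \<zero>\<^bsub>End\<^esub> = 0"
            by (rule pair.B.linear_functional_zero[OF bilinear_formsD(2)[OF \<beta>]])
          then show ?thesis using False unit_matrix_compose[OF ab cd] by simp
        qed
        then show "\<omega> (\<gamma> d) (\<gamma> c - \<gamma> d) *
          mult_form \<omega> cf.Fr End \<beta> (frac_word D (m b a)) (unit_matrix V b a) (frac_word D (n d c)) (unit_matrix V d c) =
          (if d = a then \<omega> (\<gamma> a) (\<gamma> c - \<gamma> a) * \<omega> (\<gamma> b - \<gamma> a) (\<gamma> c - \<gamma> a) *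
          \<beta> (frac_word D (m b a \<cdot> n a c)) (unit_matrix V b c) else 0)"
          unfolding pair.mult_form_homogeneous[OF \<beta> mc nh[OF cd] unit_matrix_hpart[OF ab] Ec] by simp
      qed
      also have "\<dots> = (\<Sum>c\<in>I. \<omega> (\<gamma> a) (\<gamma> c - \<gamma> a) * \<omega> (\<gamma> b - \<gamma> a) (\<gamma> c - \<gamma> a) *
          \<beta> (frac_word D (m b a \<cdot> n a c)) (unit_matrix V b c))" using ab by simp
      finally show ?thesis .
    qed
    have "(frac_matrix D m \<otimes>\<^bsub>FE\<^esub> frac_matrix D n) \<beta> = frac_matrix D m ?G"
      unfolding mult tensor_mult_eq using \<beta> by simp
    also have "\<dots> = (\<Sum>a\<in>I. \<Sum>b\<in>I. \<omega> (\<gamma> b) (\<gamma> a - \<gamma> b) * ?G (frac_word D (m b a)) (unit_matrix V b a))"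
      by (rule frac_matrix_bil[OF G])
    also have "\<dots> = (\<Sum>a\<in>I. \<Sum>b\<in>I. \<Sum>c\<in>I. \<omega> (\<gamma> b) (\<gamma> c - \<gamma> b) * \<beta> (frac_word D (m b a \<cdot> n a c)) (unit_matrix V b c))"
    proof (intro sum.cong refl)
      fix a b assume ab: "a \<in> I" "b \<in> I"
      show "\<omega> (\<gamma> b) (\<gamma> a - \<gamma> b) * ?G (frac_word D (m b a)) (unit_matrix V b a) =
          (\<Sum>c\<in>I. \<omega> (\<gamma> b) (\<gamma> c - \<gamma> b) * \<beta> (frac_word D (m b a \<cdot> n a c)) (unit_matrix V b c))"
        unfolding inner[OF ab] sum_distrib_left
      proof (intro sum.cong refl)
        fix c
        show "\<omega> (\<gamma> b) (\<gamma> a - \<gamma> b) * (\<omega> (\<gamma> a) (\<gamma> c - \<gamma> a) * \<omega> (\<gamma> b - \<gamma> a) (\<gamma> c - \<gamma> a) *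
            \<beta> (frac_word D (m b a \<cdot> n a c)) (unit_matrix V b c)) =
          \<omega> (\<gamma> b) (\<gamma> c - \<gamma> b) * \<beta> (frac_word D (m b a \<cdot> n a c)) (unit_matrix V b c)"
          unfolding fac_matrix_product[of b a c, symmetric] by (simp only: mult.assoc)
      qed
    qed
    also have "\<dots> = (\<Sum>b\<in>I. \<Sum>c\<in>I. \<Sum>a\<in>I. \<omega> (\<gamma> b) (\<gamma> c - \<gamma> b) * \<beta> (frac_word D (m b a \<cdot> n a c)) (unit_matrix V b c))"
      by (subst sum.swap, intro sum.cong refl sum.swap)
    also have "\<dots> = (\<Sum>c\<in>I. \<Sum>b\<in>I. \<Sum>a\<in>I. \<omega> (\<gamma> b) (\<gamma> c - \<gamma> b) * \<beta> (frac_word D (m b a \<cdot> n a c)) (unit_matrix V b c))"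
      by (rule sum.swap)
    also have "\<dots> = (\<Sum>c\<in>I. \<Sum>b\<in>I. \<omega> (\<gamma> b) (\<gamma> c - \<gamma> b) *
        \<beta> (frac_word D (\<lambda>w. \<Sum>a\<in>I. (m b a \<cdot> n a c) w)) (unit_matrix V b c))"
    proof (intro sum.cong refl)
      fix c b assume cb: "c \<in> I" "b \<in> I"
      have "\<beta> (frac_word D (\<lambda>w. \<Sum>a\<in>I. (m b a \<cdot> n a c) w)) (unit_matrix V b c) =
          (\<Sum>a\<in>I. \<beta> (frac_word D (m b a \<cdot> n a c)) (unit_matrix V b c))"
        using cb by (intro frac_word_sum[OF bilinear_formsD(1)[OF \<beta> Ec]] gen.mult mg ng)
      then show "(\<Sum>a\<in>I. \<omega> (\<gamma> b) (\<gamma> c - \<gamma> b) * \<beta> (frac_word D (m b a \<cdot> n a c)) (unit_matrix V b c)) =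
        \<omega> (\<gamma> b) (\<gamma> c - \<gamma> b) * \<beta> (frac_word D (\<lambda>w. \<Sum>a\<in>I. (m b a \<cdot> n a c) w)) (unit_matrix V b c)"
        by (simp add: sum_distrib_left)
    qed
    also have "\<dots> = frac_matrix D (\<lambda>b c w. \<Sum>a\<in>I. (m b a \<cdot> n a c) w) \<beta>"
      by (rule frac_matrix_bil[OF \<beta>, symmetric])
    finally show ?thesis .
  qed
qed

lemma frac_matrix_one:
  assumes m: "\<And>b c. b \<in> I ==> c \<in> I ==> m b c = (if b = c then unit_word else (\<lambda>_. 0))"
  shows "frac_matrix D m = \<one>\<^bsub>FE\<^esub>"
proof
  fix \<beta>
  have one: "\<one>\<^bsub>FE\<^esub> = tens cf.Fr End (frac_word D unit_word) id" by (simp add: tensor_alg_def frac_word_one)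
  show "frac_matrix D m \<beta> = \<one>\<^bsub>FE\<^esub> \<beta>"
  proof (cases "\<beta> \<in> bilinear_forms cf.Fr End")
    case False
    then show ?thesis unfolding one frac_matrix_apply by (simp add: tens_def)
  next
    case True
    note \<beta> = True
    note one_c = frac_word_props(1)[OF gen.unit]
    have id: "(\<lambda>v. \<Sum>a\<in>I. unit_matrix V a a v) = id"
      using co_expand by (simp add: fun_eq_iff unit_matrix_def flip: co_expand)
    have "frac_matrix D m \<beta> = (\<Sum>a\<in>I. \<Sum>b\<in>I. if b = a then \<beta> (frac_word D unit_word) (unit_matrix V a a) else 0)"
      unfolding frac_matrix_bil[OF \<beta>]
    proof (intro sum.cong refl)
      fix a b assume ab: "a \<in> I" "b \<in> I"
      have "\<beta> \<zero>\<^bsub>cf.Fr\<^esub> (unit_matrix V b a) = 0"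
        by (rule pair.A.linear_functional_zero[OF bilinear_formsD(1)[OF \<beta>]]) (simp add: linear_unit_matrix)
      then show "\<omega> (\<gamma> b) (\<gamma> a - \<gamma> b) * \<beta> (frac_word D (m b a)) (unit_matrix V b a) =
          (if b = a then \<beta> (frac_word D unit_word) (unit_matrix V a a) else 0)"
        using m[OF ab(2,1)] by (simp add: frac_word_zero)
    qed
    also have "\<dots> = (\<Sum>a\<in>I. \<beta> (frac_word D unit_word) (unit_matrix V a a))" by simp
    also have "\<dots> = \<beta> (frac_word D unit_word) (\<lambda>v. \<Sum>a\<in>I. unit_matrix V a a v)"
      by (rule linear_functional_End_sum[OF bilinear_formsD(2)[OF \<beta> one_c] linear_unit_matrix, symmetric])
    also have "\<dots> = \<one>\<^bsub>FE\<^esub> \<beta>" unfolding id one using \<beta> by (simp add: tens_def)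
    finally show ?thesis .
  qed
qed

text \<open>The inverse is the matrix \<open>sw\<close>. The tensor product is not commutative, so
  both orders are checked; they come from the two antipode identities and not from
  determinants.\<close>

lemma generic_matrix_unit: "frac_matrix D tw \<in> Units FE"
proof -
  have m: "homogeneous_matrix tw" unfolding homogeneous_matrix_def using tw_gen tsset_mono tw_dg by blast
  have n: "homogeneous_matrix sw" unfolding homogeneous_matrix_def using sw_gen sw_dg by blast
  have "frac_matrix D tw \<otimes>\<^bsub>FE\<^esub> frac_matrix D sw = \<one>\<^bsub>FE\<^esub>"
    unfolding frac_matrix_mult[OF m n] by (rule frac_matrix_one) (rule tw_sw)
  moreover have "frac_matrix D sw \<otimes>\<^bsub>FE\<^esub> frac_matrix D tw = \<one>\<^bsub>FE\<^esub>"
    unfolding frac_matrix_mult[OF n m] by (rule frac_matrix_one) (rule sw_tw)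
  ultimately show ?thesis
    unfolding Units_def using frac_matrix_carrier[OF m] frac_matrix_carrier[OF n] by blast
qed

lemma frac_word_tw:
  assumes ab: "a \<in> I" "b \<in> I"
  shows "fraction (R tset) D (mcoeff V b a) \<one>\<^bsub>R tset\<^esub> = frac_word D (tw b a)"
  unfolding mcoeff_eq[OF ab] frac_word_def
proof (rule cf.fraction_embed)
  show "ofw (tw b a) \<in> carrier (R tset)" using tw_gen[OF ab] by (simp add: R_simps)
  show t: "ofw (tw b a) \<in> carrier (R tsset)" using tsset_mono[OF tw_gen[OF ab]] by (simp add: R_simps)
  show "\<one>\<^bsub>R tset\<^esub> \<in> D" using cf.D_one by (simp add: R_simps)
  show "ofw (tw b a) = \<one>\<^bsub>R tset\<^esub> \<otimes>\<^bsub>R tsset\<^esub> ofw (tw b a)" using cf.B.l_one[OF t] by (simp add: R_simps)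
qed

lemma fraction_theorem:
  "(\<Sum>a\<in>I. \<Sum>b\<in>I. \<omega> (\<gamma> b) (\<gamma> a - \<gamma> b) \<odot>\<^bsub>FE\<^esub>
      tens cf.Fr End (fraction (R tset) D (mcoeff V b a) \<one>\<^bsub>R tset\<^esub>) (unit_matrix V b a)) \<in> Units FE
    \<and> galg_iso (R tsset) cf.Fr \<noteq> {}"
proof
  have "(\<Sum>a\<in>I. \<Sum>b\<in>I. \<omega> (\<gamma> b) (\<gamma> a - \<gamma> b) \<odot>\<^bsub>FE\<^esub>
      tens cf.Fr End (fraction (R tset) D (mcoeff V b a) \<one>\<^bsub>R tset\<^esub>) (unit_matrix V b a)) = frac_matrix D tw"
    unfolding frac_matrix_def by (intro sum.cong refl) (simp add: frac_word_tw tensor_alg_def)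
  then show "(\<Sum>a\<in>I. \<Sum>b\<in>I. \<omega> (\<gamma> b) (\<gamma> a - \<gamma> b) \<odot>\<^bsub>FE\<^esub>
      tens cf.Fr End (fraction (R tset) D (mcoeff V b a) \<one>\<^bsub>R tset\<^esub>) (unit_matrix V b a)) \<in> Units FE"
    using generic_matrix_unit by simp
  show "galg_iso (R tsset) cf.Fr \<noteq> {}" using cf.embed_galg_iso by blast
qed

end

end

theorem theorem6p13:
  fixes V :: "('g::ab_group_add, 'v::ab_group_add, 'i) gspace"
    and Lp Lm :: "'i list \<Rightarrow>\<^sub>0 complex"
    and Dp Dm :: "'i env \<Rightarrow> complex"
  assumes "commutative_factor (fac V)"
    and "graded_vector_space (scal V) (part V)"
    and "homogeneous_basis V"
    and "antisymmetrizer V (sgn_dim V 1) ` sgn_tensor_power V 1 (sgn_dim V 1) =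
           range (\<lambda>c. Poly_Mapping.map ((*) c) Lp)"
    and "symmetrizer V (sgn_dim V (-1)) ` sgn_tensor_power V (-1) (sgn_dim V (-1)) =
           range (\<lambda>c. Poly_Mapping.map ((*) c) Lm)"
    and "coaction_minor V 1 Lp Dp"
    and "coaction_minor V (-1) Lm Dm"
  shows "let T = matrix_coeff_alg V;
             DD = minor_powers V Dp Dm;
             F = fraction_alg T DD;
             FE = tensor_alg (fac V) F (End_alg V)
         in (\<Sum>a\<in>ind V. \<Sum>b\<in>ind V.
               fac V (deg V b) (deg V a - deg V b) \<odot>\<^bsub>FE\<^esub>
                 tens F (End_alg V) (fraction T DD (mcoeff V b a) \<one>\<^bsub>T\<^esub>) (unit_matrix V b a))
              \<in> Units FE
            \<and> galg_iso (coordinate_alg V) F \<noteq> {}"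
proof -
  interpret graded_basis V using assms(1-3) by unfold_locales
  have fin: "finite (sgn_ind V \<epsilon>)" for \<epsilon> using finite_subset[OF _ finite_I] by (auto simp: sgn_ind_def)
  \<comment> \<open>The indices of each sign are listed in some order; the lengths are the
    dimensions of \<open>V\<^sub>+\<close> and \<open>V\<^sub>-\<close>, so both lists are words to
    which the symmetrizers apply.\<close>
  obtain ps where ps: "distinct ps" "set ps = sgn_ind V 1" using finite_distinct_list[OF fin] by blast
  obtain ms where ms: "distinct ms" "set ms = sgn_ind V (- 1)" using finite_distinct_list[OF fin] by blast
  have dim: "sgn_dim V 1 = length ps" "sgn_dim V (- 1) = length ms"
    using distinct_card[OF ps(1)] distinct_card[OF ms(1)] by (simp_all add: sgn_dim_card ps(2) ms(2))
  define dp where "dp = minor (\<lambda>\<sigma>. of_int (sign \<sigma>)) ps"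
  define dm where "dm = minor (\<lambda>\<sigma>. 1) ms"
  have Dp: "Dp = ofw dp"
    unfolding dp_def
    by (rule coaction_minor_eq[OF ps _ assms(4)[unfolded dim symmetrizers_eq] assms(6)]) (simp only: sign_id of_int_1)
  have Dm: "Dm = ofw dm"
    unfolding dm_def by (rule coaction_minor_eq[OF ms refl assms(5)[unfolded dim symmetrizers_eq] assms(7)])
  have sub: "set ps \<subseteq> I" "set ms \<subseteq> I" using ps ms by (auto simp: sgn_ind_def)
  have parts: "set ps = {a \<in> I. \<not> par a}" "set ms = {a \<in> I. par a}" using ps(2) ms(2) sgn_ind_iff by blast+
  note inv = minors_invert[OF ps(1) parts(1) ms(1) parts(2), folded dp_def dm_def]
  have v: "vhom (\<lambda>c. 0) dp" "vhom (\<lambda>c. 0) dm" unfolding dp_def dm_def by (rule minor_vhom)+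
  have g: "dp \<in> gen tset" "dm \<in> gen tset" unfolding dp_def dm_def by (rule minor_gen[OF sub(1)], rule minor_gen[OF sub(2)])
  have DD: "minor_powers V Dp Dm = ofw ` wpowers dp dm" unfolding Dp Dm by (rule minor_powers_eq[OF g])
  show ?thesis
    unfolding Let_def matrix_coeff_alg_eq coordinate_alg_eq DD
    by (rule fraction_theorem[OF central_fractions_minors[OF v g inv]])
qed

end
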